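(* Let $n\ge 1$, $0<s<1$, and let $V:\mathbb R^{n+1}\to\mathbb R$ satisfy, for some $K>0$: $\|V\|_{C^1(\mathbb R^{n+1})}\le K$ if $1/2\le s<1$; and $\|V\|_{C^2(\mathbb R^{n+1})}\le K$ together with $\|\langle\nabla_xV,x\rangle\|_{L^\infty(\mathbb R^{n+1})}\le K$ if $0<s<1/2$. Let $u\in\mathrm{Dom}(H^s)$ be a solution in $\mathbb R^{n+1}$ of $$H^su(x,t)=(\partial_t-\Delta)^su(x,t)=V(x,t)\,u(x,t).$$ If $u$ vanishes to infinite order backward in time at some point $(x_0,t_0)\in\mathbb R^{n+1}$, then $u(\cdot,t)\equiv0$ for all $t\le t_0$.
   Context: Points of $\mathbb R^{n+1}$ are $(x,t)$ with $x\in\mathbb R^n$, $t\in\mathbb R$. The Fourier transform is $\hat u(\xi,\sigma)=\int_{\mathbb R^{n+1}}e^{-2\pi i(\langle\xi,x\rangle+\sigma t)}u(x,t)\,dx\,dt$. The operator $H^s=(\partial_t-\Delta)^s$ is defined by $\widehat{H^su}(\xi,\sigma)=\big((2\pi|\xi|)^2+2\pi i\sigma\big)^s\hat u(\xi,\sigma)$ (principal branch), with domain $\mathrm{Dom}(H^s)=\{u\in L^2(\mathbb R^{n+1}) : ((2\pi|\xi|)^2+2\pi i\sigma)^s\hat u\in L^2(\mathbb R^{n+1})\}$. The norm is $\|f\|_{C^k(\mathbb R^{n+1})}=\sum_{|\alpha|+j\le k}\sup_{(x,t)}|D_x^\alpha D_t^jf(x,t)|$, for $f$ of class $C^k$. Let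 $B_r(x_0)$ be the Euclidean ball in $\mathbb R^n$ and $Q_r(x_0,t_0)=B_r(x_0)\times(t_0-r^2,t_0]$. A function $u\in L^\infty_{loc}(\mathbb R^{n+1})$ vanishes to infinite order backward in time at $(x_0,t_0)$ if for every $N>0$ one has $\operatorname{ess\,sup}_{Q_r(x_0,t_0)}|u|=O(r^N)$ as $r\to0^+$. *)

theory Defs
  imports "HOL-Analysis.Analysis" "HOL-Probability.Essential_Supremum"
begin

text \<open>Points of \<open>\<real>\<^sup>n \<times> \<real>\<close> are pairs \<open>(x, t)\<close> with \<open>x :: real ^ 'n\<close>. All measure-theoretic notions
  refer to Lebesgue measure; elements of \<open>L\<^sup>2\<close> and \<open>L\<^sup>\<infinity>\<close> are represented by functions,
  which matter only up to equality almost everywhere.\<close>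

section \<open>The Fourier transform and the fractional heat operator\<close>

definition L1 :: "('a::euclidean_space \<Rightarrow> complex) set" where
  "L1 = {f. integrable lebesgue f}"

definition L2 :: "('a::euclidean_space \<Rightarrow> complex) set" where
  "L2 = {f. f \<in> borel_measurable lebesgue \<and> integrable lebesgue (\<lambda>p. (norm (f p))\<^sup>2)}"

definition L2_lim :: "(nat \<Rightarrow> 'a::euclidean_space \<Rightarrow> complex) \<Rightarrow> ('a \<Rightarrow> complex) \<Rightarrow> bool" where
  "L2_lim f g \<longleftrightarrow> (\<lambda>k. \<integral>\<^sup>+ p. ennreal ((norm (f k p - g p))\<^sup>2) \<partial>lebesgue) \<longlonglongrightarrow> 0"

definition fourier_integral ::
  "((real ^ 'n::finite) \<times> real \<Rightarrow> complex) \<Rightarrow> (real ^ 'n) \<times> real \<Rightarrow> complex" where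
  "fourier_integral u = (\<lambda>(\<xi>, \<sigma>).
     LINT (x, t)|lebesgue. exp (- 2 * of_real pi * \<i> * of_real (\<xi> \<bullet> x + \<sigma> * t)) * u (x, t))"

text \<open>The integral above converges only for \<open>u \<in> L\<^sup>1\<close>; on \<open>L\<^sup>2\<close> the transform is its continuous
  extension from \<open>L\<^sup>1 \<inter> L\<^sup>2\<close> (Plancherel), which determines it up to a null set.\<close>

definition is_fourier ::
  "((real ^ 'n::finite) \<times> real \<Rightarrow> complex) \<Rightarrow> ((real ^ 'n) \<times> real \<Rightarrow> complex) \<Rightarrow> bool" where
  "is_fourier u v \<longleftrightarrow> u \<in> L2 \<and> v \<in> L2 \<and>
     (\<exists>f. (\<forall>k. f k \<in> L1 \<inter> L2) \<and> L2_lim f u \<and> L2_lim (\<lambda>k. fourier_integral (f k)) v)"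

definition fourier ::
  "((real ^ 'n::finite) \<times> real \<Rightarrow> complex) \<Rightarrow> (real ^ 'n) \<times> real \<Rightarrow> complex" where
  "fourier u = (SOME v. is_fourier u v)"

text \<open>\<open>powr\<close> on \<open>complex\<close> is the principal branch, with \<open>0 powr s = 0\<close>.\<close>

definition heat_symbol :: "real \<Rightarrow> (real ^ 'n::finite) \<times> real \<Rightarrow> complex" where
  "heat_symbol s = (\<lambda>(\<xi>, \<sigma>).
     (of_real ((2 * pi * norm \<xi>)\<^sup>2) + 2 * of_real pi * \<i> * of_real \<sigma>) powr of_real s)"

definition Dom_H :: "real \<Rightarrow> ((real ^ 'n::finite) \<times> real \<Rightarrow> complex) set" where
  "Dom_H s = {u \<in> L2. (\<lambda>p. heat_symbol s p * fourier u p) \<in> L2}"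

definition H :: "real \<Rightarrow> ((real ^ 'n::finite) \<times> real \<Rightarrow> complex) \<Rightarrow> (real ^ 'n) \<times> real \<Rightarrow> complex"
  where "H s u = (SOME w. is_fourier w (\<lambda>p. heat_symbol s p * fourier u p))"

section \<open>Partial derivatives and the \<open>C\<^sup>k\<close> norm\<close>

definition Dx1 :: "'n \<Rightarrow> ((real ^ 'n::finite) \<times> real \<Rightarrow> real) \<Rightarrow> (real ^ 'n) \<times> real \<Rightarrow> real" where
  "Dx1 i f = (\<lambda>(x, t). deriv (\<lambda>h. f (x + h *\<^sub>R axis i 1, t)) 0)"

definition Dt :: "((real ^ 'n::finite) \<times> real \<Rightarrow> real) \<Rightarrow> (real ^ 'n) \<times> real \<Rightarrow> real" where
  "Dt f = (\<lambda>(x, t). deriv (\<lambda>h. f (x, t + h)) 0)"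

fun C_class :: "nat \<Rightarrow> ((real ^ 'n::finite) \<times> real \<Rightarrow> real) \<Rightarrow> bool" where
  "C_class 0 f \<longleftrightarrow> continuous_on UNIV f"
| "C_class (Suc k) f \<longleftrightarrow> continuous_on UNIV f \<and>
     (\<forall>i x t. (\<lambda>h. f (x + h *\<^sub>R axis i 1, t)) differentiable (at 0)) \<and>
     (\<forall>x t. (\<lambda>h. f (x, t + h)) differentiable (at 0)) \<and>
     (\<forall>i. C_class k (Dx1 i f)) \<and> C_class k (Dt f)"

text \<open>The multi-index derivative \<open>D\<^sub>x\<^sup>\<alpha>\<close> takes \<open>\<alpha> i\<close> derivatives in direction \<open>i\<close>. The index type carries
  no order, so some order of differentiation is chosen; for functions of class \<open>C\<^sup>k\<close> with
  \<open>k \<ge> \<bar>\<alpha>\<bar>\<close> the result does not depend on it.\<close>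

definition Dx ::
  "('n \<Rightarrow> nat) \<Rightarrow> ((real ^ 'n::finite) \<times> real \<Rightarrow> real) \<Rightarrow> (real ^ 'n) \<times> real \<Rightarrow> real" where
  "Dx \<alpha> f = foldr Dx1 (SOME is. \<forall>i. count_list is i = \<alpha> i) f"

definition C_norm :: "nat \<Rightarrow> ((real ^ 'n::finite) \<times> real \<Rightarrow> real) \<Rightarrow> ennreal" where
  "C_norm k f = (\<Sum>(\<alpha>, j)\<in>{(\<alpha>, j). sum \<alpha> UNIV + j \<le> k}. SUP p. ennreal \<bar>Dx \<alpha> ((Dt ^^ j) f) p\<bar>)"

text \<open>The index set of this sum is finite, so the sum is not the default value \<open>0\<close>.\<close>

lemma finite_multi_indices: "finite {(\<alpha> :: 'n::finite \<Rightarrow> nat, j). sum \<alpha> UNIV + j \<le> k}"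
proof (rule finite_subset)
  show "{(\<alpha> :: 'n \<Rightarrow> nat, j). sum \<alpha> UNIV + j \<le> k} \<subseteq> (UNIV \<rightarrow>\<^sub>E {..k}) \<times> {..k}"
  proof (intro subsetI, unfold mem_Collect_eq split_paired_all prod.case)
    fix \<alpha> :: "'n \<Rightarrow> nat" and j assume le: "sum \<alpha> UNIV + j \<le> k"
    have "\<alpha> i \<le> k" for i using le member_le_sum[of i UNIV \<alpha>] by simp
    then show "(\<alpha>, j) \<in> (UNIV \<rightarrow>\<^sub>E {..k}) \<times> {..k}" using le by auto
  qed
  show "finite ((UNIV \<rightarrow>\<^sub>E {..k}) \<times> {..k} :: (('n \<Rightarrow> nat) \<times> nat) set)"
    by (intro finite_cartesian_product finite_PiE) auto
qed

definition grad_x :: "((real ^ 'n::finite) \<times> real \<Rightarrow> real) \<Rightarrow> (real ^ 'n) \<times> real \<Rightarrow> real ^ 'n" where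
  "grad_x f p = (\<chi> i. Dx1 i f p)"

section \<open>Essential suprema and vanishing to infinite order\<close>

definition Linf_norm_on :: "'a::euclidean_space set \<Rightarrow> ('a \<Rightarrow> 'b::real_normed_vector) \<Rightarrow> ennreal" where
  "Linf_norm_on S f = esssup (lebesgue_on S) (\<lambda>p. ennreal (norm (f p)))"

definition Linf_loc :: "('a::euclidean_space \<Rightarrow> complex) set" where
  "Linf_loc = {f. f \<in> borel_measurable lebesgue \<and> (\<forall>S. compact S \<longrightarrow> Linf_norm_on S f < \<infinity>)}"

definition Q :: "real \<Rightarrow> real ^ 'n::finite \<Rightarrow> real \<Rightarrow> ((real ^ 'n) \<times> real) set" where
  "Q r x\<^sub>0 t\<^sub>0 = ball x\<^sub>0 r \<times> {t\<^sub>0 - r\<^sup>2 <.. t\<^sub>0}"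

definition vanishes_backward ::
  "((real ^ 'n::finite) \<times> real \<Rightarrow> complex) \<Rightarrow> real ^ 'n \<Rightarrow> real \<Rightarrow> bool" where
  "vanishes_backward u x\<^sub>0 t\<^sub>0 \<longleftrightarrow> u \<in> Linf_loc \<and>
     (\<forall>N>0. \<exists>C. \<forall>\<^sub>F r in at_right 0. Linf_norm_on (Q r x\<^sub>0 t\<^sub>0) u \<le> ennreal (C * r powr N))"

end

theory Submission
  imports Defs "HOL-Probability.Probability" "HOL-Computational_Algebra.Polynomial"
begin

text \<open>Move the point to the origin, reverse time, and let
  \<open>F\<^sub>\<alpha>(\<theta>)\<close> be the moment of \<open>u(\<cdot>, \<theta>)\<close> against the polynomial-times-Gaussian solution \<open>\<phi>\<^sub>\<alpha>\<close> of the adjoint heat equation that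
  is built from the Hermite function of index \<open>\<alpha>\<close>. In \<open>x\<close> the Fourier transform of \<open>\<phi>\<^sub>\<alpha>\<close> is a multiple of
  \<open>\<xi>\<^sup>\<alpha> exp (- 4 \<pi>\<^sup>2 \<bar>\<xi>\<bar>\<^sup>2 \<theta>)\<close>, so a test function \<open>f(\<theta>) \<phi>\<^sub>\<alpha>\<close> turns the symbol of \<open>H\<^sup>s\<close> into \<open>z\<^sup>s\<close> acting on the
  Laplace transform of \<open>f\<close>: the moments \<open>F\<^sub>\<alpha>\<close> and \<open>G\<^sub>\<alpha>\<close> of \<open>u\<close> and \<open>V u\<close> satisfy a one-dimensional fractional equation, weakly
  \<open>F\<^sub>\<alpha>(t) = \<integral> (\<tau> - t)\<^sub>+\<^sup>s\<^sup>-\<^sup>1 G\<^sub>\<alpha>(\<tau>) d\<tau> / \<Gamma>(s)\<close> up to an additive constant.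

  As \<open>F\<^sub>\<alpha>\<close> is flat at \<open>0\<close>, the first \<open>m\<close> Taylor terms of this kernel in \<open>t\<close> may be subtracted for every \<open>m\<close>, and
  Schur's test gives a weighted inequality whose constant stays bounded as long as the weight exponent keeps away from the
  integers. By Parseval the moments of all orders sum up to the Gaussian average
  \<open>W(\<theta>) = \<integral> \<bar>u(x, \<theta>)\<bar>\<^sup>2 exp (- \<bar>x\<bar>\<^sup>2 / 4\<theta>) dx\<close>, whence
  \<open>\<integral> \<theta>\<^sup>-\<^sup>2\<^sup>N\<^sup>-\<^sup>1 W \<le> L \<integral> \<theta>\<^sup>2\<^sup>s\<^sup>-\<^sup>2\<^sup>N\<^sup>-\<^sup>1 W\<close> with \<open>L\<close> independent of \<open>N\<close>. For small \<open>\<theta>\<close> the right-hand side is absorbed,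
  and \<open>N \<rightarrow> \<infinity>\<close> shows \<open>u = 0\<close> for \<open>0 < \<theta> < T\<close>. Then all \<open>G\<^sub>\<alpha>\<close> vanish on \<open>(0, T)\<close>, so that the vanishing of all Taylor
  terms says that the moments of \<open>G\<^sub>\<alpha>\<close> in the bounded variable \<open>1 / \<tau>\<close> are zero; hence \<open>G\<^sub>\<alpha> = 0\<close>, \<open>F\<^sub>\<alpha> = 0\<close> and \<open>u = 0\<close>
  for all \<open>\<theta> > 0\<close>.\<close>

section \<open>Square-integrable functions and orthonormal bases\<close>

text \<open>Three difficulties shape the argument. After Parseval the weight exponent left for
  F_\<alpha> is \<mu> = N - n/4 - |\<alpha>|/2, so a single N must keep infinitely many exponents
  away from the integers. N = n/4 + 1/4 + j does so, because 4\<mu> is then an odd integer. For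
  large |\<alpha>| the exponent is negative and no Taylor term may be subtracted at all, which is
  why even the zeroth one has to be shown to vanish there. The equation can be tested only against
  functions of mean zero, hence the additive constant. It and all Taylor coefficients vanish for one
  reason: no power of t is integrable over the whole half-line, whereas F_\<alpha> and the corrected
  fractional integral lie in a common power-weighted L^2 space. The Fourier transform of the
  hypotheses is given through arbitrary L^2 limits. In the Hermite basis it is diagonal, with powers
  of -i as eigenvalues; its existence, its uniqueness and Plancherel's identity thus reduce to
  Parseval's identity for that basis.\<close>

definition square_integrable :: "'a measure \<Rightarrow> ('a \<Rightarrow> complex) \<Rightarrow> bool" where
  "square_integrable M f \<longleftrightarrow> f \<in> borel_measurable M \<and> integrable M (\<lambda>x. (norm (f x))\<^sup>2)"

lemma square_integrableD:
  assumes "square_integrable M f"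
  shows "f \<in> borel_measurable M" "integrable M (\<lambda>x. (norm (f x))\<^sup>2)"
  using assms by (auto simp: square_integrable_def)

lemma norm_add_sq_le: "(norm (a + b :: 'a::real_normed_vector))\<^sup>2 \<le> 2 * (norm a)\<^sup>2 + 2 * (norm b)\<^sup>2"
proof -
  have "(norm (a + b))\<^sup>2 \<le> (norm a + norm b)\<^sup>2"
    by (simp add: norm_triangle_ineq power_mono)
  also have "\<dots> \<le> 2 * (norm a)\<^sup>2 + 2 * (norm b)\<^sup>2"
    using zero_le_power2[of "norm a - norm b"] by (simp add: power2_sum power2_diff)
  finally show ?thesis .
qed

lemma square_integrable_add:
  assumes f: "square_integrable M f" and g: "square_integrable M g"
  shows "square_integrable M (\<lambda>x. f x + g x)"
proof -
  note [measurable] = square_integrableD(1)[OF f] square_integrableD(1)[OF g]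
  have "integrable M (\<lambda>x. 2 * (norm (f x))\<^sup>2 + 2 * (norm (g x))\<^sup>2)"
    using square_integrableD(2)[OF f] square_integrableD(2)[OF g] by simp
  then have "integrable M (\<lambda>x. (norm (f x + g x))\<^sup>2)"
    by (rule Bochner_Integration.integrable_bound) (auto intro!: AE_I2 order_trans[OF norm_add_sq_le])
  then show ?thesis by (simp add: square_integrable_def)
qed

lemma square_integrable_cmult:
  "square_integrable M f \<Longrightarrow> square_integrable M (\<lambda>x. c * f x)"
  by (auto simp: square_integrable_def norm_mult power_mult_distrib)

lemma square_integrable_uminus: "square_integrable M f \<Longrightarrow> square_integrable M (\<lambda>x. - f x)"
  using square_integrable_cmult[of M f "-1"] by simp

lemma square_integrable_diff:
  "square_integrable M f \<Longrightarrow> square_integrable M g \<Longrightarrow> square_integrable M (\<lambda>x. f x - g x)"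
  using square_integrable_add[of M f "\<lambda>x. - g x"] square_integrable_uminus[of M g] by simp

lemma square_integrable_sum:
  "(\<And>k. k \<in> A \<Longrightarrow> square_integrable M (f k)) \<Longrightarrow> square_integrable M (\<lambda>x. \<Sum>k\<in>A. f k x)"
proof (induction A rule: infinite_finite_induct)
  case (insert a A)
  then show ?case using square_integrable_add[of M "f a" "\<lambda>x. \<Sum>k\<in>A. f k x"] by simp
qed (auto simp: square_integrable_def)

lemma borel_measurable_cnj [measurable (raw)]:
  "f \<in> borel_measurable M \<Longrightarrow> (\<lambda>x. cnj (f x)) \<in> borel_measurable M"
  by (rule borel_measurable_continuous_on[of cnj]) (intro continuous_intros)

lemma square_integrable_cnj: "square_integrable M f \<Longrightarrow> square_integrable M (\<lambda>x. cnj (f x))"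
  by (auto simp: square_integrable_def)

lemma square_integrable_iff_nn_integral:
  "square_integrable M f \<longleftrightarrow> f \<in> borel_measurable M \<and> (\<integral>\<^sup>+ x. ennreal ((norm (f x))\<^sup>2) \<partial>M) < \<infinity>"
  unfolding square_integrable_def by (auto simp: integrable_iff_bounded)

lemma square_integrable_mult:
  assumes f: "square_integrable M f" and g: "square_integrable M g"
  shows "integrable M (\<lambda>x. f x * g x)"
proof -
  note [measurable] = square_integrableD(1)[OF f] square_integrableD(1)[OF g]
  have "integrable M (\<lambda>x. (norm (f x))\<^sup>2 + (norm (g x))\<^sup>2)"
    using square_integrableD(2)[OF f] square_integrableD(2)[OF g] by simp
  then show ?thesis
  proof (rule Bochner_Integration.integrable_bound; (intro AE_I2)?)
    fix x
    have "2 * (norm (f x) * norm (g x)) \<le> (norm (f x))\<^sup>2 + (norm (g x))\<^sup>2"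
      using sum_squares_bound[of "norm (f x)" "norm (g x)"] by simp
    moreover have "0 \<le> norm (f x) * norm (g x)" by simp
    ultimately have "norm (f x) * norm (g x) \<le> (norm (f x))\<^sup>2 + (norm (g x))\<^sup>2" by linarith
    then show "norm (f x * g x) \<le> norm ((norm (f x))\<^sup>2 + (norm (g x))\<^sup>2)"
      by (simp add: norm_mult)
  qed simp
qed

lemma Cauchy_Schwarz_integral:
  assumes f: "square_integrable M f" and g: "square_integrable M g"
  shows "(norm (LINT x|M. f x * g x))\<^sup>2 \<le> (LINT x|M. (norm (f x))\<^sup>2) * (LINT x|M. (norm (g x))\<^sup>2)"
proof -
  note [measurable] = square_integrableD(1)[OF f] square_integrableD(1)[OF g]
  define A where "A = (LINT x|M. (norm (f x))\<^sup>2)"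
  define B where "B = (LINT x|M. (norm (g x))\<^sup>2)"
  define C where "C = (LINT x|M. norm (f x) * norm (g x))"
  have iC: "integrable M (\<lambda>x. norm (f x) * norm (g x))"
    using integrable_norm[OF square_integrable_mult[OF f g]] by (simp add: norm_mult)
  have nn: "A \<ge> 0" "B \<ge> 0" "C \<ge> 0" unfolding A_def B_def C_def by (auto intro!: integral_nonneg_AE)
  \<comment> \<open>This integrates (t |f| - |g|)^2 >= 0. Below, t = C / A is the minimiser; for A =
    0 the bound is linear in t, and t = (B + 1) / C refutes C > 0.\<close>
  have key: "2 * C * t \<le> A * t\<^sup>2 + B" for t :: real
  proof -
    have "(LINT x|M. 2 * t * (norm (f x) * norm (g x))) \<le> (LINT x|M. t\<^sup>2 * (norm (f x))\<^sup>2 + (norm (g x))\<^sup>2)"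
    proof (rule integral_mono)
      fix x show "2 * t * (norm (f x) * norm (g x)) \<le> t\<^sup>2 * (norm (f x))\<^sup>2 + (norm (g x))\<^sup>2"
        using zero_le_power2[of "t * norm (f x) - norm (g x)"] by (simp add: power2_diff algebra_simps power_mult_distrib)
    qed (use iC square_integrableD(2)[OF f] square_integrableD(2)[OF g] in auto)
    then show ?thesis
      using square_integrableD(2)[OF f] square_integrableD(2)[OF g] iC
      by (simp add: A_def B_def C_def algebra_simps)
  qed
  have "C\<^sup>2 \<le> A * B"
  proof (cases "A = 0")
    case True
    have "C = 0"
    proof (rule ccontr)
      assume "C \<noteq> 0"
      then have "C > 0" using nn by simp
      then have "2 * C * ((B + 1) / C) = 2 * B + 2" by simp
      with key[of "(B + 1) / C"] True nn show False by simp
    qed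
    then show ?thesis using nn by simp
  next
    case False
    then have "A > 0" using nn by simp
    with key[of "C / A"] show ?thesis by (simp add: field_simps power2_eq_square)
  qed
  moreover have "norm (LINT x|M. f x * g x) \<le> C"
    unfolding C_def by (rule order_trans[OF integral_norm_bound]) (simp add: norm_mult)
  ultimately show ?thesis unfolding A_def[symmetric] B_def[symmetric]
    using nn by (meson norm_ge_zero order_trans power_mono)
qed

text \<open>Riesz-Fischer. Along \<open>r\<close> the squared distances fall below 4^-j, so the sum
  of 2^j d_j^2 is finite a.e.; then d_j is summable because d_j <= 2^-j + 2^j d_j^2, and the
  subsequence converges a.e. Fatou's lemma returns to convergence in mean.\<close>

lemma square_integrable_complete:
  fixes f :: "nat \<Rightarrow> 'a \<Rightarrow> complex"
  assumes f: "\<And>n. square_integrable M (f n)"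
    and Cauchy: "\<And>\<epsilon>. \<epsilon> > 0 \<Longrightarrow> \<exists>N. \<forall>m\<ge>N. \<forall>n\<ge>N. (LINT x|M. (norm (f m x - f n x))\<^sup>2) < \<epsilon>"
  obtains g where "square_integrable M g"
    "(\<lambda>n. LINT x|M. (norm (f n x - g x))\<^sup>2) \<longlonglongrightarrow> 0"
proof -
  note [measurable] = square_integrableD(1)[OF f]
  have fd: "square_integrable M (\<lambda>x. f m x - f n x)" for m n
    by (intro square_integrable_diff f)
  have "\<exists>N. \<forall>j. (\<forall>m\<ge>N j. \<forall>n\<ge>N j. (LINT x|M. (norm (f m x - f n x))\<^sup>2) < (1/4)^j)"
    using Cauchy by (intro choice) auto
  then obtain N where N: "\<And>j m n. m \<ge> N j \<Longrightarrow> n \<ge> N j \<Longrightarrow> (LINT x|M. (norm (f m x - f n x))\<^sup>2) < (1/4)^j"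
    by blast
  define r where "r j = (\<Sum>i\<le>j. N i) + j" for j
  have rN: "r j \<ge> N j" for j
    unfolding r_def using member_le_sum[of j "{..j}" N] by (simp add: trans_le_add1)
  have rS: "r (Suc j) \<ge> N j" for j using rN[of j] by (simp add: r_def)
  define d where "d j x = norm (f (r (Suc j)) x - f (r j) x)" for j x
  have d_meas [measurable]: "d j \<in> borel_measurable M" for j unfolding d_def by measurable
  have d_int: "integrable M (\<lambda>x. 2^j * (d j x)\<^sup>2)" for j
    using square_integrableD(2)[OF fd] by (simp add: d_def)
  have d_bound: "(\<integral>\<^sup>+ x. ennreal (2^j * (d j x)\<^sup>2) \<partial>M) \<le> ennreal ((1/2)^j)" for j
  proof -
    have "(\<integral>\<^sup>+ x. ennreal (2^j * (d j x)\<^sup>2) \<partial>M) = ennreal (LINT x|M. 2^j * (d j x)\<^sup>2)"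
      by (rule nn_integral_eq_integral[OF d_int]) auto
    also have "(LINT x|M. 2^j * (d j x)\<^sup>2) = 2^j * (LINT x|M. (d j x)\<^sup>2)" by simp
    also have "\<dots> \<le> 2^j * (1/4)^j"
      using N[OF rS rN, of j] unfolding d_def by (intro mult_left_mono less_imp_le) auto
    also have "\<dots> = (1/2)^j" by (simp add: power_mult_distrib[symmetric])
    finally show ?thesis by (simp add: ennreal_leI)
  qed
  have "(\<integral>\<^sup>+ x. (\<Sum>j. ennreal (2^j * (d j x)\<^sup>2)) \<partial>M) = (\<Sum>j. \<integral>\<^sup>+ x. ennreal (2^j * (d j x)\<^sup>2) \<partial>M)"
    by (rule nn_integral_suminf) measurable
  also have "\<dots> \<le> (\<Sum>j. ennreal ((1/2)^j))" by (intro suminf_le d_bound) auto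
  also have "\<dots> < \<infinity>" by (simp add: suminf_ennreal2 summable_geometric)
  finally have "AE x in M. (\<Sum>j. ennreal (2^j * (d j x)\<^sup>2)) \<noteq> \<infinity>"
    by (intro nn_integral_PInf_AE) (auto simp: less_top)
  then have conv: "AE x in M. convergent (\<lambda>j. f (r j) x)"
  proof (rule AE_mp, intro AE_I2 impI)
    fix x assume "(\<Sum>j. ennreal (2^j * (d j x)\<^sup>2)) \<noteq> \<infinity>"
    then have s1: "summable (\<lambda>j. 2^j * (d j x)\<^sup>2)"
      by (intro summable_suminf_not_top) auto
    have "summable (\<lambda>j. (1/2::real)^j + 2^j * (d j x)\<^sup>2)"
      by (intro summable_add s1 summable_geometric) auto
    then have "summable (\<lambda>j. d j x)"
    proof (rule summable_comparison_test'[where N=0])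
      fix j :: nat
      have a: "(1/2::real)^j * 2^j = 1" by (simp add: power_mult_distrib[symmetric])
      define w where "w = (1/2::real)^j"
      define z where "z = (2::real)^j"
      have wz: "w * z = 1" "w \<ge> 0" using a by (simp_all add: w_def z_def)
      have "w * (2 * (z * d j x)) \<le> w * (1 + (z * d j x)\<^sup>2)"
        using zero_le_power2[of "z * d j x - 1"] wz by (intro mult_left_mono) (auto simp: power2_diff)
      also have "w * (1 + (z * d j x)\<^sup>2) = w + (w * z) * (z * (d j x)\<^sup>2)"
        by (simp add: power2_eq_square algebra_simps)
      finally have "(w * z) * (2 * d j x) \<le> w + (w * z) * (z * (d j x)\<^sup>2)" by (simp add: algebra_simps)
      then have "2 * d j x \<le> (1/2)^j + 2^j * (d j x)\<^sup>2" unfolding wz by (simp add: w_def z_def)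
      moreover have "d j x \<ge> 0" by (simp add: d_def)
      ultimately show "norm (d j x) \<le> (1/2)^j + 2^j * (d j x)\<^sup>2" by simp
    qed
    then have "summable (\<lambda>j. f (r (Suc j)) x - f (r j) x)"
      unfolding d_def by (rule summable_norm_cancel)
    then have "convergent (\<lambda>n. (\<Sum>j<n. f (r (Suc j)) x - f (r j) x))"
      by (simp only: summable_iff_convergent)
    moreover have "(\<Sum>j<n. f (r (Suc j)) x - f (r j) x) = f (r n) x - f (r 0) x" for n
      by (rule sum_lessThan_telescope)
    ultimately show "convergent (\<lambda>j. f (r j) x)"
      by (simp add: convergent_diff_const_right_iff)
  qed
  define g where "g x = lim (\<lambda>j. f (r j) x)" for x
  have [measurable]: "g \<in> borel_measurable M"
    unfolding g_def by (rule borel_measurable_lim_metric) measurable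
  have lim: "AE x in M. (\<lambda>j. f (r j) x) \<longlonglongrightarrow> g x"
    using conv by (auto elim!: AE_mp simp: g_def convergent_LIMSEQ_iff)
  have fatou: "(\<integral>\<^sup>+ x. ennreal ((norm (f n x - g x))\<^sup>2) \<partial>M) \<le> ennreal \<epsilon>"
    if "\<epsilon> > 0" "\<forall>m\<ge>N0. \<forall>n\<ge>N0. (LINT x|M. (norm (f m x - f n x))\<^sup>2) < \<epsilon>" "n \<ge> N0" for n \<epsilon> N0
  proof -
    have "(\<integral>\<^sup>+ x. ennreal ((norm (f n x - g x))\<^sup>2) \<partial>M) = (\<integral>\<^sup>+ x. liminf (\<lambda>j. ennreal ((norm (f n x - f (r j) x))\<^sup>2)) \<partial>M)"
    proof (rule nn_integral_cong_AE, rule AE_mp[OF lim], intro AE_I2 impI)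
      fix x assume "(\<lambda>j. f (r j) x) \<longlonglongrightarrow> g x"
      then have "(\<lambda>j. ennreal ((norm (f n x - f (r j) x))\<^sup>2)) \<longlonglongrightarrow> ennreal ((norm (f n x - g x))\<^sup>2)"
        by (intro tendsto_intros)
      then show "ennreal ((norm (f n x - g x))\<^sup>2) = liminf (\<lambda>j. ennreal ((norm (f n x - f (r j) x))\<^sup>2))"
        using lim_imp_Liminf[OF trivial_limit_sequentially] by metis
    qed
    also have "\<dots> \<le> liminf (\<lambda>j. \<integral>\<^sup>+ x. ennreal ((norm (f n x - f (r j) x))\<^sup>2) \<partial>M)"
      by (rule nn_integral_liminf) measurable
    also have "\<dots> \<le> ennreal \<epsilon>"
    proof (rule order_trans[OF Liminf_le_Limsup Limsup_bounded], simp, rule eventually_sequentiallyI[of N0])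
      fix j assume "N0 \<le> j"
      then have "r j \<ge> N0" by (simp add: r_def)
      have "(\<integral>\<^sup>+ x. ennreal ((norm (f n x - f (r j) x))\<^sup>2) \<partial>M) = ennreal (LINT x|M. (norm (f n x - f (r j) x))\<^sup>2)"
        by (rule nn_integral_eq_integral[OF square_integrableD(2)[OF fd]]) auto
      also have "\<dots> \<le> ennreal \<epsilon>" using that \<open>r j \<ge> N0\<close> by (intro ennreal_leI) (auto intro: less_imp_le)
      finally show "(\<integral>\<^sup>+ x. ennreal ((norm (f n x - f (r j) x))\<^sup>2) \<partial>M) \<le> ennreal \<epsilon>" .
    qed
    finally show ?thesis .
  qed
  have fg: "square_integrable M (\<lambda>x. f n x - g x)" if "\<epsilon> > 0" "\<forall>m\<ge>N0. \<forall>n\<ge>N0. (LINT x|M. (norm (f m x - f n x))\<^sup>2) < \<epsilon>" "n \<ge> N0" for n \<epsilon> N0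
    using order.strict_trans1[OF fatou[OF that]] by (simp add: square_integrable_iff_nn_integral)
  obtain N1 where N1: "\<forall>m\<ge>N1. \<forall>n\<ge>N1. (LINT x|M. (norm (f m x - f n x))\<^sup>2) < 1"
    using Cauchy[of 1] by auto
  have g: "square_integrable M g"
    using square_integrable_diff[OF f fg[OF _ N1 order_refl], of N1] by simp
  have "(\<lambda>n. LINT x|M. (norm (f n x - g x))\<^sup>2) \<longlonglongrightarrow> 0"
  proof (rule LIMSEQ_I)
    fix e :: real assume "e > 0"
    then obtain N0 where N0: "\<forall>m\<ge>N0. \<forall>n\<ge>N0. (LINT x|M. (norm (f m x - f n x))\<^sup>2) < e / 2"
      using Cauchy[of "e/2"] by auto
    have "norm ((LINT x|M. (norm (f n x - g x))\<^sup>2) - 0) < e" if "n \<ge> N0" for n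
    proof -
      have "ennreal (LINT x|M. (norm (f n x - g x))\<^sup>2) = (\<integral>\<^sup>+ x. ennreal ((norm (f n x - g x))\<^sup>2) \<partial>M)"
        by (rule nn_integral_eq_integral[symmetric, OF square_integrableD(2)[OF square_integrable_diff[OF f g]]]) auto
      also have "\<dots> \<le> ennreal (e / 2)" using fatou[OF _ N0 that] \<open>e > 0\<close> by simp
      finally have "(LINT x|M. (norm (f n x - g x))\<^sup>2) \<le> e / 2" using \<open>e > 0\<close> by simp
      moreover have "(LINT x|M. (norm (f n x - g x))\<^sup>2) \<ge> 0" by (intro integral_nonneg_AE) auto
      ultimately show ?thesis using \<open>e > 0\<close> by simp
    qed
    then show "\<exists>no. \<forall>n\<ge>no. norm ((LINT x|M. (norm (f n x - g x))\<^sup>2) - 0) < e" by blast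
  qed
  with g show ?thesis by (rule that)
qed

section \<open>Orthonormal expansions and Parseval's identity\<close>

lemma of_real_LINT_norm_sq:
  "complex_of_real (LINT x|M. (norm (f x))\<^sup>2) = (LINT x|M. f x * cnj (f x))"
  by (simp add: complex_norm_square[symmetric] flip: of_real_power)

lemma LINT_norm_add_sq:
  assumes f: "square_integrable M f" and g: "square_integrable M g"
  shows "(LINT x|M. (norm (f x + g x))\<^sup>2) =
    (LINT x|M. (norm (f x))\<^sup>2) + (LINT x|M. (norm (g x))\<^sup>2) + 2 * Re (LINT x|M. f x * cnj (g x))"
proof -
  have i: "integrable M (\<lambda>x. f x * cnj (g x))" by (intro square_integrable_mult square_integrable_cnj f g)
  have "(norm (a + b))\<^sup>2 = (norm a)\<^sup>2 + (norm b)\<^sup>2 + 2 * Re (a * cnj b)" for a b :: complex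
    unfolding cmod_power2 by (simp add: power2_eq_square algebra_simps)
  then have "(LINT x|M. (norm (f x + g x))\<^sup>2) =
      (LINT x|M. ((norm (f x))\<^sup>2 + (norm (g x))\<^sup>2) + 2 * Re (f x * cnj (g x)))" by simp
  also have "\<dots> = (LINT x|M. (norm (f x))\<^sup>2 + (norm (g x))\<^sup>2) + (LINT x|M. 2 * Re (f x * cnj (g x)))"
    using square_integrableD(2)[OF f] square_integrableD(2)[OF g] i
    by (intro Bochner_Integration.integral_add Bochner_Integration.integrable_add integrable_mult_right integrable_Re)
  also have "(LINT x|M. (norm (f x))\<^sup>2 + (norm (g x))\<^sup>2) = (LINT x|M. (norm (f x))\<^sup>2) + (LINT x|M. (norm (g x))\<^sup>2)"
    using square_integrableD(2)[OF f] square_integrableD(2)[OF g] by simp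
  also have "(LINT x|M. 2 * Re (f x * cnj (g x))) = 2 * Re (LINT x|M. f x * cnj (g x))"
    using integral_Re[OF i] by (simp only: integral_mult_right_zero)
  finally show ?thesis .
qed

lemma inner_product_tendsto:
  assumes f: "\<And>n. square_integrable M (f n)" "square_integrable M g" "square_integrable M h"
    and lim: "(\<lambda>n. LINT x|M. (norm (f n x - g x))\<^sup>2) \<longlonglongrightarrow> 0"
  shows "(\<lambda>n. LINT x|M. f n x * h x) \<longlonglongrightarrow> (LINT x|M. g x * h x)"
proof -
  have le: "norm ((LINT x|M. f n x * h x) - (LINT x|M. g x * h x))
      \<le> sqrt ((LINT x|M. (norm (f n x - g x))\<^sup>2) * (LINT x|M. (norm (h x))\<^sup>2))" for n
  proof -
    have "(LINT x|M. f n x * h x) - (LINT x|M. g x * h x) = (LINT x|M. (f n x - g x) * h x)"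
      using f by (simp add: square_integrable_mult left_diff_distrib)
    then show ?thesis
      using Cauchy_Schwarz_integral[OF square_integrable_diff[OF f(1,2)] f(3), of n] by (simp add: real_le_rsqrt)
  qed
  have "(\<lambda>n. sqrt ((LINT x|M. (norm (f n x - g x))\<^sup>2) * (LINT x|M. (norm (h x))\<^sup>2))) \<longlonglongrightarrow> sqrt (0 * (LINT x|M. (norm (h x))\<^sup>2))"
    by (intro tendsto_intros lim)
  then have "(\<lambda>n. (LINT x|M. f n x * h x) - (LINT x|M. g x * h x)) \<longlonglongrightarrow> 0"
    by (intro Lim_null_comparison[OF eventuallyI[OF le]]) simp
  then show ?thesis by (simp add: LIM_zero_iff)
qed

text \<open>The basis is real-valued, so coefficients carry no conjugation. The index type is
  countable instead of \<open>nat\<close>, so that multi-indices can be used as they are.\<close>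

locale complete_orthonormal =
  fixes M :: "'a measure" and e :: "'k::countable \<Rightarrow> 'a \<Rightarrow> real"
  assumes basis: "\<And>k. square_integrable M (\<lambda>x. of_real (e k x))"
    and orthonormal: "\<And>j k. (LINT x|M. e j x * e k x) = (if j = k then 1 else 0)"
    and complete: "\<And>f. square_integrable M f \<Longrightarrow> (\<And>k. (LINT x|M. f x * of_real (e k x)) = 0)
      \<Longrightarrow> AE x in M. f x = 0"
begin

definition coef :: "('a \<Rightarrow> complex) \<Rightarrow> 'k \<Rightarrow> complex" where
  "coef f k = (LINT x|M. f x * of_real (e k x))"

definition partial_sum :: "'k set \<Rightarrow> ('k \<Rightarrow> complex) \<Rightarrow> 'a \<Rightarrow> complex" where
  "partial_sum A c x = (\<Sum>k\<in>A. c k * of_real (e k x))"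

definition first_indices :: "nat \<Rightarrow> 'k set" where
  "first_indices n = {k. to_nat k < n}"

lemma finite_first_indices [simp]: "finite (first_indices n)"
proof -
  have "first_indices n \<subseteq> from_nat ` {..<n}"
    unfolding first_indices_def by (metis (mono_tags) from_nat_to_nat image_eqI lessThan_iff mem_Collect_eq subsetI)
  then show ?thesis by (rule finite_subset) auto
qed

text \<open>Sums over indices are written as integrals for counting measure, so that Tonelli's
  theorem can exchange them with time integrals. Here they are linked to finite partial
  sums.\<close>

lemma nn_integral_count_space_SUP:
  fixes g :: "'k \<Rightarrow> ennreal"
  shows "(\<integral>\<^sup>+k. g k \<partial>count_space UNIV) = (SUP n. \<Sum>k\<in>first_indices n. g k)"
proof -
  have "(SUP n. g k * indicator (first_indices n) k) = g k" for k
    by (rule antisym) (auto intro!: SUP_least SUP_upper2[of "Suc (to_nat k)"] simp: first_indices_def indicator_def)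
  then have "(\<integral>\<^sup>+k. g k \<partial>count_space UNIV) = (\<integral>\<^sup>+k. (SUP n. g k * indicator (first_indices n) k) \<partial>count_space UNIV)" by simp
  also have "\<dots> = (SUP n. \<integral>\<^sup>+k. g k * indicator (first_indices n) k \<partial>count_space UNIV)"
    by (intro nn_integral_monotone_convergence_SUP)
      (auto simp: incseq_def le_fun_def first_indices_def indicator_def)
  also have "\<dots> = (SUP n. \<Sum>k\<in>first_indices n. g k)"
    by (simp add: nn_integral_count_space_indicator[symmetric] nn_integral_count_space_finite)
  finally show ?thesis .
qed

lemma square_integrable_partial_sum: "square_integrable M (partial_sum A c)"
  unfolding partial_sum_def by (intro square_integrable_sum square_integrable_cmult basis)

lemma LINT_mult_partial_sum:
  assumes f: "square_integrable M f"
  shows "(LINT x|M. f x * partial_sum A c x) = (\<Sum>k\<in>A. c k * coef f k)"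
proof -
  have "integrable M (\<lambda>x. f x * (c k * of_real (e k x)))" for k
    by (intro square_integrable_mult square_integrable_cmult basis f)
  then have "(LINT x|M. f x * partial_sum A c x) = (\<Sum>k\<in>A. LINT x|M. f x * (c k * of_real (e k x)))"
    unfolding partial_sum_def sum_distrib_left by (intro Bochner_Integration.integral_sum) auto
  also have "\<dots> = (\<Sum>k\<in>A. c k * coef f k)"
    unfolding coef_def by (intro sum.cong refl) (simp add: mult.left_commute)
  finally show ?thesis .
qed

lemma coef_basis: "coef (\<lambda>x. of_real (e j x)) k = (if j = k then 1 else 0)"
proof -
  have "coef (\<lambda>x. of_real (e j x)) k = (LINT x|M. complex_of_real (e j x * e k x))" by (simp add: coef_def)
  also have "\<dots> = of_real (LINT x|M. e j x * e k x)" by (rule integral_complex_of_real)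
  finally show ?thesis using orthonormal[of j k] by simp
qed

lemma coef_partial_sum:
  assumes "finite A"
  shows "coef (partial_sum A c) k = (if k \<in> A then c k else 0)"
proof -
  have "coef (partial_sum A c) k = (LINT x|M. of_real (e k x) * partial_sum A c x)"
    unfolding coef_def by (simp add: mult.commute)
  also have "\<dots> = (\<Sum>j\<in>A. c j * coef (\<lambda>x. of_real (e k x)) j)" by (rule LINT_mult_partial_sum[OF basis])
  also have "\<dots> = (\<Sum>j\<in>A. if k = j then c j else 0)" by (intro sum.cong) (auto simp: coef_basis)
  finally show ?thesis using assms by simp
qed

lemma cnj_partial_sum: "cnj (partial_sum A c x) = partial_sum A (\<lambda>k. cnj (c k)) x"
  by (simp add: partial_sum_def)

lemma LINT_norm_partial_sum:
  assumes "finite A"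
  shows "(LINT x|M. (norm (partial_sum A c x))\<^sup>2) = (\<Sum>k\<in>A. (norm (c k))\<^sup>2)"
proof -
  have "complex_of_real (LINT x|M. (norm (partial_sum A c x))\<^sup>2) = (\<Sum>k\<in>A. cnj (c k) * coef (partial_sum A c) k)"
    unfolding of_real_LINT_norm_sq cnj_partial_sum by (rule LINT_mult_partial_sum[OF square_integrable_partial_sum])
  also have "\<dots> = complex_of_real (\<Sum>k\<in>A. (norm (c k))\<^sup>2)"
    using assms by (simp only: of_real_sum complex_norm_square coef_partial_sum mult.commute if_True cong: sum.cong)
  finally show ?thesis by (simp only: of_real_eq_iff)
qed

lemma partial_sum_diff:
  assumes "finite A" "B \<subseteq> A"
  shows "partial_sum A c x - partial_sum B c x = partial_sum (A - B) c x"
  using assms by (simp add: partial_sum_def sum_diff)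

lemma coef_diff: "square_integrable M f \<Longrightarrow> square_integrable M g \<Longrightarrow> coef (\<lambda>x. f x - g x) k = coef f k - coef g k"
  unfolding coef_def by (simp add: square_integrable_mult basis left_diff_distrib)

lemma coef_add: "square_integrable M f \<Longrightarrow> square_integrable M g \<Longrightarrow> coef (\<lambda>x. f x + g x) k = coef f k + coef g k"
  unfolding coef_def by (simp add: square_integrable_mult basis distrib_right)

lemma coef_cmult: "coef (\<lambda>x. c * f x) k = c * coef f k"
  unfolding coef_def by (simp add: mult.assoc)

lemma coef_eq_imp_AE_eq:
  assumes "square_integrable M f" "square_integrable M g" "\<And>k. coef f k = coef g k"
  shows "AE x in M. f x = g x"
proof -
  have "AE x in M. f x - g x = 0"
    using assms coef_diff[OF assms(1,2)] by (intro complete square_integrable_diff) (auto simp: coef_def)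
  then show ?thesis by simp
qed

lemma coef_tendsto:
  assumes "\<And>n. square_integrable M (f n)" "square_integrable M g"
    "(\<lambda>n. LINT x|M. (norm (f n x - g x))\<^sup>2) \<longlonglongrightarrow> 0"
  shows "(\<lambda>n. coef (f n) k) \<longlonglongrightarrow> coef g k"
  unfolding coef_def using assms by (intro inner_product_tendsto basis)

lemma Bessel_eq:
  assumes f: "square_integrable M f" and "finite A"
  shows "(LINT x|M. (norm (partial_sum A (coef f) x - f x))\<^sup>2) =
    (LINT x|M. (norm (f x))\<^sup>2) - (\<Sum>k\<in>A. (norm (coef f k))\<^sup>2)"
proof -
  have g: "square_integrable M (\<lambda>x. - partial_sum A (coef f) x)"
    by (intro square_integrable_uminus square_integrable_partial_sum)
  have "(LINT x|M. f x * cnj (- partial_sum A (coef f) x)) = - (\<Sum>k\<in>A. cnj (coef f k) * coef f k)"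
    using LINT_mult_partial_sum[OF f, of A "\<lambda>k. cnj (coef f k)"] by (simp add: cnj_partial_sum)
  also have "\<dots> = complex_of_real (- (\<Sum>k\<in>A. (norm (coef f k))\<^sup>2))"
    by (simp only: of_real_minus of_real_sum complex_norm_square mult.commute)
  finally have "Re (LINT x|M. f x * cnj (- partial_sum A (coef f) x)) = - (\<Sum>k\<in>A. (norm (coef f k))\<^sup>2)"
    by (simp only: Re_complex_of_real)
  then show ?thesis
    using LINT_norm_add_sq[OF f g] LINT_norm_partial_sum[OF assms(2), of "coef f"]
    by (simp add: norm_minus_commute)
qed

text \<open>Squared distances between partial sums are differences of the bounded monotone sequence
  \<open>\<sigma>\<close>, so completeness of L^2 supplies the limit, and coefficients are
  continuous under convergence in mean.\<close>

lemma synthesis: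
  assumes c: "(\<integral>\<^sup>+k. ennreal ((norm (c k))\<^sup>2) \<partial>count_space UNIV) < \<infinity>"
  obtains f where "square_integrable M f" "\<And>k. coef f k = c k"
    "(\<lambda>n. LINT x|M. (norm (partial_sum (first_indices n) c x - f x))\<^sup>2) \<longlonglongrightarrow> 0"
proof -
  define \<sigma> where "\<sigma> n = (\<Sum>k\<in>first_indices n. (norm (c k))\<^sup>2)" for n
  define S where "S n = partial_sum (first_indices n) c" for n
  have sub: "first_indices m \<subseteq> first_indices n" if "m \<le> n" for m n
    using that by (auto simp: first_indices_def)
  have mono: "incseq \<sigma>" unfolding incseq_def \<sigma>_def by (auto intro!: sum_mono2 sub)
  obtain B where B: "(\<integral>\<^sup>+k. ennreal ((norm (c k))\<^sup>2) \<partial>count_space UNIV) = ennreal B" "B \<ge> 0"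
    using c by (cases "\<integral>\<^sup>+k. ennreal ((norm (c k))\<^sup>2) \<partial>count_space UNIV") auto
  have "ennreal (\<sigma> n) \<le> ennreal B" for n
    unfolding B(1)[symmetric] nn_integral_count_space_SUP \<sigma>_def
    by (rule SUP_upper2[of n]) (auto simp: sum_ennreal)
  then have "\<sigma> n \<le> B" for n using B(2) by simp
  then have "convergent \<sigma>" using mono by (metis incseq_convergent convergentI)
  then have "Cauchy \<sigma>" by (rule convergent_Cauchy)
  have dist: "(LINT x|M. (norm (S m x - S n x))\<^sup>2) = \<bar>\<sigma> m - \<sigma> n\<bar>" for m n
  proof -
    have *: "(LINT x|M. (norm (S m x - S n x))\<^sup>2) = \<bar>\<sigma> m - \<sigma> n\<bar>" if "n \<le> m" for m n
    proof -
      have "(LINT x|M. (norm (S m x - S n x))\<^sup>2) = (\<Sum>k\<in>first_indices m - first_indices n. (norm (c k))\<^sup>2)"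
        unfolding S_def partial_sum_diff[OF finite_first_indices sub[OF that]] by (rule LINT_norm_partial_sum) simp
      also have "\<dots> = \<sigma> m - \<sigma> n" unfolding \<sigma>_def by (simp add: sum_diff sub[OF that])
      finally show ?thesis using incseqD[OF mono that] by simp
    qed
    show ?thesis
    proof (cases "n \<le> m")
      case False
      then show ?thesis using *[of m n] by (simp add: norm_minus_commute abs_minus_commute)
    qed (rule *)
  qed
  have si: "square_integrable M (S n)" for n unfolding S_def by (rule square_integrable_partial_sum)
  obtain f where f: "square_integrable M f" "(\<lambda>n. LINT x|M. (norm (S n x - f x))\<^sup>2) \<longlonglongrightarrow> 0"
  proof (rule square_integrable_complete[of M S])
    fix \<epsilon> :: real assume "\<epsilon> > 0"
    then show "\<exists>N. \<forall>m\<ge>N. \<forall>n\<ge>N. (LINT x|M. (norm (S m x - S n x))\<^sup>2) < \<epsilon>"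
      unfolding dist using \<open>Cauchy \<sigma>\<close> by (auto simp: Cauchy_def dist_real_def)
  qed (use si in auto)
  have "coef f k = c k" for k
  proof -
    have "(\<lambda>n. coef (S n) k) \<longlonglongrightarrow> coef f k" by (rule coef_tendsto[OF si f])
    moreover have "eventually (\<lambda>n. coef (S n) k = c k) sequentially"
      using eventually_gt_at_top[of "to_nat k"]
      by eventually_elim (simp add: S_def coef_partial_sum first_indices_def[symmetric], simp add: first_indices_def)
    ultimately show ?thesis
      by (metis LIMSEQ_unique tendsto_eventually)
  qed
  with f show ?thesis by (intro that[of f]) (auto simp: S_def)
qed

lemma Bessel_le:
  assumes f: "square_integrable M f"
  shows "(\<integral>\<^sup>+k. ennreal ((norm (coef f k))\<^sup>2) \<partial>count_space UNIV) \<le> ennreal (LINT x|M. (norm (f x))\<^sup>2)"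
  unfolding nn_integral_count_space_SUP
proof (rule SUP_least)
  fix n
  have "0 \<le> (LINT x|M. (norm (partial_sum (first_indices n) (coef f) x - f x))\<^sup>2)" by (intro integral_nonneg_AE) auto
  then show "(\<Sum>k\<in>first_indices n. ennreal ((norm (coef f k))\<^sup>2)) \<le> ennreal (LINT x|M. (norm (f x))\<^sup>2)"
    unfolding Bessel_eq[OF f finite_first_indices] by (simp add: sum_ennreal)
qed

text \<open>By Bessel's inequality the series converges to some function with the coefficients of f;
  completeness of the basis identifies the two.\<close>

lemma partial_sums_tendsto:
  assumes f: "square_integrable M f"
  shows "(\<lambda>n. LINT x|M. (norm (partial_sum (first_indices n) (coef f) x - f x))\<^sup>2) \<longlonglongrightarrow> 0"
proof -
  obtain g where g: "square_integrable M g" "\<And>k. coef g k = coef f k"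
    "(\<lambda>n. LINT x|M. (norm (partial_sum (first_indices n) (coef f) x - g x))\<^sup>2) \<longlonglongrightarrow> 0"
    using synthesis[OF order.strict_trans1[OF Bessel_le[OF f]]] by auto
  have ae: "AE x in M. g x = f x" by (rule coef_eq_imp_AE_eq[OF g(1) f g(2)])
  have "(LINT x|M. (norm (partial_sum (first_indices n) (coef f) x - g x))\<^sup>2) =
    (LINT x|M. (norm (partial_sum (first_indices n) (coef f) x - f x))\<^sup>2)" for n
    using ae square_integrableD(1)[OF f] square_integrableD(1)[OF g(1)] square_integrableD(1)[OF square_integrable_partial_sum]
    by (intro integral_cong_AE) (auto elim: AE_mp)
  with g(3) show ?thesis by simp
qed

theorem Parseval:
  assumes f: "square_integrable M f"
  shows "(\<integral>\<^sup>+k. ennreal ((norm (coef f k))\<^sup>2) \<partial>count_space UNIV) = ennreal (LINT x|M. (norm (f x))\<^sup>2)"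
proof (rule antisym[OF Bessel_le[OF f]])
  have "(\<lambda>n. (LINT x|M. (norm (f x))\<^sup>2) - (LINT x|M. (norm (partial_sum (first_indices n) (coef f) x - f x))\<^sup>2))
      \<longlonglongrightarrow> (LINT x|M. (norm (f x))\<^sup>2) - 0"
    by (intro tendsto_diff tendsto_const partial_sums_tendsto f)
  then have "(\<lambda>n. ennreal (\<Sum>k\<in>first_indices n. (norm (coef f k))\<^sup>2)) \<longlonglongrightarrow> ennreal (LINT x|M. (norm (f x))\<^sup>2)"
    unfolding Bessel_eq[OF f finite_first_indices] by (intro tendsto_ennrealI) simp
  then show "ennreal (LINT x|M. (norm (f x))\<^sup>2) \<le> (\<integral>\<^sup>+k. ennreal ((norm (coef f k))\<^sup>2) \<partial>count_space UNIV)"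
    unfolding nn_integral_count_space_SUP
    by (rule LIMSEQ_le_const2) (auto intro!: exI[of _ 0] SUP_upper simp: sum_ennreal)
qed

lemma LINT_norm_unimodular:
  assumes "square_integrable M f" "square_integrable M f'"
    and "\<And>k. norm (\<theta> k) = 1" "\<And>k. coef f' k = \<theta> k * coef f k"
  shows "(LINT x|M. (norm (f' x))\<^sup>2) = (LINT x|M. (norm (f x))\<^sup>2)"
proof -
  have "ennreal (LINT x|M. (norm (f' x))\<^sup>2) = ennreal (LINT x|M. (norm (f x))\<^sup>2)"
    unfolding Parseval[OF assms(1), symmetric] Parseval[OF assms(2), symmetric]
    by (simp add: assms(3,4) norm_mult)
  then show ?thesis by (simp add: integral_nonneg_AE)
qed

text \<open>Polarisation: norms are preserved by Parseval, hence so is the real part of the inner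
  product with c g; c = 1 and c = \<i> recover the whole inner product. With the Fourier eigenvalues
  as \<theta> this is Plancherel's identity.\<close>

lemma inner_product_unimodular:
  assumes f: "square_integrable M f" "square_integrable M f'" and g: "square_integrable M g" "square_integrable M g'"
    and \<theta>: "\<And>k. norm (\<theta> k) = 1" "\<And>k. coef f' k = \<theta> k * coef f k" "\<And>k. coef g' k = \<theta> k * coef g k"
  shows "(LINT x|M. f' x * cnj (g' x)) = (LINT x|M. f x * cnj (g x))"
proof -
  have *: "Re (LINT x|M. f' x * cnj (c * g' x)) = Re (LINT x|M. f x * cnj (c * g x))" for c
  proof -
    have cg: "square_integrable M (\<lambda>x. c * g x)" "square_integrable M (\<lambda>x. c * g' x)"
      by (intro square_integrable_cmult g)+
    have "(LINT x|M. (norm (f' x + c * g' x))\<^sup>2) = (LINT x|M. (norm (f x + c * g x))\<^sup>2)"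
      using f cg \<theta> by (intro LINT_norm_unimodular[where \<theta> = \<theta>] square_integrable_add)
        (auto simp: coef_add coef_cmult algebra_simps)
    moreover have "(LINT x|M. (norm (f' x))\<^sup>2) = (LINT x|M. (norm (f x))\<^sup>2)"
      by (rule LINT_norm_unimodular[OF f \<theta>(1,2)])
    moreover have "(LINT x|M. (norm (c * g' x))\<^sup>2) = (LINT x|M. (norm (c * g x))\<^sup>2)"
      by (rule LINT_norm_unimodular[OF cg, of \<theta>]) (simp_all add: coef_cmult \<theta>)
    ultimately show ?thesis
      unfolding LINT_norm_add_sq[OF f(1) cg(1)] LINT_norm_add_sq[OF f(2) cg(2)] by simp
  qed
  have "(LINT x|M. h x * cnj (\<i> * k x)) = - \<i> * (LINT x|M. h x * cnj (k x))" for h k :: "'a \<Rightarrow> complex"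
    by (subst integral_mult_right_zero[symmetric]) (simp add: algebra_simps)
  with *[of \<i>] have "Re (- \<i> * (LINT x|M. f' x * cnj (g' x))) = Re (- \<i> * (LINT x|M. f x * cnj (g x)))"
    by (simp only:)
  with *[of 1] show ?thesis by (simp add: complex_eq_iff)
qed

end

section \<open>Functions determined by their moments\<close>

lemma sum_exp_terms_le:
  assumes "0 \<le> (y::real)"
  shows "(\<Sum>k<n. y ^ k / fact k) \<le> exp y"
proof -
  have s: "(\<lambda>k. y ^ k / fact k) sums exp y" using exp_converges[of y] by (simp add: divide_inverse mult.commute)
  show ?thesis using sum_le_suminf[OF sums_summable[OF s], of "{..<n}"] sums_unique[OF s] assms by simp
qed

lemma integrable_moment:
  fixes h :: "'a \<Rightarrow> complex" and X :: "'a \<Rightarrow> real"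
  assumes [measurable]: "h \<in> borel_measurable M" "X \<in> borel_measurable M"
    and int: "\<And>c. integrable M (\<lambda>x. norm (h x) * exp (c * \<bar>X x\<bar>))"
  shows "integrable M (\<lambda>x. h x * of_real (X x ^ k))"
proof (rule Bochner_Integration.integrable_bound[OF integrable_mult_right[OF int[of 1], of "fact k"]], safe intro!: AE_I2)
  fix x
  have "\<bar>X x\<bar> ^ k / fact k \<le> (\<Sum>j<Suc k. \<bar>X x\<bar> ^ j / fact j)" by (auto intro!: member_le_sum simp del: sum.lessThan_Suc)
  also have "\<dots> \<le> exp \<bar>X x\<bar>" by (rule sum_exp_terms_le) auto
  finally have "\<bar>X x\<bar> ^ k \<le> fact k * exp \<bar>X x\<bar>" by (simp add: field_simps)
  then have "norm (h x) * \<bar>X x\<bar> ^ k \<le> norm (h x) * (fact k * exp \<bar>X x\<bar>)"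
    by (intro mult_left_mono) auto
  then show "norm (h x * complex_of_real (X x ^ k)) \<le> norm (fact k * (norm (h x) * exp (1 * \<bar>X x\<bar>)))"
    by (simp add: norm_mult norm_power abs_mult mult_ac)
qed simp

text \<open>The exponential series is integrated term by term. All its partial sums are dominated by
  exp (|t| |X|), which is why integrability is assumed against every exponential and not only for
  the moments.\<close>

lemma integral_exp_eq_0_of_moments:
  fixes h :: "'a \<Rightarrow> complex" and X :: "'a \<Rightarrow> real"
  assumes [measurable]: "h \<in> borel_measurable M" "X \<in> borel_measurable M"
    and int: "\<And>c. integrable M (\<lambda>x. norm (h x) * exp (c * \<bar>X x\<bar>))"
    and moments: "\<And>k. (LINT x|M. h x * of_real (X x ^ k)) = 0"
  shows "(LINT x|M. h x * iexp (t * X x)) = 0"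
proof -
  define S where "S n x = (\<Sum>k<n. h x * ((\<i> * of_real (t * X x)) ^ k / fact k))" for n x
  have bound: "norm (S n x) \<le> norm (h x) * exp (\<bar>t\<bar> * \<bar>X x\<bar>)" for n x
  proof -
    have "norm (S n x) \<le> (\<Sum>k<n. norm (h x) * ((\<bar>t\<bar> * \<bar>X x\<bar>) ^ k / fact k))"
      unfolding S_def
      by (rule sum_norm_le) (simp add: norm_mult norm_divide norm_power abs_mult)
    also have "\<dots> \<le> norm (h x) * exp (\<bar>t\<bar> * \<bar>X x\<bar>)"
      unfolding sum_distrib_left[symmetric] by (intro mult_left_mono sum_exp_terms_le) auto
    finally show ?thesis .
  qed
  note term_int = integrable_moment[OF assms(1,2) int]
  have "(LINT x|M. S n x) = 0" for n
  proof -
    have eq: "h x * ((\<i> * of_real (t * X x)) ^ k / fact k) = ((\<i> * of_real t) ^ k / fact k) * (h x * of_real (X x ^ k))" for k x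
      by (simp add: power_mult_distrib)
    have "(LINT x|M. S n x) = (\<Sum>k<n. ((\<i> * of_real t) ^ k / fact k) * (LINT x|M. h x * of_real (X x ^ k)))"
      unfolding S_def eq using term_int by (subst Bochner_Integration.integral_sum) auto
    then show ?thesis using moments by simp
  qed
  moreover have "(\<lambda>n. LINT x|M. S n x) \<longlonglongrightarrow> (LINT x|M. h x * iexp (t * X x))"
  proof (rule integral_dominated_convergence[where w="\<lambda>x. norm (h x) * exp (\<bar>t\<bar> * \<bar>X x\<bar>)"])
    show "AE x in M. (\<lambda>n. S n x) \<longlonglongrightarrow> h x * iexp (t * X x)"
    proof (rule AE_I2)
      fix x
      have "(\<lambda>k. (\<i> * of_real (t * X x)) ^ k / fact k) sums iexp (t * X x)"
        using exp_converges[of "\<i> * of_real (t * X x)"] by (simp add: scaleR_conv_of_real divide_inverse mult.commute)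
      then show "(\<lambda>n. S n x) \<longlonglongrightarrow> h x * iexp (t * X x)"
        unfolding S_def sum_distrib_left[symmetric] sums_def by (intro tendsto_intros)
    qed
    show "(\<lambda>x. S n x) \<in> borel_measurable M" for n unfolding S_def by measurable
  qed (use int bound in auto)
  ultimately show ?thesis by (simp add: LIMSEQ_const_iff)
qed

text \<open>The positive and the negative part of h, normalised to probability measures, give X the
  same characteristic function, hence by Levy's theorem the same law. The measurable left inverse Y
  of X carries this back to an equality of measures on M.\<close>

lemma AE_le_0_of_Fourier_eq_0:
  fixes h :: "'a \<Rightarrow> real" and X :: "'a \<Rightarrow> real"
  assumes h: "integrable M h" and [measurable]: "X \<in> borel_measurable M"
    and Y [measurable]: "Y \<in> borel \<rightarrow>\<^sub>M M" and YX: "\<And>x. x \<in> space M \<Longrightarrow> Y (X x) = x"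
    and zero: "\<And>t. (LINT x|M. of_real (h x) * iexp (t * X x)) = 0"
  shows "AE x in M. h x \<le> 0"
proof -
  have [measurable]: "h \<in> borel_measurable M" using h by simp
  \<comment> \<open>At frequency 0 the hypothesis says that both parts have the same mass m, so one
    normalisation serves both; m = 0 is the trivial case.\<close>
  define m where "m = (LINT x|M. max 0 (h x))"
  have pos: "integrable M (\<lambda>x. max 0 (h x))" and neg: "integrable M (\<lambda>x. max 0 (- h x))"
    using h by auto
  have h_eq: "h x = max 0 (h x) - max 0 (- h x)" for x by auto
  have "(LINT x|M. h x) = 0"
    using zero[of 0] by simp
  then have m': "m = (LINT x|M. max 0 (- h x))"
    using pos neg unfolding m_def by (subst (asm) h_eq) simp
  show ?thesis
  proof (cases "m = 0")
    case True
    have "AE x in M. max 0 (h x) = 0"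
      using True pos unfolding m_def by (subst (asm) integral_nonneg_eq_0_iff_AE) auto
    then show ?thesis by eventually_elim (auto simp: max_def split: if_splits)
  next
    case False
    moreover have "m \<ge> 0" unfolding m_def by (intro integral_nonneg_AE) auto
    ultimately have m: "m > 0" by simp
    define P where "P f = density M (\<lambda>x. ennreal (max 0 (f x) / m))" for f :: "'a \<Rightarrow> real"
    have sets_P [measurable_cong]: "sets (P f) = sets M" for f by (simp add: P_def)
    have P_dist: "real_distribution (distr (P f) borel X)"
      if [measurable]: "f \<in> borel_measurable M" and f: "integrable M (\<lambda>x. max 0 (f x))" "(LINT x|M. max 0 (f x)) = m" for f
    proof -
      have "emeasure (P f) (space (P f)) = (\<integral>\<^sup>+x. ennreal (max 0 (f x) / m) \<partial>M)"
        unfolding P_def by (simp add: emeasure_density cong: nn_integral_cong)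
      also have "\<dots> = ennreal (LINT x|M. max 0 (f x) / m)"
        using m f by (intro nn_integral_eq_integral) auto
      also have "\<dots> = 1" using m f by simp
      finally interpret prob_space "P f" by (rule prob_spaceI)
      have "random_variable borel X" by measurable
      then interpret D: prob_space "distr (P f) borel X" by (rule prob_space_distr)
      show ?thesis by unfold_locales simp_all
    qed
    have char_P: "char (distr (P f) borel X) t = (LINT x|M. of_real (max 0 (f x)) * iexp (t * X x)) / of_real m"
      if [measurable]: "f \<in> borel_measurable M" for f t
    proof -
      have "char (distr (P f) borel X) t = (LINT x|P f. iexp (t * X x))"
        unfolding char_def by (rule integral_distr) measurable
      also have "\<dots> = (LINT x|M. (max 0 (f x) / m) *\<^sub>R iexp (t * X x))"
        unfolding P_def using m by (intro integral_density) auto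
      also have "\<dots> = (LINT x|M. of_real (max 0 (f x)) * iexp (t * X x)) / of_real m"
        by (subst integral_divide_zero[symmetric]) (simp add: scaleR_conv_of_real)
      finally show ?thesis .
    qed
    have "distr (P h) borel X = distr (P (\<lambda>x. - h x)) borel X"
    proof (rule Levy_uniqueness)
      show "char (distr (P h) borel X) = char (distr (P (\<lambda>x. - h x)) borel X)"
      proof
        fix t
        have i: "integrable M (\<lambda>x. of_real (max 0 (f x)) * iexp (t * X x))"
          if "integrable M (\<lambda>x. max 0 (f x))" "f \<in> borel_measurable M" for f
          using that by (intro Bochner_Integration.integrable_bound[OF that(1)]) (auto simp: norm_mult)
        have "(LINT x|M. of_real (max 0 (h x)) * iexp (t * X x)) - (LINT x|M. of_real (max 0 (- h x)) * iexp (t * X x))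
          = (LINT x|M. of_real (h x) * iexp (t * X x))"
          using i[OF pos] i[OF neg]
          by (simp only: Bochner_Integration.integral_diff[symmetric] left_diff_distrib[symmetric]
              of_real_diff[symmetric] h_eq[symmetric] borel_measurable_uminus \<open>h \<in> borel_measurable M\<close>)
        then show "char (distr (P h) borel X) t = char (distr (P (\<lambda>x. - h x)) borel X) t"
          using zero[of t] by (simp add: char_P)
      qed
    qed (use P_dist pos neg m' in \<open>auto simp: m_def\<close>)
    then have eq: "emeasure (distr (P h) borel X) (Y -` A) = emeasure (distr (P (\<lambda>x. - h x)) borel X) (Y -` A)" for A by simp
    have dist_eq: "emeasure (distr (P f) borel X) (Y -` A) = emeasure (P f) A" if A: "A \<in> sets M" for A f
    proof -
      have "Y -` A \<in> sets borel" using measurable_sets[OF Y A] by simp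
      moreover have "X \<in> P f \<rightarrow>\<^sub>M borel" by measurable
      ultimately have "emeasure (distr (P f) borel X) (Y -` A) = emeasure (P f) (X -` (Y -` A) \<inter> space (P f))"
        by (intro emeasure_distr)
      also have "X -` (Y -` A) \<inter> space (P f) = A"
        using YX sets.sets_into_space[OF A] by (auto simp: P_def)
      finally show ?thesis .
    qed
    \<comment> \<open>The measure with density max 0 (- h) does not charge this set, so by equality
      of the measures neither does the one with density max 0 h.\<close>
    define A where "A = {x\<in>space M. h x > 0}"
    have A [measurable]: "A \<in> sets M" unfolding A_def by measurable
    have "(\<integral>\<^sup>+x. ennreal (max 0 (h x) / m) * indicator A x \<partial>M) = emeasure (P h) A"
      unfolding P_def by (simp add: emeasure_density)
    also have "\<dots> = emeasure (P (\<lambda>x. - h x)) A" using eq[of A] dist_eq[OF A] by simp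
    also have "\<dots> = (\<integral>\<^sup>+x. ennreal (max 0 (- h x) / m) * indicator A x \<partial>M)"
      unfolding P_def by (simp add: emeasure_density)
    also have "\<dots> = (\<integral>\<^sup>+x. 0 \<partial>M)"
      by (intro nn_integral_cong) (auto simp: A_def indicator_def)
    finally have "AE x in M. ennreal (max 0 (h x) / m) * indicator A x = 0"
      by (simp add: nn_integral_0_iff_AE)
    then show ?thesis
    proof (rule AE_mp, intro AE_I2 impI)
      fix x assume "x \<in> space M" "ennreal (max 0 (h x) / m) * indicator A x = 0"
      then show "h x \<le> 0" using m by (auto simp: A_def indicator_def max_def field_simps split: if_splits)
    qed
  qed
qed

text \<open>Determinacy of the moment problem under exponential integrability. The sign lemma is
  applied to Re h, - Re h, Im h and - Im h, whose moments vanish since real-linear maps pass under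
  the integral. It serves twice: with X y = y for completeness of the Hermite functions, and with
  the bounded variable X \<tau> = 1 / \<tau> for the final continuation.\<close>

theorem AE_eq_0_of_moments_eq_0:
  fixes h :: "'a \<Rightarrow> complex" and X :: "'a \<Rightarrow> real"
  assumes h [measurable]: "h \<in> borel_measurable M" and X [measurable]: "X \<in> borel_measurable M"
    and Y: "Y \<in> borel \<rightarrow>\<^sub>M M" "\<And>x. x \<in> space M \<Longrightarrow> Y (X x) = x"
    and int: "\<And>c. integrable M (\<lambda>x. norm (h x) * exp (c * \<bar>X x\<bar>))"
    and moments: "\<And>k. (LINT x|M. h x * of_real (X x ^ k)) = 0"
  shows "AE x in M. h x = 0"
proof -
  have hi: "integrable M h" using int[of 0] by (simp add: integrable_norm_iff)
  have le: "AE x in M. f (h x) \<le> 0" if f: "\<And>z. norm (of_real (f z) :: complex) \<le> norm z" and lin: "bounded_linear f" for f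
  proof (rule AE_le_0_of_Fourier_eq_0[OF _ X Y])
    have [measurable]: "f \<in> borel_measurable borel"
      using lin by (intro borel_measurable_continuous_onI linear_continuous_on)
    show "integrable M (\<lambda>x. f (h x))" by (rule integrable_bounded_linear[OF lin hi])
    have pow: "f z * r = f (z * of_real r)" for z r
      using linear_scale[OF bounded_linear.linear[OF lin], of r z] by (simp add: scaleR_conv_of_real mult.commute)
    have ik: "integrable M (\<lambda>x. h x * of_real (X x ^ k))" for k
      by (rule integrable_moment[OF h X int])
    show "(LINT x|M. of_real (f (h x)) * iexp (t * X x)) = 0" for t
    proof (rule integral_exp_eq_0_of_moments)
      show "integrable M (\<lambda>x. norm (complex_of_real (f (h x))) * exp (c * \<bar>X x\<bar>))" for c
        using f by (intro Bochner_Integration.integrable_bound[OF int[of c]]) (auto intro!: mult_right_mono)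
      show "(LINT x|M. complex_of_real (f (h x)) * complex_of_real (X x ^ k)) = 0" for k
      proof -
        have "(LINT x|M. complex_of_real (f (h x)) * complex_of_real (X x ^ k)) = of_real (LINT x|M. f (h x * of_real (X x ^ k)))"
          by (simp only: pow[symmetric] of_real_mult[symmetric] integral_complex_of_real)
        also have "(LINT x|M. f (h x * of_real (X x ^ k))) = f (LINT x|M. h x * of_real (X x ^ k))"
          by (rule integral_bounded_linear[OF lin ik])
        finally show ?thesis using moments bounded_linear.linear[OF lin] by (simp add: linear_0)
      qed
    qed measurable
  qed
  have "AE x in M. Re (h x) \<le> 0" by (rule le) (auto simp: abs_Re_le_cmod bounded_linear_Re)
  moreover have "AE x in M. - Re (h x) \<le> 0"
    by (rule le[of "\<lambda>z. - Re z"]) (auto simp: abs_Re_le_cmod intro!: bounded_linear_minus bounded_linear_Re)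
  moreover have "AE x in M. Im (h x) \<le> 0" by (rule le) (auto simp: abs_Im_le_cmod bounded_linear_Im)
  moreover have "AE x in M. - Im (h x) \<le> 0"
    by (rule le[of "\<lambda>z. - Im z"]) (auto simp: abs_Im_le_cmod intro!: bounded_linear_minus bounded_linear_Im)
  ultimately show ?thesis by eventually_elim (simp add: complex_eq_iff)
qed

section \<open>Hermite functions\<close>

definition gauss_poly :: "real \<Rightarrow> real poly \<Rightarrow> real \<Rightarrow> real" where
  "gauss_poly c p y = poly p y * exp (- c * y\<^sup>2)"

lemma gauss_poly_measurable [measurable]: "gauss_poly c p \<in> borel_measurable borel"
  unfolding gauss_poly_def by (intro borel_measurable_continuous_onI continuous_intros)

lemma gauss_poly_linear:
  "gauss_poly c (p + q) y = gauss_poly c p y + gauss_poly c q y"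
  "gauss_poly c (p - q) y = gauss_poly c p y - gauss_poly c q y"
  "gauss_poly c (smult a p) y = a * gauss_poly c p y"
  by (simp_all add: gauss_poly_def algebra_simps)

lemma integrable_gauss_monom:
  fixes c :: real
  assumes "c > 0"
  shows "integrable lborel (\<lambda>y. y ^ k * exp (- c * y\<^sup>2))"
proof -
  \<comment> \<open>Up to a constant, the Gaussian is the centred normal density of variance 1 / (2
    c), whose moments are known to be integrable.\<close>
  define \<sigma> where "\<sigma> = sqrt (1 / (2 * c))"
  have \<sigma>: "\<sigma> > 0" "\<sigma>\<^sup>2 = 1 / (2 * c)" using assms by (auto simp: \<sigma>_def)
  have "integrable lborel (\<lambda>y. sqrt (2 * pi * \<sigma>\<^sup>2) * (normal_density 0 \<sigma> y * (y - 0) ^ k))"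
    using \<sigma> by (intro integrable_mult_right integrable_normal_moment)
  also have "(\<lambda>y. sqrt (2 * pi * \<sigma>\<^sup>2) * (normal_density 0 \<sigma> y * (y - 0) ^ k)) = (\<lambda>y. y ^ k * exp (- c * y\<^sup>2))"
  proof
    fix y
    have "sqrt (2 * pi * \<sigma>\<^sup>2) \<noteq> 0" "exp (- (y - 0)\<^sup>2 / (2 * \<sigma>\<^sup>2)) = exp (- c * y\<^sup>2)"
      using \<sigma> assms by (auto simp: field_simps)
    then show "sqrt (2 * pi * \<sigma>\<^sup>2) * (normal_density 0 \<sigma> y * (y - 0) ^ k) = y ^ k * exp (- c * y\<^sup>2)"
      unfolding normal_density_def by simp
  qed
  finally show ?thesis .
qed

lemma integrable_gauss_poly:
  assumes "c > 0"
  shows "integrable lborel (gauss_poly c p)"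
proof -
  have "gauss_poly c p = (\<lambda>y. \<Sum>k\<le>degree p. coeff p k * (y ^ k * exp (- c * y\<^sup>2)))"
    unfolding gauss_poly_def by (auto simp: poly_altdef sum_distrib_right mult.assoc)
  then show ?thesis using integrable_gauss_monom[OF assms] by simp
qed

lemma tendsto_gauss_monom:
  fixes c :: real
  assumes "c > 0"
  shows "((\<lambda>y. y ^ k * exp (- c * y\<^sup>2)) \<longlongrightarrow> 0) at_top"
proof -
  have "((\<lambda>y. y ^ k / exp y * exp (y - c * y\<^sup>2)) \<longlongrightarrow> 0 * 0) at_top"
  proof (intro tendsto_mult tendsto_power_div_exp_0)
    have "LIM y at_top. c * (y * (y - 1/c)) :> at_top"
      by (intro filterlim_tendsto_pos_mult_at_top[OF tendsto_const assms] filterlim_at_top_mult_at_top filterlim_ident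
         filterlim_tendsto_add_at_top[OF tendsto_const, of "\<lambda>y. y" at_top "-1/c", simplified])
    moreover have "(\<lambda>y. c * (y * (y - 1 / c))) = (\<lambda>y. c * y\<^sup>2 - y)"
      using assms by (auto simp: field_simps power2_eq_square)
    ultimately have "LIM y at_top. - (c * y\<^sup>2 - y) :> at_bot"
      by (simp only: filterlim_uminus_at_top)
    then have "((\<lambda>y. exp (- (c * y\<^sup>2 - y))) \<longlongrightarrow> 0) at_top"
      by (rule filterlim_compose[OF exp_at_bot])
    then show "((\<lambda>y. exp (y - c * y\<^sup>2)) \<longlongrightarrow> 0) at_top" by simp
  qed
  moreover have "y ^ k / exp y * exp (y - c * y\<^sup>2) = y ^ k * exp (- c * y\<^sup>2)" for y
    by (simp add: exp_diff exp_minus field_simps)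
  ultimately show ?thesis by simp
qed

lemma tendsto_gauss_poly:
  assumes "c > 0"
  shows "(gauss_poly c p \<longlongrightarrow> 0) at_top" "(gauss_poly c p \<longlongrightarrow> 0) at_bot"
proof -
  have *: "(gauss_poly c p \<longlongrightarrow> 0) at_top" for p
  proof -
    have "((\<lambda>y. \<Sum>k\<le>degree p. coeff p k * (y ^ k * exp (- c * y\<^sup>2))) \<longlongrightarrow> (\<Sum>k\<le>degree p. coeff p k * 0)) at_top"
      by (intro tendsto_intros tendsto_gauss_monom assms)
    moreover have "gauss_poly c p = (\<lambda>y. \<Sum>k\<le>degree p. coeff p k * (y ^ k * exp (- c * y\<^sup>2)))"
      unfolding gauss_poly_def by (auto simp: poly_altdef sum_distrib_right mult.assoc)
    ultimately show ?thesis by simp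
  qed
  show "(gauss_poly c p \<longlongrightarrow> 0) at_top" by (rule *)
  have "gauss_poly c p (- y) = gauss_poly c (pcompose p [:0, -1:]) y" for y
    by (simp add: gauss_poly_def poly_pcompose)
  then show "(gauss_poly c p \<longlongrightarrow> 0) at_bot"
    unfolding filterlim_at_bot_mirror using *[of "pcompose p [:0, -1:]"] by simp
qed

section \<open>Fourier transforms of polynomials times Gaussians\<close>

definition polyX :: "real poly" where "polyX = [:0, 1:]"

lemma polyX_simps [simp]: "poly polyX y = y" "pderiv polyX = 1" "coeff (polyX * p) (Suc k) = coeff p k"
    "degree (polyX * p) = (if p = 0 then 0 else Suc (degree p))"
  by (simp_all add: polyX_def pderiv_pCons)

definition gauss_fourier :: "real \<Rightarrow> real \<Rightarrow> real poly \<Rightarrow> complex" where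
  "gauss_fourier c w p = (LINT y|lborel. of_real (gauss_poly c p y) * iexp (w * y))"

lemma integrable_gauss_fourier:
  assumes "c > 0"
  shows "integrable lborel (\<lambda>y. complex_of_real (gauss_poly c p y) * iexp (w * y))"
  by (rule Bochner_Integration.integrable_bound[OF integrable_gauss_poly[OF assms, of p]]) (auto simp: norm_mult)

lemma gauss_fourier_linear:
  assumes "c > 0"
  shows "gauss_fourier c w (p + q) = gauss_fourier c w p + gauss_fourier c w q"
    "gauss_fourier c w (p - q) = gauss_fourier c w p - gauss_fourier c w q"
    "gauss_fourier c w (smult a p) = of_real a * gauss_fourier c w p"
  unfolding gauss_fourier_def gauss_poly_linear
  using integrable_gauss_fourier[OF assms]
  by (simp_all only: of_real_add of_real_diff of_real_mult distrib_right left_diff_distrib mult.assoc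
      Bochner_Integration.integral_add Bochner_Integration.integral_diff integral_mult_right_zero)

text \<open>The sum of the three integrands is the derivative of p(y) exp (- c y^2 + \<i> w y),
  which tends to 0 at both ends. The Hermite identities below are algebra on top of this relation,
  with c = pi or c = 2 pi.\<close>

lemma gauss_fourier_by_parts:
  assumes "c > 0"
  shows "gauss_fourier c w (pderiv p) - of_real (2 * c) * gauss_fourier c w (polyX * p)
     + \<i> * of_real w * gauss_fourier c w p = 0"
proof -
  define F where "F y = of_real (gauss_poly c p y) * iexp (w * y)" for y
  define f where "f y = of_real (gauss_poly c (pderiv p - smult (2 * c) (polyX * p)) y) * iexp (w * y)
     + \<i> * of_real w * (of_real (gauss_poly c p y) * iexp (w * y))" for y
  have int: "integrable lborel f"
    unfolding f_def using integrable_gauss_fourier[OF assms] by auto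
  have "(LBINT y=-\<infinity>..\<infinity>. f y) = 0 - 0"
  proof (rule interval_integral_FTC_integrable)
    fix y :: real
    have g: "(gauss_poly c p has_real_derivative gauss_poly c (pderiv p - smult (2 * c) (polyX * p)) y) (at y)"
      unfolding gauss_poly_def by (auto intro!: derivative_eq_intros poly_DERIV simp: algebra_simps)
    have "((\<lambda>y. of_real (gauss_poly c p y)) has_vector_derivative (of_real (gauss_poly c (pderiv p - smult (2 * c) (polyX * p)) y) :: complex)) (at y)"
      using g by (intro has_vector_derivative_of_real) (simp add: has_real_derivative_iff_has_vector_derivative)
    moreover have "((\<lambda>y. exp (\<i> * of_real w * of_real y)) has_vector_derivative (\<i> * of_real w * exp (\<i> * of_real w * of_real y))) (at y)"
      by (rule has_vector_derivative_real_field[of "\<lambda>z. exp (\<i> * of_real w * z)"]) (auto intro!: derivative_eq_intros)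
    then have "((\<lambda>y. iexp (w * y)) has_vector_derivative (\<i> * of_real w * iexp (w * y))) (at y)"
      by (simp add: mult.assoc)
    ultimately show "(F has_vector_derivative f y) (at y)"
      unfolding F_def f_def by (rule has_vector_derivative_eq_rhs[OF has_vector_derivative_mult]) (simp add: algebra_simps)
    show "isCont f y" unfolding f_def gauss_poly_def by (intro continuous_intros)
  next
    show "set_integrable lborel (einterval (- \<infinity>) \<infinity>) f" using int by (simp add: set_integrable_def)
    have nF: "(\<lambda>y. norm (F y)) = (\<lambda>y. \<bar>gauss_poly c p y\<bar>)" by (simp add: F_def norm_mult)
    have lim: "(F \<longlongrightarrow> 0) at_top" "(F \<longlongrightarrow> 0) at_bot"
      by (rule tendsto_norm_zero_cancel, unfold nF, intro tendsto_rabs_zero tendsto_gauss_poly assms)+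
    show "((F \<circ> real_of_ereal) \<longlongrightarrow> 0) (at_right (- \<infinity>))" "((F \<circ> real_of_ereal) \<longlongrightarrow> 0) (at_left \<infinity>)"
      using lim by (simp_all add: ereal_tendsto_simps)
  qed simp
  then have "(LINT y|lborel. f y) = 0"
    by (simp add: interval_lebesgue_integral_def set_lebesgue_integral_def)
  moreover have "(LINT y|lborel. f y) = gauss_fourier c w (pderiv p - smult (2 * c) (polyX * p)) + \<i> * of_real w * gauss_fourier c w p"
    unfolding f_def gauss_fourier_def using integrable_gauss_fourier[OF assms] by simp
  ultimately show ?thesis by (simp add: gauss_fourier_linear[OF assms])
qed

text \<open>Rescaling by sqrt (2 c) reduces this to the characteristic function of the standard
  normal law.\<close>

lemma gauss_fourier_1:
  assumes "c > 0"
  shows "gauss_fourier c w 1 = of_real (sqrt (pi / c) * exp (- w\<^sup>2 / (4 * c)))"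
proof -
  define r where "r = sqrt (2 * c)"
  have r: "r > 0" "r\<^sup>2 = 2 * c" using assms by (auto simp: r_def)
  have "complex_of_real (exp (- ((w / r)^2) / 2)) = char std_normal_distribution (w / r)"
    by (simp add: char_std_normal_distribution)
  also have "\<dots> = (LINT x|lborel. std_normal_density x *\<^sub>R iexp (w / r * x))"
    unfolding char_def by (rule integral_density) (auto simp: normal_density_nonneg)
  also have "\<dots> = \<bar>r\<bar> *\<^sub>R (LINT y|lborel. std_normal_density (0 + r * y) *\<^sub>R iexp (w / r * (0 + r * y)))"
    using r by (intro lborel_integral_real_affine) auto
  also have "(\<lambda>y. std_normal_density (0 + r * y) *\<^sub>R iexp (w / r * (0 + r * y)))
      = (\<lambda>y. of_real (1 / sqrt (2 * pi)) * (of_real (gauss_poly c 1 y) * iexp (w * y)))"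
    using r by (auto simp: normal_density_def gauss_poly_def power_mult_distrib scaleR_conv_of_real)
  also have "(LINT y|lborel. of_real (1 / sqrt (2 * pi)) * (of_real (gauss_poly c 1 y) * iexp (w * y))) =
      of_real (1 / sqrt (2 * pi)) * gauss_fourier c w 1"
    unfolding gauss_fourier_def by (rule integral_mult_right_zero)
  finally have "complex_of_real (exp (- ((w / r)^2) / 2)) = of_real (r / sqrt (2 * pi)) * gauss_fourier c w 1"
    using r by (simp add: scaleR_conv_of_real)
  moreover have "r / sqrt (2 * pi) * sqrt (pi / c) = 1"
    using assms by (simp add: r_def real_sqrt_divide real_sqrt_mult)
  moreover have "- ((w / r)^2) / 2 = - w\<^sup>2 / (4 * c)" using r by (simp add: power_divide)
  ultimately have "complex_of_real (sqrt (pi / c) * exp (- w\<^sup>2 / (4 * c))) = of_real (r / sqrt (2 * pi) * sqrt (pi / c)) * gauss_fourier c w 1"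
    unfolding \<open>- ((w / r)^2) / 2 = - w\<^sup>2 / (4 * c)\<close>[symmetric] of_real_mult[of "r / sqrt (2 * pi)"] of_real_mult[of "sqrt (pi / c)"]
    by simp
  with \<open>r / sqrt (2 * pi) * sqrt (pi / c) = 1\<close> show ?thesis by (simp only: of_real_1 mult_1)
qed

text \<open>The scaling is the one in which \<open>exp (- \<pi> y\<^sup>2)\<close> is its own Fourier transform: these polynomials are orthogonal for the weight
  \<open>exp (- 2 \<pi> y\<^sup>2)\<close>.\<close>

fun hermite :: "nat \<Rightarrow> real poly" where
  "hermite 0 = 1"
| "hermite (Suc k) = smult (4 * pi) (polyX * hermite k) - pderiv (hermite k)"

declare hermite.simps(2) [simp del]

lemma pderiv_hermite: "pderiv (hermite (Suc k)) = smult (4 * pi * real (Suc k)) (hermite k)"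
proof (induction k)
  case 0
  show ?case by (simp add: hermite.simps pderiv_diff pderiv_smult pderiv_mult)
next
  case (Suc k)
  have "pderiv (hermite (Suc (Suc k))) = smult (4 * pi) (hermite (Suc k) + polyX * pderiv (hermite (Suc k)))
      - pderiv (pderiv (hermite (Suc k)))"
    by (simp only: hermite.simps(2)[of "Suc k"] pderiv_diff pderiv_smult pderiv_mult polyX_simps mult_1_right add.commute)
  also have "\<dots> = smult (4 * pi) (hermite (Suc k)) + smult (4 * pi * real (Suc k)) (smult (4 * pi) (polyX * hermite k) - pderiv (hermite k))"
    unfolding Suc pderiv_smult
    by (simp add: smult_add_right smult_diff_right mult_ac del: of_nat_Suc)
  also have "\<dots> = smult (4 * pi) (hermite (Suc k)) + smult (4 * pi * real (Suc k)) (hermite (Suc k))"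
    by (simp only: hermite.simps(2))
  also have "\<dots> = smult (4 * pi * real (Suc (Suc k))) (hermite (Suc k))"
    by (simp add: smult_add_left[symmetric] algebra_simps del: hermite.simps)
  finally show ?case .
qed

lemma degree_hermite: "degree (hermite k) = k \<and> lead_coeff (hermite k) = (4 * pi) ^ k"
proof (induction k)
  case (Suc k)
  have nz: "hermite k \<noteq> 0" using Suc by auto
  have "degree (pderiv (hermite k)) \<le> k" using Suc degree_pderiv[of "hermite k"] by simp
  moreover have "degree (smult (4 * pi) (polyX * hermite k)) = Suc k"
    using Suc nz by (simp add: degree_mult_eq)
  moreover have "coeff (smult (4 * pi) (polyX * hermite k)) (Suc k) = (4 * pi) ^ Suc k"
    using Suc by (metis coeff_smult polyX_simps(3) power_Suc)
  moreover have "coeff (pderiv (hermite k)) (Suc k) = 0"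
    using calculation(1) by (intro coeff_eq_0) simp
  ultimately have "coeff (hermite (Suc k)) (Suc k) = (4 * pi) ^ Suc k" "degree (hermite (Suc k)) \<le> Suc k"
    by (auto intro: degree_diff_le simp: hermite.simps)
  moreover have "degree (hermite (Suc k)) \<ge> Suc k"
    using calculation(1) by (intro le_degree) simp
  ultimately show ?case by (simp del: hermite.simps)
qed simp

text \<open>For the weight exp (- 2 pi y^2) the recursion step p \<mapsto> 4 pi y p - p' is the
  adjoint of differentiation. Iterated, this gives orthogonality to lower degrees and, together with
  \<open>pderiv_hermite\<close>, the norms.\<close>

lemma gauss_fourier_mult_hermite:
  "gauss_fourier (2 * pi) 0 (q * hermite (Suc k)) = gauss_fourier (2 * pi) 0 (pderiv q * hermite k)"
proof -
  have eq: "q * hermite (Suc k) = smult (4 * pi) (polyX * (q * hermite k)) - q * pderiv (hermite k)"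
    by (simp add: right_diff_distrib mult_ac hermite.simps)
  have "gauss_fourier (2 * pi) 0 (pderiv (q * hermite k)) = of_real (4 * pi) * gauss_fourier (2 * pi) 0 (polyX * (q * hermite k))"
    using gauss_fourier_by_parts[of "2 * pi" 0 "q * hermite k"] by simp
  then show ?thesis
    unfolding eq by (simp add: gauss_fourier_linear pderiv_mult mult.commute[of "hermite k"])
      (metis add_diff_cancel_left')
qed

lemma gauss_fourier_mult_hermite_eq_0: "degree q < k \<Longrightarrow> gauss_fourier (2 * pi) 0 (q * hermite k) = 0"
proof (induction k arbitrary: q)
  case (Suc k)
  show ?case
  proof (cases "pderiv q = 0")
    case False
    then have "degree (pderiv q) < k"
      using Suc.prems by (cases "degree q") (auto simp: degree_pderiv pderiv_eq_0_iff)
    then show ?thesis unfolding gauss_fourier_mult_hermite by (rule Suc.IH)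
  qed (simp only: gauss_fourier_mult_hermite, simp add: gauss_fourier_def gauss_poly_def)
qed simp

text \<open>The norm of \<open>hermite k\<close> in L^2 for the weight exp (- 2 pi y^2): sqrt (1 /
  2) is the integral of the weight, and the step from k - 1 to k multiplies the square by 4 pi
  k.\<close>

definition hermite_norm :: "nat \<Rightarrow> real" where
  "hermite_norm k = sqrt (sqrt (1 / 2) * (4 * pi) ^ k * fact k)"

lemma hermite_norm_pos [simp]: "hermite_norm k > 0" "hermite_norm k \<noteq> 0" "0 \<le> hermite_norm k"
proof -
  show "hermite_norm k > 0" by (simp add: hermite_norm_def)
  then show "hermite_norm k \<noteq> 0" "0 \<le> hermite_norm k" by simp_all
qed

lemma gauss_fourier_hermite_sq: "gauss_fourier (2 * pi) 0 (hermite k * hermite k) = of_real ((hermite_norm k)\<^sup>2)"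
proof -
  have "gauss_fourier (2 * pi) 0 (hermite k * hermite k) = of_real (sqrt (1 / 2) * (4 * pi) ^ k * fact k)"
  proof (induction k)
    case (Suc k)
    have "gauss_fourier (2 * pi) 0 (hermite (Suc k) * hermite (Suc k)) =
        gauss_fourier (2 * pi) 0 (smult (4 * pi * real (Suc k)) (hermite k) * hermite k)"
      by (simp only: gauss_fourier_mult_hermite pderiv_hermite)
    also have "\<dots> = of_real (4 * pi * real (Suc k)) * gauss_fourier (2 * pi) 0 (hermite k * hermite k)"
      by (simp add: gauss_fourier_linear)
    finally show ?case unfolding Suc by (simp add: algebra_simps)
  qed (simp add: gauss_fourier_1)
  then show ?thesis by (simp add: hermite_norm_def)
qed

section \<open>Hermite functions: orthonormality, Fourier transform, completeness\<close>

definition hermite_fun :: "nat \<Rightarrow> real \<Rightarrow> real" where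
  "hermite_fun k y = gauss_poly pi (hermite k) y / hermite_norm k"

lemma hermite_fun_measurable [measurable]: "hermite_fun k \<in> borel_measurable borel"
  unfolding hermite_fun_def by measurable

lemma gauss_poly_mult: "gauss_poly a p y * gauss_poly b q y = gauss_poly (a + b) (p * q) y"
  by (simp add: gauss_poly_def mult_exp_exp algebra_simps)

lemma hermite_fun_mult:
  "hermite_fun j y * hermite_fun k y = gauss_poly (2 * pi) (hermite j * hermite k) y / (hermite_norm j * hermite_norm k)"
  unfolding hermite_fun_def by (simp add: gauss_poly_mult)

lemma LINT_gauss_poly: "complex_of_real (LINT y|lborel. gauss_poly c p y) = gauss_fourier c 0 p"
  by (simp add: gauss_fourier_def)

lemma hermite_fun_orthonormal: "(LINT y|lborel. hermite_fun j y * hermite_fun k y) = (if j = k then 1 else 0)"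
proof -
  have "gauss_fourier (2 * pi) 0 (hermite j * hermite k) = (if j = k then of_real ((hermite_norm k)\<^sup>2) else 0)"
    using gauss_fourier_mult_hermite_eq_0[of "hermite j" k] gauss_fourier_mult_hermite_eq_0[of "hermite k" j]
      degree_hermite[of j] degree_hermite[of k] gauss_fourier_hermite_sq[of k]
    by (cases j k rule: linorder_cases) (auto simp: mult.commute)
  then have "complex_of_real (LINT y|lborel. hermite_fun j y * hermite_fun k y) = (if j = k then 1 else 0)"
    unfolding hermite_fun_mult by (simp add: LINT_gauss_poly power2_eq_square)
  then show ?thesis by (metis of_real_0 of_real_1 of_real_eq_iff)
qed

lemma integrable_hermite_fun: "integrable lborel (hermite_fun k)"
  unfolding hermite_fun_def using integrable_gauss_poly[of pi] by simp

lemma square_integrable_hermite_fun: "square_integrable lborel (\<lambda>y. of_real (hermite_fun k y))"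
proof -
  have "(norm (complex_of_real (hermite_fun k y)))\<^sup>2 = gauss_poly (2 * pi) (hermite k * hermite k) y / (hermite_norm k * hermite_norm k)" for y
    using hermite_fun_mult[of k y k] by (simp add: power2_eq_square)
  then show ?thesis unfolding square_integrable_def using integrable_gauss_poly[of "2 * pi"] by simp
qed

text \<open>Both sides obey the same three-term recurrence, so the induction needs two predecessors.
  The outcome is that Hermite functions are eigenfunctions of the Fourier transform.\<close>

lemma gauss_fourier_hermite:
  "gauss_fourier pi (- 2 * pi * \<eta>) (hermite k) = (- \<i>) ^ k * of_real (gauss_poly pi (hermite k) \<eta>)"
proof (induction k rule: less_induct)
  case (less k)
  let ?J = "gauss_fourier pi (- 2 * pi * \<eta>)"
  have z: "?J 1 = of_real (gauss_poly pi 1 \<eta>)"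
    by (simp add: gauss_fourier_1 gauss_poly_def power_mult_distrib power2_eq_square)
  have bp: "of_real (2 * pi) * ?J (polyX * p) = ?J (pderiv p) - \<i> * of_real (2 * pi * \<eta>) * ?J p" for p
    using gauss_fourier_by_parts[of pi "- 2 * pi * \<eta>" p] by (simp add: algebra_simps)
  have step: "?J (hermite (Suc j)) = ?J (pderiv (hermite j)) - \<i> * of_real (4 * pi * \<eta>) * ?J (hermite j)" for j
  proof -
    have "?J (hermite (Suc j)) = 2 * (of_real (2 * pi) * ?J (polyX * hermite j)) - ?J (pderiv (hermite j))"
      by (simp only: hermite.simps gauss_fourier_linear pi_gt_zero) simp
    then show ?thesis unfolding bp by (simp add: algebra_simps)
  qed
  consider "k = 0" | "k = 1" | j where "k = Suc (Suc j)" by (metis One_nat_def old.nat.exhaust)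
  then show ?case
  proof cases
    case 1
    then show ?thesis using z by simp
  next
    case 2
    have "?J (hermite (Suc 0)) = - \<i> * of_real (4 * pi * \<eta> * gauss_poly pi 1 \<eta>)"
      unfolding step using z by (simp add: gauss_fourier_def gauss_poly_def)
    then show ?thesis using 2 by (simp add: gauss_poly_def hermite.simps)
  next
    case 3
    have j: "?J (hermite j) = (- \<i>) ^ j * of_real (gauss_poly pi (hermite j) \<eta>)"
      and Sj: "?J (hermite (Suc j)) = (- \<i>) ^ Suc j * of_real (gauss_poly pi (hermite (Suc j)) \<eta>)"
      by (intro less; simp add: 3)+
    have poly_eq: "hermite (Suc (Suc j)) = smult (4 * pi) (polyX * hermite (Suc j)) - smult (4 * pi * real (Suc j)) (hermite j)"
      by (simp only: hermite.simps(2)[of "Suc j"] pderiv_hermite)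
    have gp_eq: "gauss_poly pi (hermite (Suc (Suc j))) \<eta> = 4 * pi * \<eta> * gauss_poly pi (hermite (Suc j)) \<eta> - 4 * pi * real (Suc j) * gauss_poly pi (hermite j) \<eta>"
      unfolding poly_eq gauss_poly_linear by (simp add: gauss_poly_def)
    have "?J (hermite (Suc (Suc j))) = of_real (4 * pi * real (Suc j)) * ?J (hermite j) - \<i> * of_real (4 * pi * \<eta>) * ?J (hermite (Suc j))"
      unfolding step[of "Suc j"] pderiv_hermite by (simp add: gauss_fourier_linear)
    then show ?thesis unfolding j Sj 3 gp_eq by (simp add: algebra_simps)
  qed
qed

lemma hermite_fun_fourier:
  "(LINT y|lborel. of_real (hermite_fun k y) * iexp (- 2 * pi * \<eta> * y)) = (- \<i>) ^ k * of_real (hermite_fun k \<eta>)"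
proof -
  have "(LINT y|lborel. of_real (hermite_fun k y) * iexp (- 2 * pi * \<eta> * y)) =
      (LINT y|lborel. inverse (of_real (hermite_norm k)) * (of_real (gauss_poly pi (hermite k) y) * iexp (- 2 * pi * \<eta> * y)))"
    unfolding hermite_fun_def by (intro Bochner_Integration.integral_cong) (simp_all add: field_simps)
  also have "\<dots> = inverse (of_real (hermite_norm k)) * gauss_fourier pi (- 2 * pi * \<eta>) (hermite k)"
    unfolding gauss_fourier_def by (rule integral_mult_right_zero)
  finally show ?thesis unfolding gauss_fourier_hermite by (simp add: hermite_fun_def field_simps)
qed

text \<open>Rodrigues' formula on the Fourier side: \<open>hermite k\<close> times exp (- 2 pi y^2)
  is, up to sign, the k-th derivative of that Gaussian.\<close>

lemma gauss_fourier_2pi_hermite: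
  "gauss_fourier (2 * pi) w (hermite k) = (\<i> * of_real w) ^ k * gauss_fourier (2 * pi) w 1"
proof (induction k)
  case (Suc k)
  have "gauss_fourier (2 * pi) w (hermite (Suc k)) = \<i> * of_real w * gauss_fourier (2 * pi) w (hermite k)"
    using gauss_fourier_by_parts[of "2 * pi" w "hermite k"]
    by (simp add: gauss_fourier_linear hermite.simps algebra_simps)
  then show ?case using Suc by (simp add: mult.assoc)
qed simp

text \<open>A second factor exp (- pi y^2) turns the Gaussian of the Hermite function into the one
  of Rodrigues' formula. The monomial on the right is the origin of the factor \<xi>^\<alpha> in the
  transform of the dual caloric functions.\<close>

lemma hermite_fun_gauss_fourier:
  "(LINT y|lborel. of_real (hermite_fun k y * exp (- pi * y\<^sup>2)) * iexp (w * y)) =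
    of_real (sqrt (1 / 2) / hermite_norm k) * (\<i> * of_real w) ^ k * of_real (exp (- w\<^sup>2 / (8 * pi)))"
proof -
  have "hermite_fun k y * exp (- pi * y\<^sup>2) = gauss_poly (2 * pi) (hermite k) y / hermite_norm k" for y
    using gauss_poly_mult[of pi "hermite k" y pi 1] by (simp add: hermite_fun_def gauss_poly_def)
  then have "(LINT y|lborel. of_real (hermite_fun k y * exp (- pi * y\<^sup>2)) * iexp (w * y)) =
      (LINT y|lborel. inverse (of_real (hermite_norm k)) * (of_real (gauss_poly (2 * pi) (hermite k) y) * iexp (w * y)))"
    by (simp add: divide_inverse mult_ac del: of_real_mult) (simp add: mult_ac)
  also have "\<dots> = inverse (of_real (hermite_norm k)) * gauss_fourier (2 * pi) w (hermite k)"
    unfolding gauss_fourier_def by (rule integral_mult_right_zero)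
  finally show ?thesis unfolding gauss_fourier_2pi_hermite
    by (simp add: gauss_fourier_1 field_simps)
qed

text \<open>Hermite polynomials span all polynomials, so f times exp (- pi y^2) has vanishing
  moments of every order and the moment theorem applies.\<close>

lemma hermite_fun_complete:
  assumes f: "square_integrable lborel f" and zero: "\<And>k. (LINT y|lborel. f y * of_real (hermite_fun k y)) = 0"
  shows "AE y in lborel. f y = 0"
proof -
  note [measurable] = square_integrableD(1)[OF f]
  have g: "square_integrable lborel (\<lambda>y. of_real (gauss_poly c p y))" if "c > 0" for c p
    unfolding square_integrable_def using integrable_gauss_poly[of "c + c" "p * p"] that
    by (simp add: gauss_poly_mult power2_eq_square)
  define L where "L p = (LINT y|lborel. f y * of_real (gauss_poly pi p y))" for p
  have int: "integrable lborel (\<lambda>y. f y * of_real (gauss_poly pi p y))" for p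
    by (intro square_integrable_mult f g) simp
  have L_lin: "L (p + q) = L p + L q" "L (smult a p) = of_real a * L p" for p q a
    unfolding L_def gauss_poly_linear of_real_add of_real_mult distrib_left mult.left_commute[of "f _"]
    using int[of p] int[of q] by simp_all
  have L_hermite: "L (hermite k) = 0" for k
  proof -
    have "f y * of_real (gauss_poly pi (hermite k) y) = of_real (hermite_norm k) * (f y * of_real (hermite_fun k y))" for y
      by (simp add: hermite_fun_def)
    then have "L (hermite k) = of_real (hermite_norm k) * (LINT y|lborel. f y * of_real (hermite_fun k y))"
      unfolding L_def by (simp only: integral_mult_right_zero)
    then show ?thesis using zero[of k] by simp
  qed
  have L0: "L p = 0" if "degree p < n" for p n
    using that
  proof (induction n arbitrary: p)
    case (Suc n)
    \<comment> \<open>Subtracting this multiple of \<open>hermite n\<close> cancels the coefficient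
      of degree n and leaves the functional \<open>L\<close> unchanged.\<close>
    define a where "a = coeff p n / (4 * pi) ^ n"
    define q where "q = p + smult (- a) (hermite n)"
    have "coeff (hermite n) n = (4 * pi) ^ n" using degree_hermite[of n] by metis
    then have "coeff q n = 0" by (simp add: q_def a_def)
    moreover have "degree q \<le> n" unfolding q_def using Suc.prems degree_hermite[of n]
      by (intro degree_add_le) (auto simp: order_trans[OF degree_smult_le])
    ultimately have "degree q < n \<or> q = 0"
      by (metis le_neq_implies_less leading_coeff_0_iff)
    then have "L q = 0" using Suc.IH by (auto simp: L_def gauss_poly_def)
    moreover have "L q = L p" unfolding q_def L_lin L_hermite by simp
    ultimately show ?case by simp
  qed simp
  have "AE y in lborel. f y * of_real (gauss_poly pi 1 y) = 0"
  proof (rule AE_eq_0_of_moments_eq_0[where X = "\<lambda>y. y" and Y = "\<lambda>y. y"])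
    show "(LINT y|lborel. f y * of_real (gauss_poly pi 1 y) * of_real (y ^ k)) = 0" for k
    proof -
      have "gauss_poly pi 1 y * y ^ k = gauss_poly pi (monom 1 k) y" for y
        by (simp add: gauss_poly_def poly_monom)
      then show ?thesis using L0[OF lessI, of "monom 1 k"] by (simp only: L_def mult.assoc of_real_mult[symmetric] \<open>\<And>y. gauss_poly pi 1 y * y ^ k = gauss_poly pi (monom 1 k) y\<close>)
    qed
    show "integrable lborel (\<lambda>y. norm (f y * of_real (gauss_poly pi 1 y)) * exp (c * \<bar>y\<bar>))" for c
    proof (rule Bochner_Integration.integrable_bound)
      show "integrable lborel (\<lambda>y. exp (c\<^sup>2 / (2 * pi)) *\<^sub>R (f y * of_real (gauss_poly (pi / 2) 1 y)))"
        by (intro integrable_scaleR_right square_integrable_mult f g) simp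
      show "AE y in lborel. norm (norm (f y * of_real (gauss_poly pi 1 y)) * exp (c * \<bar>y\<bar>))
          \<le> norm (exp (c\<^sup>2 / (2 * pi)) *\<^sub>R (f y * of_real (gauss_poly (pi / 2) 1 y)))"
      proof (rule AE_I2)
        fix y :: real
        \<comment> \<open>Completing the square: half of the Gaussian exponent absorbs exp (c |y|),
          and the other half still leaves a square-integrable factor to pair with f.\<close>
        have "0 \<le> (pi * \<bar>y\<bar> - c)\<^sup>2 / (2 * pi)" by simp
        also have "\<dots> = pi / 2 * y\<^sup>2 - c * \<bar>y\<bar> + c\<^sup>2 / (2 * pi)"
          by (simp add: power2_diff field_simps power2_eq_square)
        finally have "exp (- pi * y\<^sup>2 + c * \<bar>y\<bar>) \<le> exp (c\<^sup>2 / (2 * pi) + - (pi / 2) * y\<^sup>2)" by simp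
        then have "exp (- pi * y\<^sup>2) * exp (c * \<bar>y\<bar>) \<le> exp (c\<^sup>2 / (2 * pi)) * exp (- (pi / 2) * y\<^sup>2)"
          by (simp only: exp_add)
        then have "norm (f y) * (exp (- pi * y\<^sup>2) * exp (c * \<bar>y\<bar>)) \<le> norm (f y) * (exp (c\<^sup>2 / (2 * pi)) * exp (- (pi / 2) * y\<^sup>2))"
          by (intro mult_left_mono) auto
        then show "norm (norm (f y * of_real (gauss_poly pi 1 y)) * exp (c * \<bar>y\<bar>))
          \<le> norm (exp (c\<^sup>2 / (2 * pi)) *\<^sub>R (f y * of_real (gauss_poly (pi / 2) 1 y)))"
          by (simp add: gauss_poly_def norm_mult mult_ac)
      qed
    qed simp
  qed simp_all
  then show ?thesis by (simp add: gauss_poly_def)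
qed

section \<open>Hermite bases in several variables\<close>

text \<open>Completeness without orthonormality: only this part needs an induction over the
  coordinates, and it alone passes through products and measure-preserving maps.\<close>

definition complete_family :: "'a measure \<Rightarrow> ('k \<Rightarrow> 'a \<Rightarrow> real) \<Rightarrow> bool" where
  "complete_family M E \<longleftrightarrow> (\<forall>f. square_integrable M f \<longrightarrow>
     (\<forall>k. (LINT x|M. f x * of_real (E k x)) = 0) \<longrightarrow> (AE x in M. f x = 0))"

lemma (in pair_sigma_finite) square_integrable_times:
  assumes f: "square_integrable M1 f" and g: "square_integrable M2 g"
  shows "square_integrable (M1 \<Otimes>\<^sub>M M2) (\<lambda>p. f (fst p) * g (snd p))"
proof -
  note [measurable] = square_integrableD(1)[OF f] square_integrableD(1)[OF g]
  have "(\<integral>\<^sup>+p. ennreal ((norm (f (fst p) * g (snd p)))\<^sup>2) \<partial>(M1 \<Otimes>\<^sub>M M2)) =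
      (\<integral>\<^sup>+x. \<integral>\<^sup>+y. ennreal ((norm (f x))\<^sup>2) * ennreal ((norm (g y))\<^sup>2) \<partial>M2 \<partial>M1)"
    by (subst M2.nn_integral_fst[symmetric]) (auto simp: norm_mult power_mult_distrib ennreal_mult)
  also have "\<dots> = (\<integral>\<^sup>+x. ennreal ((norm (f x))\<^sup>2) \<partial>M1) * (\<integral>\<^sup>+y. ennreal ((norm (g y))\<^sup>2) \<partial>M2)"
    by (simp add: nn_integral_cmult nn_integral_multc)
  also have "\<dots> < \<infinity>"
    using f g by (auto simp: square_integrable_iff_nn_integral ennreal_mult_less_top)
  finally show ?thesis by (simp add: square_integrable_iff_nn_integral)
qed

lemma (in pair_sigma_finite) AE_square_integrable_fst:
  assumes f: "square_integrable (M1 \<Otimes>\<^sub>M M2) f"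
  shows "AE x in M1. square_integrable M2 (\<lambda>y. f (x, y))"
  using AE_integrable_fst'[OF square_integrableD(2)[OF f]] AE_space
  by eventually_elim (use square_integrableD(1)[OF f] in \<open>simp add: square_integrable_def\<close>)

text \<open>For fixed k the slice coefficient \<open>F k\<close> is square-integrable by
  Cauchy-Schwarz and orthogonal to every \<open>E j\<close>, hence null. As there are countably many
  k, almost every slice has all its coefficients zero and vanishes by completeness of E'.\<close>

lemma complete_family_pair:
  fixes E' :: "'k::countable \<Rightarrow> 'b \<Rightarrow> real"
  assumes M: "sigma_finite_measure M" and N: "sigma_finite_measure N"
    and E: "complete_family M E" "\<And>j. square_integrable M (\<lambda>x. of_real (E j x))"
    and E': "complete_family N E'" "\<And>k. square_integrable N (\<lambda>x. of_real (E' k x))"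
  shows "complete_family (M \<Otimes>\<^sub>M N) (\<lambda>(j, k) p. E j (fst p) * E' k (snd p))"
  unfolding complete_family_def
proof (intro allI impI)
  interpret M: sigma_finite_measure M by fact
  interpret N: sigma_finite_measure N by fact
  interpret P: pair_sigma_finite M N ..
  fix f assume f: "square_integrable (M \<Otimes>\<^sub>M N) f"
    and zero: "\<forall>k. (LINT p|(M \<Otimes>\<^sub>M N). f p * of_real ((case k of (j, k) \<Rightarrow> \<lambda>p. E j (fst p) * E' k (snd p)) p)) = 0"
  note [measurable] = square_integrableD(1)[OF f] square_integrableD(1)[OF E'(2)]
  define F where "F k x = (LINT y|N. f (x, y) * of_real (E' k y))" for k x
  have "AE x in M. F k x = 0" for k
  proof -
    have Fm: "F k \<in> borel_measurable M" unfolding F_def by measurable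
    define C where "C = (LINT y|N. (norm (complex_of_real (E' k y)))\<^sup>2)"
    have F: "square_integrable M (F k)"
      unfolding square_integrable_def
    proof (intro conjI Fm, rule Bochner_Integration.integrable_bound)
      show "integrable M (\<lambda>x. (LINT y|N. (norm (f (x, y)))\<^sup>2) * C)"
        by (intro integrable_mult_left P.integrable_fst' square_integrableD(2) f)
      show "AE x in M. norm ((norm (F k x))\<^sup>2) \<le> norm ((LINT y|N. (norm (f (x, y)))\<^sup>2) * C)"
        using P.AE_square_integrable_fst[OF f]
      proof eventually_elim
        case (elim x)
        show ?case using Cauchy_Schwarz_integral[OF elim E'(2)[of k]] by (simp add: F_def C_def)
      qed
    qed (use Fm in measurable)
    show ?thesis
    proof (rule E(1)[unfolded complete_family_def, rule_format, OF F])
      fix j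
      have i: "integrable (M \<Otimes>\<^sub>M N) (\<lambda>p. f p * (of_real (E j (fst p)) * of_real (E' k (snd p))))"
        by (intro square_integrable_mult f P.square_integrable_times E E')
      have "(LINT x|M. F k x * of_real (E j x)) = (LINT x|M. LINT y|N. f (x, y) * (of_real (E j x) * of_real (E' k y)))"
        unfolding F_def
        by (subst integral_mult_left_zero[symmetric]) (simp add: mult_ac)
      also have "\<dots> = (LINT p|(M \<Otimes>\<^sub>M N). f p * (of_real (E j (fst p)) * of_real (E' k (snd p))))"
        using P.integral_fst'[OF i] by simp
      also have "\<dots> = 0" using zero[rule_format, of "(j, k)"] by simp
      finally show "(LINT x|M. F k x * of_real (E j x)) = 0" .
    qed
  qed
  then have "AE x in M. \<forall>k. F k x = 0" by (simp add: AE_all_countable)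
  then have "AE x in M. AE y in N. f (x, y) = 0"
    using P.AE_square_integrable_fst[OF f]
  proof eventually_elim
    case (elim x)
    then show ?case using E'(1) unfolding complete_family_def F_def by blast
  qed
  then show "AE p in M \<Otimes>\<^sub>M N. f p = 0"
    by (intro P.AE_pair_measure) measurable
qed

text \<open>Functions on N are pulled back along the measure-preserving T. It suffices that each
  member of the old family is the pullback of some member of the new one, so the index types may
  differ.\<close>

lemma complete_family_distr:
  assumes E: "complete_family M E" and T: "T \<in> M \<rightarrow>\<^sub>M N" "distr M N T = N"
    and E': "\<And>j. E' j \<in> borel_measurable N" and eq: "\<And>k. \<exists>j. \<forall>x\<in>space M. E' j (T x) = E k x"
  shows "complete_family N E'"
  unfolding complete_family_def
proof (intro allI impI)
  fix f assume f: "square_integrable N f" and zero: "\<forall>k. (LINT x|N. f x * of_real (E' k x)) = 0"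
  note [measurable] = square_integrableD(1)[OF f] T(1) E'
  have "integrable (distr M N T) (\<lambda>x. (norm (f x))\<^sup>2)" unfolding T(2) by (rule square_integrableD(2)[OF f])
  then have "square_integrable M (\<lambda>x. f (T x))"
    unfolding square_integrable_def by (subst (asm) integrable_distr_eq) auto
  moreover have "(LINT x|M. f (T x) * of_real (E k x)) = 0" for k
  proof -
    obtain j where j: "\<forall>x\<in>space M. E' j (T x) = E k x" using eq[of k] by auto
    have "(LINT x|M. f (T x) * of_real (E k x)) = (LINT x|M. f (T x) * of_real (E' j (T x)))"
      using j by (intro Bochner_Integration.integral_cong) auto
    also have "\<dots> = (LINT x|distr M N T. f x * of_real (E' j x))" by (rule integral_distr[symmetric]) measurable
    finally show ?thesis using zero unfolding T(2) by simp
  qed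
  ultimately have "AE x in M. f (T x) = 0" using E unfolding complete_family_def by blast
  then have "AE x in distr M N T. f x = 0" by (subst AE_distr_iff) measurable
  then show "AE x in N. f x = 0" unfolding T(2) .
qed

lemma (in product_sigma_finite) distr_fun_upd:
  assumes [simp]: "finite I" "i \<notin> I"
  shows "distr (Pi\<^sub>M I M \<Otimes>\<^sub>M M i) (Pi\<^sub>M (insert i I) M) (\<lambda>(f, y). f(i := y)) = Pi\<^sub>M (insert i I) M"
proof (rule measure_eqI)
  interpret I: finite_product_sigma_finite M I by standard simp
  fix A assume "A \<in> sets (distr (Pi\<^sub>M I M \<Otimes>\<^sub>M M i) (Pi\<^sub>M (insert i I) M) (\<lambda>(f, y). f(i := y)))"
  then have A [measurable]: "A \<in> sets (Pi\<^sub>M (insert i I) M)" by simp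
  have [measurable]: "(\<lambda>(f, y). f(i := y)) \<in> Pi\<^sub>M I M \<Otimes>\<^sub>M M i \<rightarrow>\<^sub>M Pi\<^sub>M (insert i I) M" by (rule measurable_add_dim)
  have "emeasure (distr (Pi\<^sub>M I M \<Otimes>\<^sub>M M i) (Pi\<^sub>M (insert i I) M) (\<lambda>(f, y). f(i := y))) A =
      (\<integral>\<^sup>+p. indicator A ((\<lambda>(f, y). f(i := y)) p) \<partial>(Pi\<^sub>M I M \<Otimes>\<^sub>M M i))"
    by (subst nn_integral_distr[symmetric, where M'="Pi\<^sub>M (insert i I) M"]) auto
  also have "\<dots> = (\<integral>\<^sup>+f. \<integral>\<^sup>+y. indicator A (f(i := y)) \<partial>M i \<partial>Pi\<^sub>M I M)"
    by (subst M.nn_integral_fst[symmetric]) auto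
  also have "\<dots> = (\<integral>\<^sup>+f. indicator A f \<partial>Pi\<^sub>M (insert i I) M)"
    by (subst product_nn_integral_insert) auto
  finally show "emeasure (distr (Pi\<^sub>M I M \<Otimes>\<^sub>M M i) (Pi\<^sub>M (insert i I) M) (\<lambda>(f, y). f(i := y))) A = emeasure (Pi\<^sub>M (insert i I) M) A"
    by simp
qed simp

interpretation lborel_product: product_sigma_finite "\<lambda>_. lborel :: real measure" ..

definition hermite_prod :: "'i set \<Rightarrow> ('i \<Rightarrow> nat) \<Rightarrow> ('i \<Rightarrow> real) \<Rightarrow> real" where
  "hermite_prod I \<alpha> x = (\<Prod>i\<in>I. hermite_fun (\<alpha> i) (x i))"

lemma integrable_hermite_fun_mult: "integrable lborel (\<lambda>y. hermite_fun j y * hermite_fun k y)"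
  unfolding hermite_fun_mult using integrable_gauss_poly[of "2 * pi"] by simp

lemma hermite_prod_measurable [measurable]: "hermite_prod I \<alpha> \<in> borel_measurable (Pi\<^sub>M I (\<lambda>_. lborel))"
  unfolding hermite_prod_def by measurable

lemma hermite_prod_mult: "hermite_prod I \<alpha> x * hermite_prod I \<beta> x = (\<Prod>i\<in>I. hermite_fun (\<alpha> i) (x i) * hermite_fun (\<beta> i) (x i))"
  by (simp add: hermite_prod_def prod.distrib)

lemma square_integrable_hermite_prod:
  assumes "finite I"
  shows "square_integrable (Pi\<^sub>M I (\<lambda>_. lborel)) (\<lambda>x. of_real (hermite_prod I \<alpha> x))"
proof -
  have "integrable (Pi\<^sub>M I (\<lambda>_. lborel)) (\<lambda>x. \<Prod>i\<in>I. hermite_fun (\<alpha> i) (x i) * hermite_fun (\<alpha> i) (x i))"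
    by (intro lborel_product.product_integrable_prod assms integrable_hermite_fun_mult)
  then show ?thesis
    by (simp add: square_integrable_def power2_eq_square hermite_prod_mult[symmetric])
qed

lemma complete_family_hermite_prod:
  assumes "finite (I :: 'i::finite set)"
  shows "complete_family (Pi\<^sub>M I (\<lambda>_. lborel)) (hermite_prod I)"
  using assms
proof induction
  case empty
  \<comment> \<open>Over the empty index set the space is a single point of mass 1 and the empty
    product is the constant 1, so orthogonality already is vanishing.\<close>
  let ?P = "Pi\<^sub>M ({} :: 'i set) (\<lambda>_. lborel :: real measure)"
  show ?case unfolding complete_family_def
  proof (intro allI impI)
    fix f assume "square_integrable (?P) f"
      and zero: "\<forall>k. (LINT x|(?P). f x * complex_of_real (hermite_prod {} k x)) = 0"
    have "emeasure (?P) (space (?P)) = 1"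
      by (simp add: space_PiM_empty)
    then have m: "measure (?P) (space (?P)) = 1"
      by (simp add: measure_def)
    have "(LINT x|(?P). f x) = (LINT x|(?P). f (\<lambda>_. undefined))"
      by (intro Bochner_Integration.integral_cong) (auto simp: space_PiM_empty)
    also have "\<dots> = f (\<lambda>_. undefined)" using m by simp
    finally have "f (\<lambda>_. undefined) = 0" using zero by (simp add: hermite_prod_def)
    then show "AE x in ?P. f x = 0"
      by (intro AE_I2) (auto simp: space_PiM_empty)
  qed
next
  case (insert i I)
  interpret I: finite_product_sigma_finite "\<lambda>_. lborel :: real measure" I by standard (rule insert)
  have "complete_family (Pi\<^sub>M I (\<lambda>_. lborel) \<Otimes>\<^sub>M lborel) (\<lambda>(\<alpha>, k) p. hermite_prod I \<alpha> (fst p) * hermite_fun k (snd p))"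
  proof (rule complete_family_pair[OF _ _ insert.IH])
    show "complete_family lborel hermite_fun"
      unfolding complete_family_def using hermite_fun_complete by blast
  qed (use insert.hyps square_integrable_hermite_fun in \<open>auto intro!: sigma_finite_lborel I.sigma_finite_measure_axioms square_integrable_hermite_prod\<close>)
  then show ?case
  proof (rule complete_family_distr[where T = "\<lambda>(f, y). f(i := y)"])
    show "(\<lambda>(f, y). f(i := y)) \<in> Pi\<^sub>M I (\<lambda>_. lborel) \<Otimes>\<^sub>M (lborel :: real measure) \<rightarrow>\<^sub>M Pi\<^sub>M (insert i I) (\<lambda>_. lborel)"
      by (rule measurable_add_dim)
    show "distr (Pi\<^sub>M I (\<lambda>_. lborel) \<Otimes>\<^sub>M (lborel :: real measure)) (Pi\<^sub>M (insert i I) (\<lambda>_. lborel)) (\<lambda>(f, y). f(i := y)) = Pi\<^sub>M (insert i I) (\<lambda>_. lborel)"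
      using insert by (intro lborel_product.distr_fun_upd) auto
    show "\<exists>\<beta>. \<forall>x\<in>space (Pi\<^sub>M I (\<lambda>_. lborel) \<Otimes>\<^sub>M lborel). hermite_prod (insert i I) \<beta> ((\<lambda>(f, y). f(i := y)) x) =
        (case k of (\<alpha>, k) \<Rightarrow> \<lambda>p. hermite_prod I \<alpha> (fst p) * hermite_fun k (snd p)) x" for k
    proof (cases k)
      case (Pair \<alpha> m)
      have "hermite_prod (insert i I) (\<alpha>(i := m)) (f(i := y)) = hermite_prod I \<alpha> f * hermite_fun m y" for f y
        using insert.hyps unfolding hermite_prod_def by (simp add: mult.commute) (intro prod.cong disjI2, auto)
      then show ?thesis using Pair by (intro exI[of _ "\<alpha>(i := m)"]) auto
    qed
  qed measurable
qed

section \<open>Transfer of the product basis to Euclidean space\<close>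

lemma vec_lambda_measurable [measurable]: "(\<lambda>f. \<chi> i. f i) \<in> Pi\<^sub>M UNIV (\<lambda>_. lborel) \<rightarrow>\<^sub>M (borel :: (real ^ 'n::finite) measure)"
proof (subst borel_measurable_euclidean_space, intro ballI)
  fix b :: "real ^ 'n" assume "b \<in> Basis"
  then obtain i where b: "b = axis i 1" by (auto simp: Basis_vec_def)
  show "(\<lambda>f. (\<chi> i. f i) \<bullet> b) \<in> borel_measurable (Pi\<^sub>M UNIV (\<lambda>_. lborel))"
    unfolding b by (simp add: inner_axis)
qed

lemma distr_vec_lambda_lborel:
  "distr (Pi\<^sub>M UNIV (\<lambda>_. lborel)) lborel (\<lambda>f. \<chi> i. f i) = (lborel :: (real ^ 'n::finite) measure)"
proof (rule lborel_eqI[symmetric])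
  fix l u :: "real ^ 'n" assume le: "\<And>b. b \<in> Basis \<Longrightarrow> l \<bullet> b \<le> u \<bullet> b"
  then have le': "l $ i \<le> u $ i" for i
    using le[of "axis i 1"] by (auto simp: Basis_vec_def inner_axis)
  have "emeasure (distr (Pi\<^sub>M UNIV (\<lambda>_. lborel)) lborel (\<lambda>f. \<chi> i. f i)) (box l u) =
      emeasure (Pi\<^sub>M UNIV (\<lambda>_. lborel)) ((\<lambda>f. \<chi> i. f i) -` box l u \<inter> space (Pi\<^sub>M UNIV (\<lambda>_. lborel)))"
    by (intro emeasure_distr) auto
  also have "(\<lambda>f. \<chi> i. f i) -` box l u \<inter> space (Pi\<^sub>M UNIV (\<lambda>_. lborel)) = Pi\<^sub>E UNIV (\<lambda>i. {l $ i <..< u $ i})"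
    by (auto simp: space_PiM mem_box_cart PiE_def Pi_iff)
  also have "emeasure (Pi\<^sub>M UNIV (\<lambda>_. lborel)) \<dots> = (\<Prod>i\<in>UNIV. emeasure lborel {l $ i <..< u $ i})"
    by (intro lborel_product.emeasure_PiM) auto
  also have "\<dots> = ennreal (\<Prod>i\<in>UNIV. u $ i - l $ i)"
    using le' by (simp add: prod_ennreal)
  also have "(\<Prod>i\<in>UNIV. u $ i - l $ i) = (\<Prod>b\<in>Basis. (u - l) \<bullet> b)"
    by (rule sym, rule prod.reindex_bij_betw[of "\<lambda>i. axis i 1" UNIV Basis "\<lambda>b. (u - l) \<bullet> b", THEN trans[OF sym]])
      (auto simp: Basis_vec_def inner_axis bij_betw_def inj_on_def axis_eq_axis)
  finally show "emeasure (distr (Pi\<^sub>M UNIV (\<lambda>_. lborel)) lborel (\<lambda>f. \<chi> i. f i)) (box l u) = ennreal (\<Prod>b\<in>Basis. (u - l) \<bullet> b)" .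
qed simp

lemma
  fixes f :: "'n::finite \<Rightarrow> real \<Rightarrow> 'b::{real_normed_field, banach, second_countable_topology}"
  assumes f: "\<And>i. integrable lborel (f i)"
  shows integrable_vec_prod: "integrable lborel (\<lambda>x :: real ^ 'n. \<Prod>i\<in>UNIV. f i (x $ i))"
    and integral_vec_prod: "(LINT x|lborel. (\<Prod>i\<in>UNIV. f i ((x :: real ^ 'n) $ i))) = (\<Prod>i\<in>UNIV. LINT y|lborel. f i y)"
proof -
  have [measurable]: "f i \<in> borel_measurable borel" for i using f[of i] by simp
  have "integrable (Pi\<^sub>M UNIV (\<lambda>_. lborel)) (\<lambda>x. \<Prod>i\<in>UNIV. f i (x i))"
    by (intro lborel_product.product_integrable_prod f) simp
  then have "integrable (distr (Pi\<^sub>M UNIV (\<lambda>_. lborel)) lborel (\<lambda>f. \<chi> i. f i)) (\<lambda>x :: real ^ 'n. \<Prod>i\<in>UNIV. f i (x $ i))"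
    by (subst integrable_distr_eq) auto
  then show "integrable lborel (\<lambda>x :: real ^ 'n. \<Prod>i\<in>UNIV. f i (x $ i))"
    unfolding distr_vec_lambda_lborel .
  have "(LINT x|lborel. (\<Prod>i\<in>UNIV. f i ((x :: real ^ 'n) $ i))) =
      (LINT x|(distr (Pi\<^sub>M UNIV (\<lambda>_. lborel)) lborel (\<lambda>f. \<chi> i. f i)). (\<Prod>i\<in>UNIV. f i ((x :: real ^ 'n) $ i)))"
    unfolding distr_vec_lambda_lborel ..
  also have "\<dots> = (LINT x|(Pi\<^sub>M UNIV (\<lambda>_. lborel)). (\<Prod>i\<in>UNIV. f i (x i)))"
    by (subst integral_distr) auto
  also have "\<dots> = (\<Prod>i\<in>UNIV. LINT y|lborel. f i y)"
    by (intro lborel_product.product_integral_prod f) simp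
  finally show "(LINT x|lborel. (\<Prod>i\<in>UNIV. f i ((x :: real ^ 'n) $ i))) = (\<Prod>i\<in>UNIV. LINT y|lborel. f i y)" .
qed

definition hermite_vec :: "('n::finite \<Rightarrow> nat) \<Rightarrow> real ^ 'n \<Rightarrow> real" where
  "hermite_vec \<alpha> x = (\<Prod>i\<in>UNIV. hermite_fun (\<alpha> i) (x $ i))"

lemma hermite_vec_measurable [measurable]: "hermite_vec \<alpha> \<in> borel_measurable borel"
  unfolding hermite_vec_def by measurable

lemma integrable_hermite_vec: "integrable lborel (hermite_vec \<alpha>)"
  unfolding hermite_vec_def by (intro integrable_vec_prod integrable_hermite_fun)

interpretation hermite_vec: complete_orthonormal lborel "hermite_vec :: ('n::finite \<Rightarrow> nat) \<Rightarrow> _"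
proof
  have mult: "hermite_vec \<alpha> x * hermite_vec \<beta> x = (\<Prod>i\<in>UNIV. hermite_fun (\<alpha> i) (x $ i) * hermite_fun (\<beta> i) (x $ i))"
    for \<alpha> \<beta> :: "'n \<Rightarrow> nat" and x by (simp add: hermite_vec_def prod.distrib)
  show "square_integrable lborel (\<lambda>x. complex_of_real (hermite_vec \<alpha> x))" for \<alpha> :: "'n \<Rightarrow> nat"
    using integrable_vec_prod[OF integrable_hermite_fun_mult, of \<alpha> \<alpha>]
    by (simp add: square_integrable_def power2_eq_square mult)
  show "(LINT x|lborel. hermite_vec \<alpha> x * hermite_vec \<beta> x) = (if \<alpha> = \<beta> then 1 else 0)" for \<alpha> \<beta> :: "'n \<Rightarrow> nat"
    unfolding mult integral_vec_prod[OF integrable_hermite_fun_mult] hermite_fun_orthonormal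
    by (auto simp: fun_eq_iff)
  have "complete_family lborel (hermite_vec :: ('n \<Rightarrow> nat) \<Rightarrow> _)"
  proof (rule complete_family_distr[OF complete_family_hermite_prod[OF finite] _ distr_vec_lambda_lborel])
    show "\<exists>\<beta>. \<forall>x\<in>space (Pi\<^sub>M UNIV (\<lambda>_. lborel)). hermite_vec \<beta> (\<chi> i. x i) = hermite_prod UNIV \<alpha> x" for \<alpha> :: "'n \<Rightarrow> nat"
      by (intro exI[of _ \<alpha>]) (simp add: hermite_vec_def hermite_prod_def)
  qed simp_all
  then show "AE x in lborel. f x = 0" if "square_integrable lborel f"
    "\<And>\<alpha> :: 'n \<Rightarrow> nat. (LINT x|lborel. f x * complex_of_real (hermite_vec \<alpha> x)) = 0" for f
    using that unfolding complete_family_def by blast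
qed

section \<open>The basis on space-time\<close>

definition hermite_pair :: "('n::finite \<Rightarrow> nat) \<times> nat \<Rightarrow> (real ^ 'n) \<times> real \<Rightarrow> real" where
  "hermite_pair k p = hermite_vec (fst k) (fst p) * hermite_fun (snd k) (snd p)"

lemma hermite_pair_measurable [measurable]: "hermite_pair k \<in> borel_measurable borel"
  unfolding hermite_pair_def[abs_def] borel_prod[symmetric] by measurable

interpretation lborel_pair: pair_sigma_finite "lborel :: 'a::euclidean_space measure" "lborel :: 'b::euclidean_space measure" ..

lemma lborel_LINT_fst:
  fixes f :: "'a::euclidean_space \<times> 'b::euclidean_space \<Rightarrow> 'c::{banach, second_countable_topology}"
  assumes "integrable lborel f"
  shows "(LINT p|lborel. f p) = (LINT x|lborel. LINT y|lborel. f (x, y))"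
  using lborel_pair.integral_fst'[of f] assms unfolding lborel_prod by simp

lemma integrable_lborel_times:
  fixes f :: "'a::euclidean_space \<Rightarrow> 'c::{real_normed_field, banach, second_countable_topology}"
    and g :: "'b::euclidean_space \<Rightarrow> 'c"
  assumes f: "integrable lborel f" and g: "integrable lborel g"
  shows "integrable lborel (\<lambda>p. f (fst p) * g (snd p))"
proof -
  have "integrable (lborel \<Otimes>\<^sub>M lborel) (\<lambda>p. f (fst p) * g (snd p))"
  proof (rule lborel_pair.Fubini_integrable)
    have [measurable]: "f \<in> borel_measurable lborel" "g \<in> borel_measurable lborel" using f g by auto
    show "(\<lambda>p. f (fst p) * g (snd p)) \<in> borel_measurable (lborel \<Otimes>\<^sub>M lborel)" by measurable
    show "integrable lborel (\<lambda>x. LINT y|lborel. norm (f (fst (x, y)) * g (snd (x, y))))"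
      using f by (simp add: norm_mult)
    show "AE x in lborel. integrable lborel (\<lambda>y. f (fst (x, y)) * g (snd (x, y)))"
      using g by simp
  qed
  then show ?thesis unfolding lborel_prod .
qed

lemma integral_lborel_times:
  fixes f :: "'a::euclidean_space \<Rightarrow> 'c::{real_normed_field, banach, second_countable_topology}"
    and g :: "'b::euclidean_space \<Rightarrow> 'c"
  assumes f: "integrable lborel f" and g: "integrable lborel g"
  shows "(LINT p|lborel. f (fst p) * g (snd p)) = (LINT x|lborel. f x) * (LINT y|lborel. g y)"
  by (simp add: lborel_LINT_fst[OF integrable_lborel_times[OF assms]])

interpretation hermite_pair: complete_orthonormal lborel "hermite_pair :: ('n::finite \<Rightarrow> nat) \<times> nat \<Rightarrow> _"
proof
  show "square_integrable lborel (\<lambda>p. complex_of_real (hermite_pair k p))" for k :: "('n \<Rightarrow> nat) \<times> nat"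
    using lborel_pair.square_integrable_times[OF hermite_vec.basis[of "fst k"] square_integrable_hermite_fun[of "snd k"]]
    unfolding lborel_prod hermite_pair_def by simp
  show "(LINT p|lborel. hermite_pair j p * hermite_pair k p) = (if j = k then 1 else 0)" for j k :: "('n \<Rightarrow> nat) \<times> nat"
  proof -
    have i: "integrable lborel (\<lambda>x. hermite_vec (fst j) x * hermite_vec (fst k) x)"
      using square_integrable_mult[OF hermite_vec.basis[of "fst j"] hermite_vec.basis[of "fst k"]]
      by (simp only: of_real_mult[symmetric] complex_of_real_integrable_eq)
    have "(LINT p|lborel. hermite_pair j p * hermite_pair k p) =
        (LINT p|lborel. (hermite_vec (fst j) (fst p) * hermite_vec (fst k) (fst p)) * (hermite_fun (snd j) (snd p) * hermite_fun (snd k) (snd p)))"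
      by (simp add: hermite_pair_def mult_ac)
    also have "\<dots> = (if j = k then 1 else 0)"
      unfolding integral_lborel_times[OF i integrable_hermite_fun_mult] hermite_vec.orthonormal hermite_fun_orthonormal
      by (simp add: prod_eq_iff)
    finally show ?thesis .
  qed
  have "complete_family (lborel \<Otimes>\<^sub>M lborel) (\<lambda>(\<alpha> :: 'n \<Rightarrow> nat, k) p. hermite_vec \<alpha> (fst p) * hermite_fun k (snd p))"
  proof (rule complete_family_pair)
    show "complete_family lborel (hermite_vec :: ('n \<Rightarrow> nat) \<Rightarrow> _)"
      unfolding complete_family_def using hermite_vec.complete by blast
    show "complete_family lborel hermite_fun"
      unfolding complete_family_def using hermite_fun_complete by blast
  qed (auto intro: hermite_vec.basis square_integrable_hermite_fun sigma_finite_lborel)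
  then show "AE p in lborel. f p = 0" if "square_integrable lborel f"
    "\<And>k :: ('n \<Rightarrow> nat) \<times> nat. (LINT p|lborel. f p * complex_of_real (hermite_pair k p)) = 0" for f
    using that unfolding complete_family_def lborel_prod by (auto simp: hermite_pair_def split: prod.splits)
qed

section \<open>The Fourier transform and the weak form of the equation\<close>

text \<open>The hypotheses speak of Lebesgue measurable functions, while the product structure and
  Fubini's theorem are available for Borel measure; passing to a Borel representative costs a null
  set.\<close>

lemma ex_borel_representative:
  fixes f :: "'a::euclidean_space \<Rightarrow> complex"
  assumes "f \<in> borel_measurable lebesgue"
  obtains g where "g \<in> borel_measurable borel" "AE x in lborel. f x = g x"
proof -
  have "(\<lambda>x. Re (f x)) \<in> borel_measurable lebesgue" "(\<lambda>x. Im (f x)) \<in> borel_measurable lebesgue"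
    using assms by measurable
  from this[THEN completion_ex_borel_measurable_real] obtain a b
    where "a \<in> borel_measurable lborel" "AE x in lborel. Re (f x) = a x"
      "b \<in> borel_measurable lborel" "AE x in lborel. Im (f x) = b x" by blast
  then show ?thesis
    by (intro that[of "\<lambda>x. Complex (a x) (b x)"]) (auto elim: AE_mp intro!: borel_measurable_complex_iff[THEN iffD2] simp: complex_eq_iff)
qed

lemma AE_lebesgue_iff: "(AE x in lebesgue. P x) \<longleftrightarrow> (AE x in lborel. P x)"
  by (rule AE_completion_iff)

lemma borel_measurable_lebesgueI: "f \<in> borel_measurable borel \<Longrightarrow> f \<in> borel_measurable lebesgue"
  by (rule measurable_completion) simp

lemma square_integrable_L2:
  assumes "f \<in> L2" "g \<in> borel_measurable borel" "AE x in lborel. f x = g x"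
  shows "square_integrable lborel g"
proof -
  have "integrable lebesgue (\<lambda>x. (norm (g x))\<^sup>2)"
  proof (rule integrable_cong_AE_imp)
    show "integrable lebesgue (\<lambda>x. (norm (f x))\<^sup>2)" using assms(1) by (simp add: L2_def)
    show "AE x in lebesgue. (norm (f x))\<^sup>2 = (norm (g x))\<^sup>2"
      using assms(3) unfolding AE_lebesgue_iff by (auto elim: AE_mp)
  qed (use borel_measurable_lebesgueI[OF assms(2)] in measurable)
  then show ?thesis using assms(2) by (subst (asm) integrable_completion) (auto simp: square_integrable_def)
qed

lemma L2_borel_representative:
  assumes "f \<in> L2"
  obtains g where "square_integrable lborel g" "AE x in lborel. f x = g x"
proof -
  obtain g where g: "g \<in> borel_measurable borel" "AE x in lborel. f x = g x"
    using ex_borel_representative[of f] assms by (auto simp: L2_def)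
  then show ?thesis using square_integrable_L2[OF assms g] by (intro that[of g])
qed

lemma L2_of_square_integrable:
  assumes "square_integrable lborel g" "AE x in lborel. f x = g x"
  shows "f \<in> L2"
proof -
  have g [measurable]: "g \<in> borel_measurable borel" using square_integrableD(1)[OF assms(1)] by simp
  have ae: "AE x in lebesgue. f x = g x" using assms(2) unfolding AE_lebesgue_iff .
  have f: "f \<in> borel_measurable lebesgue"
    by (rule borel_measurable_AE[OF borel_measurable_lebesgueI[OF g]]) (use ae in \<open>auto elim: AE_mp\<close>)
  have "integrable lebesgue (\<lambda>x. (norm (g x))\<^sup>2)"
    using square_integrableD(2)[OF assms(1)] by (subst integrable_completion) auto
  then have "integrable lebesgue (\<lambda>x. (norm (f x))\<^sup>2)"
    by (rule integrable_cong_AE_imp) (use f ae in \<open>auto elim: AE_mp\<close>)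
  with f show ?thesis by (simp add: L2_def)
qed

lemma L2_lim_iff:
  assumes [measurable]: "\<And>n. f' n \<in> borel_measurable borel" "g' \<in> borel_measurable borel"
    and ae: "\<And>n. AE x in lborel. f n x = f' n x" "AE x in lborel. g x = g' x"
  shows "L2_lim f g \<longleftrightarrow> (\<lambda>n. \<integral>\<^sup>+x. ennreal ((norm (f' n x - g' x))\<^sup>2) \<partial>lborel) \<longlonglongrightarrow> 0"
proof -
  have "(\<integral>\<^sup>+x. ennreal ((norm (f n x - g x))\<^sup>2) \<partial>lebesgue) = (\<integral>\<^sup>+x. ennreal ((norm (f' n x - g' x))\<^sup>2) \<partial>lborel)" for n
  proof -
    have "AE x in lborel. ennreal ((norm (f n x - g x))\<^sup>2) = ennreal ((norm (f' n x - g' x))\<^sup>2)"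
      using ae(1)[of n] ae(2) by eventually_elim simp
    then have "(\<integral>\<^sup>+x. ennreal ((norm (f n x - g x))\<^sup>2) \<partial>lebesgue) = (\<integral>\<^sup>+x. ennreal ((norm (f' n x - g' x))\<^sup>2) \<partial>lebesgue)"
      by (intro nn_integral_cong_AE) (simp add: AE_lebesgue_iff)
    also have "\<dots> = (\<integral>\<^sup>+x. ennreal ((norm (f' n x - g' x))\<^sup>2) \<partial>lborel)"
      by (rule nn_integral_completion)
    finally show ?thesis .
  qed
  then show ?thesis by (simp add: L2_lim_def)
qed

section \<open>The Fourier transform in Hermite coefficients\<close>

definition fourier_kernel :: "(real ^ 'n::finite) \<times> real \<Rightarrow> (real ^ 'n) \<times> real \<Rightarrow> complex" where
  "fourier_kernel q p = iexp (- 2 * pi * (q \<bullet> p))"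

lemma fourier_kernel_commute: "fourier_kernel q p = fourier_kernel p q"
  by (simp add: fourier_kernel_def inner_commute)

lemma norm_fourier_kernel [simp]: "norm (fourier_kernel q p) = 1"
  unfolding fourier_kernel_def by (rule norm_exp_i_times)

lemma fourier_kernel_measurable [measurable (raw)]:
  assumes "f \<in> borel_measurable M" "g \<in> borel_measurable M"
  shows "(\<lambda>x. fourier_kernel (f x) (g x)) \<in> borel_measurable M"
proof -
  have "(\<lambda>x. f x \<bullet> g x) \<in> borel_measurable M" using assms by measurable
  then show ?thesis unfolding fourier_kernel_def by measurable
qed

lemma fourier_integral_altdef:
  "fourier_integral u q = (LINT p|lebesgue. fourier_kernel q p * u p)"
proof -
  have "exp (- 2 * of_real pi * \<i> * of_real (fst q \<bullet> x + snd q * t)) = fourier_kernel q (x, t)" for x t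
    unfolding fourier_kernel_def by (rule arg_cong[of _ _ exp]) (simp add: inner_prod_def algebra_simps)
  then show ?thesis by (simp add: fourier_integral_def case_prod_beta')
qed

lemma fourier_integral_borel:
  fixes u u' :: "(real ^ 'n::finite) \<times> real \<Rightarrow> complex"
  assumes [measurable]: "u' \<in> borel_measurable borel" and u: "u \<in> borel_measurable lebesgue"
    and ae: "AE p in lborel. u p = u' p"
  shows "fourier_integral u q = (LINT p|lborel. fourier_kernel q p * u' p)"
proof -
  have k: "fourier_kernel q \<in> borel_measurable lebesgue"
    by (intro borel_measurable_lebesgueI) measurable
  have "fourier_integral u q = (LINT p|lebesgue. fourier_kernel q p * u' p)"
    unfolding fourier_integral_altdef
    using ae k u borel_measurable_lebesgueI[OF assms(1)] unfolding AE_lebesgue_iff[symmetric]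
    by (intro integral_cong_AE) (auto elim: AE_mp)
  also have "\<dots> = (LINT p|lborel. fourier_kernel q p * u' p)"
    by (rule integral_completion) measurable
  finally show ?thesis .
qed

lemma fourier_integral_lborel:
  "u \<in> borel_measurable borel \<Longrightarrow> fourier_integral u q = (LINT p|lborel. fourier_kernel q p * u p)"
  by (intro fourier_integral_borel borel_measurable_lebesgueI) auto

definition hermite_phase :: "('n::finite \<Rightarrow> nat) \<times> nat \<Rightarrow> complex" where
  "hermite_phase k = (\<Prod>i\<in>UNIV. (- \<i>) ^ fst k i) * (- \<i>) ^ snd k"

lemma norm_hermite_phase [simp]: "norm (hermite_phase k) = 1"
  by (simp add: hermite_phase_def norm_mult norm_power prod_norm[symmetric])

lemma hermite_vec_fourier:
  "(LINT x|lborel. iexp (- 2 * pi * (\<xi> \<bullet> x)) * of_real (hermite_vec \<alpha> x)) =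
    (\<Prod>i\<in>UNIV. (- \<i>) ^ \<alpha> i) * of_real (hermite_vec \<alpha> \<xi>)"
proof -
  have i: "integrable lborel (\<lambda>y. complex_of_real (hermite_fun k y) * iexp (- 2 * pi * \<eta> * y))" for k \<eta>
    by (rule Bochner_Integration.integrable_bound[OF integrable_hermite_fun[of k]]) (auto simp: norm_mult)
  have eq: "iexp (- 2 * pi * (\<xi> \<bullet> x)) * of_real (hermite_vec \<alpha> x) =
      (\<Prod>i\<in>UNIV. complex_of_real (hermite_fun (\<alpha> i) (x $ i)) * iexp (- 2 * pi * (\<xi> $ i) * (x $ i)))" for x
    unfolding prod.distrib hermite_vec_def exp_sum[OF finite, symmetric] of_real_prod
    by (simp add: inner_vec_def sum_distrib_left sum_negf mult_ac)
  show ?thesis unfolding eq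
    by (subst integral_vec_prod[OF i]) (simp only: hermite_fun_fourier prod.distrib hermite_vec_def of_real_prod)
qed

lemma hermite_pair_fourier:
  "(LINT p|lborel. fourier_kernel q p * of_real (hermite_pair k p)) = hermite_phase k * of_real (hermite_pair k q)"
proof -
  have 1: "integrable lborel (\<lambda>x. iexp (- 2 * pi * (fst q \<bullet> x)) * complex_of_real (hermite_vec (fst k) x))"
    by (rule Bochner_Integration.integrable_bound[OF integrable_hermite_vec[of "fst k"]]) (auto simp: norm_mult)
  have 2: "integrable lborel (\<lambda>y. complex_of_real (hermite_fun (snd k) y) * iexp (- 2 * pi * snd q * y))"
    by (rule Bochner_Integration.integrable_bound[OF integrable_hermite_fun[of "snd k"]]) (auto simp: norm_mult)
  have eq: "fourier_kernel q p * of_real (hermite_pair k p) =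
    (iexp (- 2 * pi * (fst q \<bullet> fst p)) * complex_of_real (hermite_vec (fst k) (fst p))) *
    (complex_of_real (hermite_fun (snd k) (snd p)) * iexp (- 2 * pi * snd q * snd p))" for p
  proof -
    have "fourier_kernel q p = iexp (- 2 * pi * (fst q \<bullet> fst p)) * iexp (- 2 * pi * snd q * snd p)"
      unfolding fourier_kernel_def exp_add[symmetric] by (rule arg_cong[of _ _ exp]) (simp add: inner_prod_def algebra_simps)
    then show ?thesis by (simp add: hermite_pair_def)
  qed
  show ?thesis
    unfolding eq integral_lborel_times[OF 1 2] hermite_vec_fourier hermite_fun_fourier
    by (simp add: hermite_phase_def hermite_pair_def)
qed

lemma integrable_hermite_pair: "integrable lborel (hermite_pair k)"
  unfolding hermite_pair_def[abs_def] by (intro integrable_lborel_times integrable_hermite_vec integrable_hermite_fun)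

text \<open>Fubini's theorem and the symmetry of the kernel move the transform onto the basis
  function, which is an eigenfunction. Only integrability of f is used, so the transform itself need
  not be square-integrable.\<close>

lemma hermite_coef_fourier:
  assumes f: "integrable lborel f"
  shows "hermite_pair.coef (\<lambda>q. LINT p|lborel. fourier_kernel q p * f p) k = hermite_phase k * hermite_pair.coef f k"
proof -
  have [measurable]: "f \<in> borel_measurable borel" using f by simp
  have i: "integrable (lborel \<Otimes>\<^sub>M lborel) (\<lambda>(q, p). fourier_kernel q p * f p * of_real (hermite_pair k q))"
  proof (rule Bochner_Integration.integrable_bound)
    show "integrable (lborel \<Otimes>\<^sub>M lborel) (\<lambda>x. complex_of_real (hermite_pair k (fst x)) * f (snd x))"
      unfolding lborel_prod using f integrable_hermite_pair[of k]
      by (intro integrable_lborel_times) (simp_all add: complex_of_real_integrable_eq)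
    show "(\<lambda>(q, p). fourier_kernel q p * f p * of_real (hermite_pair k q)) \<in> borel_measurable (lborel \<Otimes>\<^sub>M lborel)"
      by measurable
  qed (auto simp: norm_mult)
  have "hermite_pair.coef (\<lambda>q. LINT p|lborel. fourier_kernel q p * f p) k =
      (LINT q|lborel. LINT p|lborel. fourier_kernel q p * f p * of_real (hermite_pair k q))"
    unfolding hermite_pair.coef_def by simp
  also have "\<dots> = (LINT p|lborel. LINT q|lborel. fourier_kernel q p * f p * of_real (hermite_pair k q))"
    by (rule lborel_pair.Fubini_integral[OF i, symmetric])
  also have "\<dots> = (LINT p|lborel. f p * (LINT q|lborel. fourier_kernel p q * of_real (hermite_pair k q)))"
    by (subst integral_mult_right_zero[symmetric])
      (simp add: mult_ac fourier_kernel_commute)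
  also have "\<dots> = hermite_phase k * hermite_pair.coef f k"
    unfolding hermite_pair_fourier hermite_pair.coef_def
    by (subst integral_mult_right_zero[symmetric]) (simp add: mult_ac)
  finally show ?thesis .
qed

lemma hermite_coef_fourier_tendsto:
  assumes f: "\<And>n. integrable lborel (f n)" "\<And>n. square_integrable lborel (f n)"
    and u: "square_integrable lborel u" and v: "square_integrable lborel v"
    and fu: "(\<lambda>n. \<integral>\<^sup>+x. ennreal ((norm (f n x - u x))\<^sup>2) \<partial>lborel) \<longlonglongrightarrow> 0"
    and fv: "(\<lambda>n. \<integral>\<^sup>+q. ennreal ((norm ((LINT p|lborel. fourier_kernel q p * f n p) - v q))\<^sup>2) \<partial>lborel) \<longlonglongrightarrow> 0"
  shows "hermite_pair.coef v k = hermite_phase k * hermite_pair.coef u k"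
proof -
  define F where "F n q = (LINT p|lborel. fourier_kernel q p * f n p)" for n q
  have [measurable]: "f n \<in> borel_measurable borel" for n using f(1)[of n] by simp
  have [measurable]: "u \<in> borel_measurable borel" "v \<in> borel_measurable borel" using u v by (auto simp: square_integrable_def)
  have [measurable]: "F n \<in> borel_measurable borel" for n unfolding F_def by measurable
  have lim: "(\<lambda>n. LINT x|lborel. (norm (g n x))\<^sup>2) \<longlonglongrightarrow> 0"
    if "\<And>n. square_integrable lborel (g n)" "(\<lambda>n. \<integral>\<^sup>+x. ennreal ((norm (g n x))\<^sup>2) \<partial>lborel) \<longlonglongrightarrow> 0"
    for g :: "nat \<Rightarrow> _ \<Rightarrow> complex"
  proof -
    have "(\<integral>\<^sup>+x. ennreal ((norm (g n x))\<^sup>2) \<partial>lborel) = ennreal (LINT x|lborel. (norm (g n x))\<^sup>2)" for n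
      by (rule nn_integral_eq_integral[OF square_integrableD(2)[OF that(1)]]) auto
    then show ?thesis using that(2) by (simp add: ennreal_tendsto_0_iff integral_nonneg_AE)
  qed
  \<comment> \<open>The transforms F n are not known to be square-integrable for every n, but they
    are once their distance to v is finite; all limits are therefore taken from N onwards.\<close>
  have "eventually (\<lambda>n. (\<integral>\<^sup>+q. ennreal ((norm (F n q - v q))\<^sup>2) \<partial>lborel) < 1) sequentially"
    using fv unfolding F_def by (rule order_tendstoD) simp
  then obtain N where N: "\<And>n. n \<ge> N \<Longrightarrow> (\<integral>\<^sup>+q. ennreal ((norm (F n q - v q))\<^sup>2) \<partial>lborel) < 1"
    by (auto simp: eventually_sequentially)
  have d: "square_integrable lborel (\<lambda>q. F (n + N) q - v q)" for n
    using order.strict_trans[OF N[of "n + N"], of \<infinity>] by (simp add: square_integrable_iff_nn_integral)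
  have F: "square_integrable lborel (F (n + N))" for n
    using square_integrable_add[OF d v, of n] by simp
  have 1: "(\<lambda>n. hermite_pair.coef (F (n + N)) k) \<longlonglongrightarrow> hermite_pair.coef v k"
    by (intro hermite_pair.coef_tendsto F v lim d LIMSEQ_ignore_initial_segment[OF fv[folded F_def]])
  have "hermite_pair.coef (F n) k = hermite_phase k * hermite_pair.coef (f n) k" for n
    unfolding F_def by (rule hermite_coef_fourier[OF f(1)])
  moreover have "(\<lambda>n. hermite_phase k * hermite_pair.coef (f (n + N)) k) \<longlonglongrightarrow> hermite_phase k * hermite_pair.coef u k"
    by (intro tendsto_intros LIMSEQ_ignore_initial_segment hermite_pair.coef_tendsto f u lim square_integrable_diff fu)
  ultimately show ?thesis using 1 by (simp add: LIMSEQ_unique)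
qed

text \<open>This holds whichever approximating sequence witnesses \<open>is_fourier\<close>: the
  coefficients of v are forced by those of u, so the transform is unique up to a null set.\<close>

lemma is_fourier_coef:
  assumes uv: "is_fourier u v"
    and u': "square_integrable lborel u'" "AE p in lborel. u p = u' p"
    and v': "square_integrable lborel v'" "AE p in lborel. v p = v' p"
  shows "hermite_pair.coef v' k = hermite_phase k * hermite_pair.coef u' k"
proof -
  obtain f where f: "\<And>n. f n \<in> L1" "\<And>n. f n \<in> L2" "L2_lim f u" "L2_lim (\<lambda>n. fourier_integral (f n)) v"
    using uv by (auto simp: is_fourier_def)
  have "\<exists>g. \<forall>n. square_integrable lborel (g n) \<and> (AE x in lborel. f n x = g n x)"
    using L2_borel_representative[OF f(2)] by (intro choice) metis
  then obtain g where g: "\<And>n. square_integrable lborel (g n)" "\<And>n. AE x in lborel. f n x = g n x" by blast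
  have gm [measurable]: "g n \<in> borel_measurable borel" for n using g(1)[of n] by (simp add: square_integrable_def)
  have [measurable]: "u' \<in> borel_measurable borel" "v' \<in> borel_measurable borel" using u' v' by (auto simp: square_integrable_def)
  have gi: "integrable lborel (g n)" for n
  proof -
    have "integrable lebesgue (g n)"
    proof (rule integrable_cong_AE_imp)
      show "integrable lebesgue (f n)" using f(1)[of n] by (simp add: L1_def)
      show "AE x in lebesgue. f n x = g n x" using g(2)[of n] unfolding AE_lebesgue_iff .
    qed (intro borel_measurable_lebesgueI gm)
    then show ?thesis by (subst (asm) integrable_completion) auto
  qed
  have fm: "f n \<in> borel_measurable lebesgue" for n using f(2)[of n] by (simp add: L2_def)
  have "(\<lambda>n. \<integral>\<^sup>+x. ennreal ((norm (g n x - u' x))\<^sup>2) \<partial>lborel) \<longlonglongrightarrow> 0"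
    by (rule L2_lim_iff[THEN iffD1, OF _ _ _ _ f(3)]) (use g u' in auto)
  moreover have "(\<lambda>n. \<integral>\<^sup>+q. ennreal ((norm ((LINT p|lborel. fourier_kernel q p * g n p) - v' q))\<^sup>2) \<partial>lborel) \<longlonglongrightarrow> 0"
    by (rule L2_lim_iff[THEN iffD1, OF _ _ _ _ f(4)])
      (use v' in \<open>auto intro!: AE_I2 fourier_integral_borel gm fm g(2)\<close>)
  ultimately show ?thesis using gi g(1) u'(1) v'(1) by (intro hermite_coef_fourier_tendsto)
qed

text \<open>The approximating sequence consists of partial Hermite sums of u: they are integrable,
  and their Fourier integrals are exactly the partial sums of v.\<close>

lemma is_fourierI:
  assumes u': "square_integrable lborel u'" "AE p in lborel. u p = u' p"
    and v': "square_integrable lborel v'" "AE p in lborel. v p = v' p"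
    and coef: "\<And>k. hermite_pair.coef v' k = hermite_phase k * hermite_pair.coef u' k"
  shows "is_fourier u v"
proof -
  note [measurable] = square_integrableD(1)[OF u'(1)] square_integrableD(1)[OF v'(1)]
  define S where "S c n = hermite_pair.partial_sum (hermite_pair.first_indices n) c" for c :: "('a \<Rightarrow> nat) \<times> nat \<Rightarrow> complex" and n
  have S: "square_integrable lborel (S c n)" for c n
    unfolding S_def by (rule hermite_pair.square_integrable_partial_sum)
  have S_int: "integrable lborel (S c n)" for c n
    unfolding S_def hermite_pair.partial_sum_def[abs_def] using integrable_hermite_pair
    by (intro Bochner_Integration.integrable_sum integrable_mult_right) (simp add: complex_of_real_integrable_eq)
  note [measurable] = square_integrableD(1)[OF S]
  have S_fourier: "fourier_integral (S c n) q = S (\<lambda>k. hermite_phase k * c k) n q" for c n q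
  proof -
    have i: "integrable lborel (\<lambda>p. fourier_kernel q p * complex_of_real (hermite_pair k p))" for k
      by (rule Bochner_Integration.integrable_bound[OF integrable_hermite_pair[of k]]) (auto simp: norm_mult)
    have "fourier_integral (S c n) q = (LINT p|lborel. fourier_kernel q p * S c n p)"
      using square_integrableD(1)[OF S] by (intro fourier_integral_lborel) simp
    also have "\<dots> = (LINT p|lborel. (\<Sum>k\<in>hermite_pair.first_indices n. c k * (fourier_kernel q p * complex_of_real (hermite_pair k p))))"
      unfolding S_def hermite_pair.partial_sum_def sum_distrib_left by (simp add: mult_ac)
    also have "\<dots> = (\<Sum>k\<in>hermite_pair.first_indices n. c k * (hermite_phase k * of_real (hermite_pair k q)))"
      using i by (subst Bochner_Integration.integral_sum) (simp_all add: hermite_pair_fourier)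
    finally show ?thesis by (simp add: S_def hermite_pair.partial_sum_def mult_ac)
  qed
  have lim: "L2_lim (S (hermite_pair.coef f')) f" if f: "square_integrable lborel f'" "AE p in lborel. f p = f' p" for f f'
  proof -
    note [measurable] = square_integrableD(1)[OF f(1)]
    have "(\<integral>\<^sup>+x. ennreal ((norm (S (hermite_pair.coef f') n x - f' x))\<^sup>2) \<partial>lborel) = ennreal (LINT x|lborel. (norm (S (hermite_pair.coef f') n x - f' x))\<^sup>2)" for n
      by (rule nn_integral_eq_integral[OF square_integrableD(2)[OF square_integrable_diff[OF S f(1)]]]) auto
    moreover have "(\<lambda>n. LINT x|lborel. (norm (S (hermite_pair.coef f') n x - f' x))\<^sup>2) \<longlonglongrightarrow> 0"
      unfolding S_def by (rule hermite_pair.partial_sums_tendsto[OF f(1)])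
    ultimately have "(\<lambda>n. \<integral>\<^sup>+x. ennreal ((norm (S (hermite_pair.coef f') n x - f' x))\<^sup>2) \<partial>lborel) \<longlonglongrightarrow> 0"
      using tendsto_ennrealI[of _ 0] by simp
    then show ?thesis
      by (intro L2_lim_iff[THEN iffD2, of "S (hermite_pair.coef f')" f']) (use f square_integrableD(1)[OF S] in auto)
  qed
  have "S (hermite_pair.coef u') n \<in> L1" for n
    unfolding L1_def using S_int[of _ n] square_integrableD(1)[OF S] by (simp add: integrable_completion)
  moreover have "S (hermite_pair.coef u') n \<in> L2" for n
    by (rule L2_of_square_integrable[OF S AE_I2]) (rule refl)
  moreover have "(\<lambda>n. fourier_integral (S (hermite_pair.coef u') n)) = S (hermite_pair.coef v')"
    unfolding fun_eq_iff S_fourier coef[symmetric] by simp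
  ultimately have "(\<forall>n. S (hermite_pair.coef u') n \<in> L1 \<inter> L2) \<and> L2_lim (S (hermite_pair.coef u')) u \<and>
      L2_lim (\<lambda>n. fourier_integral (S (hermite_pair.coef u') n)) v"
    using lim[OF u'] lim[OF v'] by simp
  then show ?thesis
    unfolding is_fourier_def using L2_of_square_integrable[OF u'] L2_of_square_integrable[OF v'] by blast
qed

text \<open>Guarantees that the choice in \<open>fourier\<close> selects an actual transform:
  multiplying coefficients by phases keeps them square-summable.\<close>

lemma ex_is_fourier:
  assumes "u \<in> L2"
  shows "\<exists>v. is_fourier u v"
proof -
  obtain u' where u': "square_integrable lborel u'" "AE p in lborel. u p = u' p"
    using L2_borel_representative[OF assms] by blast
  have "(\<integral>\<^sup>+k. ennreal ((norm (hermite_phase k * hermite_pair.coef u' k))\<^sup>2) \<partial>count_space UNIV) < \<infinity>"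
    using hermite_pair.Parseval[OF u'(1)] by (simp add: norm_mult)
  then obtain v where "square_integrable lborel v" "\<And>k. hermite_pair.coef v k = hermite_phase k * hermite_pair.coef u' k"
    by (rule hermite_pair.synthesis) blast
  then have "is_fourier u v" by (intro is_fourierI[OF u']) auto
  then show ?thesis by blast
qed

text \<open>The same for the choice in \<open>H\<close>, whose value is an inverse transform; the
  phases are inverted by conjugation.\<close>

lemma ex_is_fourier_inverse:
  assumes "v \<in> L2"
  shows "\<exists>u. is_fourier u v"
proof -
  obtain v' where v': "square_integrable lborel v'" "AE p in lborel. v p = v' p"
    using L2_borel_representative[OF assms] by blast
  have "(\<integral>\<^sup>+k. ennreal ((norm (cnj (hermite_phase k) * hermite_pair.coef v' k))\<^sup>2) \<partial>count_space UNIV) < \<infinity>"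
    using hermite_pair.Parseval[OF v'(1)] by (simp add: norm_mult)
  then obtain u where u: "square_integrable lborel u" "\<And>k. hermite_pair.coef u k = cnj (hermite_phase k) * hermite_pair.coef v' k"
    by (rule hermite_pair.synthesis) blast
  have "hermite_phase k * cnj (hermite_phase k) = 1" for k :: "('a \<Rightarrow> nat) \<times> nat"
    using complex_norm_square[of "hermite_phase k"] by simp
  then have "is_fourier u v" using u by (intro is_fourierI[OF _ _ v']) (auto simp flip: mult.assoc)
  then show ?thesis by blast
qed

text \<open>Plancherel's identity between an L^2 function, whose transform is a limit, and a test
  function, whose transform is an honest integral.\<close>

lemma LINT_mult_cnj_fourier:
  assumes "is_fourier u v" "square_integrable lborel u'" "AE p in lborel. u p = u' p"
    "square_integrable lborel v'" "AE p in lborel. v p = v' p"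
    and \<psi>: "integrable lborel \<psi>" "square_integrable lborel \<psi>" "square_integrable lborel (fourier_integral \<psi>)"
  shows "(LINT p|lborel. v' p * cnj (fourier_integral \<psi> p)) = (LINT p|lborel. u' p * cnj (\<psi> p))"
proof (rule hermite_pair.inner_product_unimodular[where \<theta> = hermite_phase])
  have "fourier_integral \<psi> = (\<lambda>q. LINT p|lborel. fourier_kernel q p * \<psi> p)"
    using \<psi>(1) by (intro ext fourier_integral_lborel) simp
  then show "hermite_pair.coef (fourier_integral \<psi>) k = hermite_phase k * hermite_pair.coef \<psi> k" for k
    using hermite_coef_fourier[OF \<psi>(1)] by simp
  show "hermite_pair.coef v' k = hermite_phase k * hermite_pair.coef u' k" for k
    using assms(1-5) by (rule is_fourier_coef)
qed (use assms in auto)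

text \<open>Plancherel's identity is applied on both sides of the multiplication by the symbol,
  which moves to the test functions as its conjugate: \<psi> plays the part of the adjoint operator
  applied to \<phi>.\<close>

theorem weak_equation:
  assumes u: "u \<in> Dom_H s" and H: "AE p in lebesgue. H s u p = w p"
    and u': "square_integrable lborel u'" "AE p in lborel. u p = u' p"
    and w': "square_integrable lborel w'" "AE p in lborel. w p = w' p"
    and \<phi>: "integrable lborel \<phi>" "square_integrable lborel \<phi>" "square_integrable lborel (fourier_integral \<phi>)"
    and \<psi>: "integrable lborel \<psi>" "square_integrable lborel \<psi>" "square_integrable lborel (fourier_integral \<psi>)"
    and symbol: "AE q in lborel. fourier_integral \<psi> q = cnj (heat_symbol s q) * fourier_integral \<phi> q"
  shows "(LINT p|lborel. u' p * cnj (\<psi> p)) = (LINT p|lborel. w' p * cnj (\<phi> p))"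
proof -
  have uL2: "u \<in> L2" and mL2: "(\<lambda>p. heat_symbol s p * fourier u p) \<in> L2" using u by (auto simp: Dom_H_def)
  have F: "is_fourier u (fourier u)" unfolding fourier_def using ex_is_fourier[OF uL2] by (rule someI_ex)
  have G: "is_fourier (H s u) (\<lambda>p. heat_symbol s p * fourier u p)"
    unfolding H_def using ex_is_fourier_inverse[OF mL2] by (rule someI_ex)
  obtain v where v: "square_integrable lborel v" "AE p in lborel. fourier u p = v p"
    using L2_borel_representative[of "fourier u"] F by (auto simp: is_fourier_def)
  obtain h where h: "square_integrable lborel h" "AE p in lborel. heat_symbol s p * fourier u p = h p"
    using L2_borel_representative[OF mL2] by blast
  have Hw: "AE p in lborel. H s u p = w' p" using H w'(2) unfolding AE_lebesgue_iff by eventually_elim simp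
  have "(LINT p|lborel. u' p * cnj (\<psi> p)) = (LINT p|lborel. v p * cnj (fourier_integral \<psi> p))"
    by (rule LINT_mult_cnj_fourier[OF F u' v \<psi>, symmetric])
  also have "\<dots> = (LINT p|lborel. h p * cnj (fourier_integral \<phi> p))"
  proof (rule integral_cong_AE)
    show "AE p in lborel. v p * cnj (fourier_integral \<psi> p) = h p * cnj (fourier_integral \<phi> p)"
      using v(2) h(2) symbol by eventually_elim (simp add: mult_ac)
  qed (use v(1) h(1) \<phi>(3) \<psi>(3) in \<open>auto dest!: square_integrableD(1)\<close>)
  also have "\<dots> = (LINT p|lborel. w' p * cnj (\<phi> p))"
    by (rule LINT_mult_cnj_fourier[OF G w'(1) Hw h \<phi>])
  finally show ?thesis .
qed

section \<open>Kernels of fractional integration\<close>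

definition half_line :: "real measure" where
  "half_line = restrict_space lborel {0<..}"

lemma space_half_line [simp]: "space half_line = {0<..}"
  by (simp add: half_line_def space_restrict_space)

lemma sets_half_line: "sets half_line = sets (restrict_space borel {0<..})"
  unfolding half_line_def by (rule sets_restrict_space_cong) simp

lemma borel_measurable_half_line [measurable (raw)]:
  "f \<in> borel_measurable borel \<Longrightarrow> f \<in> borel_measurable half_line"
  unfolding half_line_def by (rule measurable_restrict_space1) simp

lemma ident_measurable_half_line [measurable]: "(\<lambda>t. t) \<in> borel_measurable half_line"
  by (rule borel_measurable_half_line) simp

interpretation half_line: sigma_finite_measure half_line
  unfolding half_line_def by (rule sigma_finite_measure_restrict_space) (auto intro: sigma_finite_lborel)

interpretation half_line_pair: pair_sigma_finite half_line half_line ..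

lemma nn_integral_half_line: "(\<integral>\<^sup>+t. f t \<partial>half_line) = (\<integral>\<^sup>+t. f t * indicator {0<..} t \<partial>lborel)"
  unfolding half_line_def by (rule nn_integral_restrict_space) simp

lemma integrable_half_line_iff:
  fixes f :: "real \<Rightarrow> 'b::{banach, second_countable_topology}"
  shows "integrable half_line f \<longleftrightarrow> integrable lborel (\<lambda>t. indicator {0<..} t *\<^sub>R f t)"
  unfolding half_line_def by (rule integrable_restrict_space) simp

lemma AE_half_line: "(AE t in half_line. P t) \<longleftrightarrow> (AE t in lborel. t > 0 \<longrightarrow> P t)"
  unfolding half_line_def by (subst AE_restrict_space_iff) auto

lemma nn_integral_powr_0:
  assumes "a > -1" "c > (0::real)"
  shows "(\<integral>\<^sup>+t. ennreal (t powr a) * indicator {..c} t \<partial>half_line) = ennreal (c powr (a + 1) / (a + 1))"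
proof -
  have "(\<integral>\<^sup>+t. ennreal (t powr a) * indicator {..c} t \<partial>half_line) = (\<integral>\<^sup>+t. ennreal (indicator {0..c} t * t powr a) \<partial>lborel)"
    unfolding nn_integral_half_line
    by (intro nn_integral_cong) (auto simp: indicator_def)
  also have "\<dots> = ennreal (c powr (a + 1) / (a + 1))"
    by (rule nn_integral_has_integral_lebesgue) (use assms has_integral_powr_from_0[of a c] in auto)
  finally show ?thesis .
qed

lemma nn_integral_powr_inf:
  assumes "a < -1" "c > (0::real)"
  shows "(\<integral>\<^sup>+t. ennreal (t powr a) * indicator {c<..} t \<partial>half_line) = ennreal (c powr (a + 1) / - (a + 1))"
proof -
  have "(\<integral>\<^sup>+t. ennreal (t powr a) * indicator {c<..} t \<partial>half_line) = (\<integral>\<^sup>+t. ennreal (indicator {c..} t * t powr a) \<partial>lborel)"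
    unfolding nn_integral_half_line
    using assms AE_lborel_singleton[of c] by (intro nn_integral_cong_AE) (auto elim!: AE_mp simp: indicator_def)
  also have "\<dots> = ennreal (- (c powr (a + 1)) / (a + 1))"
    by (rule nn_integral_has_integral_lebesgue) (use assms has_integral_powr_to_inf[of a c] in auto)
  also have "- (c powr (a + 1)) / (a + 1) = c powr (a + 1) / - (a + 1)" by (metis minus_divide_left minus_divide_right)
  finally show ?thesis .
qed

lemma Cauchy_Schwarz_nn_integral:
  fixes f g :: "'a \<Rightarrow> real"
  assumes [measurable]: "f \<in> borel_measurable M" "g \<in> borel_measurable M"
    and nn: "\<And>x. 0 \<le> f x" "\<And>x. 0 \<le> g x"
  shows "(\<integral>\<^sup>+x. ennreal (f x * g x) \<partial>M)\<^sup>2 \<le> (\<integral>\<^sup>+x. ennreal ((f x)\<^sup>2) \<partial>M) * (\<integral>\<^sup>+x. ennreal ((g x)\<^sup>2) \<partial>M)"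
proof -
  \<comment> \<open>A factor of zero norm is treated apart because 0 times \<infinity> is 0 on the
    right-hand side; then the left-hand side has to vanish as well.\<close>
  have null: "(\<integral>\<^sup>+x. ennreal (f x * g x) \<partial>M) = 0"
    if [measurable]: "f \<in> borel_measurable M" "g \<in> borel_measurable M" "(\<integral>\<^sup>+x. ennreal ((f x)\<^sup>2) \<partial>M) = 0"
    for f g :: "'a \<Rightarrow> real"
  proof -
    have "AE x in M. ennreal ((f x)\<^sup>2) = 0" using that(3) by (subst (asm) nn_integral_0_iff_AE) auto
    then have "AE x in M. ennreal (f x * g x) = 0" by eventually_elim simp
    then show ?thesis by (subst nn_integral_0_iff_AE) auto
  qed
  show ?thesis
  proof (cases "(\<integral>\<^sup>+x. ennreal ((f x)\<^sup>2) \<partial>M) = 0 \<or> (\<integral>\<^sup>+x. ennreal ((g x)\<^sup>2) \<partial>M) = 0")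
    case True
    then have "(\<integral>\<^sup>+x. ennreal (f x * g x) \<partial>M) = 0"
      using null[of f g] null[of g f] by (auto simp: mult.commute)
    then show ?thesis by simp
  next
    case nz: False
    show ?thesis
    proof (cases "(\<integral>\<^sup>+x. ennreal ((f x)\<^sup>2) \<partial>M) = \<infinity> \<or> (\<integral>\<^sup>+x. ennreal ((g x)\<^sup>2) \<partial>M) = \<infinity>")
      case True
      then show ?thesis using nz by (auto simp: ennreal_top_mult ennreal_mult_top)
    next
      case False
      then have si: "square_integrable M (\<lambda>x. of_real (f x))" "square_integrable M (\<lambda>x. of_real (g x))"
        by (auto simp: square_integrable_iff_nn_integral less_top)
      have i: "integrable M (\<lambda>x. f x * g x)"
        using square_integrable_mult[OF si] by (simp only: of_real_mult[symmetric] complex_of_real_integrable_eq)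
      have "(LINT x|M. complex_of_real (f x) * complex_of_real (g x)) = of_real (LINT x|M. f x * g x)"
        by (simp only: of_real_mult[symmetric] integral_complex_of_real)
      then have "(LINT x|M. f x * g x)\<^sup>2 \<le> (LINT x|M. (f x)\<^sup>2) * (LINT x|M. (g x)\<^sup>2)"
        using Cauchy_Schwarz_integral[OF si] by simp
      moreover have "(\<integral>\<^sup>+x. ennreal (f x * g x) \<partial>M) = ennreal (LINT x|M. f x * g x)"
        by (rule nn_integral_eq_integral[OF i]) (auto simp: nn)
      moreover have "(\<integral>\<^sup>+x. ennreal ((f x)\<^sup>2) \<partial>M) = ennreal (LINT x|M. (f x)\<^sup>2)" "(\<integral>\<^sup>+x. ennreal ((g x)\<^sup>2) \<partial>M) = ennreal (LINT x|M. (g x)\<^sup>2)"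
        using square_integrableD(2)[OF si(1)] square_integrableD(2)[OF si(2)] by (auto intro!: nn_integral_eq_integral)
      ultimately show ?thesis
        by (simp add: ennreal_mult[symmetric] ennreal_power integral_nonneg_AE nn ennreal_leI)
    qed
  qed
qed

section \<open>Taylor expansion of the fractional kernel\<close>

definition binom_coeff :: "real \<Rightarrow> nat \<Rightarrow> real" where
  "binom_coeff s k = pochhammer (1 - s) k / fact k"

lemma binom_coeff_pos:
  assumes "s < 1"
  shows "binom_coeff s k > 0"
  unfolding binom_coeff_def using assms by (simp add: pochhammer_pos)

lemma binom_coeff_0 [simp]: "binom_coeff s 0 = 1"
  by (simp add: binom_coeff_def)

text \<open>Successive quotients are 1 - s / (k + 1) <= exp (- s ln (1 + 1 / (k + 1))), and these
  exponentials telescope. The decay k^-s is what makes \<open>kernel_norm\<close> converge.\<close>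

lemma binom_coeff_le:
  assumes s: "0 < s" "s < 1"
  shows "binom_coeff s k \<le> (real k + 1) powr (- s)"
proof (induction k)
  case (Suc k)
  have "binom_coeff s (Suc k) = binom_coeff s k * (1 - s / (real k + 1))"
    by (simp add: binom_coeff_def pochhammer_Suc field_simps)
  also have "\<dots> \<le> (real k + 1) powr (- s) * exp (- s * ln (1 + 1 / (real k + 1)))"
  proof (rule mult_mono[OF Suc])
    have "1 - s / (real k + 1) \<le> exp (- s * (1 / (real k + 1)))"
      using exp_ge_add_one_self[of "- s * (1 / (real k + 1))"] by simp
    also have "\<dots> \<le> exp (- s * ln (1 + 1 / (real k + 1)))"
      using s mult_left_mono[OF ln_add_one_self_le_self[of "1 / (real k + 1)"], of s] by simp
    finally show "1 - s / (real k + 1) \<le> exp (- s * ln (1 + 1 / (real k + 1)))" .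
    show "0 \<le> 1 - s / (real k + 1)" using s by (simp add: field_simps)
  qed auto
  also have "\<dots> = (real (Suc k) + 1) powr (- s)"
  proof -
    have "1 + 1 / (real k + 1) = (real k + 2) / (real k + 1)" by (simp add: field_simps)
    then have "ln (1 + 1 / (real k + 1)) = ln (real k + 2) - ln (real k + 1)"
      by (simp add: ln_div)
    show ?thesis unfolding powr_def \<open>ln (1 + 1 / (real k + 1)) = ln (real k + 2) - ln (real k + 1)\<close>
      by (simp add: exp_add[symmetric] algebra_simps)
  qed
  finally show ?case .
qed simp

text \<open>The subtracted sum is the Taylor polynomial at \<open>t = 0\<close>, of degree less than \<open>m\<close>, of \<open>t \<mapsto> (\<tau> - t) powr (s - 1)\<close>.\<close>

definition frac_kernel :: "real \<Rightarrow> nat \<Rightarrow> real \<Rightarrow> real \<Rightarrow> real" where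
  "frac_kernel s m t \<tau> = (if t < \<tau> then (\<tau> - t) powr (s - 1) else 0)
     - (\<Sum>k<m. binom_coeff s k * t ^ k * \<tau> powr (s - 1 - real k))"

lemma frac_kernel_measurable [measurable]: "case_prod (frac_kernel s m) \<in> borel_measurable (borel \<Otimes>\<^sub>M borel)"
  unfolding frac_kernel_def[abs_def] by measurable

lemma frac_kernel_sums:
  assumes "0 < t" "t < \<tau>"
  shows "(\<lambda>k. binom_coeff s k * t ^ k * \<tau> powr (s - 1 - real k)) sums (\<tau> - t) powr (s - 1)"
proof -
  have "(\<lambda>k. ((s - 1) gchoose k) * (- t) ^ k * \<tau> powr (s - 1 - real k)) sums (- t + \<tau>) powr (s - 1)"
    using assms by (intro gen_binomial_real') auto
  moreover have "((s - 1) gchoose k) * (- t) ^ k = binom_coeff s k * t ^ k" for k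
  proof -
    have "((s - 1) gchoose k) * (- t) ^ k = ((-1) ^ k * (-1) ^ k) * (pochhammer (1 - s) k / fact k * t ^ k)"
      unfolding gbinomial_pochhammer by (simp add: power_minus[of t])
    also have "(-1::real) ^ k * (-1) ^ k = 1" by (simp flip: power_mult_distrib)
    finally show ?thesis by (simp add: binom_coeff_def)
  qed
  ultimately show ?thesis by simp
qed

text \<open>All Taylor terms are positive. For \<tau> \<le> t the kernel is minus the subtracted
  terms k < m, for \<tau> > t it is the remaining tail k >= m. Hence its absolute value is a sum
  without cancellation, in which each term lives on one side of the diagonal: this is what
  \<open>(k < m) = (\<tau> \<le> t)\<close> encodes.\<close>

lemma ennreal_abs_frac_kernel:
  assumes "s < 1" "0 < t" "0 < \<tau>"
  shows "ennreal \<bar>frac_kernel s m t \<tau>\<bar> =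
    (\<Sum>k. ennreal (binom_coeff s k * t ^ k * \<tau> powr (s - 1 - real k)) * (if (k < m) = (\<tau> \<le> t) then 1 else 0))"
proof -
  define e where "e k = binom_coeff s k * t ^ k * \<tau> powr (s - 1 - real k)" for k
  have e: "e k \<ge> 0" for k using assms binom_coeff_pos[OF assms(1), of k] by (simp add: e_def)
  show ?thesis
  proof (cases "\<tau> \<le> t")
    case True
    then have "frac_kernel s m t \<tau> = - (\<Sum>k<m. e k)" by (simp add: frac_kernel_def e_def)
    moreover have "(\<Sum>k<m. e k) \<ge> 0" using e by (simp add: sum_nonneg)
    ultimately have "ennreal \<bar>frac_kernel s m t \<tau>\<bar> = (\<Sum>k<m. ennreal (e k))" using e by simp
    also have "\<dots> = (\<Sum>k. ennreal (e k) * (if k < m then 1 else 0))"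
      by (subst suminf_finite[of "{..<m}"]) auto
    finally show ?thesis using True by (simp add: e_def)
  next
    case False
    have s: "e sums (\<tau> - t) powr (s - 1)" unfolding e_def using assms False by (intro frac_kernel_sums) auto
    define e' where "e' k = (if k < m then 0 else e k)" for k
    have "(\<lambda>k. if k \<in> {..<m} then e k else 0) sums (\<Sum>k<m. e k)" by (rule sums_If_finite_set) simp
    from sums_diff[OF s this] have "(\<lambda>k. e k - (if k \<in> {..<m} then e k else 0)) sums frac_kernel s m t \<tau>"
      using False by (simp add: frac_kernel_def e_def)
    also have "(\<lambda>k. e k - (if k \<in> {..<m} then e k else 0)) = e'" by (auto simp: e'_def)
    finally have s': "e' sums frac_kernel s m t \<tau>" .
    moreover have "e' k \<ge> 0" for k using e by (simp add: e'_def)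
    ultimately have "(\<Sum>k. ennreal (e' k)) = ennreal (frac_kernel s m t \<tau>)" "frac_kernel s m t \<tau> \<ge> 0"
      by (auto simp: suminf_ennreal2 sums_iff dest: suminf_nonneg)
    moreover have "ennreal (e' k) = ennreal (e k) * (if \<not> k < m then 1 else 0)" for k by (simp add: e'_def)
    ultimately show ?thesis using False by (simp add: e_def)
  qed
qed

text \<open>The constant of Schur's test. The k-th Taylor term, integrated against a power over its
  side of the diagonal, yields the factor 1 / |k - \<mu>|; m disappears because it is determined by
  \<mu>.\<close>

definition kernel_norm :: "real \<Rightarrow> real \<Rightarrow> ennreal" where
  "kernel_norm s \<mu> = (\<Sum>k. ennreal (binom_coeff s k / \<bar>real k - \<mu>\<bar>))"

text \<open>With m - 1 < \<mu> < m each term is integrable exactly on its side: the power \<mu> - 1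
  - k exceeds -1, as needed at 0, for k < m, and is below -1, as needed at infinity, for k >=
  m.\<close>

lemma nn_integral_frac_kernel_snd:
  assumes s: "0 < s" "s < 1" and \<mu>: "\<mu> < real m" "m = 0 \<or> real m - 1 < \<mu>" and t: "t > 0"
  shows "(\<integral>\<^sup>+\<tau>. ennreal (\<bar>frac_kernel s m t \<tau>\<bar> * \<tau> powr (\<mu> - s)) \<partial>half_line) = kernel_norm s \<mu> * ennreal (t powr \<mu>)"
proof -
  have "(\<integral>\<^sup>+\<tau>. ennreal (\<bar>frac_kernel s m t \<tau>\<bar> * \<tau> powr (\<mu> - s)) \<partial>half_line) =
    (\<integral>\<^sup>+\<tau>. (\<Sum>k. ennreal (binom_coeff s k * t ^ k) * (ennreal (\<tau> powr (\<mu> - 1 - real k)) * (if (k < m) = (\<tau> \<le> t) then 1 else 0))) \<partial>half_line)"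
  proof (rule nn_integral_cong)
    fix \<tau> assume "\<tau> \<in> space half_line"
    then have \<tau>: "\<tau> > 0" by simp
    have "ennreal (\<bar>frac_kernel s m t \<tau>\<bar> * \<tau> powr (\<mu> - s)) =
      (\<Sum>k. ennreal (binom_coeff s k * t ^ k * \<tau> powr (s - 1 - real k)) * (if (k < m) = (\<tau> \<le> t) then 1 else 0)) * ennreal (\<tau> powr (\<mu> - s))"
      using ennreal_abs_frac_kernel[OF s(2) t \<tau>] by (simp add: ennreal_mult)
    also have "\<dots> = (\<Sum>k. ennreal (binom_coeff s k * t ^ k * \<tau> powr (s - 1 - real k)) * (if (k < m) = (\<tau> \<le> t) then 1 else 0) * ennreal (\<tau> powr (\<mu> - s)))"
      by (rule ennreal_suminf_multc[symmetric])
    also have "\<dots> = (\<Sum>k. ennreal (binom_coeff s k * t ^ k) * (ennreal (\<tau> powr (\<mu> - 1 - real k)) * (if (k < m) = (\<tau> \<le> t) then 1 else 0)))"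
    proof (rule suminf_cong)
      fix k
      have "\<tau> powr (s - 1 - real k) * \<tau> powr (\<mu> - s) = \<tau> powr (\<mu> - 1 - real k)"
        by (simp add: powr_add[symmetric] algebra_simps)
      then show "ennreal (binom_coeff s k * t ^ k * \<tau> powr (s - 1 - real k)) * (if (k < m) = (\<tau> \<le> t) then 1 else 0) * ennreal (\<tau> powr (\<mu> - s)) =
          ennreal (binom_coeff s k * t ^ k) * (ennreal (\<tau> powr (\<mu> - 1 - real k)) * (if (k < m) = (\<tau> \<le> t) then 1 else 0))"
        using t binom_coeff_pos[OF s(2), of k] by (simp add: ennreal_mult[symmetric] mult.assoc)
    qed
    finally show "ennreal (\<bar>frac_kernel s m t \<tau>\<bar> * \<tau> powr (\<mu> - s)) = \<dots>" .
  qed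
  also have "\<dots> = (\<Sum>k. \<integral>\<^sup>+\<tau>. ennreal (binom_coeff s k * t ^ k) * (ennreal (\<tau> powr (\<mu> - 1 - real k)) * (if (k < m) = (\<tau> \<le> t) then 1 else 0)) \<partial>half_line)"
    by (rule nn_integral_suminf) measurable
  also have "\<dots> = (\<Sum>k. ennreal (binom_coeff s k / \<bar>real k - \<mu>\<bar>) * ennreal (t powr \<mu>))"
  proof (rule suminf_cong)
    fix k
    have pw: "t ^ k * t powr (\<mu> - real k) = t powr \<mu>"
      using t by (simp add: powr_realpow[symmetric] powr_add[symmetric])
    have "(\<integral>\<^sup>+\<tau>. (ennreal (\<tau> powr (\<mu> - 1 - real k)) * (if (k < m) = (\<tau> \<le> t) then 1 else 0)) \<partial>half_line)
       = ennreal (t powr (\<mu> - real k) / \<bar>real k - \<mu>\<bar>)"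
    proof (cases "k < m")
      case True
      then have k: "real k < \<mu>" using \<mu>(2) by linarith
      have "(\<integral>\<^sup>+\<tau>. (ennreal (\<tau> powr (\<mu> - 1 - real k)) * (if (k < m) = (\<tau> \<le> t) then 1 else 0)) \<partial>half_line)
         = (\<integral>\<^sup>+\<tau>. ennreal (\<tau> powr (\<mu> - 1 - real k)) * indicator {..t} \<tau> \<partial>half_line)"
        using True by (intro nn_integral_cong) (auto simp: indicator_def)
      then show ?thesis using k t by (simp add: nn_integral_powr_0)
    next
      case False
      then have k: "real k > \<mu>" using \<mu>(1) by linarith
      have "(\<integral>\<^sup>+\<tau>. (ennreal (\<tau> powr (\<mu> - 1 - real k)) * (if (k < m) = (\<tau> \<le> t) then 1 else 0)) \<partial>half_line)
         = (\<integral>\<^sup>+\<tau>. ennreal (\<tau> powr (\<mu> - 1 - real k)) * indicator {t<..} \<tau> \<partial>half_line)"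
        using False by (intro nn_integral_cong) (auto simp: indicator_def)
      then show ?thesis using k t by (simp add: nn_integral_powr_inf)
    qed
    then have "(\<integral>\<^sup>+\<tau>. ennreal (binom_coeff s k * t ^ k) * (ennreal (\<tau> powr (\<mu> - 1 - real k)) * (if (k < m) = (\<tau> \<le> t) then 1 else 0)) \<partial>half_line)
       = ennreal (binom_coeff s k * t ^ k) * ennreal (t powr (\<mu> - real k) / \<bar>real k - \<mu>\<bar>)"
      by (subst nn_integral_cmult) auto
    also have "\<dots> = ennreal (binom_coeff s k / \<bar>real k - \<mu>\<bar> * (t ^ k * t powr (\<mu> - real k)))"
      using t binom_coeff_pos[OF s(2), of k] by (simp add: ennreal_mult[symmetric])
    finally show "(\<integral>\<^sup>+\<tau>. ennreal (binom_coeff s k * t ^ k) * (ennreal (\<tau> powr (\<mu> - 1 - real k)) * (if (k < m) = (\<tau> \<le> t) then 1 else 0)) \<partial>half_line) =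
      ennreal (binom_coeff s k / \<bar>real k - \<mu>\<bar>) * ennreal (t powr \<mu>)"
      unfolding pw by (simp only: ennreal_mult'' powr_ge_zero)
  qed
  also have "\<dots> = kernel_norm s \<mu> * ennreal (t powr \<mu>)"
    unfolding kernel_norm_def by (rule ennreal_suminf_multc)
  finally show ?thesis .
qed

text \<open>In the other variable the sides are exchanged and the exponent becomes k - \<mu> - 1, so
  convergence and the constant are the same.\<close>

lemma nn_integral_frac_kernel_fst:
  assumes s: "0 < s" "s < 1" and \<mu>: "\<mu> < real m" "m = 0 \<or> real m - 1 < \<mu>" and \<tau>: "\<tau> > 0"
  shows "(\<integral>\<^sup>+t. ennreal (\<bar>frac_kernel s m t \<tau>\<bar> * t powr (- \<mu> - 1)) \<partial>half_line) = kernel_norm s \<mu> * ennreal (\<tau> powr (s - 1 - \<mu>))"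
proof -
  have "(\<integral>\<^sup>+t. ennreal (\<bar>frac_kernel s m t \<tau>\<bar> * t powr (- \<mu> - 1)) \<partial>half_line) =
    (\<integral>\<^sup>+t. (\<Sum>k. ennreal (binom_coeff s k * \<tau> powr (s - 1 - real k)) * (ennreal (t powr (real k - \<mu> - 1)) * (if (k < m) = (\<tau> \<le> t) then 1 else 0))) \<partial>half_line)"
  proof (rule nn_integral_cong)
    fix t assume "t \<in> space half_line"
    then have t: "t > 0" by simp
    have "ennreal (\<bar>frac_kernel s m t \<tau>\<bar> * t powr (- \<mu> - 1)) =
      (\<Sum>k. ennreal (binom_coeff s k * t ^ k * \<tau> powr (s - 1 - real k)) * (if (k < m) = (\<tau> \<le> t) then 1 else 0)) * ennreal (t powr (- \<mu> - 1))"
      using ennreal_abs_frac_kernel[OF s(2) t \<tau>] by (simp add: ennreal_mult)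
    also have "\<dots> = (\<Sum>k. ennreal (binom_coeff s k * t ^ k * \<tau> powr (s - 1 - real k)) * (if (k < m) = (\<tau> \<le> t) then 1 else 0) * ennreal (t powr (- \<mu> - 1)))"
      by (rule ennreal_suminf_multc[symmetric])
    also have "\<dots> = (\<Sum>k. ennreal (binom_coeff s k * \<tau> powr (s - 1 - real k)) * (ennreal (t powr (real k - \<mu> - 1)) * (if (k < m) = (\<tau> \<le> t) then 1 else 0)))"
    proof (rule suminf_cong)
      fix k
      have "t ^ k * t powr (- \<mu> - 1) = t powr (real k - \<mu> - 1)"
        using t by (simp add: powr_realpow[symmetric] powr_add[symmetric] algebra_simps)
      then have eq: "binom_coeff s k * t ^ k * \<tau> powr (s - 1 - real k) * t powr (- \<mu> - 1) = binom_coeff s k * \<tau> powr (s - 1 - real k) * t powr (real k - \<mu> - 1)"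
        by (metis mult.assoc mult.commute)
      then show "ennreal (binom_coeff s k * t ^ k * \<tau> powr (s - 1 - real k)) * (if (k < m) = (\<tau> \<le> t) then 1 else 0) * ennreal (t powr (- \<mu> - 1)) =
          ennreal (binom_coeff s k * \<tau> powr (s - 1 - real k)) * (ennreal (t powr (real k - \<mu> - 1)) * (if (k < m) = (\<tau> \<le> t) then 1 else 0))"
        using t binom_coeff_pos[OF s(2), of k] by (auto simp: ennreal_mult[symmetric])
    qed
    finally show "ennreal (\<bar>frac_kernel s m t \<tau>\<bar> * t powr (- \<mu> - 1)) = \<dots>" .
  qed
  also have "\<dots> = (\<Sum>k. \<integral>\<^sup>+t. ennreal (binom_coeff s k * \<tau> powr (s - 1 - real k)) * (ennreal (t powr (real k - \<mu> - 1)) * (if (k < m) = (\<tau> \<le> t) then 1 else 0)) \<partial>half_line)"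
    by (rule nn_integral_suminf) measurable
  also have "\<dots> = (\<Sum>k. ennreal (binom_coeff s k / \<bar>real k - \<mu>\<bar>) * ennreal (\<tau> powr (s - 1 - \<mu>)))"
  proof (rule suminf_cong)
    fix k
    have pw: "\<tau> powr (s - 1 - real k) * \<tau> powr (real k - \<mu>) = \<tau> powr (s - 1 - \<mu>)"
      by (simp add: powr_add[symmetric] algebra_simps)
    have "(\<integral>\<^sup>+t. (ennreal (t powr (real k - \<mu> - 1)) * (if (k < m) = (\<tau> \<le> t) then 1 else 0)) \<partial>half_line)
       = ennreal (\<tau> powr (real k - \<mu>) / \<bar>real k - \<mu>\<bar>)"
    proof (cases "k < m")
      case True
      then have k: "real k < \<mu>" using \<mu>(2) by linarith
      have "(\<integral>\<^sup>+t. (ennreal (t powr (real k - \<mu> - 1)) * (if (k < m) = (\<tau> \<le> t) then 1 else 0)) \<partial>half_line)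
         = (\<integral>\<^sup>+t. ennreal (t powr (real k - \<mu> - 1)) * indicator {\<tau><..} t \<partial>half_line)"
        using True AE_lborel_singleton[of \<tau>] by (intro nn_integral_cong_AE) (auto elim!: AE_mp simp: AE_half_line indicator_def)
      then show ?thesis using k \<tau> by (simp add: nn_integral_powr_inf)
    next
      case False
      then have k: "real k > \<mu>" using \<mu>(1) by linarith
      have "(\<integral>\<^sup>+t. (ennreal (t powr (real k - \<mu> - 1)) * (if (k < m) = (\<tau> \<le> t) then 1 else 0)) \<partial>half_line)
         = (\<integral>\<^sup>+t. ennreal (t powr (real k - \<mu> - 1)) * indicator {..\<tau>} t \<partial>half_line)"
        using False AE_lborel_singleton[of \<tau>] by (intro nn_integral_cong_AE) (auto elim!: AE_mp simp: AE_half_line indicator_def)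
      then show ?thesis using k \<tau> by (simp add: nn_integral_powr_0)
    qed
    then have "(\<integral>\<^sup>+t. ennreal (binom_coeff s k * \<tau> powr (s - 1 - real k)) * (ennreal (t powr (real k - \<mu> - 1)) * (if (k < m) = (\<tau> \<le> t) then 1 else 0)) \<partial>half_line)
       = ennreal (binom_coeff s k * \<tau> powr (s - 1 - real k)) * ennreal (\<tau> powr (real k - \<mu>) / \<bar>real k - \<mu>\<bar>)"
      by (subst nn_integral_cmult) auto
    also have "\<dots> = ennreal (binom_coeff s k / \<bar>real k - \<mu>\<bar> * (\<tau> powr (s - 1 - real k) * \<tau> powr (real k - \<mu>)))"
      using \<tau> binom_coeff_pos[OF s(2), of k] by (simp add: ennreal_mult[symmetric])
    finally show "(\<integral>\<^sup>+t. ennreal (binom_coeff s k * \<tau> powr (s - 1 - real k)) * (ennreal (t powr (real k - \<mu> - 1)) * (if (k < m) = (\<tau> \<le> t) then 1 else 0)) \<partial>half_line) =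
      ennreal (binom_coeff s k / \<bar>real k - \<mu>\<bar>) * ennreal (\<tau> powr (s - 1 - \<mu>))"
      unfolding pw by (simp only: ennreal_mult'' powr_ge_zero)
  qed
  also have "\<dots> = kernel_norm s \<mu> * ennreal (\<tau> powr (s - 1 - \<mu>))"
    unfolding kernel_norm_def by (rule ennreal_suminf_multc)
  finally show ?thesis .
qed

text \<open>Schur's test with power weights: |K| |G| is split as the square root of |K|
  \<tau>^(\<mu> - s) times that of |K| \<tau>^(s - \<mu>) |G|^2. Cauchy-Schwarz, Tonelli and the two
  preceding integrals each contribute \<open>kernel_norm\<close> once.\<close>

lemma Schur_frac_kernel:
  fixes G :: "real \<Rightarrow> 'b::{real_normed_vector, second_countable_topology}"
  assumes s: "0 < s" "s < 1" and \<mu>: "\<mu> < real m" "m = 0 \<or> real m - 1 < \<mu>"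
    and [measurable]: "G \<in> borel_measurable half_line"
  shows "(\<integral>\<^sup>+t. ennreal (t powr (- 2 * \<mu> - 1)) * (\<integral>\<^sup>+\<tau>. ennreal (\<bar>frac_kernel s m t \<tau>\<bar> * norm (G \<tau>)) \<partial>half_line)\<^sup>2 \<partial>half_line)
    \<le> (kernel_norm s \<mu>)\<^sup>2 * (\<integral>\<^sup>+\<tau>. ennreal (\<tau> powr (2 * s - 2 * \<mu> - 1) * (norm (G \<tau>))\<^sup>2) \<partial>half_line)"
proof -
  let ?K = "frac_kernel s m" and ?N = "kernel_norm s \<mu>"
  define h where "h \<tau> = \<tau> powr (s - \<mu>) * (norm (G \<tau>))\<^sup>2" for \<tau>
  have [measurable]: "h \<in> borel_measurable half_line" unfolding h_def by measurable
  have pointwise: "(\<integral>\<^sup>+\<tau>. ennreal (\<bar>?K t \<tau>\<bar> * norm (G \<tau>)) \<partial>half_line)\<^sup>2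
      \<le> ?N * ennreal (t powr \<mu>) * (\<integral>\<^sup>+\<tau>. ennreal (\<bar>?K t \<tau>\<bar> * h \<tau>) \<partial>half_line)" if t: "t > 0" for t
  proof -
    define f where "f \<tau> = sqrt (\<bar>?K t \<tau>\<bar> * \<tau> powr (\<mu> - s))" for \<tau>
    define g where "g \<tau> = sqrt (\<bar>?K t \<tau>\<bar> * h \<tau>)" for \<tau>
    have h0: "h \<tau> \<ge> 0" for \<tau> by (simp add: h_def)
    have [measurable]: "f \<in> borel_measurable half_line" "g \<in> borel_measurable half_line"
      unfolding f_def g_def by measurable
    have "(\<integral>\<^sup>+\<tau>. ennreal (\<bar>?K t \<tau>\<bar> * norm (G \<tau>)) \<partial>half_line) = (\<integral>\<^sup>+\<tau>. ennreal (f \<tau> * g \<tau>) \<partial>half_line)"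
    proof (rule nn_integral_cong)
      fix \<tau> assume "\<tau> \<in> space half_line"
      then have \<tau>: "\<tau> > 0" by simp
      have "(\<bar>?K t \<tau>\<bar> * \<tau> powr (\<mu> - s)) * (\<bar>?K t \<tau>\<bar> * h \<tau>) = (\<tau> powr (\<mu> - s) * \<tau> powr (s - \<mu>)) * (\<bar>?K t \<tau>\<bar> * norm (G \<tau>))\<^sup>2"
        by (simp add: h_def power2_eq_square mult_ac)
      also have "\<tau> powr (\<mu> - s) * \<tau> powr (s - \<mu>) = 1" using \<tau> by (simp add: powr_add[symmetric])
      finally have "f \<tau> * g \<tau> = \<bar>?K t \<tau>\<bar> * norm (G \<tau>)"
        unfolding f_def g_def real_sqrt_mult[symmetric] by simp
      then show "ennreal (\<bar>?K t \<tau>\<bar> * norm (G \<tau>)) = ennreal (f \<tau> * g \<tau>)" by simp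
    qed
    then have "(\<integral>\<^sup>+\<tau>. ennreal (\<bar>?K t \<tau>\<bar> * norm (G \<tau>)) \<partial>half_line)\<^sup>2
        \<le> (\<integral>\<^sup>+\<tau>. ennreal ((f \<tau>)\<^sup>2) \<partial>half_line) * (\<integral>\<^sup>+\<tau>. ennreal ((g \<tau>)\<^sup>2) \<partial>half_line)"
      using Cauchy_Schwarz_nn_integral[of f half_line g] h0 by (simp add: f_def g_def)
    also have "(\<integral>\<^sup>+\<tau>. ennreal ((f \<tau>)\<^sup>2) \<partial>half_line) = ?N * ennreal (t powr \<mu>)"
      unfolding f_def using nn_integral_frac_kernel_snd[OF s \<mu> t] by simp
    also have "(\<integral>\<^sup>+\<tau>. ennreal ((g \<tau>)\<^sup>2) \<partial>half_line) = (\<integral>\<^sup>+\<tau>. ennreal (\<bar>?K t \<tau>\<bar> * h \<tau>) \<partial>half_line)"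
      unfolding g_def using h0 by simp
    finally show ?thesis .
  qed
  have "(\<integral>\<^sup>+t. ennreal (t powr (- 2 * \<mu> - 1)) * (\<integral>\<^sup>+\<tau>. ennreal (\<bar>?K t \<tau>\<bar> * norm (G \<tau>)) \<partial>half_line)\<^sup>2 \<partial>half_line)
      \<le> (\<integral>\<^sup>+t. ?N * (\<integral>\<^sup>+\<tau>. ennreal (\<bar>?K t \<tau>\<bar> * t powr (- \<mu> - 1)) * ennreal (h \<tau>) \<partial>half_line) \<partial>half_line)"
  proof (rule nn_integral_mono)
    fix t assume "t \<in> space half_line"
    then have t: "t > 0" by simp
    have pw: "t powr (- 2 * \<mu> - 1) * t powr \<mu> = t powr (- \<mu> - 1)"
      by (simp add: powr_add[symmetric] algebra_simps)
    have "ennreal (t powr (- 2 * \<mu> - 1)) * (\<integral>\<^sup>+\<tau>. ennreal (\<bar>?K t \<tau>\<bar> * norm (G \<tau>)) \<partial>half_line)\<^sup>2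
        \<le> ennreal (t powr (- 2 * \<mu> - 1)) * (?N * ennreal (t powr \<mu>) * (\<integral>\<^sup>+\<tau>. ennreal (\<bar>?K t \<tau>\<bar> * h \<tau>) \<partial>half_line))"
      by (intro mult_left_mono pointwise t) simp
    also have "\<dots> = ?N * (ennreal (t powr (- 2 * \<mu> - 1)) * ennreal (t powr \<mu>) * (\<integral>\<^sup>+\<tau>. ennreal (\<bar>?K t \<tau>\<bar> * h \<tau>) \<partial>half_line))"
      by (simp add: mult_ac)
    also have "ennreal (t powr (- 2 * \<mu> - 1)) * ennreal (t powr \<mu>) = ennreal (t powr (- \<mu> - 1))"
      unfolding pw[symmetric] by (simp add: ennreal_mult)
    also have "ennreal (t powr (- \<mu> - 1)) * (\<integral>\<^sup>+\<tau>. ennreal (\<bar>?K t \<tau>\<bar> * h \<tau>) \<partial>half_line) =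
        (\<integral>\<^sup>+\<tau>. ennreal (\<bar>?K t \<tau>\<bar> * t powr (- \<mu> - 1)) * ennreal (h \<tau>) \<partial>half_line)"
      by (subst nn_integral_cmult[symmetric]) (auto intro!: nn_integral_cong simp: h_def ennreal_mult[symmetric] mult_ac)
    finally show "ennreal (t powr (- 2 * \<mu> - 1)) * (\<integral>\<^sup>+\<tau>. ennreal (\<bar>?K t \<tau>\<bar> * norm (G \<tau>)) \<partial>half_line)\<^sup>2
       \<le> ?N * (\<integral>\<^sup>+\<tau>. ennreal (\<bar>?K t \<tau>\<bar> * t powr (- \<mu> - 1)) * ennreal (h \<tau>) \<partial>half_line)" .
  qed
  also have "\<dots> = ?N * (\<integral>\<^sup>+t. (\<integral>\<^sup>+\<tau>. ennreal (\<bar>?K t \<tau>\<bar> * t powr (- \<mu> - 1)) * ennreal (h \<tau>) \<partial>half_line) \<partial>half_line)"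
    by (rule nn_integral_cmult) measurable
  also have "(\<integral>\<^sup>+t. (\<integral>\<^sup>+\<tau>. ennreal (\<bar>?K t \<tau>\<bar> * t powr (- \<mu> - 1)) * ennreal (h \<tau>) \<partial>half_line) \<partial>half_line)
     = (\<integral>\<^sup>+\<tau>. (\<integral>\<^sup>+t. ennreal (\<bar>?K t \<tau>\<bar> * t powr (- \<mu> - 1)) * ennreal (h \<tau>) \<partial>half_line) \<partial>half_line)"
    by (rule half_line_pair.Fubini') measurable
  also have "\<dots> = (\<integral>\<^sup>+\<tau>. ?N * ennreal (\<tau> powr (2 * s - 2 * \<mu> - 1) * (norm (G \<tau>))\<^sup>2) \<partial>half_line)"
  proof (rule nn_integral_cong)
    fix \<tau> assume "\<tau> \<in> space half_line"
    then have \<tau>: "\<tau> > 0" by simp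
    have pw: "\<tau> powr (s - 1 - \<mu>) * \<tau> powr (s - \<mu>) = \<tau> powr (2 * s - 2 * \<mu> - 1)"
      by (simp add: powr_add[symmetric] algebra_simps)
    have "(\<integral>\<^sup>+t. ennreal (\<bar>?K t \<tau>\<bar> * t powr (- \<mu> - 1)) * ennreal (h \<tau>) \<partial>half_line) = ?N * ennreal (\<tau> powr (s - 1 - \<mu>)) * ennreal (h \<tau>)"
      by (subst nn_integral_multc) (simp_all add: nn_integral_frac_kernel_fst[OF s \<mu> \<tau>])
    also have "\<dots> = ?N * ennreal (\<tau> powr (s - 1 - \<mu>) * h \<tau>)"
      by (simp add: ennreal_mult mult.assoc h_def)
    also have "\<tau> powr (s - 1 - \<mu>) * h \<tau> = \<tau> powr (2 * s - 2 * \<mu> - 1) * (norm (G \<tau>))\<^sup>2"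
      unfolding h_def pw[symmetric] by simp
    finally show "(\<integral>\<^sup>+t. ennreal (\<bar>?K t \<tau>\<bar> * t powr (- \<mu> - 1)) * ennreal (h \<tau>) \<partial>half_line) = ?N * ennreal (\<tau> powr (2 * s - 2 * \<mu> - 1) * (norm (G \<tau>))\<^sup>2)" .
  qed
  also have "\<dots> = ?N * (\<integral>\<^sup>+\<tau>. ennreal (\<tau> powr (2 * s - 2 * \<mu> - 1) * (norm (G \<tau>))\<^sup>2) \<partial>half_line)"
    by (rule nn_integral_cmult) measurable
  finally show ?thesis by (simp add: power2_eq_square mult.assoc)
qed

text \<open>The bound depends on \<mu> only through its distance to the natural numbers. This
  uniformity yields one constant for moments of all orders and for arbitrarily large
  weights.\<close>

lemma kernel_norm_bounded:
  assumes s: "0 < s" "s < 1" and \<delta>: "0 < \<delta>" "\<delta> \<le> 1 / 2"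
  obtains C where "C \<ge> 0" "\<And>\<mu> m. \<mu> < real m \<Longrightarrow> m = 0 \<or> real m - 1 < \<mu> \<Longrightarrow> (\<And>k :: nat. \<delta> \<le> \<bar>real k - \<mu>\<bar>) \<Longrightarrow> kernel_norm s \<mu> \<le> ennreal C"
proof -
  \<comment> \<open>Conjugate exponents for Young's inequality: p = 2 / s turns the decay (k + 1)^-s
    of the coefficients into (k + 1)^-2, and q > 1 makes the sum of |k - \<mu>|^-q converge.\<close>
  define p where "p = 2 / s"
  define q where "q = 2 / (2 - s)"
  have p: "p > 1" and q: "q > 1" and pq: "1 / p + 1 / q = 1"
    using s by (auto simp: p_def q_def field_simps)
  define A where "A = (\<Sum>k. (real k + 1) powr (- 2))"
  define B where "B = (\<Sum>j. ((real j + 1) * \<delta>) powr (- q))"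
  have sA: "summable (\<lambda>k. (real k + 1) powr (- 2))"
    using summable_Suc_iff[of "\<lambda>k. real k powr (- 2)"] by (simp add: summable_real_powr_iff add.commute)
  have "summable (\<lambda>j. (real j + 1) powr (- q))"
    using q summable_Suc_iff[of "\<lambda>k. real k powr (- q)"] by (simp add: summable_real_powr_iff add.commute)
  then have "summable (\<lambda>j. (real j + 1) powr (- q) * \<delta> powr (- q))" by (rule summable_mult2)
  then have sB: "summable (\<lambda>j. ((real j + 1) * \<delta>) powr (- q))" using \<delta> by (simp add: powr_mult)
  have A: "(\<Sum>k. ennreal ((real k + 1) powr (- 2))) = ennreal A" unfolding A_def by (rule suminf_ennreal2[OF _ sA]) simp
  have B: "(\<Sum>j. ennreal (((real j + 1) * \<delta>) powr (- q))) = ennreal B" unfolding B_def by (rule suminf_ennreal2[OF _ sB]) simp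
  have nn: "A \<ge> 0" "B \<ge> 0" unfolding A_def B_def by (auto intro!: suminf_nonneg sA sB)
  show ?thesis
  proof (rule that[of "A + 2 * B"])
    show "A + 2 * B \<ge> 0" using nn by simp
    fix \<mu> m assume \<mu>: "\<mu> < real m" "m = 0 \<or> real m - 1 < \<mu>" and d: "\<And>k :: nat. \<delta> \<le> \<bar>real k - \<mu>\<bar>"
    define \<phi> where "\<phi> k = ennreal (\<bar>real k - \<mu>\<bar> powr (- q))" for k :: nat
    have \<phi>_le: "\<phi> k \<le> ennreal (((real j + 1) * \<delta>) powr (- q))" if "real j \<le> \<bar>real k - \<mu>\<bar>" for j k :: nat
    proof -
      \<comment> \<open>For j = 0 this is the assumed distance \<delta>; for j >= 1 it follows from
        \<delta> \<le> 1 / 2, since (j + 1) / 2 \<le> j.\<close>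
      have "(real j + 1) * \<delta> \<le> \<bar>real k - \<mu>\<bar>"
      proof (cases "j = 0")
        case False
        have "(real j + 1) * \<delta> \<le> (real j + 1) * (1 / 2)" using \<delta> by (intro mult_left_mono) auto
        also have "\<dots> \<le> real j" using False by (cases j) auto
        finally show ?thesis using that by linarith
      qed (use d[of k] in simp)
      then show ?thesis unfolding \<phi>_def using q \<delta> by (intro ennreal_leI powr_mono2') auto
    qed
    have "(\<Sum>k. \<phi> k) = (\<Sum>k. \<phi> (k + m)) + (\<Sum>k<m. \<phi> k)" by (rule suminf_offset) simp
    also have "(\<Sum>k. \<phi> (k + m)) \<le> (\<Sum>j. ennreal (((real j + 1) * \<delta>) powr (- q)))"
      using \<mu>(1) by (intro suminf_le \<phi>_le) auto
    \<comment> \<open>Counted downwards, the index m - 1 - j lies below \<mu> at distance more than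
      j, just as m + j lies above \<mu> at distance more than j.\<close>
    also have "(\<Sum>k<m. \<phi> k) = (\<Sum>j<m. \<phi> (m - Suc j))" by (rule sum.nat_diff_reindex[symmetric])
    also have "\<dots> \<le> (\<Sum>j<m. ennreal (((real j + 1) * \<delta>) powr (- q)))"
      using \<mu>(2) by (intro sum_mono \<phi>_le) (auto simp: of_nat_diff)
    also have "\<dots> \<le> (\<Sum>j. ennreal (((real j + 1) * \<delta>) powr (- q)))" by (rule sum_le_suminf) auto
    finally have \<phi>: "(\<Sum>k. \<phi> k) \<le> ennreal (2 * B)" using nn by (simp add: B ennreal_plus[symmetric] add_mono del: ennreal_plus)
    have "kernel_norm s \<mu> \<le> (\<Sum>k. ennreal ((real k + 1) powr (- 2)) + \<phi> k)"
      unfolding kernel_norm_def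
    proof (rule suminf_le)
      fix k
      have c: "0 < binom_coeff s k" by (rule binom_coeff_pos[OF s(2)])
      have x: "0 < \<bar>real k - \<mu>\<bar>" using d[of k] \<delta> by linarith
      have "binom_coeff s k * (1 / \<bar>real k - \<mu>\<bar>) \<le> binom_coeff s k powr p / p + (1 / \<bar>real k - \<mu>\<bar>) powr q / q"
        using p q pq c x by (intro Youngs_inequality) auto
      also have "\<dots> \<le> binom_coeff s k powr p + (1 / \<bar>real k - \<mu>\<bar>) powr q"
        using p q by (intro add_mono) (auto simp: field_simps mult_le_cancel_right1)
      also have "binom_coeff s k powr p \<le> ((real k + 1) powr (- s)) powr p"
        using binom_coeff_le[OF s] c p by (intro powr_mono2) auto
      also have "\<dots> = (real k + 1) powr (- 2)" using s by (simp add: powr_powr p_def)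
      also have "(1 / \<bar>real k - \<mu>\<bar>) powr q = \<bar>real k - \<mu>\<bar> powr (- q)" using x by (simp add: powr_minus_divide powr_divide)
      finally have "binom_coeff s k / \<bar>real k - \<mu>\<bar> \<le> (real k + 1) powr (- 2) + \<bar>real k - \<mu>\<bar> powr (- q)" by simp
      then show "ennreal (binom_coeff s k / \<bar>real k - \<mu>\<bar>) \<le> ennreal ((real k + 1) powr (- 2)) + \<phi> k"
        unfolding \<phi>_def by (simp add: ennreal_plus[symmetric] ennreal_leI del: ennreal_plus)
    qed auto
    also have "\<dots> = (\<Sum>k. ennreal ((real k + 1) powr (- 2))) + (\<Sum>k. \<phi> k)" by (rule suminf_add[symmetric]) auto
    also have "\<dots> \<le> ennreal A + ennreal (2 * B)" unfolding A using \<phi> by (intro add_left_mono)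
    also have "\<dots> = ennreal (A + 2 * B)" using nn by simp
    finally show "kernel_norm s \<mu> \<le> ennreal (A + 2 * B)" .
  qed
qed

lemma kernel_norm_finite:
  assumes s: "0 < s" "s < 1" and "\<mu> < real m" "m = 0 \<or> real m - 1 < \<mu>"
    and "0 < \<delta>" "\<delta> \<le> 1 / 2" "\<And>k :: nat. \<delta> \<le> \<bar>real k - \<mu>\<bar>"
  shows "kernel_norm s \<mu> < \<infinity>"
  using kernel_norm_bounded[OF s assms(5,6)] assms(3,4,7) by (metis ennreal_less_top infinity_ennreal_def order.strict_trans1)

section \<open>A Carleman inequality for fractional integrals\<close>

lemma AE_eq_0_of_set_integrals:
  fixes h :: "'a \<Rightarrow> real"
  assumes "integrable M h" "\<And>A. A \<in> sets M \<Longrightarrow> (LINT x:A|M. h x) = 0"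
  shows "AE x in M. h x = 0"
  by (rule density_unique_real) (use assms in auto)

text \<open>Open intervals are stable under intersection and generate the Borel sets, so the class
  of sets over which the integral vanishes is everything; exhaustion by intervals handles the whole
  line, hence complements.\<close>

lemma AE_eq_0_of_interval_integrals_lborel:
  fixes h :: "real \<Rightarrow> complex"
  assumes h: "integrable lborel h" and zero: "\<And>p q. p < q \<Longrightarrow> (LINT x|lborel. indicator {p<..<q} x *\<^sub>R h x) = 0"
  shows "AE x in lborel. h x = 0"
proof -
  have hi: "integrable lborel (\<lambda>x. indicator A x *\<^sub>R h x)" if "A \<in> sets borel" for A
    using that by (intro integrable_mult_indicator h) simp
  have UNIV0: "(LINT x|lborel. h x) = 0"
  proof (rule LIMSEQ_unique)
    show "(\<lambda>n. LINT x|lborel. indicator {- real n - 1<..<real n + 1} x *\<^sub>R h x) \<longlonglongrightarrow> (LINT x|lborel. h x)"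
    proof (rule integral_dominated_convergence[where w = "\<lambda>x. norm (h x)"])
      show "AE x in lborel. (\<lambda>n. indicator {- real n - 1<..<real n + 1} x *\<^sub>R h x) \<longlonglongrightarrow> h x"
      proof (rule AE_I2, rule tendsto_eventually)
        fix x :: real
        show "\<forall>\<^sub>F n in sequentially. indicator {- real n - 1<..<real n + 1} x *\<^sub>R h x = h x"
          using eventually_ge_at_top[of "nat \<lceil>\<bar>x\<bar>\<rceil>"] by eventually_elim (auto simp: indicator_def; linarith)
      qed
    qed (use h in \<open>auto simp: indicator_def\<close>)
    show "(\<lambda>n. LINT x|lborel. indicator {- real n - 1<..<real n + 1} x *\<^sub>R h x) \<longlonglongrightarrow> 0"
      by (subst zero) auto
  qed
  have set0: "(LINT x|lborel. indicator A x *\<^sub>R h x) = 0" if "A \<in> sets borel" for A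
  proof -
    have "Int_stable (range (\<lambda>(a, b). box a b :: real set))"
      by (auto simp: Int_stable_def box_real Int_greaterThanLessThan)
    moreover have "A \<in> sigma_sets UNIV (range (\<lambda>(a, b). box a b :: real set))"
      using that by (simp add: borel_eq_box sets_measure_of)
    ultimately show ?thesis
    proof (induction rule: sigma_sets_induct_disjoint[OF _ subset_UNIV[of "range (\<lambda>(a, b). box a b :: real set)", folded Pow_UNIV], consumes 2, case_names basic empty compl union])
      case (basic A)
      then obtain a b where "A = {a<..<b}" by (auto simp: box_real)
      then show ?case using zero[of a b] by (cases "a < b") auto
    next
      case (compl A)
      then have A: "A \<in> sets borel" by (simp add: borel_eq_box sets_measure_of)
      have "(LINT x|lborel. indicator (UNIV - A) x *\<^sub>R h x) = (LINT x|lborel. h x - indicator A x *\<^sub>R h x)"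
        by (intro Bochner_Integration.integral_cong) (auto simp: indicator_def)
      also have "\<dots> = 0" using compl UNIV0 hi[OF A] h by simp
      finally show ?case .
    next
      case (union A)
      then have A: "A i \<in> sets borel" for i by (auto simp: borel_eq_box sets_measure_of)
      have "(LINT x:(\<Union>i. A i)|lborel. h x) = (\<Sum>i. (LINT x:(A i)|lborel. h x))"
        using A union(1) hi[of "\<Union>i. A i"]
        by (intro lebesgue_integral_countable_add) (auto simp: disjoint_family_on_def set_integrable_def)
      then show ?case using union(3) by (simp add: set_lebesgue_integral_def)
    qed auto
  qed
  have "AE x in lborel. Re (h x) = 0"
  proof (rule AE_eq_0_of_set_integrals)
    show "(LINT x:A|lborel. Re (h x)) = 0" if "A \<in> sets lborel" for A
      using set0[of A] integral_Re[OF hi[of A]] that by (simp add: set_lebesgue_integral_def)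
  qed (use h in auto)
  moreover have "AE x in lborel. Im (h x) = 0"
  proof (rule AE_eq_0_of_set_integrals)
    show "(LINT x:A|lborel. Im (h x)) = 0" if "A \<in> sets lborel" for A
      using set0[of A] integral_Im[OF hi[of A]] that by (simp add: set_lebesgue_integral_def)
  qed (use h in auto)
  ultimately show ?thesis by eventually_elim (simp add: complex_eq_iff)
qed

lemma integral_half_line:
  fixes f :: "real \<Rightarrow> 'b::{banach, second_countable_topology}"
  shows "(LINT t|half_line. f t) = (LINT t|lborel. indicator {0<..} t *\<^sub>R f t)"
  unfolding half_line_def by (rule integral_restrict_space) simp

lemma AE_eq_0_of_interval_integrals:
  fixes h :: "real \<Rightarrow> complex"
  assumes h: "\<And>p q. 0 < p \<Longrightarrow> p < q \<Longrightarrow> integrable half_line (\<lambda>t. indicator {p<..<q} t *\<^sub>R h t)"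
    and zero: "\<And>p q. 0 < p \<Longrightarrow> p < q \<Longrightarrow> (LINT t|half_line. indicator {p<..<q} t *\<^sub>R h t) = 0"
  shows "AE t in half_line. h t = 0"
proof -
  \<comment> \<open>h is integrable only away from 0 and infinity, so the whole-line statement is
    applied to truncations exhausting the half-line.\<close>
  define I where "I n = {1 / (real n + 1)<..<real n + 2}" for n
  have pos: "0 < 1 / (real n + 1)" "1 / (real n + 1) < real n + 2" for n
    by (auto simp: field_simps intro!: add_pos_nonneg mult_nonneg_nonneg)
  have ind: "indicator {0<..} t *\<^sub>R indicator {p<..<q} t *\<^sub>R h t = indicator {p<..<q} t *\<^sub>R h t" if "0 < p" for p q t
    using that by (auto simp: indicator_def)
  have "AE t in lborel. indicator (I n) t *\<^sub>R h t = 0" for n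
  proof (rule AE_eq_0_of_interval_integrals_lborel)
    show "integrable lborel (\<lambda>t. indicator (I n) t *\<^sub>R h t)"
      using h[OF pos] unfolding integrable_half_line_iff I_def ind[OF pos(1)] .
    fix p q :: real assume "p < q"
    define p' q' where "p' = max p (1 / (real n + 1))" and "q' = min q (real n + 2)"
    have eq: "indicator {p<..<q} t *\<^sub>R indicator (I n) t *\<^sub>R h t = indicator {p'<..<q'} t *\<^sub>R h t" for t
      by (auto simp: indicator_def p'_def q'_def I_def)
    have p': "p' > 0" using pos(1)[of n] by (simp add: p'_def less_max_iff_disj)
    show "(LINT t|lborel. indicator {p<..<q} t *\<^sub>R indicator (I n) t *\<^sub>R h t) = 0"
      unfolding eq using zero[OF p', of q'] unfolding integral_half_line ind[OF p']
      by (cases "p' < q'") auto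
  qed
  then have "AE t in lborel. \<forall>n. indicator (I n) t *\<^sub>R h t = 0" unfolding AE_all_countable by blast
  then show ?thesis unfolding AE_half_line
  proof (rule AE_mp, intro AE_I2 impI)
    fix t :: real assume *: "\<forall>n. indicator (I n) t *\<^sub>R h t = 0" and t: "t > 0"
    obtain n where n: "1 / t < real n" "t < real n" using reals_Archimedean2[of "max (1/t) t"] by auto
    then have "t \<in> I n" using t by (auto simp: I_def field_simps)
    then show "h t = 0" using *[rule_format, of n] by simp
  qed
qed

text \<open>A power converges at most at one end. The comparison powers -1 - 1/n on (1, \<infinity>)
  and -1 + 1/n on (0, 1) have integral exactly n.\<close>

lemma nn_integral_powr_half_line: "(\<integral>\<^sup>+t. ennreal (t powr e) \<partial>half_line) = \<infinity>"
proof -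
  have "ennreal n \<le> (\<integral>\<^sup>+t. ennreal (t powr e) \<partial>half_line)" if "n > 0" for n :: real
  proof (cases "e \<ge> -1")
    case True
    have "ennreal n = (\<integral>\<^sup>+t. ennreal (t powr (-1 - 1 / n)) * indicator {1<..} t \<partial>half_line)"
      using that by (subst nn_integral_powr_inf) auto
    also have "\<dots> \<le> (\<integral>\<^sup>+t. ennreal (t powr e) \<partial>half_line)"
    proof (rule nn_integral_mono)
      fix t :: real
      have "-1 - 1 / n \<le> e" using True that by (auto intro: order_trans[of _ "-1"])
      then show "ennreal (t powr (-1 - 1 / n)) * indicator {1<..} t \<le> ennreal (t powr e)"
        by (auto simp: indicator_def intro!: ennreal_leI powr_mono)
    qed
    finally show ?thesis .
  next
    case False
    have "ennreal n = (\<integral>\<^sup>+t. ennreal (t powr (-1 + 1 / n)) * indicator {..1} t \<partial>half_line)"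
      using that by (subst nn_integral_powr_0) auto
    also have "\<dots> \<le> (\<integral>\<^sup>+t. ennreal (t powr e) \<partial>half_line)"
    proof (rule nn_integral_mono)
      fix t :: real assume "t \<in> space half_line"
      have "-1 + 1 / n \<ge> e" using False that by (auto intro: order_trans[of _ "-1"])
      then show "ennreal (t powr (-1 + 1 / n)) * indicator {..1} t \<le> ennreal (t powr e)"
        using \<open>t \<in> space half_line\<close> by (auto simp: indicator_def intro!: ennreal_leI powr_mono')
    qed
    finally show ?thesis .
  qed
  then have "ennreal (real n) \<le> (\<integral>\<^sup>+t. ennreal (t powr e) \<partial>half_line)" for n
    by (cases "n = 0") auto
  then show ?thesis
    by (cases "\<integral>\<^sup>+t. ennreal (t powr e) \<partial>half_line") (auto, metis ennreal_le_iff linorder_not_less reals_Archimedean2)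
qed

text \<open>No lower bound on the exponent a: this is flatness at 0. The upper bound 2 d records the
  behaviour at infinity, with d the weight that the moment carries in Parseval's identity.\<close>

definition flat_class :: "real \<Rightarrow> (real \<Rightarrow> complex) \<Rightarrow> bool" where
  "flat_class d F \<longleftrightarrow> F \<in> borel_measurable half_line \<and>
     (\<forall>a\<le>2 * d. (\<integral>\<^sup>+t. ennreal (t powr a * (norm (F t))\<^sup>2) \<partial>half_line) < \<infinity>)"

text \<open>Near 0 the square of t^e F is already controlled. At infinity t^e = t^(e - d) t^d, and
  t^(e - d) is square-integrable there because e < d - 1 / 2.\<close>

lemma flat_class_integrable:
  assumes F: "flat_class d F" and e: "e < d - 1 / 2"
  shows "integrable half_line (\<lambda>t. of_real (t powr e) * F t)"
proof -
  have [measurable]: "F \<in> borel_measurable half_line" using F by (simp add: flat_class_def)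
  define a where "a = 2 * e"
  have i: "(\<integral>\<^sup>+t. ennreal (t powr (2 * e) * (norm (F t))\<^sup>2) \<partial>half_line) < \<infinity>"
    "(\<integral>\<^sup>+t. ennreal (t powr (2 * d) * (norm (F t))\<^sup>2) \<partial>half_line) < \<infinity>"
    using F e unfolding flat_class_def by auto
  have "(\<integral>\<^sup>+t. ennreal (norm (of_real (t powr e) * F t)) \<partial>half_line) \<le>
     (\<integral>\<^sup>+t. (ennreal (t powr 0) * indicator {..1} t + ennreal (t powr (2 * e - 2 * d)) * indicator {1<..} t) +
       (ennreal (t powr (2 * e) * (norm (F t))\<^sup>2) + ennreal (t powr (2 * d) * (norm (F t))\<^sup>2)) \<partial>half_line)"
  proof (rule nn_integral_mono)
    fix t assume "t \<in> space half_line"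
    then have t: "t > 0" by simp
    have amgm: "x * y \<le> x\<^sup>2 + y\<^sup>2" if "0 \<le> x" "0 \<le> y" for x y :: real
    proof -
      have "2 * (x * y) \<le> x\<^sup>2 + y\<^sup>2" using sum_squares_bound[of x y] by simp
      moreover have "0 \<le> x * y" using that by simp
      ultimately show ?thesis by linarith
    qed
    have pw2: "(t powr b)\<^sup>2 = t powr (2 * b)" for b using t by (simp add: powr_powr power2_eq_square powr_add[symmetric])
    show "ennreal (norm (of_real (t powr e) * F t)) \<le>
      (ennreal (t powr 0) * indicator {..1} t + ennreal (t powr (2 * e - 2 * d)) * indicator {1<..} t) +
       (ennreal (t powr (2 * e) * (norm (F t))\<^sup>2) + ennreal (t powr (2 * d) * (norm (F t))\<^sup>2))"
    proof (cases "t \<le> 1")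
      case True
      have "norm (of_real (t powr e) * F t) \<le> 1 + t powr (2 * e) * (norm (F t))\<^sup>2"
        using amgm[of 1 "t powr e * norm (F t)"] by (simp add: norm_mult power_mult_distrib pw2)
      also have "\<dots> \<le> (1 + 0) + (t powr (2 * e) * (norm (F t))\<^sup>2 + t powr (2 * d) * (norm (F t))\<^sup>2)" by simp
      finally have "ennreal (norm (of_real (t powr e) * F t)) \<le> ennreal (1 + (t powr (2 * e) * (norm (F t))\<^sup>2 + t powr (2 * d) * (norm (F t))\<^sup>2))"
        by (intro ennreal_leI) simp
      also have "\<dots> = 1 + (ennreal (t powr (2 * e) * (norm (F t))\<^sup>2) + ennreal (t powr (2 * d) * (norm (F t))\<^sup>2))"
        by (simp add: ennreal_plus)
      finally show ?thesis using True t by simp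
    next
      case False
      have "t powr e = t powr (e - d) * t powr d" by (simp add: powr_add[symmetric])
      then have "norm (of_real (t powr e) * F t) \<le> (t powr (e - d))\<^sup>2 + (t powr d * norm (F t))\<^sup>2"
        using amgm[of "t powr (e - d)" "t powr d * norm (F t)"] by (simp add: norm_mult mult.assoc)
      also have "\<dots> = t powr (2 * e - 2 * d) + t powr (2 * d) * (norm (F t))\<^sup>2"
        by (simp add: power_mult_distrib pw2 algebra_simps)
      also have "\<dots> \<le> (0 + t powr (2 * e - 2 * d)) + (t powr (2 * e) * (norm (F t))\<^sup>2 + t powr (2 * d) * (norm (F t))\<^sup>2)" by simp
      finally show ?thesis using False by (simp add: ennreal_plus[symmetric] ennreal_leI add_nonneg_nonneg del: ennreal_plus)
    qed
  qed
  also have "\<dots> = ((\<integral>\<^sup>+t. ennreal (t powr 0) * indicator {..1} t \<partial>half_line) + (\<integral>\<^sup>+t. ennreal (t powr (2 * e - 2 * d)) * indicator {1<..} t \<partial>half_line)) +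
     ((\<integral>\<^sup>+t. ennreal (t powr (2 * e) * (norm (F t))\<^sup>2) \<partial>half_line) + (\<integral>\<^sup>+t. ennreal (t powr (2 * d) * (norm (F t))\<^sup>2) \<partial>half_line))"
    by (simp add: nn_integral_add)
  also have "\<dots> < \<infinity>"
  proof -
    have "(\<integral>\<^sup>+t. ennreal (t powr 0) * indicator {..1} t \<partial>half_line) < \<infinity>"
      by (subst nn_integral_powr_0) auto
    moreover have "(\<integral>\<^sup>+t. ennreal (t powr (2 * e - 2 * d)) * indicator {1<..} t \<partial>half_line) < \<infinity>"
      using e by (subst nn_integral_powr_inf) auto
    ultimately show ?thesis using i by simp
  qed
  finally show ?thesis by (simp add: integrable_iff_bounded)
qed

definition frac_op :: "real \<Rightarrow> nat \<Rightarrow> (real \<Rightarrow> complex) \<Rightarrow> real \<Rightarrow> complex" where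
  "frac_op s m G t = (LINT \<tau>|half_line. of_real (frac_kernel s m t \<tau>) * G \<tau>)"

text \<open>Subtracting the average over \<open>(1, 2)\<close> makes the mean zero, so that the fractional integral of the test function is
  of order \<open>\<tau> powr (s - 2)\<close> at infinity, hence integrable.\<close>

definition test_fun :: "real \<Rightarrow> real \<Rightarrow> real \<Rightarrow> real" where
  "test_fun p q t = indicator {p<..<q} t / (q - p) - indicator {1<..<2} t"

lemma test_fun_measurable [measurable]: "test_fun p q \<in> borel_measurable borel"
  unfolding test_fun_def[abs_def] by measurable

lemma frac_op_measurable [measurable (raw)]:
  assumes [measurable]: "G \<in> borel_measurable half_line"
  shows "frac_op s m G \<in> borel_measurable half_line"
  unfolding frac_op_def[abs_def] by measurable

lemma frac_kernel_test_int: "integrable half_line (\<lambda>t. frac_kernel s 0 t \<tau> * test_fun p q t)"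
  if s: "0 < s" "s < 1" and "\<tau> > 0" "0 < p" "p < q"
proof -
  have K: "integrable half_line (\<lambda>t. frac_kernel s 0 t \<tau>)"
  proof -
    \<comment> \<open>With \<mu> = -1 and m = 0 the weight exponent - \<mu> - 1 is 0, so this is the
      plain integral of the kernel.\<close>
    have "(\<integral>\<^sup>+t. ennreal (\<bar>frac_kernel s 0 t \<tau>\<bar> * t powr (- (-1) - 1)) \<partial>half_line) = kernel_norm s (-1) * ennreal (\<tau> powr (s - 1 - (-1)))"
      by (rule nn_integral_frac_kernel_fst[OF s]) (use that in auto)
    moreover have "kernel_norm s (-1) < \<infinity>"
      by (rule kernel_norm_finite[OF s, where m = 0 and \<delta> = "1 / 4"]) auto
    moreover have "(\<integral>\<^sup>+t. ennreal (\<bar>frac_kernel s 0 t \<tau>\<bar> * t powr (- (-1) - 1)) \<partial>half_line) = (\<integral>\<^sup>+t. ennreal (norm (frac_kernel s 0 t \<tau>)) \<partial>half_line)"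
      by (rule nn_integral_cong) simp
    ultimately have "(\<integral>\<^sup>+t. ennreal (norm (frac_kernel s 0 t \<tau>)) \<partial>half_line) < \<infinity>"
      by (metis ennreal_less_top ennreal_mult_less_top infinity_ennreal_def)
    then show ?thesis by (simp add: integrable_iff_bounded)
  qed
  have "0 < 1 / (q - p)" using that by simp
  then have "\<bar>test_fun p q t\<bar> \<le> 1 / (q - p) + 1" for t
    using that unfolding test_fun_def by (auto simp: indicator_def abs_if simp del: zero_less_divide_1_iff intro: less_imp_le)
  then show ?thesis
    using that
    by (intro Bochner_Integration.integrable_bound[OF integrable_mult_right[OF K, of "1 / (q - p) + 1"]])
      (auto simp: test_fun_def abs_mult mult.commute[of _ "\<bar>frac_kernel s 0 _ \<tau>\<bar>"] intro!: AE_I2 mult_left_mono)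
qed

lemma integrable_test_fun: "integrable half_line (test_fun p q)" and integral_test_fun: "(LINT t|half_line. test_fun p q t) = 0"
  if "0 < p" "p < q"
proof -
  have i: "integrable half_line (indicator {p<..<q} :: real \<Rightarrow> real)" "(LINT t|half_line. (indicator {p<..<q} t :: real)) = q - p"
    if "0 < p" "p < q" for p q :: real
  proof -
    have eq: "(\<lambda>t. indicator {0<..} t *\<^sub>R (indicator {p<..<q} t :: real)) = indicator {p<..<q}"
      using that by (auto simp: indicator_def)
    show "integrable half_line (indicator {p<..<q} :: real \<Rightarrow> real)" "(LINT t|half_line. (indicator {p<..<q} t :: real)) = q - p"
      using that unfolding integrable_half_line_iff integral_half_line eq by (auto simp: emeasure_lborel_Ioo)
  qed
  show "integrable half_line (test_fun p q)" "(LINT t|half_line. test_fun p q t) = 0"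
    using i[OF that] i[of 1 2] that unfolding test_fun_def[abs_def] by simp_all
qed

text \<open>The weak form of F being the fractional integral of G, with 1 / \<Gamma>(s) absorbed
  into G. The test functions have mean zero, so constants in F are invisible. The bound 1 / 4 is the
  smallest moment order, attained in dimension one by the moment of order zero.\<close>

locale frac_pair =
  fixes s d :: real and F G :: "real \<Rightarrow> complex"
  assumes s: "0 < s" "s < 1" and d: "1 / 4 \<le> d"
    and F: "flat_class d F" and G: "flat_class d G"
    and weak: "\<And>p q. 0 < p \<Longrightarrow> p < q \<Longrightarrow>
      (LINT t|half_line. of_real (test_fun p q t) * F t) =
      (LINT \<tau>|half_line. of_real (LINT t|half_line. frac_kernel s 0 t \<tau> * test_fun p q t) * G \<tau>)"
begin

lemma measurable_FG [measurable]: "F \<in> borel_measurable half_line" "G \<in> borel_measurable half_line"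
  using F G by (auto simp: flat_class_def)

lemma Schur_finite:
  assumes "\<mu> < real m" "m = 0 \<or> real m - 1 < \<mu>" "\<And>k :: nat. 1 / 4 \<le> \<bar>real k - \<mu>\<bar>" and a: "2 * s - 2 * \<mu> - 1 \<le> 2 * d"
  shows "(\<integral>\<^sup>+t. ennreal (t powr (- 2 * \<mu> - 1)) * (\<integral>\<^sup>+\<tau>. ennreal (\<bar>frac_kernel s m t \<tau>\<bar> * norm (G \<tau>)) \<partial>half_line)\<^sup>2 \<partial>half_line) < \<infinity>"
proof -
  have "(\<integral>\<^sup>+\<tau>. ennreal (\<tau> powr (2 * s - 2 * \<mu> - 1) * (norm (G \<tau>))\<^sup>2) \<partial>half_line) < \<infinity>"
    using G a unfolding flat_class_def by blast
  moreover have "(kernel_norm s \<mu>)\<^sup>2 < \<infinity>"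
    using kernel_norm_finite[OF s assms(1,2) _ _ assms(3)] by (simp add: power_less_top_ennreal)
  ultimately show ?thesis
    by (intro order.strict_trans1[OF Schur_frac_kernel[OF s assms(1,2)]]) (auto simp: ennreal_mult_less_top)
qed

lemma AE_frac_integrable:
  assumes "\<mu> < real m" "m = 0 \<or> real m - 1 < \<mu>" "\<And>k :: nat. 1 / 4 \<le> \<bar>real k - \<mu>\<bar>" and a: "2 * s - 2 * \<mu> - 1 \<le> 2 * d"
  shows "AE t in half_line. integrable half_line (\<lambda>\<tau>. of_real (frac_kernel s m t \<tau>) * G \<tau>)"
proof -
  have "AE t in half_line. ennreal (t powr (- 2 * \<mu> - 1)) * (\<integral>\<^sup>+\<tau>. ennreal (\<bar>frac_kernel s m t \<tau>\<bar> * norm (G \<tau>)) \<partial>half_line)\<^sup>2 \<noteq> \<infinity>"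
    using Schur_finite[OF assms] by (intro nn_integral_PInf_AE) auto
  then show ?thesis
  proof (rule AE_mp, intro AE_I2 impI)
    fix t assume t: "t \<in> space half_line" and *: "ennreal (t powr (- 2 * \<mu> - 1)) * (\<integral>\<^sup>+\<tau>. ennreal (\<bar>frac_kernel s m t \<tau>\<bar> * norm (G \<tau>)) \<partial>half_line)\<^sup>2 \<noteq> \<infinity>"
    have "(\<integral>\<^sup>+\<tau>. ennreal (\<bar>frac_kernel s m t \<tau>\<bar> * norm (G \<tau>)) \<partial>half_line) \<noteq> \<infinity>"
      using * t by (auto simp: ennreal_mult_top)
    then show "integrable half_line (\<lambda>\<tau>. of_real (frac_kernel s m t \<tau>) * G \<tau>)"
      by (simp add: integrable_iff_bounded norm_mult less_top)
  qed
qed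

lemma frac_op_weighted:
  assumes "\<mu> < real m" "m = 0 \<or> real m - 1 < \<mu>"
  shows "(\<integral>\<^sup>+t. ennreal (t powr (- 2 * \<mu> - 1) * (norm (frac_op s m G t))\<^sup>2) \<partial>half_line)
    \<le> (kernel_norm s \<mu>)\<^sup>2 * (\<integral>\<^sup>+\<tau>. ennreal (\<tau> powr (2 * s - 2 * \<mu> - 1) * (norm (G \<tau>))\<^sup>2) \<partial>half_line)"
proof -
  have "ennreal (t powr (- 2 * \<mu> - 1) * (norm (frac_op s m G t))\<^sup>2) \<le>
     ennreal (t powr (- 2 * \<mu> - 1)) * (\<integral>\<^sup>+\<tau>. ennreal (\<bar>frac_kernel s m t \<tau>\<bar> * norm (G \<tau>)) \<partial>half_line)\<^sup>2" for t
  proof -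
    \<comment> \<open>If the integral does not converge, \<open>frac_op\<close> has the default
      value 0 and the bound is trivial.\<close>
    have "ennreal (norm (frac_op s m G t)) \<le> (\<integral>\<^sup>+\<tau>. ennreal (\<bar>frac_kernel s m t \<tau>\<bar> * norm (G \<tau>)) \<partial>half_line)"
    proof (cases "integrable half_line (\<lambda>\<tau>. of_real (frac_kernel s m t \<tau>) * G \<tau>)")
      case True
      show ?thesis unfolding frac_op_def
        by (rule order_trans[OF integral_norm_bound_ennreal[OF True]]) (simp add: norm_mult)
    qed (simp add: frac_op_def not_integrable_integral_eq)
    then have "(ennreal (norm (frac_op s m G t)))\<^sup>2 \<le> (\<integral>\<^sup>+\<tau>. ennreal (\<bar>frac_kernel s m t \<tau>\<bar> * norm (G \<tau>)) \<partial>half_line)\<^sup>2"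
      by (intro power_mono) auto
    then show ?thesis by (simp add: ennreal_mult ennreal_power mult_left_mono)
  qed
  then show ?thesis by (intro order_trans[OF nn_integral_mono Schur_frac_kernel[OF s assms]]) auto
qed

lemma weighted_F: "a \<le> 2 * d \<Longrightarrow> (\<integral>\<^sup>+t. ennreal (t powr a * (norm (F t))\<^sup>2) \<partial>half_line) < \<infinity>"
  using F unfolding flat_class_def by blast

lemma weighted_frac_op:
  assumes "\<mu> < real m" "m = 0 \<or> real m - 1 < \<mu>" "\<And>k :: nat. 1 / 4 \<le> \<bar>real k - \<mu>\<bar>" and a: "2 * s - 2 * \<mu> - 1 \<le> 2 * d"
  shows "(\<integral>\<^sup>+t. ennreal (t powr (- 2 * \<mu> - 1) * (norm (frac_op s m G t))\<^sup>2) \<partial>half_line) < \<infinity>"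
proof -
  have "(\<integral>\<^sup>+\<tau>. ennreal (\<tau> powr (2 * s - 2 * \<mu> - 1) * (norm (G \<tau>))\<^sup>2) \<partial>half_line) < \<infinity>"
    using G a unfolding flat_class_def by blast
  moreover have "(kernel_norm s \<mu>)\<^sup>2 < \<infinity>"
    using kernel_norm_finite[OF s assms(1,2) _ _ assms(3)] by (simp add: power_less_top_ennreal)
  ultimately show ?thesis
    by (intro order.strict_trans1[OF frac_op_weighted[OF assms(1,2)]]) (auto simp: ennreal_mult_less_top)
qed

text \<open>A and B lie in the same weighted L^2 space, so their difference does too, but no nonzero
  monomial lies in any power-weighted L^2 space of the half-line.\<close>

lemma monomial_eq_0:
  fixes A B :: "real \<Rightarrow> complex"
  assumes [measurable]: "A \<in> borel_measurable half_line" "B \<in> borel_measurable half_line"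
    and "(\<integral>\<^sup>+t. ennreal (t powr e * (norm (A t))\<^sup>2) \<partial>half_line) < \<infinity>"
    and "(\<integral>\<^sup>+t. ennreal (t powr e * (norm (B t))\<^sup>2) \<partial>half_line) < \<infinity>"
    and eq: "AE t in half_line. A t - B t = c * of_real (t ^ k)"
  shows "c = 0"
proof (rule ccontr)
  assume c: "c \<noteq> 0"
  have "(\<integral>\<^sup>+t. ennreal ((norm c)\<^sup>2) * ennreal (t powr (e + 2 * real k)) \<partial>half_line)
      \<le> (\<integral>\<^sup>+t. 2 * ennreal (t powr e * (norm (A t))\<^sup>2) + 2 * ennreal (t powr e * (norm (B t))\<^sup>2) \<partial>half_line)"
  proof (rule nn_integral_mono_AE, rule AE_mp[OF eq], intro AE_I2 impI)
    fix t assume "t \<in> space half_line" and eq: "A t - B t = c * of_real (t ^ k)"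
    then have t: "t > 0" by simp
    have "t powr (2 * real k) = (t ^ k)\<^sup>2"
      using powr_realpow[OF t, of "k * 2"] by (simp add: power_mult mult.commute)
    then have "(norm c)\<^sup>2 * t powr (e + 2 * real k) = t powr e * (norm (A t - B t))\<^sup>2"
      unfolding eq using t by (simp add: norm_mult norm_power power_mult_distrib powr_add)
    also have "\<dots> \<le> t powr e * (2 * (norm (A t))\<^sup>2 + 2 * (norm (- B t))\<^sup>2)"
      using norm_add_sq_le[of "A t" "- B t"] by (intro mult_left_mono) auto
    finally have "(norm c)\<^sup>2 * t powr (e + 2 * real k) \<le> 2 * (t powr e * (norm (A t))\<^sup>2) + 2 * (t powr e * (norm (B t))\<^sup>2)"
      by (simp add: algebra_simps)
    then have "ennreal ((norm c)\<^sup>2 * t powr (e + 2 * real k)) \<le> ennreal (2 * (t powr e * (norm (A t))\<^sup>2) + 2 * (t powr e * (norm (B t))\<^sup>2))"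
      by (rule ennreal_leI)
    then show "ennreal ((norm c)\<^sup>2) * ennreal (t powr (e + 2 * real k)) \<le> 2 * ennreal (t powr e * (norm (A t))\<^sup>2) + 2 * ennreal (t powr e * (norm (B t))\<^sup>2)"
      by (simp add: ennreal_mult ennreal_plus)
  qed
  also have "\<dots> = 2 * (\<integral>\<^sup>+t. ennreal (t powr e * (norm (A t))\<^sup>2) \<partial>half_line) + 2 * (\<integral>\<^sup>+t. ennreal (t powr e * (norm (B t))\<^sup>2) \<partial>half_line)"
    by (simp add: nn_integral_add nn_integral_cmult)
  also have "\<dots> < \<infinity>" using assms(3,4) by (simp add: ennreal_mult_less_top)
  finally have "ennreal ((norm c)\<^sup>2) * \<infinity> < \<infinity>"
    by (subst (asm) nn_integral_cmult) (simp_all add: nn_integral_powr_half_line)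
  then show False using c by (simp add: ennreal_mult_top)
qed

lemma quarter_dist: "1 / 4 \<le> \<bar>real k - (real m + 1 / 2)\<bar>"
proof -
  consider "k \<le> m" | "Suc m \<le> k" by linarith
  then show ?thesis
  proof cases
    case 1
    then have "real k \<le> real m" by simp
    then show ?thesis by simp
  next
    case 2
    then have "real k \<ge> real m + 1" by simp
    then show ?thesis by simp
  qed
qed

text \<open>Mean-zero test functions do not see the first Taylor term \<tau>^(s - 1), which is
  constant in t; subtracting it makes the fractional integral of G converge. The weak equation then
  determines F up to a constant, and the weight t^-2 excludes a nonzero constant.\<close>

lemma F_eq_frac_op_1: "AE t in half_line. F t = frac_op s 1 G t"
proof -
  define R where "R t = F t - frac_op s 1 G t" for t
  define W where "W t = (\<integral>\<^sup>+\<tau>. ennreal (\<bar>frac_kernel s 1 t \<tau>\<bar> * norm (G \<tau>)) \<partial>half_line)" for t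
  have [measurable]: "R \<in> borel_measurable half_line" unfolding R_def by measurable
  have [measurable]: "W \<in> borel_measurable half_line" unfolding W_def by measurable
  \<comment> \<open>\<mu> = 1 / 2 lies halfway between 0 and m = 1 and produces the weight t^-2; s <
    1 makes the weight on G, of exponent 2 s - 2 < 0, admissible.\<close>
  have \<mu>: "(1 / 2 :: real) < real 1" "(1 :: nat) = 0 \<or> real 1 - 1 < 1 / 2" "\<And>k :: nat. 1 / 4 \<le> \<bar>real k - 1 / 2\<bar>" "2 * s - 2 * (1 / 2) - 1 \<le> 2 * d"
    using quarter_dist[of _ 0] s d by auto
  have W: "(\<integral>\<^sup>+t. ennreal (t powr (- 2)) * (W t)\<^sup>2 \<partial>half_line) < \<infinity>"
    using Schur_finite[OF \<mu>] by (simp add: W_def)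
  have W_loc: "(\<integral>\<^sup>+t. indicator {p<..<q} t * W t \<partial>half_line) < \<infinity>" if "0 < p" "p < q" for p q
  proof -
    have "(\<integral>\<^sup>+t. indicator {p<..<q} t * W t \<partial>half_line) \<le> (\<integral>\<^sup>+t. indicator {p<..<q} t + ennreal (q\<^sup>2) * (ennreal (t powr (- 2)) * (W t)\<^sup>2) \<partial>half_line)"
    proof (rule nn_integral_mono)
      fix t assume "t \<in> space half_line"
      then have t: "t > 0" by simp
      show "indicator {p<..<q} t * W t \<le> indicator {p<..<q} t + ennreal (q\<^sup>2) * (ennreal (t powr (- 2)) * (W t)\<^sup>2)"
      proof (cases "t \<in> {p<..<q}")
        case True
        \<comment> \<open>Local integrability of W is drawn from its weighted square by W \<le> 1 +
          W^2, the weight being bounded below on (p, q).\<close>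
        have "W t \<le> 1 + (W t)\<^sup>2"
        proof (cases "W t")
          case (real r)
          have "r \<le> 1 + r\<^sup>2" using zero_le_power2[of "r - 1"] real(1) by (simp add: power2_diff)
          then show ?thesis using real by (simp add: ennreal_power ennreal_leI flip: ennreal_1 ennreal_plus)
        qed (simp add: power2_eq_square ennreal_top_mult)
        also have "(W t)\<^sup>2 = 1 * (W t)\<^sup>2" by simp
        also have "\<dots> \<le> ennreal (q\<^sup>2 * t powr (- 2)) * (W t)\<^sup>2"
        proof (rule mult_right_mono)
          have "t\<^sup>2 \<le> q\<^sup>2" using True t by (intro power_mono) auto
          then have "1 \<le> q\<^sup>2 * t powr (- 2)" using t by (simp add: powr_minus powr_numeral field_simps)
          then show "1 \<le> ennreal (q\<^sup>2 * t powr (- 2))" by (simp add: ennreal_1[symmetric] ennreal_leI del: ennreal_1)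
        qed simp
        finally show ?thesis using True by (simp add: ennreal_mult mult.assoc add_left_mono)
      qed auto
    qed
    also have "\<dots> = (\<integral>\<^sup>+t. indicator {p<..<q} t \<partial>half_line) + ennreal (q\<^sup>2) * (\<integral>\<^sup>+t. ennreal (t powr (- 2)) * (W t)\<^sup>2 \<partial>half_line)"
      by (subst nn_integral_add) (auto simp: nn_integral_cmult)
    also have "(\<integral>\<^sup>+t. indicator {p<..<q} t \<partial>half_line) \<le> (\<integral>\<^sup>+t. indicator {p<..<q} t \<partial>lborel)"
      unfolding nn_integral_half_line by (intro nn_integral_mono) (auto simp: indicator_def)
    also have "(\<integral>\<^sup>+t. indicator {p<..<q} t \<partial>lborel) = ennreal (q - p)" using that by simp
    finally show ?thesis using W by (auto simp: ennreal_mult_less_top elim!: order.strict_trans1)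
  qed
  have T_loc: "integrable half_line (\<lambda>t. indicator {p<..<q} t *\<^sub>R frac_op s 1 G t)" if pq: "0 < p" "p < q" for p q
  proof -
    have "ennreal (norm (indicator {p<..<q} t *\<^sub>R frac_op s 1 G t)) \<le> indicator {p<..<q} t * W t" for t
    proof (cases "integrable half_line (\<lambda>\<tau>. of_real (frac_kernel s 1 t \<tau>) * G \<tau>)")
      case True
      have "ennreal (norm (frac_op s 1 G t)) \<le> W t"
        unfolding frac_op_def W_def by (rule order_trans[OF integral_norm_bound_ennreal[OF True]]) (simp add: norm_mult)
      then show ?thesis by (auto simp: indicator_def)
    qed (simp add: frac_op_def not_integrable_integral_eq)
    then have "(\<integral>\<^sup>+t. ennreal (norm (indicator {p<..<q} t *\<^sub>R frac_op s 1 G t)) \<partial>half_line) < \<infinity>"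
      by (intro order.strict_trans1[OF nn_integral_mono W_loc[OF pq]]) auto
    then show ?thesis by (simp add: integrable_iff_bounded)
  qed
  have F_loc: "integrable half_line (\<lambda>t. indicator {p<..<q} t *\<^sub>R F t)" if pq: "0 < p" "p < q" for p q
  proof (rule Bochner_Integration.integrable_bound)
    have "-1 < d - 1 / 2" using d by simp
    then show "integrable half_line (\<lambda>t. complex_of_real q * (of_real (t powr (-1)) * F t))"
      by (intro integrable_mult_right flat_class_integrable[OF F])
    show "AE t in half_line. norm (indicator {p<..<q} t *\<^sub>R F t) \<le> norm (complex_of_real q * (of_real (t powr (-1)) * F t))"
    proof (rule AE_I2)
      fix t assume "t \<in> space half_line"
      then have "t > 0" by simp
      then have "1 \<le> q * t powr (-1)" if "t < q" using that by (simp add: powr_minus_divide)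
      then have "1 * norm (F t) \<le> q * t powr (-1) * norm (F t)" if "t < q" using that by (intro mult_right_mono) auto
      then show "norm (indicator {p<..<q} t *\<^sub>R F t) \<le> norm (complex_of_real q * (of_real (t powr (-1)) * F t))"
        using pq by (auto simp: indicator_def norm_mult norm_divide)
    qed
  qed measurable
  have R_loc: "integrable half_line (\<lambda>t. indicator {p<..<q} t *\<^sub>R R t)" if pq: "0 < p" "p < q" for p q
    using F_loc[OF pq] T_loc[OF pq] unfolding R_def by (simp add: scaleR_diff_right)
  have test_eq: "of_real (test_fun p q t) * h t = (1 / (q - p)) *\<^sub>R (indicator {p<..<q} t *\<^sub>R h t) - indicator {1<..<2} t *\<^sub>R h t" for p q t and h :: "real \<Rightarrow> complex"
    by (simp add: test_fun_def scaleR_conv_of_real algebra_simps)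
  have key: "(LINT t|half_line. of_real (test_fun p q t) * R t) = 0" if pq: "0 < p" "p < q" for p q
  proof -
    have i: "integrable (half_line \<Otimes>\<^sub>M half_line) (\<lambda>(t, \<tau>). of_real (test_fun p q t) * (of_real (frac_kernel s 1 t \<tau>) * G \<tau>))"
    proof -
      have "(\<integral>\<^sup>+x. ennreal (norm ((\<lambda>(t, \<tau>). of_real (test_fun p q t) * (of_real (frac_kernel s 1 t \<tau>) * G \<tau>)) x)) \<partial>(half_line \<Otimes>\<^sub>M half_line))
        = (\<integral>\<^sup>+t. \<integral>\<^sup>+\<tau>. ennreal \<bar>test_fun p q t\<bar> * ennreal (\<bar>frac_kernel s 1 t \<tau>\<bar> * norm (G \<tau>)) \<partial>half_line \<partial>half_line)"
        by (subst half_line.nn_integral_fst[symmetric]) (simp_all add: norm_mult ennreal_mult)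
      also have "\<dots> = (\<integral>\<^sup>+t. ennreal \<bar>test_fun p q t\<bar> * W t \<partial>half_line)"
        unfolding W_def by (intro nn_integral_cong nn_integral_cmult) measurable
      also have "\<dots> \<le> (\<integral>\<^sup>+t. ennreal (1 / (q - p)) * (indicator {p<..<q} t * W t) + indicator {1<..<2} t * W t \<partial>half_line)"
      proof (rule nn_integral_mono)
        fix t
        have "ennreal \<bar>test_fun p q t\<bar> \<le> ennreal (1 / (q - p)) * indicator {p<..<q} t + indicator {1<..<2} t"
        proof -
          have "ennreal \<bar>test_fun p q t\<bar> \<le> ennreal (1 / (q - p) * indicator {p<..<q} t + indicator {1<..<2} t)"
            unfolding test_fun_def using pq divide_pos_pos[of 1 "q - p"]
            by (intro ennreal_leI) (auto simp: indicator_def abs_if simp del: zero_less_divide_1_iff intro: less_imp_le)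
          also have "\<dots> = ennreal (1 / (q - p)) * indicator {p<..<q} t + indicator {1<..<2} t"
            using pq by (auto simp: indicator_def)
          finally show ?thesis .
        qed
        from mult_right_mono[OF this, of "W t"] show "ennreal \<bar>test_fun p q t\<bar> * W t \<le> ennreal (1 / (q - p)) * (indicator {p<..<q} t * W t) + indicator {1<..<2} t * W t"
          by (simp add: algebra_simps)
      qed
      also have "\<dots> = ennreal (1 / (q - p)) * (\<integral>\<^sup>+t. indicator {p<..<q} t * W t \<partial>half_line) + (\<integral>\<^sup>+t. indicator {1<..<2} t * W t \<partial>half_line)"
        by (subst nn_integral_add) (auto simp: nn_integral_cmult)
      also have "\<dots> < \<infinity>" using W_loc[OF pq] W_loc[of 1 2] by (simp add: ennreal_mult_less_top)
      finally show ?thesis by (simp add: integrable_iff_bounded)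
    qed
    have "(LINT t|half_line. of_real (test_fun p q t) * frac_op s 1 G t) =
        (LINT t|half_line. LINT \<tau>|half_line. of_real (test_fun p q t) * (of_real (frac_kernel s 1 t \<tau>) * G \<tau>))"
      unfolding frac_op_def by simp
    also have "\<dots> = (LINT \<tau>|half_line. LINT t|half_line. of_real (test_fun p q t) * (of_real (frac_kernel s 1 t \<tau>) * G \<tau>))"
      by (rule half_line_pair.Fubini_integral[OF i, symmetric])
    also have "\<dots> = (LINT \<tau>|half_line. of_real (LINT t|half_line. frac_kernel s 0 t \<tau> * test_fun p q t) * G \<tau>)"
    proof (rule Bochner_Integration.integral_cong[OF refl])
      fix \<tau> assume "\<tau> \<in> space half_line"
      then have \<tau>: "\<tau> > 0" by simp
      have "(LINT t|half_line. of_real (test_fun p q t) * (of_real (frac_kernel s 1 t \<tau>) * G \<tau>)) =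
          (LINT t|half_line. complex_of_real (frac_kernel s 1 t \<tau> * test_fun p q t)) * G \<tau>"
        by (subst integral_mult_left_zero[symmetric]) (simp add: mult_ac)
      also have "(LINT t|half_line. complex_of_real (frac_kernel s 1 t \<tau> * test_fun p q t)) = of_real (LINT t|half_line. frac_kernel s 1 t \<tau> * test_fun p q t)"
        by (rule integral_complex_of_real)
      \<comment> \<open>The two kernels differ by a function of \<tau> alone, which integrates to 0
        against a function of mean zero.\<close>
      also have "(LINT t|half_line. frac_kernel s 1 t \<tau> * test_fun p q t) = (LINT t|half_line. frac_kernel s 0 t \<tau> * test_fun p q t - \<tau> powr (s - 1) * test_fun p q t)"
        by (simp add: frac_kernel_def algebra_simps)
      also have "\<dots> = (LINT t|half_line. frac_kernel s 0 t \<tau> * test_fun p q t)"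
        using frac_kernel_test_int[OF s \<tau> pq] integrable_test_fun[OF pq] integral_test_fun[OF pq] by simp
      finally show "(LINT t|half_line. of_real (test_fun p q t) * (of_real (frac_kernel s 1 t \<tau>) * G \<tau>)) =
        of_real (LINT t|half_line. frac_kernel s 0 t \<tau> * test_fun p q t) * G \<tau>" .
    qed
    also have "\<dots> = (LINT t|half_line. of_real (test_fun p q t) * F t)" by (rule weak[OF pq, symmetric])
    finally have eq: "(LINT t|half_line. of_real (test_fun p q t) * frac_op s 1 G t) = (LINT t|half_line. of_real (test_fun p q t) * F t)" .
    have "integrable half_line (\<lambda>t. of_real (test_fun p q t) * F t)" "integrable half_line (\<lambda>t. of_real (test_fun p q t) * frac_op s 1 G t)"
      unfolding test_eq using F_loc[OF pq] F_loc[of 1 2] T_loc[OF pq] T_loc[of 1 2] by (simp_all del: scaleR_scaleR)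
    then show ?thesis unfolding R_def using eq by (simp add: right_diff_distrib)
  qed
  \<comment> \<open>The vanishing of the tested difference says that R has the same mean over (p, q)
    as over (1, 2), so R equals its mean over (1, 2) almost everywhere.\<close>
  define c where "c = (LINT t|half_line. indicator {1<..<2} t *\<^sub>R R t)"
  have "AE t in half_line. R t - c = 0"
  proof (rule AE_eq_0_of_interval_integrals)
    fix p q :: real assume pq: "0 < p" "p < q"
    have ic: "integrable half_line (\<lambda>t. indicator {p<..<q} t *\<^sub>R c)" "(LINT t|half_line. indicator {p<..<q} t *\<^sub>R c) = (q - p) *\<^sub>R c"
    proof -
      have eq: "(\<lambda>t. indicator {0<..} t *\<^sub>R indicator {p<..<q} t *\<^sub>R c) = (\<lambda>t. indicator {p<..<q} t *\<^sub>R c)"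
        using pq by (auto simp: indicator_def)
      show "integrable half_line (\<lambda>t. indicator {p<..<q} t *\<^sub>R c)" "(LINT t|half_line. indicator {p<..<q} t *\<^sub>R c) = (q - p) *\<^sub>R c"
        using pq unfolding integrable_half_line_iff integral_half_line eq by (auto intro!: integrable_scaleR_left)
    qed
    show "integrable half_line (\<lambda>t. indicator {p<..<q} t *\<^sub>R (R t - c))"
      using R_loc[OF pq] ic by (simp add: scaleR_diff_right)
    have "(LINT t|half_line. of_real (test_fun p q t) * R t) = (1 / (q - p)) *\<^sub>R (LINT t|half_line. indicator {p<..<q} t *\<^sub>R R t) - c"
      unfolding test_eq c_def using R_loc[OF pq] R_loc[of 1 2] by (simp del: scaleR_scaleR)
    then have "c = (1 / (q - p)) *\<^sub>R (LINT t|half_line. indicator {p<..<q} t *\<^sub>R R t)"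
      unfolding key[OF pq] by (metis right_minus_eq)
    then have "(q - p) *\<^sub>R c = ((q - p) * (1 / (q - p))) *\<^sub>R (LINT t|half_line. indicator {p<..<q} t *\<^sub>R R t)"
      by (simp only: scaleR_scaleR)
    also have "(q - p) * (1 / (q - p)) = 1" using pq by simp
    finally have "(LINT t|half_line. indicator {p<..<q} t *\<^sub>R R t) = (q - p) *\<^sub>R c" by (simp only: scaleR_one)
    then show "(LINT t|half_line. indicator {p<..<q} t *\<^sub>R (R t - c)) = 0"
      using R_loc[OF pq] ic by (simp add: scaleR_diff_right)
  qed
  then have Rc: "AE t in half_line. F t - frac_op s 1 G t = c * of_real (t ^ 0)"
    unfolding R_def by eventually_elim simp
  moreover have "c = 0"
  proof (rule monomial_eq_0[OF _ _ _ _ Rc])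
    show "(\<integral>\<^sup>+t. ennreal (t powr (- 2 * (1 / 2) - 1) * (norm (F t))\<^sup>2) \<partial>half_line) < \<infinity>"
      using d by (intro weighted_F) auto
    show "(\<integral>\<^sup>+t. ennreal (t powr (- 2 * (1 / 2) - 1) * (norm (frac_op s 1 G t))\<^sup>2) \<partial>half_line) < \<infinity>"
      by (rule weighted_frac_op[OF \<mu>])
  qed measurable
  ultimately show ?thesis by simp
qed

lemma integrable_moment_G: "s - 1 - real k < d - 1 / 2 \<Longrightarrow> integrable half_line (\<lambda>\<tau>. of_real (\<tau> powr (s - 1 - real k)) * G \<tau>)"
  by (rule flat_class_integrable[OF G])

lemma frac_op_Suc:
  assumes i: "integrable half_line (\<lambda>\<tau>. of_real (frac_kernel s m t \<tau>) * G \<tau>)"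
    and k: "s - 1 - real m < d - 1 / 2"
  shows "integrable half_line (\<lambda>\<tau>. of_real (frac_kernel s (Suc m) t \<tau>) * G \<tau>)"
    "frac_op s m G t - frac_op s (Suc m) G t =
      of_real (binom_coeff s m) * (LINT \<tau>|half_line. of_real (\<tau> powr (s - 1 - real m)) * G \<tau>) * of_real (t ^ m)"
proof -
  have eq: "of_real (frac_kernel s (Suc m) t \<tau>) * G \<tau> = of_real (frac_kernel s m t \<tau>) * G \<tau> -
      of_real (binom_coeff s m) * of_real (t ^ m) * (of_real (\<tau> powr (s - 1 - real m)) * G \<tau>)" for \<tau>
    by (simp add: frac_kernel_def algebra_simps)
  show "integrable half_line (\<lambda>\<tau>. of_real (frac_kernel s (Suc m) t \<tau>) * G \<tau>)"
    unfolding eq using i integrable_moment_G[OF k] by (intro Bochner_Integration.integrable_diff integrable_mult_right)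
  show "frac_op s m G t - frac_op s (Suc m) G t =
      of_real (binom_coeff s m) * (LINT \<tau>|half_line. of_real (\<tau> powr (s - 1 - real m)) * G \<tau>) * of_real (t ^ m)"
    unfolding frac_op_def eq using i integrable_moment_G[OF k]
    by (subst Bochner_Integration.integral_diff) (auto intro!: integrable_mult_right)
qed

text \<open>Subtracting one more Taylor term changes the fractional integral by a multiple of t^(m +
  1). F and the new integral both lie in the weighted space for \<mu> = m + 3/2, so the coefficient,
  a moment of G, is zero.\<close>

lemma F_eq_frac_op_step:
  assumes F_eq: "AE t in half_line. F t = frac_op s (Suc m) G t"
  shows "(LINT \<tau>|half_line. of_real (\<tau> powr (s - 1 - real (Suc m))) * G \<tau>) = 0"
    "AE t in half_line. F t = frac_op s (Suc (Suc m)) G t"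
proof -
  define M where "M = (LINT \<tau>|half_line. of_real (\<tau> powr (s - 1 - real (Suc m))) * G \<tau>)"
  have 1: "AE t in half_line. integrable half_line (\<lambda>\<tau>. of_real (frac_kernel s (Suc m) t \<tau>) * G \<tau>)"
    by (rule AE_frac_integrable[of "real m + 1 / 2"]) (use s d quarter_dist in auto)
  have k: "s - 1 - real (Suc m) < d - 1 / 2" using s d by simp
  have eq: "AE t in half_line. F t - frac_op s (Suc (Suc m)) G t = (of_real (binom_coeff s (Suc m)) * M) * of_real (t ^ Suc m)"
    using F_eq 1
  proof eventually_elim
    case (elim t)
    then show ?case using frac_op_Suc(2)[OF elim(2) k] unfolding M_def by simp
  qed
  have c0: "of_real (binom_coeff s (Suc m)) * M = 0"
  proof (rule monomial_eq_0[OF _ _ _ _ eq])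
    show "(\<integral>\<^sup>+t. ennreal (t powr (- 2 * (real (Suc m) + 1 / 2) - 1) * (norm (F t))\<^sup>2) \<partial>half_line) < \<infinity>"
      using d by (intro weighted_F) auto
    show "(\<integral>\<^sup>+t. ennreal (t powr (- 2 * (real (Suc m) + 1 / 2) - 1) * (norm (frac_op s (Suc (Suc m)) G t))\<^sup>2) \<partial>half_line) < \<infinity>"
      by (rule weighted_frac_op[OF _ _ quarter_dist]) (use s d in auto)
  qed measurable
  then have "M = 0" using binom_coeff_pos[OF s(2), of "Suc m"] by simp
  then show "(LINT \<tau>|half_line. of_real (\<tau> powr (s - 1 - real (Suc m))) * G \<tau>) = 0" by (simp add: M_def)
  show "AE t in half_line. F t = frac_op s (Suc (Suc m)) G t" using eq unfolding c0 by eventually_elim simp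
qed

lemma F_eq_frac_op: "AE t in half_line. F t = frac_op s (Suc m) G t"
proof (induction m)
  case 0
  show ?case using F_eq_frac_op_1 by simp
qed (rule F_eq_frac_op_step(2))

lemma moments_eq_0: "(LINT \<tau>|half_line. of_real (\<tau> powr (s - 1 - real (Suc m))) * G \<tau>) = 0"
  by (rule F_eq_frac_op_step(1)[OF F_eq_frac_op])

text \<open>For negative exponents \<mu> = N - d Schur's test admits only m = 0, so the first Taylor
  term must be restored. Its coefficient is a constant in t and vanishes by comparison in the weight
  for this \<mu>; the moment exists because the hypotheses force d >= 3/4.\<close>

lemma F_eq_frac_op_0:
  assumes N: "1 / 2 \<le> N" "N - d \<le> - 1 / 4"
  shows "AE t in half_line. F t = frac_op s 0 G t"
proof -
  define M where "M = (LINT \<tau>|half_line. of_real (\<tau> powr (s - 1 - real 0)) * G \<tau>)"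
  have \<mu>: "N - d < real 0" "(0::nat) = 0 \<or> real 0 - 1 < N - d" "\<And>k :: nat. 1 / 4 \<le> \<bar>real k - (N - d)\<bar>" "2 * s - 2 * (N - d) - 1 \<le> 2 * d"
    using N s by (auto simp: abs_if)
  have k: "s - 1 - real 0 < d - 1 / 2" using s N by simp
  have eq: "AE t in half_line. frac_op s 0 G t - F t = (of_real (binom_coeff s 0) * M) * of_real (t ^ 0)"
    using F_eq_frac_op[of 0] AE_frac_integrable[OF \<mu>]
  proof eventually_elim
    case (elim t)
    then show ?case using frac_op_Suc(2)[OF elim(2) k] unfolding M_def by simp
  qed
  have "of_real (binom_coeff s 0) * M = 0"
  proof (rule monomial_eq_0[OF _ _ _ _ eq])
    show "(\<integral>\<^sup>+t. ennreal (t powr (- 2 * (N - d) - 1) * (norm (F t))\<^sup>2) \<partial>half_line) < \<infinity>"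
      using N by (intro weighted_F) auto
    show "(\<integral>\<^sup>+t. ennreal (t powr (- 2 * (N - d) - 1) * (norm (frac_op s 0 G t))\<^sup>2) \<partial>half_line) < \<infinity>"
      by (rule weighted_frac_op[OF \<mu>])
  qed measurable
  then have "AE t in half_line. frac_op s 0 G t - F t = 0" using eq by simp
  then show ?thesis by eventually_elim simp
qed

text \<open>Schur's test for the least natural number m above N - d, F being the fractional integral
  for each such m. The constant depends on N and d only through N - d, which may have either
  sign.\<close>

theorem Carleman:
  assumes N: "1 / 2 \<le> N" and dist: "\<And>k :: nat. 1 / 4 \<le> \<bar>real k - (N - d)\<bar>"
  shows "(\<integral>\<^sup>+t. ennreal (t powr (- 2 * (N - d) - 1) * (norm (F t))\<^sup>2) \<partial>half_line)
    \<le> (kernel_norm s (N - d))\<^sup>2 * (\<integral>\<^sup>+t. ennreal (t powr (2 * s - 2 * (N - d) - 1) * (norm (G t))\<^sup>2) \<partial>half_line)"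
proof -
  obtain m where m: "N - d < real m" "m = 0 \<or> real m - 1 < N - d" and F_eq: "AE t in half_line. F t = frac_op s m G t"
  proof (cases "N - d < 0")
    case True
    then have "N - d \<le> - 1 / 4" using dist[of 0] by simp
    then show ?thesis using that[of 0] F_eq_frac_op_0[OF N] True by simp
  next
    case False
    define m where "m = nat \<lfloor>N - d\<rfloor>"
    have m: "real m \<le> N - d" "N - d < real m + 1" using False by (auto simp: m_def)
    moreover have "real m \<noteq> N - d" using dist[of m] by auto
    ultimately show ?thesis using that[of "Suc m"] F_eq_frac_op[of m] by simp
  qed
  have "(\<integral>\<^sup>+t. ennreal (t powr (- 2 * (N - d) - 1) * (norm (F t))\<^sup>2) \<partial>half_line) =
      (\<integral>\<^sup>+t. ennreal (t powr (- 2 * (N - d) - 1) * (norm (frac_op s m G t))\<^sup>2) \<partial>half_line)"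
    using F_eq by (intro nn_integral_cong_AE) (auto elim: AE_mp)
  also have "\<dots> \<le> (kernel_norm s (N - d))\<^sup>2 * (\<integral>\<^sup>+t. ennreal (t powr (2 * s - 2 * (N - d) - 1) * (norm (G t))\<^sup>2) \<partial>half_line)"
    by (rule frac_op_weighted[OF m])
  finally show ?thesis .
qed

text \<open>The moments of G with powers s - 1 - (k + 1) all vanish, that is, \<open>h\<close> has
  vanishing moments in 1 / \<tau>. Since G = 0 below T this variable is bounded where it matters, so
  the moments determine \<open>h\<close>.\<close>

theorem unique_continuation:
  assumes T: "T > 0" and zero: "AE t in half_line. t < T \<longrightarrow> G t = 0"
  shows "AE t in half_line. G t = 0" "AE t in half_line. F t = 0"
proof -
  define h where "h \<tau> = of_real (\<tau> powr (s - 2)) * G \<tau>" for \<tau>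
  define X where "X \<tau> = (if T \<le> \<tau> then 1 / \<tau> else 0)" for \<tau> :: real
  define P where "P = restrict_space half_line {T..}"
  have Ts: "{T..} \<inter> space half_line \<in> sets half_line"
    using T unfolding sets_half_line by (auto simp: sets_restrict_space_iff)
  have [measurable]: "h \<in> borel_measurable half_line" unfolding h_def by measurable
  have spP: "space P = {T..}" using T by (auto simp: P_def space_restrict_space)
  have hP [measurable]: "h \<in> borel_measurable P" unfolding P_def by (rule measurable_restrict_space1) measurable
  have hi: "integrable half_line h"
    unfolding h_def using integrable_moment_G[of 1] s d by (simp add: algebra_simps)
  have intP: "(LINT \<tau>|P. f \<tau>) = (LINT \<tau>|half_line. indicator {T..} \<tau> *\<^sub>R f \<tau>)" for f :: "real \<Rightarrow> complex"
    unfolding P_def by (rule integral_restrict_space[OF Ts])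
  \<comment> \<open>On P the variable 1 / \<tau> ranges in (0, 1 / T], so its exponentials are
    bounded. Y inverts it; the default T outside this range keeps the values of Y in P.\<close>
  have "AE \<tau> in P. h \<tau> = 0"
  proof (rule AE_eq_0_of_moments_eq_0[where X = "\<lambda>\<tau>. 1 / \<tau>" and Y = "\<lambda>r. if 0 < r \<and> r \<le> 1 / T then 1 / r else T"])
    show "(\<lambda>r. if 0 < r \<and> r \<le> 1 / T then 1 / r else T) \<in> borel \<rightarrow>\<^sub>M P"
    proof -
      have "(\<lambda>r. if 0 < r \<and> r \<le> 1 / T then 1 / r else T) \<in> borel \<rightarrow>\<^sub>M restrict_space (restrict_space lborel {0<..}) {T..}"
        using T by (intro measurable_restrict_space2) (auto simp: field_simps)
      then show ?thesis by (simp add: P_def half_line_def)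
    qed
    show "(if 0 < 1 / \<tau> \<and> 1 / \<tau> \<le> 1 / T then 1 / (1 / \<tau>) else T) = \<tau>" if "\<tau> \<in> space P" for \<tau>
      using that T by (auto simp: spP field_simps)
    show "(\<lambda>\<tau>. 1 / \<tau>) \<in> borel_measurable P"
      unfolding P_def by (rule measurable_restrict_space1) measurable
    show "integrable P (\<lambda>\<tau>. norm (h \<tau>) * exp (c * \<bar>1 / \<tau>\<bar>))" for c
    proof -
      have "integrable half_line (\<lambda>\<tau>. indicator {T..} \<tau> *\<^sub>R (norm (h \<tau>) * exp (c * \<bar>1 / \<tau>\<bar>)))"
      proof (rule Bochner_Integration.integrable_bound[OF integrable_mult_right[OF integrable_norm[OF hi], of "exp (\<bar>c\<bar> / T)"]])
        show "AE \<tau> in half_line. norm (indicator {T..} \<tau> *\<^sub>R (norm (h \<tau>) * exp (c * \<bar>1 / \<tau>\<bar>))) \<le> norm (exp (\<bar>c\<bar> / T) * norm (h \<tau>))"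
        proof (rule AE_I2)
          fix \<tau> assume "\<tau> \<in> space half_line"
          have "exp (c * \<bar>1 / \<tau>\<bar>) \<le> exp (\<bar>c\<bar> / T)" if "T \<le> \<tau>"
          proof -
            have "c * \<bar>1 / \<tau>\<bar> \<le> \<bar>c\<bar> * (1 / T)"
              using that T by (intro mult_mono) (auto simp: field_simps)
            then show ?thesis by simp
          qed
          then show "norm (indicator {T..} \<tau> *\<^sub>R (norm (h \<tau>) * exp (c * \<bar>1 / \<tau>\<bar>))) \<le> norm (exp (\<bar>c\<bar> / T) * norm (h \<tau>))"
            by (auto simp: indicator_def abs_mult mult.commute intro!: mult_left_mono)
        qed
        have "(\<lambda>\<tau>. indicator {T..} \<tau> :: real) \<in> borel_measurable half_line" by (rule borel_measurable_half_line) simp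
        then show "(\<lambda>\<tau>. indicator {T..} \<tau> *\<^sub>R (norm (h \<tau>) * exp (c * \<bar>1 / \<tau>\<bar>))) \<in> borel_measurable half_line" by measurable
      qed
      then show ?thesis unfolding P_def by (subst integrable_restrict_space[OF Ts])
    qed
    show "(LINT \<tau>|P. h \<tau> * complex_of_real ((1 / \<tau>) ^ k)) = 0" for k
    proof -
      have "(LINT \<tau>|P. h \<tau> * complex_of_real ((1 / \<tau>) ^ k)) = (LINT \<tau>|half_line. indicator {T..} \<tau> *\<^sub>R (h \<tau> * complex_of_real ((1 / \<tau>) ^ k)))"
        by (rule intP)
      also have "\<dots> = (LINT \<tau>|half_line. of_real (\<tau> powr (s - 1 - real (Suc k))) * G \<tau>)"
      proof (rule integral_cong_AE)
        have "(\<lambda>\<tau>. indicator {T..} \<tau> :: real) \<in> borel_measurable half_line" by (rule borel_measurable_half_line) simp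
        then show "(\<lambda>\<tau>. indicator {T..} \<tau> *\<^sub>R (h \<tau> * complex_of_real ((1 / \<tau>) ^ k))) \<in> borel_measurable half_line" by measurable
        show "AE \<tau> in half_line. indicator {T..} \<tau> *\<^sub>R (h \<tau> * complex_of_real ((1 / \<tau>) ^ k)) = of_real (\<tau> powr (s - 1 - real (Suc k))) * G \<tau>"
          using zero
        proof (rule AE_mp, intro AE_I2 impI)
          fix \<tau> assume "\<tau> \<in> space half_line" and z: "\<tau> < T \<longrightarrow> G \<tau> = 0"
          then have \<tau>: "\<tau> > 0" by simp
          have "\<tau> powr (s - 2) * (1 / \<tau>) ^ k = \<tau> powr (s - 2) * \<tau> powr (- real k)"
            using \<tau> by (simp add: powr_minus powr_realpow power_divide divide_inverse power_inverse)
          also have "\<dots> = \<tau> powr (s - 1 - real (Suc k))" by (simp add: powr_add[symmetric] algebra_simps)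
          finally have "\<tau> powr (s - 1 - real (Suc k)) = \<tau> powr (s - 2) * (1 / \<tau>) ^ k" ..
          then show "indicator {T..} \<tau> *\<^sub>R (h \<tau> * complex_of_real ((1 / \<tau>) ^ k)) = of_real (\<tau> powr (s - 1 - real (Suc k))) * G \<tau>"
            using z by (auto simp: indicator_def h_def mult_ac)
        qed
      qed measurable
      also have "\<dots> = 0" by (rule moments_eq_0)
      finally show ?thesis .
    qed
  qed measurable
  then have "AE \<tau> in half_line. T \<le> \<tau> \<longrightarrow> h \<tau> = 0"
    unfolding P_def using Ts by (subst (asm) AE_restrict_space_iff) auto
  then show G0: "AE t in half_line. G t = 0"
    using zero AE_space
  proof eventually_elim
    case (elim t)
    then show ?case by (cases "t < T") (auto simp: h_def)
  qed
  have "frac_op s 1 G t = 0" for t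
  proof -
    have "AE \<tau> in half_line. of_real (frac_kernel s 1 t \<tau>) * G \<tau> = 0" using G0 by eventually_elim simp
    then show ?thesis unfolding frac_op_def by (rule integral_eq_zero_AE)
  qed
  then show "AE t in half_line. F t = 0" using F_eq_frac_op_1 by simp
qed

end

section \<open>Laplace transforms\<close>

lemma half_line_Gamma_integral:
  assumes a: "a > 0" and l: "(l::real) > 0"
  shows "integrable half_line (\<lambda>t. t powr (a - 1) * exp (- l * t))"
    and "(LINT t|half_line. t powr (a - 1) * exp (- l * t)) = Gamma a / l powr a"
proof -
  have "ennreal (Gamma a) = (\<integral>\<^sup>+t. ennreal (indicator {0..} t * t powr (a - 1) / exp t) \<partial>lborel)"
    by (rule Gamma_conv_nn_integral_real[OF a])
  also have "\<dots> = ennreal \<bar>l\<bar> * (\<integral>\<^sup>+t. ennreal (indicator {0..} (0 + l * t) * (0 + l * t) powr (a - 1) / exp (0 + l * t)) \<partial>lborel)"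
    using l by (intro nn_integral_real_affine) auto
  also have "(\<integral>\<^sup>+t. ennreal (indicator {0..} (0 + l * t) * (0 + l * t) powr (a - 1) / exp (0 + l * t)) \<partial>lborel) =
      (\<integral>\<^sup>+t. ennreal (l powr (a - 1)) * ennreal (t powr (a - 1) * exp (- l * t)) \<partial>half_line)"
    unfolding nn_integral_half_line
  proof (rule nn_integral_cong)
    fix t :: real
    show "ennreal (indicator {0..} (0 + l * t) * (0 + l * t) powr (a - 1) / exp (0 + l * t)) =
      ennreal (l powr (a - 1)) * ennreal (t powr (a - 1) * exp (- l * t)) * indicator {0<..} t"
      using l by (cases "t > 0") (auto simp: indicator_def powr_mult exp_minus ennreal_mult[symmetric] divide_inverse mult_ac zero_le_mult_iff)
  qed
  also have "\<dots> = ennreal (l powr (a - 1)) * (\<integral>\<^sup>+t. ennreal (t powr (a - 1) * exp (- l * t)) \<partial>half_line)"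
    by (rule nn_integral_cmult) measurable
  finally have eq: "ennreal (Gamma a) = ennreal (l powr a) * (\<integral>\<^sup>+t. ennreal (t powr (a - 1) * exp (- l * t)) \<partial>half_line)"
    using l powr_add[of l 1 "a - 1"] by (simp add: mult.assoc[symmetric] ennreal_mult[symmetric])
  have pos: "ennreal (l powr a) \<noteq> 0" using l by simp
  define X where "X = (\<integral>\<^sup>+t. ennreal (t powr (a - 1) * exp (- l * t)) \<partial>half_line)"
  have Xfin: "X < \<infinity>"
  proof (rule ccontr)
    assume "\<not> X < \<infinity>"
    then have "X = \<infinity>" using top.not_eq_extremum[of X] by auto
    moreover have "ennreal (Gamma a) = ennreal (l powr a) * X" using eq unfolding X_def .
    ultimately show False using pos by (simp add: ennreal_mult_top)
  qed
  then show i: "integrable half_line (\<lambda>t. t powr (a - 1) * exp (- l * t))"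
    unfolding X_def by (simp add: integrable_iff_bounded)
  have "X = ennreal (LINT t|half_line. t powr (a - 1) * exp (- l * t))"
    unfolding X_def by (rule nn_integral_eq_integral[OF i]) simp
  moreover have "ennreal (Gamma a) = ennreal (l powr a) * X" unfolding X_def by (rule eq)
  ultimately have "ennreal (Gamma a) = ennreal (l powr a * (LINT t|half_line. t powr (a - 1) * exp (- l * t)))"
    by (simp only: ennreal_mult' powr_ge_zero)
  then have "Gamma a = l powr a * (LINT t|half_line. t powr (a - 1) * exp (- l * t))"
    using a by (subst (asm) ennreal_inj) (auto intro!: mult_nonneg_nonneg integral_nonneg_AE Gamma_real_pos less_imp_le)
  then show "(LINT t|half_line. t powr (a - 1) * exp (- l * t)) = Gamma a / l powr a"
    using l by (simp add: field_simps)
qed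

lemma gbinomial_minus_real: "((- a) gchoose k) * (- r) ^ k = pochhammer a k / fact k * r ^ k"
  for a r :: "'a :: field_char_0"
proof -
  have "((- a) gchoose k) * (- r) ^ k = ((-1) ^ k * (-1) ^ k) * (pochhammer a k / fact k * r ^ k)"
    unfolding gbinomial_pochhammer by (simp add: power_minus[of r])
  also have "(-1 :: 'a) ^ k * (-1) ^ k = 1" by (simp flip: power_mult_distrib)
  finally show ?thesis by simp
qed

text \<open>Both sides are power series in \<open>z\<close> around a large real centre, so the complex formula
  follows termwise from the real Gamma integral.\<close>

lemma half_line_Gamma_integral_complex:
  fixes z :: complex
  assumes s: "s > 0" and z: "Re z > 0"
  shows "integrable half_line (\<lambda>t. of_real (t powr (s - 1)) * exp (- z * of_real t))"
    and "(LINT t|half_line. of_real (t powr (s - 1)) * exp (- z * of_real t)) = of_real (Gamma s) * z powr (- of_real s)"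
proof -
  \<comment> \<open>Any l > |z|^2 / (2 Re z) satisfies |l - z| < l, because |l - z|^2 = l^2 - 2 l Re
    z + |z|^2; then z lies in the disc of convergence around l.\<close>
  define l where "l = ((norm z)\<^sup>2 + 1) / (2 * Re z) + 1"
  have l: "l > 0" using z by (simp add: l_def add_nonneg_pos)
  define w where "w = of_real l - z"
  have "(norm w)\<^sup>2 = l\<^sup>2 - 2 * l * Re z + (norm z)\<^sup>2"
    unfolding w_def cmod_power2 by (simp add: power2_diff)
  moreover have "2 * l * Re z > (norm z)\<^sup>2"
  proof -
    have "2 * l * Re z = (norm z)\<^sup>2 + 1 + 2 * Re z" using z by (simp add: l_def field_simps)
    then show ?thesis using z by simp
  qed
  ultimately have "(norm w)\<^sup>2 < l\<^sup>2" by linarith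
  then have w: "norm w < l" using l by (simp add: power2_less_imp_less)
  define f where "f k t = (w ^ k / fact k) * of_real (t powr (s + real k - 1) * exp (- l * t))" for k t
  have term_eq: "of_real (t powr (s - 1) * exp (- l * t)) * ((w * of_real t) ^ k /\<^sub>R fact k) = f k t" if "t > 0" for k t
  proof -
    have "t powr (s + real k - 1) = t powr (s - 1) * t ^ k"
      using that by (simp add: powr_realpow[symmetric] powr_add[symmetric] algebra_simps)
    then show ?thesis by (simp add: f_def power_mult_distrib scaleR_conv_of_real divide_inverse mult_ac)
  qed
  have sums: "(\<lambda>k. f k t) sums (of_real (t powr (s - 1)) * exp (- z * of_real t))" if t: "t > 0" for t
  proof -
    have "(\<lambda>k. of_real (t powr (s - 1) * exp (- l * t)) * ((w * of_real t) ^ k /\<^sub>R fact k)) sums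
        (of_real (t powr (s - 1) * exp (- l * t)) * exp (w * of_real t))"
      by (intro sums_mult exp_converges)
    also have "of_real (t powr (s - 1) * exp (- l * t)) * exp (w * of_real t) = of_real (t powr (s - 1)) * exp (- z * of_real t)"
      by (simp add: w_def exp_of_real[symmetric] exp_add[symmetric] algebra_simps)
    finally show ?thesis unfolding term_eq[OF t] .
  qed
  have gi: "integrable half_line (\<lambda>t. t powr (s + real k - 1) * exp (- l * t))"
    "(LINT t|half_line. t powr (s + real k - 1) * exp (- l * t)) = Gamma s * pochhammer s k / (l powr s * l ^ k)" for k
  proof -
    show "integrable half_line (\<lambda>t. t powr (s + real k - 1) * exp (- l * t))"
      using half_line_Gamma_integral(1)[of "s + real k" l] s l by simp
    have "Gamma (s + real k) = Gamma s * pochhammer s k"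
    proof -
      have "s \<notin> \<int>\<^sub>\<le>\<^sub>0" using s nonpos_Ints_nonpos[of s] by auto
      then show ?thesis using pochhammer_Gamma[of s k] Gamma_real_pos[OF s] by (simp add: field_simps)
    qed
    then show "(LINT t|half_line. t powr (s + real k - 1) * exp (- l * t)) = Gamma s * pochhammer s k / (l powr s * l ^ k)"
      using half_line_Gamma_integral(2)[of "s + real k" l] s l by (simp add: powr_add powr_realpow)
  qed
  have fi: "integrable half_line (f k)" for k
    unfolding f_def by (intro integrable_mult_right) (simp only: complex_of_real_integrable_eq gi(1))
  have f_int: "(LINT t|half_line. f k t) = of_real (Gamma s / l powr s) * (pochhammer (of_real s) k / fact k * (w / of_real l) ^ k)" for k
  proof -
    have "(LINT t|half_line. f k t) = (w ^ k / fact k) * of_real (Gamma s * pochhammer s k / (l powr s * l ^ k))"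
      unfolding f_def by (subst integral_mult_right_zero) (simp only: integral_complex_of_real gi(2))
    then show ?thesis by (simp add: power_divide pochhammer_of_real[symmetric] mult_ac)
  qed
  have f_norm: "(LINT t|half_line. norm (f k t)) = Gamma s / l powr s * (pochhammer s k / fact k * (norm w / l) ^ k)" for k
  proof -
    have "(LINT t|half_line. norm (f k t)) = (norm w ^ k / fact k) * (LINT t|half_line. t powr (s + real k - 1) * exp (- l * t))"
      unfolding f_def by (subst integral_mult_right_zero[symmetric]) (simp add: norm_mult norm_divide norm_power)
    then show ?thesis unfolding gi(2) by (simp add: power_divide mult_ac)
  qed
  have summ: "summable (\<lambda>k. LINT t|half_line. norm (f k t))"
  proof -
    have "\<bar>- (norm w / l)\<bar> < 1" using w l by (simp add: field_simps)
    from gen_binomial_real[OF this, of "- s"]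
    have "summable (\<lambda>k. pochhammer s k / fact k * (norm w / l) ^ k)"
      unfolding gbinomial_minus_real by (rule sums_summable)
    then show ?thesis unfolding f_norm by (rule summable_mult)
  qed
  have summ_AE: "AE t in half_line. summable (\<lambda>k. norm (f k t))"
  proof (rule AE_I2)
    fix t assume "t \<in> space half_line"
    then have t: "t > 0" by simp
    have "summable (\<lambda>k. norm (of_real (t powr (s - 1) * exp (- l * t)) * ((w * of_real t) ^ k /\<^sub>R fact k)))"
      unfolding norm_mult by (intro summable_mult summable_norm_exp)
    then show "summable (\<lambda>k. norm (f k t))" unfolding term_eq[OF t] .
  qed
  have lim_int: "integrable half_line (\<lambda>t. \<Sum>k. f k t)" "(\<lambda>k. LINT t|half_line. f k t) sums (LINT t|half_line. (\<Sum>k. f k t))"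
    using integrable_suminf[OF fi summ_AE summ] sums_integral[OF fi summ_AE summ] by auto
  have sum_eq: "(\<Sum>k. f k t) = of_real (t powr (s - 1)) * exp (- z * of_real t)" if "t \<in> space half_line" for t
    using sums[of t] that by (simp add: sums_iff)
  have "integrable half_line (\<lambda>t. \<Sum>k. f k t) \<longleftrightarrow> integrable half_line (\<lambda>t. of_real (t powr (s - 1)) * exp (- z * of_real t))"
    by (intro Bochner_Integration.integrable_cong sum_eq refl)
  then show "integrable half_line (\<lambda>t. of_real (t powr (s - 1)) * exp (- z * of_real t))" using lim_int(1) by simp
  have "(LINT t|half_line. (\<Sum>k. f k t)) = (LINT t|half_line. of_real (t powr (s - 1)) * exp (- z * of_real t))"
    by (intro Bochner_Integration.integral_cong sum_eq refl)
  then have 1: "(\<lambda>k. LINT t|half_line. f k t) sums (LINT t|half_line. of_real (t powr (s - 1)) * exp (- z * of_real t))"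
    using lim_int(2) by simp
  have nw: "norm (- (w / of_real l)) < 1" using w l by (simp add: norm_divide field_simps)
  have "(\<lambda>k. pochhammer (of_real s) k / fact k * (w / of_real l) ^ k) sums ((1 + - (w / of_real l)) powr (- of_real s))"
    using gen_binomial_complex[OF nw, of "- of_real s"] unfolding gbinomial_minus_real .
  then have 2: "(\<lambda>k. LINT t|half_line. f k t) sums (of_real (Gamma s / l powr s) * (1 + - (w / of_real l)) powr (- of_real s))"
    unfolding f_int by (rule sums_mult)
  have "1 + - (w / of_real l) = z / of_real l" using l by (simp add: w_def field_simps)
  moreover have "(z / of_real l) powr (- of_real s) = z powr (- of_real s) * of_real (l powr s)"
  proof -
    have z0: "z \<noteq> 0" using z by auto
    have Ln: "Ln (z / of_real l) = Ln z - of_real (ln l)" using l z0 by (simp add: Ln_divide_of_real)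
    have "(z / of_real l) powr (- of_real s) = exp (- of_real s * (Ln z - of_real (ln l)))"
      using z0 l unfolding powr_def Ln by simp
    also have "\<dots> = exp (- of_real s * Ln z) * exp (of_real (s * ln l))"
      by (simp add: exp_add[symmetric] algebra_simps)
    finally have "(z / of_real l) powr (- of_real s) = exp (- of_real s * Ln z) * exp (of_real (s * ln l))" .
    then show ?thesis using z0 l by (simp add: powr_def exp_of_real[symmetric])
  qed
  ultimately have "of_real (Gamma s / l powr s) * (1 + - (w / of_real l)) powr (- of_real s) = of_real (Gamma s) * z powr (- of_real s)"
    using l by simp
  then show "(LINT t|half_line. of_real (t powr (s - 1)) * exp (- z * of_real t)) = of_real (Gamma s) * z powr (- of_real s)"
    using sums_unique2[OF 1 2] by simp
qed

lemma half_line_shift: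
  fixes f :: "real \<Rightarrow> 'b::{banach, second_countable_topology}"
  assumes "0 \<le> t"
  shows "integrable half_line (\<lambda>\<tau>. if t < \<tau> then f (\<tau> - t) else 0) \<longleftrightarrow> integrable half_line f"
    "(LINT \<tau>|half_line. (if t < \<tau> then f (\<tau> - t) else 0)) = (LINT \<tau>|half_line. f \<tau>)"
proof -
  have eq: "indicator {0<..} \<tau> *\<^sub>R (if t < \<tau> then f (\<tau> - t) else 0) = indicator {0<..} (- t + 1 * \<tau>) *\<^sub>R f (- t + 1 * \<tau>)" for \<tau>
    using assms by (auto simp: indicator_def)
  show "integrable half_line (\<lambda>\<tau>. if t < \<tau> then f (\<tau> - t) else 0) \<longleftrightarrow> integrable half_line f"
    unfolding integrable_half_line_iff eq by (rule lborel_integrable_real_affine_iff[of 1 "\<lambda>\<tau>. indicator {0<..} \<tau> *\<^sub>R f \<tau>" "- t"]) simp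
  show "(LINT \<tau>|half_line. (if t < \<tau> then f (\<tau> - t) else 0)) = (LINT \<tau>|half_line. f \<tau>)"
    unfolding integral_half_line eq using lborel_integral_real_affine[of 1 "\<lambda>\<tau>. indicator {0<..} \<tau> *\<^sub>R f \<tau>" "- t"] by simp
qed

section \<open>Laplace transforms of the test functions\<close>

definition half_laplace :: "(real \<Rightarrow> real) \<Rightarrow> complex \<Rightarrow> complex" where
  "half_laplace f z = (LINT t|half_line. of_real (f t) * exp (- z * of_real t))"

text \<open>Up to the factor \<Gamma>(s), the Riemann-Liouville integral of order s of
  \<open>test_fun p q\<close>.\<close>

definition frac_test :: "real \<Rightarrow> real \<Rightarrow> real \<Rightarrow> real \<Rightarrow> real" where
  "frac_test s p q \<tau> = (LINT t|half_line. frac_kernel s 0 t \<tau> * test_fun p q t)"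

lemma frac_test_measurable [measurable]: "frac_test s p q \<in> borel_measurable borel"
  unfolding frac_test_def[abs_def] by measurable

lemma frac_kernel_0: "frac_kernel s 0 t \<tau> = (if t < \<tau> then (\<tau> - t) powr (s - 1) else 0)"
  by (simp add: frac_kernel_def)

lemma test_fun_eq_0: "t \<le> min p 1 \<Longrightarrow> test_fun p q t = 0"
  by (simp add: test_fun_def)

lemma frac_test_eq_0: "\<tau> \<le> min p 1 \<Longrightarrow> frac_test s p q \<tau> = 0"
  unfolding frac_test_def by (rule integral_eq_zero_AE, rule AE_I2) (auto simp: frac_kernel_0 test_fun_eq_0)

lemma abs_test_fun_le:
  assumes "p < q"
  shows "\<bar>test_fun p q t\<bar> \<le> 1 / (q - p) + 1"
  using assms divide_pos_pos[of 1 "q - p"]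
  unfolding test_fun_def by (auto simp: indicator_def abs_if simp del: zero_less_divide_1_iff intro: less_imp_le)

text \<open>The singularity is isolated in (\<tau> - 1, \<tau>): there the test function is bounded
  and the kernel has integral 1 / s; further away the kernel is at most 1 and the test function is
  integrable.\<close>

lemma frac_test_bounded:
  assumes s: "0 < s" "s < 1" and pq: "0 < p" "p < q"
  obtains B where "B \<ge> 0" "\<And>\<tau>. \<tau> > 0 \<Longrightarrow> \<bar>frac_test s p q \<tau>\<bar> \<le> B"
proof
  define A where "A = 1 / (q - p) + 1"
  define C where "C = (LINT t|half_line. \<bar>test_fun p q t\<bar>)"
  have A: "A \<ge> 0" using pq by (simp add: A_def)
  have C: "C \<ge> 0" unfolding C_def by (intro integral_nonneg_AE) auto
  show "A * (1 / s) + C \<ge> 0" using A C s by simp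
  fix \<tau> :: real assume \<tau>: "\<tau> > 0"
  have i1: "integrable lborel (\<lambda>t. indicator {\<tau> - 1<..<\<tau>} t * (\<tau> - t) powr (s - 1))"
    and e1: "(LINT t|lborel. indicator {\<tau> - 1<..<\<tau>} t * (\<tau> - t) powr (s - 1)) = 1 / s"
  proof -
    have n: "(\<integral>\<^sup>+t. ennreal (t powr (s - 1)) * indicator {..1} t \<partial>half_line) = ennreal (1 / s)"
      using s by (subst nn_integral_powr_0) auto
    have eq: "indicator {\<tau> - 1..<\<tau>} t * (\<tau> - t) powr (s - 1) = indicator {0<..1} (\<tau> + (-1) * t) * (\<tau> + (-1) * t) powr (s - 1)" for t
      by (auto simp: indicator_def)
    have hb: "has_bochner_integral lborel (\<lambda>t. indicator {0<..1} t * t powr (s - 1)) (1 / s)"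
    proof (rule has_bochner_integral_nn_integral)
      have "(\<integral>\<^sup>+t. ennreal (t powr (s - 1)) * indicator {..1} t \<partial>half_line) = (\<integral>\<^sup>+t. ennreal (indicator {0<..1} t * t powr (s - 1)) \<partial>lborel)"
        unfolding nn_integral_half_line by (intro nn_integral_cong) (auto simp: indicator_def)
      then show "(\<integral>\<^sup>+t. ennreal (indicator {0<..1} t * t powr (s - 1)) \<partial>lborel) = ennreal (1 / s)" using n by simp
    qed (use s in auto)
    have "has_bochner_integral lborel (\<lambda>t. indicator {0<..1} (\<tau> + (-1) * t) * (\<tau> + (-1) * t) powr (s - 1)) ((1 / s) /\<^sub>R \<bar>-1\<bar>)"
      using hb lborel_has_bochner_integral_real_affine_iff[of "-1" "\<lambda>t. indicator {0<..1} t * t powr (s - 1)" "1 / s" \<tau>] by simp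
    then have "has_bochner_integral lborel (\<lambda>t. indicator {\<tau> - 1..<\<tau>} t * (\<tau> - t) powr (s - 1)) (1 / s)"
      unfolding eq by simp
    moreover have "AE t in lborel. indicator {\<tau> - 1..<\<tau>} t * (\<tau> - t) powr (s - 1) = indicator {\<tau> - 1<..<\<tau>} t * (\<tau> - t) powr (s - 1)"
      using AE_lborel_singleton[of "\<tau> - 1"] by (rule AE_mp) (auto simp: indicator_def)
    ultimately have "has_bochner_integral lborel (\<lambda>t. indicator {\<tau> - 1<..<\<tau>} t * (\<tau> - t) powr (s - 1)) (1 / s)"
      by (subst has_bochner_integral_cong_AE[symmetric]) auto
    then show "integrable lborel (\<lambda>t. indicator {\<tau> - 1<..<\<tau>} t * (\<tau> - t) powr (s - 1))"
      "(LINT t|lborel. indicator {\<tau> - 1<..<\<tau>} t * (\<tau> - t) powr (s - 1)) = 1 / s"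
      by (auto simp: has_bochner_integral_iff)
  qed
  have i2: "integrable half_line (\<lambda>t. indicator {\<tau> - 1<..<\<tau>} t * (\<tau> - t) powr (s - 1))"
    unfolding integrable_half_line_iff
    by (rule Bochner_Integration.integrable_bound[OF i1]) (auto simp: indicator_def)
  have "\<bar>frac_test s p q \<tau>\<bar> \<le> (LINT t|half_line. \<bar>frac_kernel s 0 t \<tau> * test_fun p q t\<bar>)"
    unfolding frac_test_def by (rule integral_abs_bound)
  also have "\<dots> \<le> (LINT t|half_line. A * (indicator {\<tau> - 1<..<\<tau>} t * (\<tau> - t) powr (s - 1)) + \<bar>test_fun p q t\<bar>)"
  proof (rule integral_mono)
    show "integrable half_line (\<lambda>t. \<bar>frac_kernel s 0 t \<tau> * test_fun p q t\<bar>)"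
      by (intro integrable_abs frac_kernel_test_int s pq \<tau>)
    show "integrable half_line (\<lambda>t. A * (indicator {\<tau> - 1<..<\<tau>} t * (\<tau> - t) powr (s - 1)) + \<bar>test_fun p q t\<bar>)"
      by (intro Bochner_Integration.integrable_add integrable_mult_right integrable_abs i2 integrable_test_fun pq)
    fix t
    consider "\<tau> \<le> t" | "t < \<tau>" "\<tau> - 1 < t" | "t < \<tau>" "t \<le> \<tau> - 1" by linarith
    then show "\<bar>frac_kernel s 0 t \<tau> * test_fun p q t\<bar> \<le> A * (indicator {\<tau> - 1<..<\<tau>} t * (\<tau> - t) powr (s - 1)) + \<bar>test_fun p q t\<bar>"
    proof cases
      case 1
      then show ?thesis using A by (simp add: frac_kernel_0)
    next
      case 2
      have "(\<tau> - t) powr (s - 1) * \<bar>test_fun p q t\<bar> \<le> (\<tau> - t) powr (s - 1) * A"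
        unfolding A_def by (intro mult_left_mono abs_test_fun_le pq) auto
      then show ?thesis using 2 by (simp add: frac_kernel_0 abs_mult mult.commute add_increasing2)
    next
      case 3
      have "(\<tau> - t) powr (s - 1) \<le> 1 powr (s - 1)" using 3 s by (intro powr_mono2') auto
      then have "(\<tau> - t) powr (s - 1) * \<bar>test_fun p q t\<bar> \<le> 1 * \<bar>test_fun p q t\<bar>"
        by (intro mult_right_mono) auto
      then show ?thesis using 3 A by (simp add: frac_kernel_0 abs_mult add_increasing)
    qed
  qed
  also have "\<dots> = A * (LINT t|half_line. indicator {\<tau> - 1<..<\<tau>} t * (\<tau> - t) powr (s - 1)) + C"
    unfolding C_def using i2 integrable_test_fun[OF pq] by simp
  also have "(LINT t|half_line. indicator {\<tau> - 1<..<\<tau>} t * (\<tau> - t) powr (s - 1)) \<le> 1 / s"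
    unfolding integral_half_line e1[symmetric]
    by (rule integral_mono[OF i2[unfolded integrable_half_line_iff] i1]) (auto simp: indicator_def)
  finally show "\<bar>frac_test s p q \<tau>\<bar> \<le> A * (1 / s) + C" using A by (simp add: mult_left_mono)
qed

text \<open>Mean zero permits the kernel with one Taylor term subtracted. Taking \<mu> = s makes the
  weight in \<tau> trivial, so its integral over \<tau> is a multiple of t^s, which is bounded on
  the support of the test function.\<close>

lemma integrable_frac_test:
  assumes s: "0 < s" "s < 1" and pq: "0 < p" "p < q"
  shows "integrable half_line (frac_test s p q)"
proof -
  define \<delta> where "\<delta> = min s (1 - s) / 2"
  have \<delta>: "0 < \<delta>" "\<delta> \<le> 1 / 2" using s by (auto simp: \<delta>_def min_def)
  have dist: "\<delta> \<le> \<bar>real k - s\<bar>" for k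
  proof (cases k)
    case 0
    then show ?thesis using s by (simp add: \<delta>_def min_def)
  next
    case (Suc j)
    then have "real k - s \<ge> 1 - s" by simp
    then show ?thesis using s by (simp add: \<delta>_def min_def)
  qed
  have kn: "kernel_norm s s < \<infinity>" by (rule kernel_norm_finite[OF s _ _ \<delta> dist, of 1]) (use s in auto)
  have "(\<integral>\<^sup>+\<tau>. ennreal \<bar>frac_test s p q \<tau>\<bar> \<partial>half_line) \<le> (\<integral>\<^sup>+\<tau>. \<integral>\<^sup>+t. ennreal (\<bar>frac_kernel s 1 t \<tau>\<bar>) * ennreal \<bar>test_fun p q t\<bar> \<partial>half_line \<partial>half_line)"
  proof (rule nn_integral_mono)
    fix \<tau> assume "\<tau> \<in> space half_line"
    then have \<tau>: "\<tau> > 0" by simp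
    have i: "integrable half_line (\<lambda>t. frac_kernel s 1 t \<tau> * test_fun p q t)"
      and eq: "(LINT t|half_line. frac_kernel s 1 t \<tau> * test_fun p q t) = frac_test s p q \<tau>"
    proof -
      have e: "frac_kernel s 1 t \<tau> * test_fun p q t = frac_kernel s 0 t \<tau> * test_fun p q t - \<tau> powr (s - 1) * test_fun p q t" for t
        by (simp add: frac_kernel_def algebra_simps)
      show "integrable half_line (\<lambda>t. frac_kernel s 1 t \<tau> * test_fun p q t)"
        "(LINT t|half_line. frac_kernel s 1 t \<tau> * test_fun p q t) = frac_test s p q \<tau>"
        unfolding e frac_test_def
        using frac_kernel_test_int[OF s \<tau> pq] integrable_test_fun[OF pq] integral_test_fun[OF pq] by simp_all
    qed
    have "ennreal (norm (LINT t|half_line. frac_kernel s 1 t \<tau> * test_fun p q t)) \<le> (\<integral>\<^sup>+t. ennreal (norm (frac_kernel s 1 t \<tau> * test_fun p q t)) \<partial>half_line)"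
      by (rule integral_norm_bound_ennreal[OF i])
    then show "ennreal \<bar>frac_test s p q \<tau>\<bar> \<le> (\<integral>\<^sup>+t. ennreal (\<bar>frac_kernel s 1 t \<tau>\<bar>) * ennreal \<bar>test_fun p q t\<bar> \<partial>half_line)"
      unfolding eq by (simp add: abs_mult ennreal_mult)
  qed
  also have "\<dots> = (\<integral>\<^sup>+t. \<integral>\<^sup>+\<tau>. ennreal (\<bar>frac_kernel s 1 t \<tau>\<bar>) * ennreal \<bar>test_fun p q t\<bar> \<partial>half_line \<partial>half_line)"
    by (rule half_line_pair.Fubini') measurable
  also have "\<dots> = (\<integral>\<^sup>+t. kernel_norm s s * (ennreal (t powr s) * ennreal \<bar>test_fun p q t\<bar>) \<partial>half_line)"
  proof (rule nn_integral_cong)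
    fix t assume "t \<in> space half_line"
    then have t: "t > 0" by simp
    have "(\<integral>\<^sup>+\<tau>. ennreal (\<bar>frac_kernel s 1 t \<tau>\<bar> * \<tau> powr (s - s)) \<partial>half_line) = kernel_norm s s * ennreal (t powr s)"
      by (rule nn_integral_frac_kernel_snd[OF s _ _ t]) (use s in auto)
    moreover have "(\<integral>\<^sup>+\<tau>. ennreal (\<bar>frac_kernel s 1 t \<tau>\<bar> * \<tau> powr (s - s)) \<partial>half_line) = (\<integral>\<^sup>+\<tau>. ennreal (\<bar>frac_kernel s 1 t \<tau>\<bar>) \<partial>half_line)"
      by (rule nn_integral_cong) simp
    ultimately have e: "(\<integral>\<^sup>+\<tau>. ennreal (\<bar>frac_kernel s 1 t \<tau>\<bar>) \<partial>half_line) = kernel_norm s s * ennreal (t powr s)"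
      by (simp only:)
    show "(\<integral>\<^sup>+\<tau>. ennreal (\<bar>frac_kernel s 1 t \<tau>\<bar>) * ennreal \<bar>test_fun p q t\<bar> \<partial>half_line) = kernel_norm s s * (ennreal (t powr s) * ennreal \<bar>test_fun p q t\<bar>)"
      by (subst nn_integral_multc) (measurable, simp only: e mult.assoc)
  qed
  also have "\<dots> = kernel_norm s s * (\<integral>\<^sup>+t. ennreal (t powr s) * ennreal \<bar>test_fun p q t\<bar> \<partial>half_line)"
    by (rule nn_integral_cmult) measurable
  also have "\<dots> \<le> kernel_norm s s * (\<integral>\<^sup>+t. ennreal (max q 2 powr s) * ennreal (norm (test_fun p q t)) \<partial>half_line)"
  proof (intro mult_left_mono nn_integral_mono)
    fix t assume "t \<in> space half_line"
    then have "t > 0" by simp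
    then have "ennreal (t powr s) \<le> ennreal (max q 2 powr s) \<or> test_fun p q t = 0"
      using s by (auto simp: test_fun_def indicator_def intro!: ennreal_leI powr_mono2)
    then show "ennreal (t powr s) * ennreal \<bar>test_fun p q t\<bar> \<le> ennreal (max q 2 powr s) * ennreal (norm (test_fun p q t))"
      by (auto intro: mult_right_mono)
  qed simp
  also have "\<dots> = kernel_norm s s * (ennreal (max q 2 powr s) * (\<integral>\<^sup>+t. ennreal (norm (test_fun p q t)) \<partial>half_line))"
    by (subst nn_integral_cmult) auto
  also have "\<dots> < \<infinity>"
    using kn integrable_test_fun[OF pq] by (auto simp: integrable_iff_bounded ennreal_mult_less_top)
  finally show ?thesis by (simp add: integrable_iff_bounded)
qed

text \<open>A convolution becomes a product: for fixed t the Laplace transform of the shifted kernel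
  is exp (- z t) times \<Gamma>(s) z^-s.\<close>

lemma half_laplace_frac_test:
  assumes s: "0 < s" "s < 1" and pq: "0 < p" "p < q" and z: "Re z > 0"
  shows "half_laplace (frac_test s p q) z = of_real (Gamma s) * z powr (- of_real s) * half_laplace (test_fun p q) z"
proof -
  let ?E = "\<lambda>z t. exp (- z * of_real t)"
  have inner: "integrable half_line (\<lambda>\<tau>. of_real (frac_kernel s 0 t \<tau>) * ?E z \<tau>)"
    "(LINT \<tau>|half_line. of_real (frac_kernel s 0 t \<tau>) * ?E z \<tau>) = ?E z t * (of_real (Gamma s) * z powr (- of_real s))"
    if "t > 0" "Re z > 0" for t z
  proof -
    have eq: "of_real (frac_kernel s 0 t \<tau>) * ?E z \<tau> = ?E z t * (if t < \<tau> then of_real ((\<tau> - t) powr (s - 1)) * ?E z (\<tau> - t) else 0)" for \<tau>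
      by (simp add: frac_kernel_0 exp_add[symmetric] algebra_simps)
    show "integrable half_line (\<lambda>\<tau>. of_real (frac_kernel s 0 t \<tau>) * ?E z \<tau>)"
      unfolding eq using that half_line_Gamma_integral_complex(1)[OF s(1) that(2)] half_line_shift(1)[of t "\<lambda>\<tau>. of_real (\<tau> powr (s - 1)) * ?E z \<tau>"]
      by (intro integrable_mult_right) simp
    show "(LINT \<tau>|half_line. of_real (frac_kernel s 0 t \<tau>) * ?E z \<tau>) = ?E z t * (of_real (Gamma s) * z powr (- of_real s))"
      unfolding eq using that half_line_Gamma_integral_complex(2)[OF s(1) that(2)] half_line_shift(2)[of t "\<lambda>\<tau>. of_real (\<tau> powr (s - 1)) * ?E z \<tau>"]
      by (subst integral_mult_right_zero) simp
  qed
  have i: "integrable (half_line \<Otimes>\<^sub>M half_line) (\<lambda>(t, \<tau>). of_real (test_fun p q t) * (of_real (frac_kernel s 0 t \<tau>) * ?E z \<tau>))"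
  proof (rule half_line_pair.Fubini_integrable)
    show "(\<lambda>(t, \<tau>). of_real (test_fun p q t) * (of_real (frac_kernel s 0 t \<tau>) * ?E z \<tau>)) \<in> borel_measurable (half_line \<Otimes>\<^sub>M half_line)"
      by measurable
    show "AE t in half_line. integrable half_line (\<lambda>\<tau>. case (t, \<tau>) of (t, \<tau>) \<Rightarrow> of_real (test_fun p q t) * (of_real (frac_kernel s 0 t \<tau>) * ?E z \<tau>))"
      by (rule AE_I2) (use inner(1)[OF _ z] in \<open>auto intro!: integrable_mult_right\<close>)
    \<comment> \<open>The kernel is non-negative, so the norm of the integrand is the integrand at
      the real point Re z, and \<open>inner\<close> evaluates its integral.\<close>
    have nrm: "(LINT \<tau>|half_line. norm (of_real (frac_kernel s 0 t \<tau>) * ?E z \<tau>)) = exp (- Re z * t) * (Gamma s * Re z powr (- s))" if "t > 0" for t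
    proof -
      have "complex_of_real (LINT \<tau>|half_line. norm (of_real (frac_kernel s 0 t \<tau>) * ?E z \<tau>)) = (LINT \<tau>|half_line. of_real (norm (of_real (frac_kernel s 0 t \<tau>) * ?E z \<tau>)))"
        by (rule integral_complex_of_real[symmetric])
      also have "\<dots> = (LINT \<tau>|half_line. of_real (frac_kernel s 0 t \<tau>) * ?E (of_real (Re z)) \<tau>)"
        by (intro Bochner_Integration.integral_cong) (auto simp: norm_mult frac_kernel_0 exp_of_real[symmetric])
      also have "\<dots> = ?E (of_real (Re z)) t * (of_real (Gamma s) * of_real (Re z) powr (- of_real s))"
        by (rule inner(2)) (use that z in auto)
      also have "\<dots> = complex_of_real (exp (- Re z * t) * (Gamma s * Re z powr (- s)))"
        using z by (simp add: exp_of_real[symmetric] powr_of_real[symmetric])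
      finally show ?thesis by (simp only: of_real_eq_iff)
    qed
    have "integrable half_line (\<lambda>t. \<bar>test_fun p q t\<bar> * (exp (- Re z * t) * (Gamma s * Re z powr (- s))))"
    proof (rule Bochner_Integration.integrable_bound[OF integrable_mult_right[OF integrable_test_fun[OF pq], of "Gamma s * Re z powr (- s)"]])
      show "AE t in half_line. norm (\<bar>test_fun p q t\<bar> * (exp (- Re z * t) * (Gamma s * Re z powr (- s)))) \<le> norm (Gamma s * Re z powr (- s) * test_fun p q t)"
      proof (rule AE_I2)
        fix t assume "t \<in> space half_line"
        then have "exp (- Re z * t) \<le> 1" using z by simp
        then have "(\<bar>test_fun p q t\<bar> * \<bar>Gamma s * Re z powr (- s)\<bar>) * exp (- Re z * t) \<le> (\<bar>test_fun p q t\<bar> * \<bar>Gamma s * Re z powr (- s)\<bar>) * 1"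
          by (intro mult_left_mono) auto
        then show "norm (\<bar>test_fun p q t\<bar> * (exp (- Re z * t) * (Gamma s * Re z powr (- s)))) \<le> norm (Gamma s * Re z powr (- s) * test_fun p q t)"
          by (simp add: abs_mult mult_ac)
      qed
    qed measurable
    moreover have "integrable half_line (\<lambda>t. \<bar>test_fun p q t\<bar> * (exp (- Re z * t) * (Gamma s * Re z powr (- s)))) \<longleftrightarrow>
      integrable half_line (\<lambda>t. LINT \<tau>|half_line. norm (case (t, \<tau>) of (t, \<tau>) \<Rightarrow> complex_of_real (test_fun p q t) * (of_real (frac_kernel s 0 t \<tau>) * ?E z \<tau>)))"
    proof (rule Bochner_Integration.integrable_cong[OF refl])
      fix t assume "t \<in> space half_line"
      then have "t > 0" by simp
      have "(LINT \<tau>|half_line. norm (complex_of_real (test_fun p q t) * (of_real (frac_kernel s 0 t \<tau>) * ?E z \<tau>))) = \<bar>test_fun p q t\<bar> * (LINT \<tau>|half_line. norm (of_real (frac_kernel s 0 t \<tau>) * ?E z \<tau>))"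
        by (subst integral_mult_right_zero[symmetric]) (simp add: norm_mult)
      then show "\<bar>test_fun p q t\<bar> * (exp (- Re z * t) * (Gamma s * Re z powr (- s))) = (LINT \<tau>|half_line. norm (case (t, \<tau>) of (t, \<tau>) \<Rightarrow> complex_of_real (test_fun p q t) * (of_real (frac_kernel s 0 t \<tau>) * ?E z \<tau>)))"
        using nrm[OF \<open>t > 0\<close>] by simp
    qed
    ultimately show "integrable half_line (\<lambda>t. LINT \<tau>|half_line. norm (case (t, \<tau>) of (t, \<tau>) \<Rightarrow> complex_of_real (test_fun p q t) * (of_real (frac_kernel s 0 t \<tau>) * ?E z \<tau>)))"
      by simp
  qed
  have "half_laplace (frac_test s p q) z = (LINT \<tau>|half_line. LINT t|half_line. of_real (test_fun p q t) * (of_real (frac_kernel s 0 t \<tau>) * ?E z \<tau>))"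
  proof -
    have "of_real (frac_test s p q \<tau>) * ?E z \<tau> = (LINT t|half_line. of_real (test_fun p q t) * (of_real (frac_kernel s 0 t \<tau>) * ?E z \<tau>))" for \<tau>
      unfolding frac_test_def integral_complex_of_real[symmetric]
      by (subst integral_mult_left_zero[symmetric]) (simp add: mult_ac)
    then show ?thesis unfolding half_laplace_def by simp
  qed
  also have "\<dots> = (LINT t|half_line. LINT \<tau>|half_line. of_real (test_fun p q t) * (of_real (frac_kernel s 0 t \<tau>) * ?E z \<tau>))"
    by (rule half_line_pair.Fubini_integral[OF i])
  also have "\<dots> = (LINT t|half_line. (of_real (Gamma s) * z powr (- of_real s)) * (of_real (test_fun p q t) * ?E z t))"
  proof (rule Bochner_Integration.integral_cong[OF refl])
    fix t assume "t \<in> space half_line"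
    then have "t > 0" by simp
    show "(LINT \<tau>|half_line. of_real (test_fun p q t) * (of_real (frac_kernel s 0 t \<tau>) * ?E z \<tau>)) = (of_real (Gamma s) * z powr (- of_real s)) * (of_real (test_fun p q t) * ?E z t)"
      unfolding integral_mult_right_zero inner(2)[OF \<open>t > 0\<close> z] by (simp add: mult_ac)
  qed
  also have "\<dots> = of_real (Gamma s) * z powr (- of_real s) * half_laplace (test_fun p q) z"
    unfolding half_laplace_def by (rule integral_mult_right_zero)
  finally show ?thesis .
qed

section \<open>Dual caloric functions\<close>

lemma integral_interval_exp:
  fixes z :: complex
  assumes "z \<noteq> 0" "p < q"
  shows "integrable lborel (\<lambda>t. indicator {p<..<q} t *\<^sub>R exp (- z * of_real t))"
    "(LINT t|lborel. indicator {p<..<q} t *\<^sub>R exp (- z * of_real t)) = (exp (- z * of_real p) - exp (- z * of_real q)) / z"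
proof -
  have "set_integrable lborel {p..q} (\<lambda>t. exp (- z * of_real t))"
    by (intro borel_integrable_atLeastAtMost' continuous_intros)
  then have "set_integrable lborel {p<..<q} (\<lambda>t. exp (- z * of_real t))"
    by (rule set_integrable_subset) auto
  then show i: "integrable lborel (\<lambda>t. indicator {p<..<q} t *\<^sub>R exp (- z * of_real t))"
    by (simp add: set_integrable_def)
  have "(LBINT t=p..q. exp (- z * of_real t)) = (- exp (- z * of_real q) / z) - (- exp (- z * of_real p) / z)"
  proof (rule interval_integral_FTC_finite)
    show "continuous_on {min p q..max p q} (\<lambda>t. exp (- z * complex_of_real t))" by (intro continuous_intros)
    fix t assume "min p q \<le> t" "t \<le> max p q"
    have "((\<lambda>w. - exp (- z * w) / z) has_field_derivative exp (- z * of_real t)) (at (of_real t))"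
      using assms by (auto intro!: derivative_eq_intros)
    then have "((\<lambda>t. - exp (- z * of_real t) / z) has_vector_derivative exp (- z * of_real t)) (at t)"
      by (rule has_vector_derivative_real_field)
    then show "((\<lambda>t. - exp (- z * of_real t) / z) has_vector_derivative exp (- z * of_real t)) (at t within {min p q..max p q})"
      by (rule has_vector_derivative_at_within)
  qed
  moreover have "(LBINT t=p..q. exp (- z * of_real t)) = (LINT t|lborel. indicator {p<..<q} t *\<^sub>R exp (- z * of_real t))"
    using assms by (simp add: interval_lebesgue_integral_def set_lebesgue_integral_def)
  ultimately show "(LINT t|lborel. indicator {p<..<q} t *\<^sub>R exp (- z * of_real t)) = (exp (- z * of_real p) - exp (- z * of_real q)) / z"
    using assms by (simp add: field_simps)
qed

lemma half_laplace_test_fun: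
  assumes "z \<noteq> 0" "0 < p" "p < q"
  shows "half_laplace (test_fun p q) z =
    (exp (- z * of_real p) - exp (- z * of_real q)) / (of_real (q - p) * z) - (exp (- z * of_real 1) - exp (- z * of_real 2)) / z"
proof -
  have eq: "indicator {0<..} t *\<^sub>R (of_real (test_fun p q t) * exp (- z * of_real t)) =
      (1 / of_real (q - p)) * (indicator {p<..<q} t *\<^sub>R exp (- z * of_real t)) - indicator {1<..<2} t *\<^sub>R exp (- z * of_real t)" for t
    using assms by (auto simp: test_fun_def indicator_def algebra_simps)
  show ?thesis
    unfolding half_laplace_def integral_half_line eq
    using integral_interval_exp[OF assms(1,3)] integral_interval_exp[OF assms(1), of 1 2]
    by (simp only: Bochner_Integration.integral_diff integrable_mult_right integral_mult_right_zero) simp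
qed

text \<open>Each step contributes a difference of exponentials divided by z, taken at points not
  below min p 1.\<close>

lemma norm_half_laplace_test_fun:
  assumes z: "0 < Re z" and pq: "0 < p" "p < q"
  shows "norm (half_laplace (test_fun p q) z) \<le> (2 / (q - p) + 2) * exp (- min p 1 * Re z) / norm z"
proof -
  have z0: "z \<noteq> 0" using z by auto
  have e: "norm (exp (- z * of_real r)) \<le> exp (- min p 1 * Re z)" if "min p 1 \<le> r" for r
    using mult_right_mono[OF that, of "Re z"] z by simp
  have e2: "norm (exp (- z * of_real r) - exp (- z * of_real r')) \<le> 2 * exp (- min p 1 * Re z)" if "min p 1 \<le> r" "min p 1 \<le> r'" for r r'
    using norm_triangle_ineq4[of "exp (- z * of_real r)" "exp (- z * of_real r')"] e[OF that(1)] e[OF that(2)] by linarith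
  have "norm (half_laplace (test_fun p q) z) \<le> norm ((exp (- z * of_real p) - exp (- z * of_real q)) / (of_real (q - p) * z)) + norm ((exp (- z * of_real 1) - exp (- z * of_real 2)) / z)"
    unfolding half_laplace_test_fun[OF z0 pq] by (rule norm_triangle_ineq4)
  also have "\<dots> = norm (exp (- z * of_real p) - exp (- z * of_real q)) / ((q - p) * norm z) + norm (exp (- z * of_real 1) - exp (- z * of_real 2)) / norm z"
    using pq by (simp only: norm_divide norm_mult norm_of_real)
  also have "\<dots> \<le> 2 * exp (- min p 1 * Re z) / ((q - p) * norm z) + 2 * exp (- min p 1 * Re z) / norm z"
    using pq by (intro add_mono divide_right_mono e2) auto
  also have "\<dots> = (2 / (q - p) + 2) * exp (- min p 1 * Re z) / norm z"
    using pq z0 by (simp add: field_simps)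
  finally show ?thesis .
qed

lemma norm_half_laplace_le:
  assumes f: "integrable half_line f" and zero: "\<And>t. t \<le> l \<Longrightarrow> f t = 0" and z: "0 < Re z"
  shows "norm (half_laplace f z) \<le> exp (- l * Re z) * (LINT t|half_line. \<bar>f t\<bar>)"
proof -
  have "norm (half_laplace f z) \<le> (LINT t|half_line. norm (of_real (f t) * exp (- z * of_real t)))"
    unfolding half_laplace_def by (rule integral_norm_bound)
  also have "\<dots> \<le> (LINT t|half_line. exp (- l * Re z) * \<bar>f t\<bar>)"
  proof (rule integral_mono_AE')
    show "integrable half_line (\<lambda>t. exp (- l * Re z) * \<bar>f t\<bar>)" using f by simp
    have "norm (of_real (f t) * exp (- z * of_real t)) \<le> exp (- l * Re z) * \<bar>f t\<bar>" for t
    proof (cases "t \<le> l")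
      case False
      then have "l * Re z \<le> t * Re z" using z by (intro mult_right_mono) auto
      then have "exp (- (Re z * t)) \<le> exp (- l * Re z)" by (simp add: mult.commute)
      then show ?thesis by (simp add: norm_mult mult.commute mult_left_mono)
    qed (simp add: zero)
    then show "AE t in half_line. norm (of_real (f t) * exp (- z * of_real t)) \<le> exp (- l * Re z) * \<bar>f t\<bar>" by simp
  qed auto
  finally show ?thesis by simp
qed

text \<open>At z = 4 pi^2 |\<xi>|^2 - 2 pi \<i> \<sigma> the exponential is a Gaussian in \<xi>,
  able to absorb polynomials, and the denominator gives square-integrability in \<sigma>.\<close>

definition laplace_decay :: "real \<Rightarrow> (real \<Rightarrow> real) \<Rightarrow> bool" where
  "laplace_decay l f \<longleftrightarrow> (\<exists>M\<ge>0. \<forall>z. 0 < Re z \<longrightarrow> norm (half_laplace f z) \<le> M * exp (- l * Re z) / (1 + \<bar>Im z\<bar>))"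

text \<open>The decay in 1 / |z| is required only for |z| >= 1; for smaller z integrability and the
  support of f suffice.\<close>

lemma laplace_decayI:
  assumes f: "integrable half_line f" and zero: "\<And>t. t \<le> l \<Longrightarrow> f t = 0"
    and "C \<ge> 0" and decay: "\<And>z. 0 < Re z \<Longrightarrow> 1 \<le> norm z \<Longrightarrow> norm (half_laplace f z) \<le> C * exp (- l * Re z) / norm z"
  shows "laplace_decay l f"
proof -
  define A where "A = (LINT t|half_line. \<bar>f t\<bar>)"
  have A: "A \<ge> 0" unfolding A_def by (intro integral_nonneg_AE) auto
  have "norm (half_laplace f z) \<le> 2 * (A + C) * exp (- l * Re z) / (1 + \<bar>Im z\<bar>)" if z: "0 < Re z" for z
  proof (cases "1 \<le> norm z")
    case True
    have "norm (half_laplace f z) \<le> C * exp (- l * Re z) / norm z" by (rule decay[OF z True])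
    also have "\<dots> \<le> (2 * (A + C)) * exp (- l * Re z) / (1 + \<bar>Im z\<bar>)"
    proof -
      have "1 + \<bar>Im z\<bar> \<le> 2 * norm z" using True abs_Im_le_cmod[of z] by linarith
      then have "C * exp (- l * Re z) * (1 + \<bar>Im z\<bar>) \<le> C * exp (- l * Re z) * (2 * norm z)"
        using assms(3) by (intro mult_left_mono) auto
      also have "\<dots> = 2 * C * exp (- l * Re z) * norm z" by simp
      also have "\<dots> \<le> 2 * (A + C) * exp (- l * Re z) * norm z"
        using A by (intro mult_right_mono) auto
      finally have le: "C * exp (- l * Re z) * (1 + \<bar>Im z\<bar>) \<le> 2 * (A + C) * exp (- l * Re z) * norm z" .
      have pos: "0 < norm z" "0 < 1 + \<bar>Im z\<bar>" using True by linarith+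
      show ?thesis
        unfolding pos_divide_le_eq[OF pos(1)] times_divide_eq_left pos_le_divide_eq[OF pos(2)] by (rule le)
    qed
    finally show ?thesis .
  next
    case False
    have "norm (half_laplace f z) \<le> exp (- l * Re z) * A"
      unfolding A_def by (rule norm_half_laplace_le[OF f zero z])
    also have "\<dots> \<le> (2 * (A + C)) * exp (- l * Re z) / (1 + \<bar>Im z\<bar>)"
    proof -
      have "1 + \<bar>Im z\<bar> \<le> 2" using False abs_Im_le_cmod[of z] by linarith
      then have "exp (- l * Re z) * A * (1 + \<bar>Im z\<bar>) \<le> exp (- l * Re z) * A * 2"
        using A by (intro mult_left_mono) auto
      also have "\<dots> \<le> 2 * (A + C) * exp (- l * Re z)" using assms(3) by (simp add: algebra_simps)
      finally show ?thesis by (simp add: field_simps)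
    qed
    finally show ?thesis .
  qed
  then show ?thesis unfolding laplace_decay_def using A assms(3) by (intro exI[of _ "2 * (A + C)"]) auto
qed

lemma laplace_decay_test_fun:
  assumes "0 < p" "p < q"
  shows "laplace_decay (min p 1) (test_fun p q)"
proof (rule laplace_decayI[where C = "2 / (q - p) + 2"])
  show "norm (half_laplace (test_fun p q) z) \<le> (2 / (q - p) + 2) * exp (- min p 1 * Re z) / norm z" if "0 < Re z" for z
    by (rule norm_half_laplace_test_fun[OF that assms])
qed (use assms in \<open>auto intro: integrable_test_fun test_fun_eq_0\<close>)

text \<open>The factor z^-s is at most 1 in modulus for |z| >= 1. Its singularity at 0 is harmless
  because \<open>frac_test\<close> is integrable, which is where the mean zero of the test function
  enters.\<close>

lemma laplace_decay_frac_test: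
  assumes s: "0 < s" "s < 1" and pq: "0 < p" "p < q"
  shows "laplace_decay (min p 1) (frac_test s p q)"
proof (rule laplace_decayI[where C = "Gamma s * (2 / (q - p) + 2)"])
  show "0 \<le> Gamma s * (2 / (q - p) + 2)" using s pq Gamma_real_pos[of s] by simp
  show "norm (half_laplace (frac_test s p q) z) \<le> Gamma s * (2 / (q - p) + 2) * exp (- min p 1 * Re z) / norm z"
    if z: "0 < Re z" "1 \<le> norm z" for z
  proof -
    have "norm (z powr (- of_real s)) = norm z powr (- s)"
      using norm_powr_real_powr'[of "- of_real s" z] by simp
    also have "\<dots> \<le> 1 powr (- s)" using z s by (intro powr_mono2') auto
    finally have p1: "norm (z powr (- of_real s)) \<le> 1" by simp
    have "norm (half_laplace (frac_test s p q) z) = Gamma s * norm (z powr (- of_real s)) * norm (half_laplace (test_fun p q) z)"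
      unfolding half_laplace_frac_test[OF s pq z(1)] using Gamma_real_pos[of s] s by (simp add: norm_mult)
    also have "\<dots> \<le> Gamma s * 1 * ((2 / (q - p) + 2) * exp (- min p 1 * Re z) / norm z)"
      using Gamma_real_pos[of s] s p1 norm_half_laplace_test_fun[OF z(1) pq]
      by (intro mult_mono) auto
    finally show ?thesis by simp
  qed
qed (use assms in \<open>auto intro: integrable_frac_test frac_test_eq_0\<close>)

section \<open>Dual caloric functions as derivatives of the heat kernel\<close>

definition hermite_gauss :: "nat \<Rightarrow> real \<Rightarrow> real" where
  "hermite_gauss k y = hermite_fun k y * exp (- pi * y\<^sup>2)"

lemma hermite_gauss_altdef: "hermite_gauss k y = gauss_poly (2 * pi) (hermite k) y / hermite_norm k"
  using gauss_poly_mult[of pi "hermite k" y pi 1] by (simp add: hermite_gauss_def hermite_fun_def gauss_poly_def)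

lemma hermite_gauss_measurable [measurable]: "hermite_gauss k \<in> borel_measurable borel"
  unfolding hermite_gauss_def[abs_def] by measurable

lemma integrable_hermite_gauss: "integrable lborel (hermite_gauss k)"
  unfolding hermite_gauss_altdef[abs_def] using integrable_gauss_poly[of "2 * pi"] by simp

lemma integrable_hermite_gauss_sq: "integrable lborel (\<lambda>y. (hermite_gauss k y)\<^sup>2)"
proof -
  have "(hermite_gauss k y)\<^sup>2 = gauss_poly (4 * pi) (hermite k * hermite k) y / (hermite_norm k)\<^sup>2" for y
    using gauss_poly_mult[of "2 * pi" "hermite k" y "2 * pi" "hermite k"] by (simp add: hermite_gauss_altdef power_divide power2_eq_square)
  then show ?thesis using integrable_gauss_poly[of "4 * pi"] by simp
qed

text \<open>Up to a constant, the spatial derivative of order \<alpha> of the heat kernel: the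
  Gaussian factor is exp (- |y|^2 / (4 \<tau>)), and the powers of \<tau> are those produced by
  differentiation. It solves the heat equation in the reversed time \<tau>.\<close>

definition dual_caloric :: "('n::finite \<Rightarrow> nat) \<Rightarrow> real \<Rightarrow> real ^ 'n \<Rightarrow> real" where
  "dual_caloric \<alpha> \<tau> y = (\<Prod>i\<in>UNIV. \<tau> powr (- (1 + real (\<alpha> i)) / 2) * hermite_gauss (\<alpha> i) (y $ i / sqrt (8 * pi * \<tau>)))"

lemma dual_caloric_measurable [measurable (raw)]:
  fixes \<alpha> :: "'a::finite \<Rightarrow> nat"
  assumes [measurable]: "f \<in> borel_measurable M" "g \<in> borel_measurable M"
  shows "(\<lambda>x. dual_caloric \<alpha> (f x) (g x)) \<in> borel_measurable M"
proof -
  note [measurable del] = ident_measurable_half_line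
  have "(\<lambda>v :: real ^ 'a. v $ i) \<in> borel_measurable borel" for i by measurable
  from measurable_compose[OF assms(2) this] have [measurable]: "(\<lambda>x. g x $ i) \<in> borel_measurable M" for i .
  have [measurable]: "(\<lambda>x. sqrt (8 * pi * f x)) \<in> borel_measurable M"
    by (rule measurable_compose[OF assms(1), of "\<lambda>t. sqrt (8 * pi * t)"]) measurable
  show ?thesis unfolding dual_caloric_def by measurable
qed

lemma real_scale:
  fixes f :: "real \<Rightarrow> 'b::{banach, second_countable_topology}"
  assumes "r > 0"
  shows "integrable lborel (\<lambda>y. f (y / r)) \<longleftrightarrow> integrable lborel f"
    "(LINT y|lborel. f (y / r)) = r *\<^sub>R (LINT y|lborel. f y)"
proof -
  have eq: "f (y / r) = f (0 + (1 / r) * y)" for y by simp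
  show "integrable lborel (\<lambda>y. f (y / r)) \<longleftrightarrow> integrable lborel f"
    unfolding eq by (rule lborel_integrable_real_affine_iff) (use assms in simp)
  have "(LINT y|lborel. f y) = \<bar>1 / r\<bar> *\<^sub>R (LINT y|lborel. f (0 + (1 / r) * y))"
    by (rule lborel_integral_real_affine) (use assms in simp)
  then show "(LINT y|lborel. f (y / r)) = r *\<^sub>R (LINT y|lborel. f y)" using assms by simp
qed

definition caloric_const :: "nat \<Rightarrow> complex" where
  "caloric_const k = of_real (sqrt (8 * pi) ^ Suc k * (sqrt (1 / 2) / hermite_norm k)) * (- 2 * of_real pi * \<i>) ^ k"

lemma dual_caloric_fourier_1:
  assumes \<tau>: "\<tau> > 0"
  shows "(LINT y|lborel. of_real (\<tau> powr (- (1 + real k) / 2) * hermite_gauss k (y / sqrt (8 * pi * \<tau>))) * iexp (- 2 * pi * \<xi> * y)) =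
    caloric_const k * of_real (\<xi> ^ k * exp (- 4 * pi\<^sup>2 * \<xi>\<^sup>2 * \<tau>))"
proof -
  define r where "r = sqrt (8 * pi * \<tau>)"
  have r: "r > 0" "r\<^sup>2 = 8 * pi * \<tau>" using \<tau> by (auto simp: r_def)
  have "(LINT y|lborel. of_real (\<tau> powr (- (1 + real k) / 2) * hermite_gauss k (y / r)) * iexp (- 2 * pi * \<xi> * y)) =
     (LINT y|lborel. of_real (\<tau> powr (- (1 + real k) / 2)) * ((\<lambda>v. of_real (hermite_gauss k v) * iexp ((- 2 * pi * \<xi> * r) * v)) (y / r)))"
    using r by (intro Bochner_Integration.integral_cong) (auto simp: mult_ac)
  also have "\<dots> = of_real (\<tau> powr (- (1 + real k) / 2)) * (r *\<^sub>R (LINT v|lborel. of_real (hermite_gauss k v) * iexp ((- 2 * pi * \<xi> * r) * v)))"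
    unfolding integral_mult_right_zero
      real_scale(2)[OF r(1), of "\<lambda>v. of_real (hermite_gauss k v) * iexp ((- 2 * pi * \<xi> * r) * v)"] ..
  also have "(LINT v|lborel. of_real (hermite_gauss k v) * iexp ((- 2 * pi * \<xi> * r) * v)) =
      of_real (sqrt (1 / 2) / hermite_norm k) * (\<i> * of_real (- 2 * pi * \<xi> * r)) ^ k * of_real (exp (- (- 2 * pi * \<xi> * r)\<^sup>2 / (8 * pi)))"
    unfolding hermite_gauss_def by (rule hermite_fun_gauss_fourier)
  also have "- (- 2 * pi * \<xi> * r)\<^sup>2 / (8 * pi) = - 4 * pi\<^sup>2 * \<xi>\<^sup>2 * \<tau>"
    using r by (simp add: power_mult_distrib power2_eq_square)
  also have "\<i> * of_real (- 2 * pi * \<xi> * r) = (- 2 * of_real pi * \<i>) * of_real (\<xi> * r)" by simp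
  finally have eq: "(LINT y|lborel. of_real (\<tau> powr (- (1 + real k) / 2) * hermite_gauss k (y / r)) * iexp (- 2 * pi * \<xi> * y)) =
     of_real (\<tau> powr (- (1 + real k) / 2)) * (r *\<^sub>R (of_real (sqrt (1 / 2) / hermite_norm k) *
       ((- 2 * of_real pi * \<i>) * of_real (\<xi> * r)) ^ k * of_real (exp (- 4 * pi\<^sup>2 * \<xi>\<^sup>2 * \<tau>))))" .
  \<comment> \<open>The scaling yields a Jacobian r and a monomial factor r^k, with r = sqrt (8 pi
    \<tau>). The power - (1 + k) / 2 of \<tau> cancels their dependence on \<tau>, so only the
    Gaussian in \<xi> still contains \<tau>.\<close>
  have "sqrt \<tau> ^ Suc k = \<tau> powr ((1 / 2) * real (Suc k))"
    using \<tau> by (simp add: powr_half_sqrt[symmetric] powr_realpow[symmetric] powr_powr powr_gt_zero del: power_Suc of_nat_Suc)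
  moreover have "- (1 + real k) / 2 = - ((1 / 2) * real (Suc k))" by (simp add: field_simps)
  ultimately have "\<tau> powr (- (1 + real k) / 2) = 1 / sqrt \<tau> ^ Suc k" by (simp only: powr_minus_divide)
  moreover have "r = sqrt (8 * pi) * sqrt \<tau>" by (simp add: r_def real_sqrt_mult)
  ultimately have pw: "sqrt (8 * pi) ^ Suc k = \<tau> powr (- (1 + real k) / 2) * r ^ Suc k"
    using \<tau> by (simp only: power_mult_distrib) simp
  define c where "c = - 2 * complex_of_real pi * \<i>"
  show ?thesis
    unfolding r_def[symmetric] eq caloric_const_def pw c_def[symmetric]
    by (simp add: scaleR_conv_of_real power_mult_distrib mult_ac)
qed

lemma dual_caloric_1_integrable:
  assumes \<tau>: "\<tau> > 0"
  shows "integrable lborel (\<lambda>y. \<tau> powr (- (1 + real k) / 2) * hermite_gauss k (y / sqrt (8 * pi * \<tau>)))"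
    "integrable lborel (\<lambda>y. (\<tau> powr (- (1 + real k) / 2) * hermite_gauss k (y / sqrt (8 * pi * \<tau>)))\<^sup>2)"
    "integrable lborel (\<lambda>y. complex_of_real (\<tau> powr (- (1 + real k) / 2) * hermite_gauss k (y / sqrt (8 * pi * \<tau>))) * iexp (- 2 * pi * \<xi> * y))"
proof -
  have r: "sqrt (8 * pi * \<tau>) > 0" using \<tau> by simp
  show i: "integrable lborel (\<lambda>y. \<tau> powr (- (1 + real k) / 2) * hermite_gauss k (y / sqrt (8 * pi * \<tau>)))"
    using real_scale(1)[OF r, of "hermite_gauss k"] integrable_hermite_gauss by (intro integrable_mult_right) simp
  show "integrable lborel (\<lambda>y. (\<tau> powr (- (1 + real k) / 2) * hermite_gauss k (y / sqrt (8 * pi * \<tau>)))\<^sup>2)"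
    unfolding power_mult_distrib
    using real_scale(1)[OF r, of "\<lambda>y. (hermite_gauss k y)\<^sup>2"] integrable_hermite_gauss_sq by (intro integrable_mult_right) simp
  show "integrable lborel (\<lambda>y. complex_of_real (\<tau> powr (- (1 + real k) / 2) * hermite_gauss k (y / sqrt (8 * pi * \<tau>))) * iexp (- 2 * pi * \<xi> * y))"
    by (rule Bochner_Integration.integrable_bound[OF i]) (auto simp: norm_mult)
qed

lemma dual_caloric_fourier:
  assumes \<tau>: "\<tau> > 0"
  shows "(LINT y|lborel. iexp (- 2 * pi * (\<xi> \<bullet> y)) * of_real (dual_caloric \<alpha> \<tau> y)) =
    (\<Prod>i\<in>UNIV. caloric_const (\<alpha> i) * of_real ((\<xi> $ i) ^ \<alpha> i)) * of_real (exp (- 4 * pi\<^sup>2 * (norm \<xi>)\<^sup>2 * \<tau>))"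
proof -
  define g where "g i y = complex_of_real (\<tau> powr (- (1 + real (\<alpha> i)) / 2) * hermite_gauss (\<alpha> i) (y / sqrt (8 * pi * \<tau>))) * iexp (- 2 * pi * (\<xi> $ i) * y)" for i y
  have "iexp (- 2 * pi * (\<xi> \<bullet> y)) * of_real (dual_caloric \<alpha> \<tau> y) = (\<Prod>i\<in>UNIV. g i (y $ i))" for y
    unfolding g_def prod.distrib dual_caloric_def exp_sum[OF finite, symmetric] of_real_prod of_real_mult
    by (simp add: inner_vec_def sum_distrib_left sum_negf mult_ac)
  then have "(LINT y|lborel. iexp (- 2 * pi * (\<xi> \<bullet> y)) * of_real (dual_caloric \<alpha> \<tau> y)) = (\<Prod>i\<in>UNIV. LINT y|lborel. g i y)"
    unfolding g_def by (simp only:) (rule integral_vec_prod, rule dual_caloric_1_integrable(3)[OF \<tau>])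
  also have "\<dots> = (\<Prod>i\<in>UNIV. caloric_const (\<alpha> i) * of_real ((\<xi> $ i) ^ \<alpha> i * exp (- 4 * pi\<^sup>2 * (\<xi> $ i)\<^sup>2 * \<tau>)))"
    unfolding g_def by (intro prod.cong refl dual_caloric_fourier_1 \<tau>)
  also have "\<dots> = (\<Prod>i\<in>UNIV. caloric_const (\<alpha> i) * of_real ((\<xi> $ i) ^ \<alpha> i)) * of_real (\<Prod>i\<in>UNIV. exp (- 4 * pi\<^sup>2 * (\<xi> $ i)\<^sup>2 * \<tau>))"
    by (simp add: prod.distrib mult.assoc)
  also have "(\<Prod>i\<in>UNIV. exp (- 4 * pi\<^sup>2 * (\<xi> $ i)\<^sup>2 * \<tau>)) = exp (- 4 * pi\<^sup>2 * (norm \<xi>)\<^sup>2 * \<tau>)"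
    unfolding exp_sum[OF finite, symmetric] norm_vec_def L2_set_def
    by (simp add: sum_nonneg sum_distrib_left sum_distrib_right sum_negf mult_ac)
  finally show ?thesis .
qed

text \<open>By scaling, the L^1 norm and the squared L^2 norm are constants times non-positive
  powers of \<tau>, so they are controlled by their size at l. Test functions vanish up to such an l
  > 0, away from the singular time 0.\<close>

lemma dual_caloric_bounds:
  fixes \<alpha> :: "'n::finite \<Rightarrow> nat"
  assumes l: "l > 0"
  obtains M where "\<And>\<tau>. l \<le> \<tau> \<Longrightarrow> (\<integral>\<^sup>+y. ennreal \<bar>dual_caloric \<alpha> \<tau> y\<bar> \<partial>lborel) \<le> ennreal M"
    "\<And>\<tau>. l \<le> \<tau> \<Longrightarrow> (\<integral>\<^sup>+y. ennreal ((dual_caloric \<alpha> \<tau> y)\<^sup>2) \<partial>lborel) \<le> ennreal M"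
proof -
  define A where "A k = sqrt (8 * pi) * (LINT y|lborel. \<bar>hermite_gauss k y\<bar>)" for k
  define B where "B k = sqrt (8 * pi) * (LINT y|lborel. (hermite_gauss k y)\<^sup>2)" for k
  have A0: "A k \<ge> 0" and B0: "B k \<ge> 0" for k unfolding A_def B_def by (auto intro!: mult_nonneg_nonneg integral_nonneg_AE)
  define MA where "MA = (\<Prod>i\<in>UNIV. l powr (- real (\<alpha> i) / 2) * A (\<alpha> i))"
  define MB where "MB = (\<Prod>i\<in>UNIV. l powr (- (1 / 2 + real (\<alpha> i))) * B (\<alpha> i))"
  have root: "sqrt (8 * pi * \<tau>) = sqrt (8 * pi) * \<tau> powr (1 / 2)" if "\<tau> > 0" for \<tau>
    using that by (simp add: real_sqrt_mult powr_half_sqrt)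
  show ?thesis
  proof (rule that[of "max MA MB"])
    fix \<tau> assume "l \<le> \<tau>"
    then have \<tau>: "\<tau> > 0" using l by simp
    have r: "sqrt (8 * pi * \<tau>) > 0" using \<tau> by simp
    define g where "g k y = \<tau> powr (- (1 + real k) / 2) * hermite_gauss k (y / sqrt (8 * pi * \<tau>))" for k y
    have gi: "integrable lborel (\<lambda>y. \<bar>g k y\<bar>)" "integrable lborel (\<lambda>y. (g k y)\<^sup>2)" for k
      unfolding g_def using dual_caloric_1_integrable[OF \<tau>] by auto
    have g1: "(LINT y|lborel. \<bar>g k y\<bar>) = \<tau> powr (- real k / 2) * A k" for k
    proof -
      have "(LINT y|lborel. \<bar>g k y\<bar>) = \<tau> powr (- (1 + real k) / 2) * (LINT y|lborel. (\<lambda>v. \<bar>hermite_gauss k v\<bar>) (y / sqrt (8 * pi * \<tau>)))"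
        unfolding g_def by (simp add: abs_mult)
      also have "\<dots> = (\<tau> powr (- (1 + real k) / 2) * \<tau> powr (1 / 2)) * A k"
        using real_scale(2)[OF r, of "\<lambda>v. \<bar>hermite_gauss k v\<bar>"] root[OF \<tau>] unfolding A_def by simp
      also have "\<tau> powr (- (1 + real k) / 2) * \<tau> powr (1 / 2) = \<tau> powr (- real k / 2)"
        by (simp add: powr_add[symmetric] field_simps)
      finally show ?thesis .
    qed
    have g2: "(LINT y|lborel. (g k y)\<^sup>2) = \<tau> powr (- (1 / 2 + real k)) * B k" for k
    proof -
      have "(LINT y|lborel. (g k y)\<^sup>2) = (\<tau> powr (- (1 + real k) / 2))\<^sup>2 * (LINT y|lborel. (\<lambda>v. (hermite_gauss k v)\<^sup>2) (y / sqrt (8 * pi * \<tau>)))"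
        unfolding g_def by (simp add: power_mult_distrib)
      also have "\<dots> = (\<tau> powr (- (1 + real k) / 2) * \<tau> powr (- (1 + real k) / 2) * \<tau> powr (1 / 2)) * B k"
        using real_scale(2)[OF r, of "\<lambda>v. (hermite_gauss k v)\<^sup>2"] root[OF \<tau>] unfolding B_def by (simp add: power2_eq_square)
      also have "\<tau> powr (- (1 + real k) / 2) * \<tau> powr (- (1 + real k) / 2) * \<tau> powr (1 / 2) = \<tau> powr (- (1 + real k) / 2 + - (1 + real k) / 2 + 1 / 2)"
        by (simp only: powr_add)
      also have "- (1 + real k) / 2 + - (1 + real k) / 2 + 1 / 2 = - (1 / 2 + real k)"
        by (simp add: field_simps)
      finally show ?thesis .
    qed
    have dc: "\<bar>dual_caloric \<alpha> \<tau> y\<bar> = (\<Prod>i\<in>UNIV. \<bar>g (\<alpha> i) (y $ i)\<bar>)" "(dual_caloric \<alpha> \<tau> y)\<^sup>2 = (\<Prod>i\<in>UNIV. (g (\<alpha> i) (y $ i))\<^sup>2)" for y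
      by (simp_all add: dual_caloric_def g_def abs_prod prod_power_distrib)
    have "(\<integral>\<^sup>+y. ennreal \<bar>dual_caloric \<alpha> \<tau> y\<bar> \<partial>lborel) = ennreal (LINT y|lborel. (\<Prod>i\<in>UNIV. \<bar>g (\<alpha> i) ((y :: real ^ 'n) $ i)\<bar>))"
      unfolding dc by (rule nn_integral_eq_integral[OF integrable_vec_prod[OF gi(1)]]) (intro AE_I2 prod_nonneg, simp)
    also have "\<dots> \<le> ennreal MA"
      unfolding integral_vec_prod[OF gi(1)] g1 MA_def using \<open>l \<le> \<tau>\<close> l A0
      by (intro ennreal_leI prod_mono) (auto intro!: mult_right_mono mult_nonneg_nonneg powr_mono2')
    also have "\<dots> \<le> ennreal (max MA MB)" by (intro ennreal_leI) simp
    finally show "(\<integral>\<^sup>+y. ennreal \<bar>dual_caloric \<alpha> \<tau> y\<bar> \<partial>lborel) \<le> ennreal (max MA MB)" .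
    have "(\<integral>\<^sup>+y. ennreal ((dual_caloric \<alpha> \<tau> y)\<^sup>2) \<partial>lborel) = ennreal (LINT y|lborel. (\<Prod>i\<in>UNIV. (g (\<alpha> i) ((y :: real ^ 'n) $ i))\<^sup>2))"
      unfolding dc by (rule nn_integral_eq_integral[OF integrable_vec_prod[OF gi(2)]]) (intro AE_I2 prod_nonneg, simp)
    also have "\<dots> \<le> ennreal MB"
      unfolding integral_vec_prod[OF gi(2)] g2 MB_def using \<open>l \<le> \<tau>\<close> l B0
      by (intro ennreal_leI prod_mono) (auto intro!: mult_right_mono mult_nonneg_nonneg powr_mono2')
    also have "\<dots> \<le> ennreal (max MA MB)" by (intro ennreal_leI) simp
    finally show "(\<integral>\<^sup>+y. ennreal ((dual_caloric \<alpha> \<tau> y)\<^sup>2) \<partial>lborel) \<le> ennreal (max MA MB)" .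
  qed
qed

section \<open>Moments of solutions against dual caloric functions\<close>

declare ident_measurable_half_line [measurable del]

text \<open>Moves the given point to the origin and reverses time, so that the past of t_0 becomes
  positive time. The map preserves measure and is undone by \<open>unreflect_at\<close>.\<close>

definition reflect_at :: "real ^ 'n::finite \<Rightarrow> real \<Rightarrow> (real ^ 'n) \<times> real \<Rightarrow> (real ^ 'n) \<times> real" where
  "reflect_at x\<^sub>0 t\<^sub>0 p = (x\<^sub>0 + fst p, t\<^sub>0 - snd p)"

definition unreflect_at :: "real ^ 'n::finite \<Rightarrow> real \<Rightarrow> (real ^ 'n) \<times> real \<Rightarrow> (real ^ 'n) \<times> real" where
  "unreflect_at x\<^sub>0 t\<^sub>0 p = (fst p - x\<^sub>0, t\<^sub>0 - snd p)"

lemma unreflect_reflect [simp]: "unreflect_at x\<^sub>0 t\<^sub>0 (reflect_at x\<^sub>0 t\<^sub>0 p) = p"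
  "reflect_at x\<^sub>0 t\<^sub>0 (unreflect_at x\<^sub>0 t\<^sub>0 p) = p"
  by (simp_all add: reflect_at_def unreflect_at_def)

lemma reflect_at_measurable [measurable]: "reflect_at x\<^sub>0 t\<^sub>0 \<in> borel \<rightarrow>\<^sub>M borel" "unreflect_at x\<^sub>0 t\<^sub>0 \<in> borel \<rightarrow>\<^sub>M borel"
  unfolding reflect_at_def[abs_def] unreflect_at_def[abs_def]
  by (auto intro!: borel_measurable_continuous_onI continuous_intros)

lemma distr_reflect_at: "distr lborel borel (reflect_at x\<^sub>0 t\<^sub>0) = lborel"
proof -
  have 1: "distr lborel borel ((+) x\<^sub>0) = lborel" by (rule lborel_distr_plus)
  have 2: "distr lborel borel (\<lambda>t. t\<^sub>0 - t :: real) = lborel"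
    using lborel_real_affine[of "-1" t\<^sub>0] by (simp add: density_1)
  have "distr lborel borel ((+) x\<^sub>0) \<Otimes>\<^sub>M distr lborel borel (\<lambda>t. t\<^sub>0 - t) =
      distr (lborel \<Otimes>\<^sub>M lborel) (borel \<Otimes>\<^sub>M borel) (\<lambda>(x, t). (x\<^sub>0 + x, t\<^sub>0 - t))"
    by (rule pair_measure_distr) (auto simp: 2 intro: sigma_finite_lborel)
  then show ?thesis
    unfolding 1 2 lborel_prod borel_prod by (simp add: reflect_at_def[abs_def] case_prod_beta')
qed

lemma lborel_reflect_at:
  fixes f :: "(real ^ 'n::finite) \<times> real \<Rightarrow> 'b::{banach, second_countable_topology}"
  assumes [measurable]: "f \<in> borel_measurable borel"
  shows "integrable lborel (\<lambda>p. f (reflect_at x\<^sub>0 t\<^sub>0 p)) \<longleftrightarrow> integrable lborel f"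
    "(LINT p|lborel. f (reflect_at x\<^sub>0 t\<^sub>0 p)) = (LINT p|lborel. f p)"
proof -
  have "integrable (distr lborel borel (reflect_at x\<^sub>0 t\<^sub>0)) f \<longleftrightarrow> integrable lborel (\<lambda>p. f (reflect_at x\<^sub>0 t\<^sub>0 p))"
    by (rule integrable_distr_eq) simp_all
  then show "integrable lborel (\<lambda>p. f (reflect_at x\<^sub>0 t\<^sub>0 p)) \<longleftrightarrow> integrable lborel f"
    unfolding distr_reflect_at ..
  have "(LINT p|distr lborel borel (reflect_at x\<^sub>0 t\<^sub>0). f p) = (LINT p|lborel. f (reflect_at x\<^sub>0 t\<^sub>0 p))"
    by (rule integral_distr) simp_all
  then show "(LINT p|lborel. f (reflect_at x\<^sub>0 t\<^sub>0 p)) = (LINT p|lborel. f p)"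
    unfolding distr_reflect_at ..
qed

lemma AE_reflect_at:
  assumes "AE p in lborel. P p"
  shows "AE p in lborel. P (reflect_at x\<^sub>0 t\<^sub>0 p)"
proof -
  have "AE p in distr lborel borel (reflect_at x\<^sub>0 t\<^sub>0). P p" using assms unfolding distr_reflect_at .
  then show ?thesis by (rule AE_distrD[rotated]) simp
qed

lemma AE_unreflect_at:
  assumes "AE p in lborel. P (reflect_at x\<^sub>0 t\<^sub>0 p)"
  shows "AE p in lborel. P p"
proof -
  have "reflect_at x\<^sub>0 t\<^sub>0 (reflect_at (- x\<^sub>0) t\<^sub>0 p) = p" for p by (simp add: reflect_at_def)
  then show ?thesis using AE_reflect_at[OF assms, of "- x\<^sub>0" t\<^sub>0] by simp
qed

lemma square_integrable_reflect_at:
  assumes "square_integrable lborel f"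
  shows "square_integrable lborel (\<lambda>p. f (reflect_at x\<^sub>0 t\<^sub>0 p))"
proof -
  have [measurable]: "f \<in> borel_measurable borel" using assms by (simp add: square_integrable_def)
  show ?thesis using assms unfolding square_integrable_def
    using lborel_reflect_at(1)[of "\<lambda>p. (norm (f p))\<^sup>2" x\<^sub>0 t\<^sub>0] by simp
qed

lemma lborel_LINT_snd:
  fixes h :: "'a::euclidean_space \<times> 'b::euclidean_space \<Rightarrow> 'c::{banach, second_countable_topology}"
  assumes "integrable lborel h"
  shows "(LINT p|lborel. h p) = (LINT t|lborel. LINT x|lborel. h (x, t))"
    "AE t in lborel. integrable lborel (\<lambda>x. h (x, t))"
    "integrable lborel (\<lambda>t. LINT x|lborel. h (x, t))"
proof -
  have h: "integrable (lborel \<Otimes>\<^sub>M lborel) (case_prod (\<lambda>x t. h (x, t)))"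
    using assms unfolding lborel_prod by simp
  show "(LINT p|lborel. h p) = (LINT t|lborel. LINT x|lborel. h (x, t))"
    using lborel_pair.integral_snd[OF h] unfolding lborel_prod by simp
  show "AE t in lborel. integrable lborel (\<lambda>x. h (x, t))" by (rule lborel_pair.AE_integrable_snd[OF h])
  show "integrable lborel (\<lambda>t. LINT x|lborel. h (x, t))" by (rule lborel_pair.integrable_snd[OF h])
qed

lemma lborel_nn_integral_snd:
  fixes h :: "'a::euclidean_space \<times> 'b::euclidean_space \<Rightarrow> ennreal"
  assumes "h \<in> borel_measurable borel"
  shows "(\<integral>\<^sup>+p. h p \<partial>lborel) = (\<integral>\<^sup>+t. \<integral>\<^sup>+x. h (x, t) \<partial>lborel \<partial>lborel)"
  using lborel_pair.nn_integral_snd[of h] assms unfolding lborel_prod by simp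

definition heat_test :: "('n::finite \<Rightarrow> nat) \<Rightarrow> (real \<Rightarrow> real) \<Rightarrow> (real ^ 'n) \<times> real \<Rightarrow> real" where
  "heat_test \<alpha> f p = (if 0 < snd p then f (snd p) * dual_caloric \<alpha> (snd p) (fst p) else 0)"

text \<open>The time profiles for which the product with a dual caloric function is a legitimate
  test function: support above l, boundedness and integrability place it in L^1 and L^2, and the
  Laplace decay places its Fourier transform in L^2.\<close>

definition admissible :: "real \<Rightarrow> (real \<Rightarrow> real) \<Rightarrow> bool" where
  "admissible l f \<longleftrightarrow> 0 < l \<and> f \<in> borel_measurable borel \<and> integrable half_line f \<and>
     (\<exists>B. \<forall>t>0. \<bar>f t\<bar> \<le> B) \<and> (\<forall>t\<le>l. f t = 0) \<and> laplace_decay l f"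

lemma heat_test_measurable [measurable]:
  fixes \<alpha> :: "'n::finite \<Rightarrow> nat"
  assumes "f \<in> borel_measurable borel"
  shows "heat_test \<alpha> f \<in> borel_measurable borel"
proof -
  note [measurable] = assms
  have [measurable]: "(\<lambda>p. fst p) \<in> borel_measurable (borel :: ((real ^ 'n) \<times> real) measure)" "(\<lambda>p. snd p) \<in> borel_measurable (borel :: ((real ^ 'n) \<times> real) measure)"
    by (auto intro!: borel_measurable_continuous_onI continuous_intros)
  have "(\<lambda>p. dual_caloric \<alpha> (snd p) (fst p)) \<in> borel_measurable borel" by (intro dual_caloric_measurable) measurable
  moreover have "(\<lambda>p. f (snd p)) \<in> borel_measurable (borel :: ((real ^ 'n) \<times> real) measure)"
    by (rule measurable_compose[OF _ assms]) measurable
  ultimately show ?thesis unfolding heat_test_def[abs_def] by measurable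
qed

lemma heat_test_integrable:
  assumes f: "admissible l f"
  shows "integrable lborel (heat_test \<alpha> f)" "square_integrable lborel (\<lambda>p. of_real (heat_test \<alpha> f p))"
proof -
  have l: "l > 0" and fm [measurable]: "f \<in> borel_measurable borel" and fi: "integrable half_line f" and fz: "\<And>t. t \<le> l \<Longrightarrow> f t = 0"
    using f by (auto simp: admissible_def)
  obtain B where B: "\<And>t. t > 0 \<Longrightarrow> \<bar>f t\<bar> \<le> B" using f by (auto simp: admissible_def)
  have B0: "B \<ge> 0" using B[of 1] by simp
  obtain M where M: "\<And>\<tau>. l \<le> \<tau> \<Longrightarrow> (\<integral>\<^sup>+y. ennreal \<bar>dual_caloric \<alpha> \<tau> y\<bar> \<partial>lborel) \<le> ennreal M"
    "\<And>\<tau>. l \<le> \<tau> \<Longrightarrow> (\<integral>\<^sup>+y. ennreal ((dual_caloric \<alpha> \<tau> y)\<^sup>2) \<partial>lborel) \<le> ennreal M"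
    using dual_caloric_bounds[OF l, of \<alpha>] by blast
  have ffin: "(\<integral>\<^sup>+t. ennreal \<bar>f t\<bar> \<partial>half_line) < \<infinity>" using fi by (simp add: integrable_iff_bounded)
  have dcm: "(\<lambda>y. dual_caloric \<alpha> t y) \<in> borel_measurable lborel" for t by (intro dual_caloric_measurable) auto
  have "(\<integral>\<^sup>+p. ennreal (norm (heat_test \<alpha> f p)) \<partial>lborel) = (\<integral>\<^sup>+t. \<integral>\<^sup>+y. ennreal (norm (heat_test \<alpha> f (y, t))) \<partial>lborel \<partial>lborel)"
    by (rule lborel_nn_integral_snd) measurable
  also have "\<dots> \<le> (\<integral>\<^sup>+t. ennreal M * (ennreal \<bar>f t\<bar> * indicator {0<..} t) \<partial>lborel)"
  proof (rule nn_integral_mono)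
    fix t :: real
    show "(\<integral>\<^sup>+y. ennreal (norm (heat_test \<alpha> f (y, t))) \<partial>lborel) \<le> ennreal M * (ennreal \<bar>f t\<bar> * indicator {0<..} t)"
    proof (cases "l < t")
      case True
      then have "(\<integral>\<^sup>+y. ennreal (norm (heat_test \<alpha> f (y, t))) \<partial>lborel) = ennreal \<bar>f t\<bar> * (\<integral>\<^sup>+y. ennreal \<bar>dual_caloric \<alpha> t y\<bar> \<partial>lborel)"
        using l dcm by (subst nn_integral_cmult[symmetric]) (auto simp: heat_test_def abs_mult ennreal_mult)
      also have "\<dots> \<le> ennreal \<bar>f t\<bar> * ennreal M" using True by (intro mult_left_mono M) auto
      finally show ?thesis using True l by (simp add: mult.commute)
    next
      case False
      then have "heat_test \<alpha> f (y, t) = 0" for y by (simp add: heat_test_def fz)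
      then show ?thesis by simp
    qed
  qed
  also have "\<dots> = ennreal M * (\<integral>\<^sup>+t. ennreal \<bar>f t\<bar> \<partial>half_line)"
    unfolding nn_integral_half_line by (rule nn_integral_cmult) measurable
  also have "\<dots> < \<infinity>" using ffin by (simp add: ennreal_mult_less_top)
  finally show "integrable lborel (heat_test \<alpha> f)" using heat_test_measurable[OF fm, of \<alpha>] by (simp add: integrable_iff_bounded)
  have "(\<integral>\<^sup>+p. ennreal ((norm (complex_of_real (heat_test \<alpha> f p)))\<^sup>2) \<partial>lborel) = (\<integral>\<^sup>+t. \<integral>\<^sup>+y. ennreal ((heat_test \<alpha> f (y, t))\<^sup>2) \<partial>lborel \<partial>lborel)"
    by (subst lborel_nn_integral_snd) (use heat_test_measurable[OF fm, of \<alpha>] in auto)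
  also have "\<dots> \<le> (\<integral>\<^sup>+t. ennreal (M * B) * (ennreal \<bar>f t\<bar> * indicator {0<..} t) \<partial>lborel)"
  proof (rule nn_integral_mono)
    fix t :: real
    show "(\<integral>\<^sup>+y. ennreal ((heat_test \<alpha> f (y, t))\<^sup>2) \<partial>lborel) \<le> ennreal (M * B) * (ennreal \<bar>f t\<bar> * indicator {0<..} t)"
    proof (cases "l < t")
      case True
      then have "(\<integral>\<^sup>+y. ennreal ((heat_test \<alpha> f (y, t))\<^sup>2) \<partial>lborel) = ennreal ((f t)\<^sup>2) * (\<integral>\<^sup>+y. ennreal ((dual_caloric \<alpha> t y)\<^sup>2) \<partial>lborel)"
        using l dcm by (subst nn_integral_cmult[symmetric]) (auto simp: heat_test_def power_mult_distrib ennreal_mult)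
      also have "\<dots> \<le> ennreal (B * \<bar>f t\<bar>) * ennreal M"
      proof (intro mult_mono M ennreal_leI)
        have "\<bar>f t\<bar> * \<bar>f t\<bar> \<le> B * \<bar>f t\<bar>" using B[of t] True l by (intro mult_right_mono) auto
        then show "(f t)\<^sup>2 \<le> B * \<bar>f t\<bar>" by (simp add: power2_eq_square)
      qed (use True in auto)
      finally show ?thesis using True l B0 by (simp add: ennreal_mult'' ennreal_mult' mult_ac)
    next
      case False
      then have "heat_test \<alpha> f (y, t) = 0" for y by (simp add: heat_test_def fz)
      then show ?thesis by simp
    qed
  qed
  also have "\<dots> = ennreal (M * B) * (\<integral>\<^sup>+t. ennreal \<bar>f t\<bar> \<partial>half_line)"
    unfolding nn_integral_half_line by (rule nn_integral_cmult) measurable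
  also have "\<dots> < \<infinity>" using ffin by (simp add: ennreal_mult_less_top)
  finally show "square_integrable lborel (\<lambda>p. of_real (heat_test \<alpha> f p))"
    using heat_test_measurable[OF fm, of \<alpha>] by (simp add: square_integrable_iff_nn_integral)
qed

text \<open>The complex conjugate of the base of the power in \<^const>\<open>heat_symbol\<close>.\<close>

definition heat_symbol_base :: "(real ^ 'n::finite) \<times> real \<Rightarrow> complex" where
  "heat_symbol_base q = of_real (4 * pi\<^sup>2 * (norm (fst q))\<^sup>2) - 2 * of_real pi * \<i> * of_real (snd q)"

definition caloric_poly :: "('n::finite \<Rightarrow> nat) \<Rightarrow> real ^ 'n \<Rightarrow> complex" where
  "caloric_poly \<alpha> \<xi> = (\<Prod>i\<in>UNIV. caloric_const (\<alpha> i) * of_real ((\<xi> $ i) ^ \<alpha> i))"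

definition shifted_test :: "real ^ 'n::finite \<Rightarrow> real \<Rightarrow> ('n \<Rightarrow> nat) \<Rightarrow> (real \<Rightarrow> real) \<Rightarrow> (real ^ 'n) \<times> real \<Rightarrow> complex" where
  "shifted_test x\<^sub>0 t\<^sub>0 \<alpha> f p = of_real (heat_test \<alpha> f (unreflect_at x\<^sub>0 t\<^sub>0 p))"

lemma shifted_test_integrable:
  assumes f: "admissible l f"
  shows "integrable lborel (shifted_test x\<^sub>0 t\<^sub>0 \<alpha> f)" "square_integrable lborel (shifted_test x\<^sub>0 t\<^sub>0 \<alpha> f)"
    "shifted_test x\<^sub>0 t\<^sub>0 \<alpha> f \<in> borel_measurable borel"
proof -
  have fm: "f \<in> borel_measurable borel" using f by (simp add: admissible_def)
  note [measurable] = heat_test_measurable[OF fm]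
  have m: "shifted_test x\<^sub>0 t\<^sub>0 \<alpha> f \<in> borel_measurable borel" unfolding shifted_test_def[abs_def] by measurable
  then show "shifted_test x\<^sub>0 t\<^sub>0 \<alpha> f \<in> borel_measurable borel" .
  have "integrable lborel (\<lambda>p. shifted_test x\<^sub>0 t\<^sub>0 \<alpha> f (reflect_at x\<^sub>0 t\<^sub>0 p))"
    using heat_test_integrable(1)[OF f, of \<alpha>] by (simp add: shifted_test_def complex_of_real_integrable_eq)
  then show "integrable lborel (shifted_test x\<^sub>0 t\<^sub>0 \<alpha> f)" unfolding lborel_reflect_at(1)[OF m] .
  have "integrable lborel (\<lambda>p. (norm (shifted_test x\<^sub>0 t\<^sub>0 \<alpha> f (reflect_at x\<^sub>0 t\<^sub>0 p)))\<^sup>2)"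
    using heat_test_integrable(2)[OF f, of \<alpha>] by (simp add: shifted_test_def square_integrable_def)
  then have "integrable lborel (\<lambda>p. (norm (shifted_test x\<^sub>0 t\<^sub>0 \<alpha> f p))\<^sup>2)"
    using lborel_reflect_at(1)[of "\<lambda>p. (norm (shifted_test x\<^sub>0 t\<^sub>0 \<alpha> f p))\<^sup>2" x\<^sub>0 t\<^sub>0] m by simp
  then show "square_integrable lborel (shifted_test x\<^sub>0 t\<^sub>0 \<alpha> f)" using m by (simp add: square_integrable_def)
qed

text \<open>The spatial transform leaves exp (- 4 pi^2 |\<xi>|^2 t). Time reversal turns the
  temporal phase into exp (2 pi \<i> \<sigma> t), so the remaining time integral is a Laplace
  transform at the conjugate of the base of the symbol.\<close>

lemma fourier_shifted_test:
  fixes \<alpha> :: "'n::finite \<Rightarrow> nat"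
  assumes f: "admissible l f"
  shows "fourier_integral (shifted_test x\<^sub>0 t\<^sub>0 \<alpha> f) q =
    fourier_kernel q (x\<^sub>0, t\<^sub>0) * (caloric_poly \<alpha> (fst q) * half_laplace f (heat_symbol_base q))"
proof -
  have fm [measurable]: "f \<in> borel_measurable borel" using f by (simp add: admissible_def)
  have hm: "heat_test \<alpha> f \<in> borel_measurable borel" by (rule heat_test_measurable[OF fm])
  define E where "E p = iexp (- 2 * pi * (fst q \<bullet> fst p)) * iexp (2 * pi * (snd q * snd p))" for p :: "(real ^ 'n) \<times> real"
  have k: "fourier_kernel q (reflect_at x\<^sub>0 t\<^sub>0 p) = fourier_kernel q (x\<^sub>0, t\<^sub>0) * E p" for p
    unfolding fourier_kernel_def E_def exp_add[symmetric] reflect_at_def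
    by (rule arg_cong[of _ _ exp]) (simp add: inner_prod_def inner_add_right algebra_simps)
  have "fourier_integral (shifted_test x\<^sub>0 t\<^sub>0 \<alpha> f) q = (LINT p|lborel. fourier_kernel q p * shifted_test x\<^sub>0 t\<^sub>0 \<alpha> f p)"
    by (rule fourier_integral_lborel[OF shifted_test_integrable(3)[OF f]])
  also have "\<dots> = (LINT p|lborel. fourier_kernel q (reflect_at x\<^sub>0 t\<^sub>0 p) * shifted_test x\<^sub>0 t\<^sub>0 \<alpha> f (reflect_at x\<^sub>0 t\<^sub>0 p))"
    by (rule lborel_reflect_at(2)[symmetric]) (use shifted_test_integrable(3)[OF f] in measurable)
  also have "\<dots> = fourier_kernel q (x\<^sub>0, t\<^sub>0) * (LINT p|lborel. E p * of_real (heat_test \<alpha> f p))"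
    unfolding k shifted_test_def unreflect_reflect by (subst integral_mult_right_zero[symmetric]) (simp add: mult.assoc)
  also have "(LINT p|lborel. E p * of_real (heat_test \<alpha> f p)) = (LINT t|lborel. LINT y|lborel. E (y, t) * of_real (heat_test \<alpha> f (y, t)))"
  proof (rule lborel_LINT_snd(1))
    show "integrable lborel (\<lambda>p. E p * of_real (heat_test \<alpha> f p))"
    proof (rule Bochner_Integration.integrable_bound[OF heat_test_integrable(1)[OF f, of \<alpha>]])
      have "E \<in> borel_measurable borel"
        unfolding E_def by (intro borel_measurable_continuous_onI continuous_intros)
      then show "(\<lambda>p. E p * of_real (heat_test \<alpha> f p)) \<in> borel_measurable lborel" using hm by simp
    qed (simp add: E_def norm_mult)
  qed
  also have "\<dots> = (LINT t|lborel. indicator {0<..} t *\<^sub>R (caloric_poly \<alpha> (fst q) * (of_real (f t) * exp (- heat_symbol_base q * of_real t))))"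
  proof (rule Bochner_Integration.integral_cong[OF refl])
    fix t :: real
    show "(LINT y|lborel. E (y, t) * of_real (heat_test \<alpha> f (y, t))) =
      indicator {0<..} t *\<^sub>R (caloric_poly \<alpha> (fst q) * (of_real (f t) * exp (- heat_symbol_base q * of_real t)))"
    proof (cases "t > 0")
      case True
      have "(LINT y|lborel. E (y, t) * of_real (heat_test \<alpha> f (y, t))) =
          (LINT y|lborel. (iexp (2 * pi * (snd q * t)) * of_real (f t)) * (iexp (- 2 * pi * (fst q \<bullet> y)) * of_real (dual_caloric \<alpha> t y)))"
        using True by (simp add: E_def heat_test_def mult_ac)
      also have "\<dots> = (iexp (2 * pi * (snd q * t)) * of_real (f t)) * (caloric_poly \<alpha> (fst q) * of_real (exp (- 4 * pi\<^sup>2 * (norm (fst q))\<^sup>2 * t)))"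
        unfolding integral_mult_right_zero dual_caloric_fourier[OF True] caloric_poly_def ..
      also have "\<dots> = caloric_poly \<alpha> (fst q) * (of_real (f t) * (iexp (2 * pi * (snd q * t)) * of_real (exp (- 4 * pi\<^sup>2 * (norm (fst q))\<^sup>2 * t))))"
        by (simp add: mult_ac)
      also have "iexp (2 * pi * (snd q * t)) * of_real (exp (- 4 * pi\<^sup>2 * (norm (fst q))\<^sup>2 * t)) = exp (- heat_symbol_base q * of_real t)"
        unfolding exp_of_real[symmetric] exp_add[symmetric]
        by (rule arg_cong[of _ _ exp]) (simp add: heat_symbol_base_def algebra_simps)
      finally show ?thesis using True by simp
    qed (simp add: heat_test_def)
  qed
  also have "\<dots> = caloric_poly \<alpha> (fst q) * half_laplace f (heat_symbol_base q)"
    unfolding half_laplace_def integral_half_line[symmetric] by (rule integral_mult_right_zero)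
  finally show ?thesis .
qed

text \<open>The square splits into one-dimensional factors: a monomial times a Gaussian in each
  coordinate of \<xi>, and a function of \<sigma> dominated by 1 / (1 + \<sigma>^2).\<close>

lemma integrable_heat_majorant:
  fixes \<alpha> :: "'n::finite \<Rightarrow> nat"
  assumes "l > 0"
  shows "integrable lborel (\<lambda>q :: (real ^ 'n) \<times> real. (norm (caloric_poly \<alpha> (fst q)) * exp (- l * (4 * pi\<^sup>2 * (norm (fst q))\<^sup>2)))\<^sup>2 * (1 / (1 + 2 * pi * \<bar>snd q\<bar>))\<^sup>2)"
proof (rule integrable_lborel_times[of "\<lambda>\<xi>. (norm (caloric_poly \<alpha> \<xi>) * exp (- l * (4 * pi\<^sup>2 * (norm \<xi>)\<^sup>2)))\<^sup>2" "\<lambda>\<sigma>. (1 / (1 + 2 * pi * \<bar>\<sigma>\<bar>))\<^sup>2"])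
  have i: "integrable lborel (\<lambda>y. (norm (caloric_const k))\<^sup>2 * (y ^ (2 * k) * exp (- (8 * pi\<^sup>2 * l) * y\<^sup>2)))" for k
    using assms by (intro integrable_mult_right integrable_gauss_monom) simp
  have eq: "(norm (caloric_poly \<alpha> \<xi>) * exp (- l * (4 * pi\<^sup>2 * (norm \<xi>)\<^sup>2)))\<^sup>2 =
    (\<Prod>i\<in>UNIV. (norm (caloric_const (\<alpha> i)))\<^sup>2 * ((\<xi> $ i) ^ (2 * \<alpha> i) * exp (- (8 * pi\<^sup>2 * l) * (\<xi> $ i)\<^sup>2)))" for \<xi> :: "real ^ 'n"
  proof -
    have "(norm (caloric_poly \<alpha> \<xi>))\<^sup>2 = (\<Prod>i\<in>UNIV. (norm (caloric_const (\<alpha> i)))\<^sup>2 * (\<xi> $ i) ^ (2 * \<alpha> i))"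
      by (simp add: caloric_poly_def prod_norm[symmetric] norm_mult norm_power prod_power_distrib power_mult_distrib power_mult[symmetric] mult.commute power_even_abs)
    moreover have "(exp (- l * (4 * pi\<^sup>2 * (norm \<xi>)\<^sup>2)))\<^sup>2 = (\<Prod>i\<in>UNIV. exp (- (8 * pi\<^sup>2 * l) * (\<xi> $ i)\<^sup>2))"
      unfolding exp_sum[OF finite, symmetric] norm_vec_def L2_set_def
      by (simp add: sum_nonneg sum_distrib_left sum_distrib_right sum_negf mult_ac exp_double[symmetric])
    ultimately show ?thesis by (simp only: power_mult_distrib prod.distrib[symmetric] mult.assoc)
  qed
  show "integrable lborel (\<lambda>\<xi> :: real ^ 'n. (norm (caloric_poly \<alpha> \<xi>) * exp (- l * (4 * pi\<^sup>2 * (norm \<xi>)\<^sup>2)))\<^sup>2)"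
    unfolding eq by (rule integrable_vec_prod[OF i])
  have "integrable lborel (\<lambda>\<sigma>::real. inverse (1 + \<sigma>\<^sup>2))"
    using integrable_inverse_1_plus_square by (simp add: set_integrable_def)
  then show "integrable lborel (\<lambda>\<sigma>::real. (1 / (1 + 2 * pi * \<bar>\<sigma>\<bar>))\<^sup>2)"
  proof (rule Bochner_Integration.integrable_bound)
    show "AE \<sigma> in lborel. norm ((1 / (1 + 2 * pi * \<bar>\<sigma>\<bar>))\<^sup>2) \<le> norm (inverse (1 + \<sigma>\<^sup>2))"
    proof (rule AE_I2)
      fix \<sigma> :: real
      have "1 * \<sigma>\<^sup>2 \<le> (2 * pi)\<^sup>2 * \<sigma>\<^sup>2" using pi_gt3 by (intro mult_right_mono) (auto simp: power2_eq_square intro!: mult_ge1_I)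
      then have "1 + \<sigma>\<^sup>2 \<le> (1 + 2 * pi * \<bar>\<sigma>\<bar>)\<^sup>2"
        by (simp add: power2_sum power_mult_distrib add_increasing2)
      then have "1 / (1 + 2 * pi * \<bar>\<sigma>\<bar>)\<^sup>2 \<le> 1 / (1 + \<sigma>\<^sup>2)"
        using less_le_trans[of 0 "1 + \<sigma>\<^sup>2"] by (intro frac_le) (auto intro: add_pos_nonneg)
      then show "norm ((1 / (1 + 2 * pi * \<bar>\<sigma>\<bar>))\<^sup>2) \<le> norm (inverse (1 + \<sigma>\<^sup>2))"
        by (simp add: power_divide inverse_eq_divide)
    qed
  qed measurable
qed

text \<open>Off this null set the real part of \<open>heat_symbol_base\<close> is positive, so the
  Laplace transforms converge and the powers avoid the branch cut.\<close>

lemma AE_fst_nonzero: "AE q in lborel. fst (q :: (real ^ 'n::finite) \<times> real) \<noteq> 0"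
proof -
  have "AE q in (lborel \<Otimes>\<^sub>M lborel). fst (q :: (real ^ 'n) \<times> real) \<noteq> 0"
  proof (rule lborel_pair.AE_pair_measure)
    show "AE x in lborel. AE y in lborel. fst (x :: real ^ 'n, y :: real) \<noteq> 0"
      using AE_lborel_singleton[of "0 :: real ^ 'n"] by eventually_elim simp
  qed measurable
  then show ?thesis unfolding lborel_prod .
qed

lemma Re_heat_symbol_base: "Re (heat_symbol_base q) = 4 * pi\<^sup>2 * (norm (fst q))\<^sup>2"
  and Im_heat_symbol_base: "Im (heat_symbol_base q) = - 2 * pi * snd q"
  by (simp_all add: heat_symbol_base_def)

lemma square_integrable_fourier_shifted_test:
  assumes f: "admissible l f"
  shows "square_integrable lborel (fourier_integral (shifted_test x\<^sub>0 t\<^sub>0 \<alpha> f))"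
proof -
  have l: "l > 0" using f by (simp add: admissible_def)
  obtain M where M: "M \<ge> 0" "\<And>z. 0 < Re z \<Longrightarrow> norm (half_laplace f z) \<le> M * exp (- l * Re z) / (1 + \<bar>Im z\<bar>)"
    using f by (auto simp: admissible_def laplace_decay_def)
  note [measurable] = shifted_test_integrable(3)[OF f]
  have m: "fourier_integral (shifted_test x\<^sub>0 t\<^sub>0 \<alpha> f) \<in> borel_measurable borel"
  proof -
    have "fourier_integral (shifted_test x\<^sub>0 t\<^sub>0 \<alpha> f) = (\<lambda>q. LINT p|lborel. fourier_kernel q p * shifted_test x\<^sub>0 t\<^sub>0 \<alpha> f p)"
      by (intro ext fourier_integral_lborel shifted_test_integrable(3)[OF f])
    then show ?thesis by simp
  qed
  have "integrable lborel (\<lambda>q. (norm (fourier_integral (shifted_test x\<^sub>0 t\<^sub>0 \<alpha> f) q))\<^sup>2)"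
  proof (rule Bochner_Integration.integrable_bound[OF integrable_mult_right[OF integrable_heat_majorant[OF l], of "M\<^sup>2" \<alpha>]])
    show "AE q in lborel. norm ((norm (fourier_integral (shifted_test x\<^sub>0 t\<^sub>0 \<alpha> f) q))\<^sup>2) \<le>
      norm (M\<^sup>2 * ((norm (caloric_poly \<alpha> (fst q)) * exp (- l * (4 * pi\<^sup>2 * (norm (fst q))\<^sup>2)))\<^sup>2 * (1 / (1 + 2 * pi * \<bar>snd q\<bar>))\<^sup>2))"
      using AE_fst_nonzero
    proof eventually_elim
      case (elim q)
      then have "0 < Re (heat_symbol_base q)" by (simp add: Re_heat_symbol_base)
      from M(2)[OF this] have "norm (half_laplace f (heat_symbol_base q)) \<le> M * exp (- l * (4 * pi\<^sup>2 * (norm (fst q))\<^sup>2)) * (1 / (1 + 2 * pi * \<bar>snd q\<bar>))"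
        by (simp add: Re_heat_symbol_base Im_heat_symbol_base abs_mult)
      then have "norm (fourier_integral (shifted_test x\<^sub>0 t\<^sub>0 \<alpha> f) q) \<le> norm (caloric_poly \<alpha> (fst q)) * (M * exp (- l * (4 * pi\<^sup>2 * (norm (fst q))\<^sup>2)) * (1 / (1 + 2 * pi * \<bar>snd q\<bar>)))"
        unfolding fourier_shifted_test[OF f] norm_mult norm_fourier_kernel mult_1 by (rule mult_left_mono) simp
      then have "(norm (fourier_integral (shifted_test x\<^sub>0 t\<^sub>0 \<alpha> f) q))\<^sup>2 \<le> (norm (caloric_poly \<alpha> (fst q)) * (M * exp (- l * (4 * pi\<^sup>2 * (norm (fst q))\<^sup>2)) * (1 / (1 + 2 * pi * \<bar>snd q\<bar>))))\<^sup>2"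
        by (rule power_mono) simp
      also have "\<dots> = M\<^sup>2 * ((norm (caloric_poly \<alpha> (fst q)) * exp (- l * (4 * pi\<^sup>2 * (norm (fst q))\<^sup>2)))\<^sup>2 * (1 / (1 + 2 * pi * \<bar>snd q\<bar>))\<^sup>2)"
        by (simp only: power_mult_distrib mult_ac)
      finally show ?case by simp
    qed
  qed (use m in simp)
  then show ?thesis using m by (simp add: square_integrable_def)
qed

text \<open>Conjugation commutes with the principal branch away from the negative axis; a nonzero
  \<xi> places the base in the right half-plane.\<close>

lemma cnj_heat_symbol:
  assumes "fst q \<noteq> 0"
  shows "cnj (heat_symbol s q) = heat_symbol_base q powr of_real s"
proof (cases q)
  case (Pair \<xi> \<sigma>)
  have "(2 * pi * norm \<xi>)\<^sup>2 > 0" using assms Pair by simp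
  then show ?thesis
    unfolding Pair heat_symbol_def heat_symbol_base_def prod.case
    by (subst cnj_powr) (auto simp: power_mult_distrib)
qed

lemma admissible_test_fun: "0 < p \<Longrightarrow> p < q \<Longrightarrow> admissible (min p 1) (test_fun p q)"
  unfolding admissible_def using integrable_test_fun test_fun_eq_0 abs_test_fun_le laplace_decay_test_fun by fastforce

lemma admissible_frac_test:
  assumes "0 < s" "s < 1" "0 < p" "p < q"
  shows "admissible (min p 1) (frac_test s p q)"
proof -
  obtain B where "\<And>\<tau>. \<tau> > 0 \<Longrightarrow> \<bar>frac_test s p q \<tau>\<bar> \<le> B" using frac_test_bounded[OF assms] by blast
  then show ?thesis
    unfolding admissible_def using assms integrable_frac_test[OF assms] frac_test_eq_0 laplace_decay_frac_test[OF assms] by auto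
qed

lemma admissible_cmult:
  assumes "admissible l f"
  shows "admissible l (\<lambda>t. c * f t)"
proof -
  obtain B where B: "\<And>t. t > 0 \<Longrightarrow> \<bar>f t\<bar> \<le> B" using assms by (auto simp: admissible_def)
  obtain M where M: "M \<ge> 0" "\<And>z. 0 < Re z \<Longrightarrow> norm (half_laplace f z) \<le> M * exp (- l * Re z) / (1 + \<bar>Im z\<bar>)"
    using assms by (auto simp: admissible_def laplace_decay_def)
  have L: "half_laplace (\<lambda>t. c * f t) z = of_real c * half_laplace f z" for z
    unfolding half_laplace_def by (subst integral_mult_right_zero[symmetric]) (simp add: mult.assoc)
  have "norm (half_laplace (\<lambda>t. c * f t) z) \<le> (\<bar>c\<bar> * M) * exp (- l * Re z) / (1 + \<bar>Im z\<bar>)" if "0 < Re z" for z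
    using mult_left_mono[OF M(2)[OF that], of "\<bar>c\<bar>"] unfolding L by (simp add: norm_mult mult.assoc)
  then have "laplace_decay l (\<lambda>t. c * f t)" unfolding laplace_decay_def using M(1) by (intro exI[of _ "\<bar>c\<bar> * M"]) auto
  moreover have "\<bar>c * f t\<bar> \<le> \<bar>c\<bar> * B" if "t > 0" for t using B[OF that] by (simp add: abs_mult mult_left_mono)
  ultimately show ?thesis using assms unfolding admissible_def by auto
qed

lemma half_laplace_cmult: "half_laplace (\<lambda>t. c * f t) z = of_real c * half_laplace f z"
  unfolding half_laplace_def by (subst integral_mult_right_zero[symmetric]) (simp add: mult.assoc)

definition caloric_moment :: "('n::finite \<Rightarrow> nat) \<Rightarrow> ((real ^ 'n) \<times> real \<Rightarrow> complex) \<Rightarrow> real \<Rightarrow> complex" where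
  "caloric_moment \<alpha> v \<tau> = (LINT y|lborel. v (y, \<tau>) * of_real (dual_caloric \<alpha> \<tau> y))"

lemma LINT_shifted_test:
  assumes f: "admissible l f" and u: "square_integrable lborel u"
  shows "(LINT p|lborel. u p * cnj (shifted_test x\<^sub>0 t\<^sub>0 \<alpha> f p)) =
    (LINT \<tau>|half_line. of_real (f \<tau>) * caloric_moment \<alpha> (\<lambda>p. u (reflect_at x\<^sub>0 t\<^sub>0 p)) \<tau>)"
proof -
  have um [measurable]: "u \<in> borel_measurable borel" using u by (simp add: square_integrable_def)
  note [measurable] = shifted_test_integrable(3)[OF f]
  have i: "integrable lborel (\<lambda>p. u (reflect_at x\<^sub>0 t\<^sub>0 p) * of_real (heat_test \<alpha> f p))"
    by (intro square_integrable_mult square_integrable_reflect_at u heat_test_integrable[OF f])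
  have "(LINT p|lborel. u p * cnj (shifted_test x\<^sub>0 t\<^sub>0 \<alpha> f p)) =
     (LINT p|lborel. u (reflect_at x\<^sub>0 t\<^sub>0 p) * cnj (shifted_test x\<^sub>0 t\<^sub>0 \<alpha> f (reflect_at x\<^sub>0 t\<^sub>0 p)))"
    by (rule lborel_reflect_at(2)[symmetric]) measurable
  also have "\<dots> = (LINT p|lborel. u (reflect_at x\<^sub>0 t\<^sub>0 p) * of_real (heat_test \<alpha> f p))"
    by (simp add: shifted_test_def)
  also have "\<dots> = (LINT t|lborel. LINT y|lborel. u (reflect_at x\<^sub>0 t\<^sub>0 (y, t)) * of_real (heat_test \<alpha> f (y, t)))"
    by (rule lborel_LINT_snd(1)[OF i])
  also have "\<dots> = (LINT t|lborel. indicator {0<..} t *\<^sub>R (of_real (f t) * caloric_moment \<alpha> (\<lambda>p. u (reflect_at x\<^sub>0 t\<^sub>0 p)) t))"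
  proof (rule Bochner_Integration.integral_cong[OF refl])
    fix t :: real
    show "(LINT y|lborel. u (reflect_at x\<^sub>0 t\<^sub>0 (y, t)) * of_real (heat_test \<alpha> f (y, t))) =
       indicator {0<..} t *\<^sub>R (of_real (f t) * caloric_moment \<alpha> (\<lambda>p. u (reflect_at x\<^sub>0 t\<^sub>0 p)) t)"
    proof (cases "t > 0")
      case True
      then show ?thesis unfolding caloric_moment_def
        by (subst integral_mult_right_zero[symmetric]) (simp add: heat_test_def mult_ac)
    qed (simp add: heat_test_def)
  qed
  finally show ?thesis unfolding integral_half_line .
qed

text \<open>The profiles are matched so that the symbol cancels: the transform of the one built from
  \<open>test_fun\<close> contains \<Gamma>(s) L(z), that of the one built from
  \<open>frac_test\<close> contains \<Gamma>(s) z^-s L(z), and their quotient z^s is the conjugate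
  symbol.\<close>

theorem caloric_moment_weak:
  assumes s: "0 < s" "s < 1" and u: "u \<in> Dom_H s" and H: "AE p in lebesgue. H s u p = w p"
    and u': "square_integrable lborel u'" "AE p in lborel. u p = u' p"
    and w': "square_integrable lborel w'" "AE p in lborel. w p = w' p"
    and pq: "0 < p" "p < q"
  shows "(LINT t|half_line. of_real (test_fun p q t) * caloric_moment \<alpha> (\<lambda>p. u' (reflect_at x\<^sub>0 t\<^sub>0 p)) t) =
    (LINT \<tau>|half_line. of_real (frac_test s p q \<tau>) * (caloric_moment \<alpha> (\<lambda>p. w' (reflect_at x\<^sub>0 t\<^sub>0 p)) \<tau> / of_real (Gamma s)))"
proof -
  \<comment> \<open>The factor \<open>Gamma s\<close> compensates the missing normalisation of
    \<open>frac_test\<close>; at the end it is divided out and moves to the moment of w.\<close>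
  define f where "f t = Gamma s * test_fun p q t" for t
  have G: "Gamma s > 0" by (rule Gamma_real_pos[OF s(1)])
  have af: "admissible (min p 1) f" unfolding f_def by (intro admissible_cmult admissible_test_fun pq)
  have ag: "admissible (min p 1) (frac_test s p q)" by (rule admissible_frac_test[OF s pq])
  have "AE k in lborel. fourier_integral (shifted_test x\<^sub>0 t\<^sub>0 \<alpha> f) k = cnj (heat_symbol s k) * fourier_integral (shifted_test x\<^sub>0 t\<^sub>0 \<alpha> (frac_test s p q)) k"
    using AE_fst_nonzero
  proof eventually_elim
    case (elim k)
    let ?z = "heat_symbol_base k"
    have z: "Re ?z > 0" using elim by (simp add: Re_heat_symbol_base)
    then have "?z \<noteq> 0" by auto
    then have "?z powr of_real s * ?z powr (- of_real s) = 1" by (simp add: powr_add[symmetric])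
    then have "half_laplace f ?z = ?z powr of_real s * half_laplace (frac_test s p q) ?z"
      unfolding f_def half_laplace_cmult half_laplace_frac_test[OF s pq z] by (simp add: mult_ac)
    then show ?case
      unfolding fourier_shifted_test[OF af] fourier_shifted_test[OF ag] cnj_heat_symbol[OF elim] by (simp add: mult_ac)
  qed
  then have "(LINT p|lborel. u' p * cnj (shifted_test x\<^sub>0 t\<^sub>0 \<alpha> f p)) = (LINT k|lborel. w' k * cnj (shifted_test x\<^sub>0 t\<^sub>0 \<alpha> (frac_test s p q) k))"
    by (intro weak_equation[OF u H u' w'] shifted_test_integrable[OF af] shifted_test_integrable[OF ag]
        square_integrable_fourier_shifted_test[OF af] square_integrable_fourier_shifted_test[OF ag])
  then have "(LINT t|half_line. of_real (Gamma s) * (of_real (test_fun p q t) * caloric_moment \<alpha> (\<lambda>p. u' (reflect_at x\<^sub>0 t\<^sub>0 p)) t)) =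
     (LINT \<tau>|half_line. of_real (frac_test s p q \<tau>) * caloric_moment \<alpha> (\<lambda>p. w' (reflect_at x\<^sub>0 t\<^sub>0 p)) \<tau>)"
    unfolding LINT_shifted_test[OF af u'(1)] LINT_shifted_test[OF ag w'(1)] by (simp add: f_def mult.assoc)
  then have eq: "of_real (Gamma s) * (LINT t|half_line. of_real (test_fun p q t) * caloric_moment \<alpha> (\<lambda>p. u' (reflect_at x\<^sub>0 t\<^sub>0 p)) t) =
     (LINT \<tau>|half_line. of_real (frac_test s p q \<tau>) * caloric_moment \<alpha> (\<lambda>p. w' (reflect_at x\<^sub>0 t\<^sub>0 p)) \<tau>)"
    by (simp only: integral_mult_right_zero)
  have "(LINT \<tau>|half_line. of_real (frac_test s p q \<tau>) * (caloric_moment \<alpha> (\<lambda>p. w' (reflect_at x\<^sub>0 t\<^sub>0 p)) \<tau> / of_real (Gamma s))) =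
     (LINT \<tau>|half_line. of_real (frac_test s p q \<tau>) * caloric_moment \<alpha> (\<lambda>p. w' (reflect_at x\<^sub>0 t\<^sub>0 p)) \<tau>) / of_real (Gamma s)"
    by (subst integral_divide_zero[symmetric]) simp
  then show ?thesis using eq[symmetric] G by simp
qed

section \<open>Gaussian averages\<close>

lemma lborel_LINT_scale:
  fixes f :: "'a::euclidean_space \<Rightarrow> 'b::{banach, second_countable_topology}"
  assumes r: "r > 0" and f: "f \<in> borel_measurable borel"
  shows "integrable lborel (\<lambda>x. f (r *\<^sub>R x)) \<longleftrightarrow> integrable lborel f"
    "(LINT y|lborel. f y) = r ^ DIM('a) *\<^sub>R (LINT x|lborel. f (r *\<^sub>R x))"
proof -
  have eq: "lborel = density (distr lborel borel (\<lambda>x :: 'a. r *\<^sub>R x)) (\<lambda>_. ennreal (r ^ DIM('a)))"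
    using lborel_affine[of r "0 :: 'a"] r by simp
  have m: "(\<lambda>x :: 'a. r *\<^sub>R x) \<in> borel_measurable lborel" by simp
  have "integrable (density (distr lborel borel (\<lambda>x :: 'a. r *\<^sub>R x)) (\<lambda>_. ennreal (r ^ DIM('a)))) f \<longleftrightarrow> integrable lborel (\<lambda>x. f (r *\<^sub>R x))"
    using r f m integrable_scaleR_right[of "1 / r ^ DIM('a)" lborel "\<lambda>x. r ^ DIM('a) *\<^sub>R f (r *\<^sub>R x)"]
    by (subst integrable_density) (auto simp: integrable_distr_eq)
  then show "integrable lborel (\<lambda>x. f (r *\<^sub>R x)) \<longleftrightarrow> integrable lborel f" unfolding eq[symmetric] ..
  have "(LINT y|density (distr lborel borel (\<lambda>x :: 'a. r *\<^sub>R x)) (\<lambda>_. ennreal (r ^ DIM('a))). f y) = r ^ DIM('a) *\<^sub>R (LINT x|lborel. f (r *\<^sub>R x))"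
    using r f m by (subst integral_density) (auto simp: integral_distr)
  then show "(LINT y|lborel. f y) = r ^ DIM('a) *\<^sub>R (LINT x|lborel. f (r *\<^sub>R x))" unfolding eq[symmetric] .
qed

definition gauss_mass :: "((real ^ 'n::finite) \<times> real \<Rightarrow> complex) \<Rightarrow> real \<Rightarrow> ennreal" where
  "gauss_mass v \<tau> = (\<integral>\<^sup>+y. ennreal ((norm (v (y, \<tau>)))\<^sup>2 * exp (- (norm y)\<^sup>2 / (4 * \<tau>))) \<partial>lborel)"

text \<open>2 d is the power of \<tau> that makes the squared moments of all orders homogeneous of
  the same degree. The summand n / 4 removes the remaining power \<tau>^(n/2) of the volume, so
  \<open>gauss_mass\<close> appears without a power of \<tau>.\<close>

definition moment_order :: "('n::finite \<Rightarrow> nat) \<Rightarrow> real" where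
  "moment_order \<alpha> = real CARD('n) / 4 + real (sum \<alpha> UNIV) / 2"

lemma moment_order_ge: "1 / 4 \<le> moment_order (\<alpha> :: 'a::finite \<Rightarrow> nat)"
proof -
  have "1 \<le> real CARD('a)" by (simp add: Suc_leI)
  then show ?thesis unfolding moment_order_def by (simp add: add_increasing2 sum_nonneg)
qed

lemma borel_measurable_section:
  fixes v :: "'a::euclidean_space \<times> 'b::euclidean_space \<Rightarrow> 'c::topological_space"
  assumes "v \<in> borel_measurable borel"
  shows "(\<lambda>y. v (y, \<tau>)) \<in> borel_measurable borel"
  by (rule measurable_compose[OF _ assms]) (auto intro!: borel_measurable_continuous_onI continuous_intros)

lemma measurable_swap_borel [measurable]:
  fixes v :: "'a::euclidean_space \<times> 'b::euclidean_space \<Rightarrow> 'c::topological_space"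
  assumes "v \<in> borel_measurable borel"
  shows "(\<lambda>p. v (snd p, fst p)) \<in> borel_measurable (borel \<Otimes>\<^sub>M lborel)"
proof -
  have "(\<lambda>p :: 'b \<times> 'a. (snd p, fst p)) \<in> borel \<Otimes>\<^sub>M lborel \<rightarrow>\<^sub>M borel"
    unfolding borel_prod[symmetric] by measurable
  from measurable_compose[OF this assms] show ?thesis .
qed

lemma gauss_mass_measurable [measurable]:
  fixes v :: "(real ^ 'n::finite) \<times> real \<Rightarrow> complex"
  assumes "v \<in> borel_measurable borel"
  shows "gauss_mass v \<in> borel_measurable borel"
proof -
  note [measurable] = measurable_swap_borel[OF assms]
  show ?thesis unfolding gauss_mass_def[abs_def] by (rule lborel.borel_measurable_nn_integral) (simp add: case_prod_beta)
qed

lemma caloric_moment_measurable [measurable]: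
  fixes v :: "(real ^ 'n::finite) \<times> real \<Rightarrow> complex"
  assumes "v \<in> borel_measurable borel"
  shows "caloric_moment \<alpha> v \<in> borel_measurable borel"
proof -
  note [measurable] = measurable_swap_borel[OF assms]
  have "(\<lambda>p :: real \<times> (real ^ 'n). dual_caloric \<alpha> (fst p) (snd p)) \<in> borel_measurable (borel \<Otimes>\<^sub>M lborel)"
    by (intro dual_caloric_measurable) simp_all
  note [measurable] = this
  show ?thesis unfolding caloric_moment_def[abs_def] by (rule lborel.borel_measurable_lebesgue_integral) (simp add: case_prod_beta)
qed

text \<open>The Gaussian exp (- |y|^2 / (4 \<tau>)) is shared equally: one half belongs to the
  rescaled Hermite function, the other half is left for the function that is paired with it.\<close>

lemma dual_caloric_hermite_vec:
  fixes \<alpha> :: "'n::finite \<Rightarrow> nat"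
  assumes \<tau>: "\<tau> > 0"
  shows "dual_caloric \<alpha> \<tau> y = \<tau> powr (- (real CARD('n) + real (sum \<alpha> UNIV)) / 2) *
    (hermite_vec \<alpha> ((1 / sqrt (8 * pi * \<tau>)) *\<^sub>R y) * exp (- (norm y)\<^sup>2 / (8 * \<tau>)))"
proof -
  have "(\<Prod>i\<in>UNIV. \<tau> powr (- (1 + real (\<alpha> i)) / 2)) = \<tau> powr (\<Sum>i\<in>UNIV. - (1 + real (\<alpha> i)) / 2)"
    using \<tau> by (subst powr_sum) auto
  also have "(\<Sum>i\<in>UNIV. - (1 + real (\<alpha> i)) / 2) = - (real CARD('n) + real (sum \<alpha> UNIV)) / 2"
    by (simp only: sum_divide_distrib[symmetric] sum_negf sum.distrib) simp
  finally have 1: "(\<Prod>i\<in>UNIV. \<tau> powr (- (1 + real (\<alpha> i)) / 2)) = \<tau> powr (- (real CARD('n) + real (sum \<alpha> UNIV)) / 2)" .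
  have "- pi * (y $ i / sqrt (8 * pi * \<tau>))\<^sup>2 = - ((y $ i)\<^sup>2 / (8 * \<tau>))" for i
    using \<tau> by (simp add: power_divide field_simps)
  then have "(\<Prod>i\<in>UNIV. exp (- pi * (y $ i / sqrt (8 * pi * \<tau>))\<^sup>2)) = exp (\<Sum>i\<in>UNIV. - ((y $ i)\<^sup>2 / (8 * \<tau>)))"
    by (simp add: exp_sum)
  also have "(\<Sum>i\<in>UNIV. - ((y $ i)\<^sup>2 / (8 * \<tau>))) = - (norm y)\<^sup>2 / (8 * \<tau>)"
    by (simp add: norm_vec_def L2_set_def sum_nonneg sum_negf sum_divide_distrib[symmetric])
  finally have 2: "(\<Prod>i\<in>UNIV. exp (- pi * (y $ i / sqrt (8 * pi * \<tau>))\<^sup>2)) = exp (- (norm y)\<^sup>2 / (8 * \<tau>))" .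
  show ?thesis
    unfolding dual_caloric_def hermite_gauss_def prod.distrib 1 2 by (simp add: hermite_vec_def)
qed

text \<open>Attaching the left-over half of the Gaussian to v gives g, whose squared norm is the
  Gaussian mass. After rescaling by sqrt (8 pi \<tau>) the moments of v are multiples of the Hermite
  coefficients of g.\<close>

lemma caloric_moment_Parseval:
  fixes v :: "(real ^ 'n::finite) \<times> real \<Rightarrow> complex"
  assumes \<tau>: "\<tau> > 0" and v: "v \<in> borel_measurable borel" and fin: "gauss_mass v \<tau> < \<infinity>"
  shows "(\<integral>\<^sup>+\<alpha>. ennreal (\<tau> powr (2 * moment_order \<alpha>) * (norm (caloric_moment \<alpha> v \<tau>))\<^sup>2) \<partial>count_space UNIV) =
    ennreal ((8 * pi) powr (real CARD('n) / 2)) * gauss_mass v \<tau>"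
proof -
  define r where "r = sqrt (8 * pi * \<tau>)"
  have r: "r > 0" using \<tau> by (simp add: r_def)
  define n where "n = real CARD('n)"
  define g where "g y = v (y, \<tau>) * of_real (exp (- (norm y)\<^sup>2 / (8 * \<tau>)))" for y
  note [measurable] = borel_measurable_section[OF v]
  have gm [measurable]: "g \<in> borel_measurable borel" unfolding g_def by measurable
  have ng: "(norm (g y))\<^sup>2 = (norm (v (y, \<tau>)))\<^sup>2 * exp (- (norm y)\<^sup>2 / (4 * \<tau>))" for y
    by (simp add: g_def norm_mult power_mult_distrib exp_double[symmetric])
  have mass: "gauss_mass v \<tau> = (\<integral>\<^sup>+y. ennreal ((norm (g y))\<^sup>2) \<partial>lborel)" unfolding gauss_mass_def ng ..
  then have g: "square_integrable lborel g" using fin by (simp add: square_integrable_iff_nn_integral)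
  have g2: "integrable lborel (\<lambda>y. (norm (g y))\<^sup>2)" by (rule square_integrableD(2)[OF g])
  have mass': "gauss_mass v \<tau> = ennreal (LINT y|lborel. (norm (g y))\<^sup>2)"
    unfolding mass by (rule nn_integral_eq_integral[OF g2]) simp
  define f where "f x = g (r *\<^sub>R x)" for x
  have f: "square_integrable lborel f"
    unfolding square_integrable_def f_def using lborel_LINT_scale(1)[OF r, of "\<lambda>y. (norm (g y))\<^sup>2"] g2 by simp
  have fg: "r ^ CARD('n) * (LINT x|lborel. (norm (f x))\<^sup>2) = (LINT y|lborel. (norm (g y))\<^sup>2)"
    using lborel_LINT_scale(2)[OF r, of "\<lambda>y. (norm (g y))\<^sup>2"] by (simp add: f_def)
  have "\<tau> powr (2 * moment_order \<alpha>) * (norm (caloric_moment \<alpha> v \<tau>))\<^sup>2 = ((8 * pi) powr (n / 2) * r ^ CARD('n)) * (norm (hermite_vec.coef f \<alpha>))\<^sup>2" for \<alpha>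
  proof -
    let ?e = "- (real CARD('n) + real (sum \<alpha> UNIV)) / 2"
    have "caloric_moment \<alpha> v \<tau> = (LINT y|lborel. of_real (\<tau> powr ?e) * (g y * of_real (hermite_vec \<alpha> ((1 / r) *\<^sub>R y))))"
      unfolding caloric_moment_def dual_caloric_hermite_vec[OF \<tau>] g_def r_def by (simp add: mult_ac)
    also have "\<dots> = of_real (\<tau> powr ?e) * (LINT y|lborel. g y * of_real (hermite_vec \<alpha> ((1 / r) *\<^sub>R y)))"
      by (rule integral_mult_right_zero)
    also have "(LINT y|lborel. g y * of_real (hermite_vec \<alpha> ((1 / r) *\<^sub>R y))) = r ^ CARD('n) *\<^sub>R hermite_vec.coef f \<alpha>"
      using r by (subst lborel_LINT_scale(2)[OF r]) (simp_all add: hermite_vec.coef_def f_def)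
    finally have "(norm (caloric_moment \<alpha> v \<tau>))\<^sup>2 = (\<tau> powr ?e)\<^sup>2 * (r ^ CARD('n))\<^sup>2 * (norm (hermite_vec.coef f \<alpha>))\<^sup>2"
      using r by (simp add: norm_mult power_mult_distrib)
    moreover have "\<tau> powr (2 * moment_order \<alpha>) * (\<tau> powr ?e)\<^sup>2 = \<tau> powr (- n / 2)"
      by (simp add: power2_eq_square powr_add[symmetric] moment_order_def n_def field_simps)
    moreover have "r ^ CARD('n) = (8 * pi) powr (n / 2) * \<tau> powr (n / 2)"
      using \<tau> r by (simp add: powr_realpow[symmetric] r_def n_def powr_half_sqrt[symmetric] powr_powr powr_mult[symmetric])
    moreover have "\<tau> powr (- n / 2) * \<tau> powr (n / 2) = 1" using \<tau> by (simp add: powr_add[symmetric])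
    ultimately show ?thesis by (simp add: power2_eq_square) (simp add: mult_ac)?
  qed
  then have "(\<integral>\<^sup>+\<alpha>. ennreal (\<tau> powr (2 * moment_order \<alpha>) * (norm (caloric_moment \<alpha> v \<tau>))\<^sup>2) \<partial>count_space UNIV) =
      (\<integral>\<^sup>+\<alpha>. ennreal ((8 * pi) powr (n / 2) * r ^ CARD('n)) * ennreal ((norm (hermite_vec.coef f \<alpha>))\<^sup>2) \<partial>count_space UNIV)"
    using r by (simp add: ennreal_mult[symmetric])
  also have "\<dots> = ennreal ((8 * pi) powr (n / 2) * r ^ CARD('n)) * ennreal (LINT x|lborel. (norm (f x))\<^sup>2)"
    by (subst nn_integral_cmult) (simp_all add: hermite_vec.Parseval[OF f])
  also have "\<dots> = ennreal ((8 * pi) powr (n / 2)) * gauss_mass v \<tau>"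
    unfolding mass' fg[symmetric] using r by (simp add: ennreal_mult[symmetric] mult.assoc)
  finally show ?thesis unfolding n_def .
qed

text \<open>Unlike Parseval's identity this inequality is also valid where the mass is infinite, so
  it applies at every time.\<close>

lemma caloric_moment_Bessel:
  fixes v :: "(real ^ 'n::finite) \<times> real \<Rightarrow> complex"
  assumes \<tau>: "\<tau> > 0" and v: "v \<in> borel_measurable borel"
  shows "(\<integral>\<^sup>+\<alpha>. ennreal (\<tau> powr (2 * moment_order \<alpha>) * (norm (caloric_moment \<alpha> v \<tau>))\<^sup>2) \<partial>count_space UNIV)
    \<le> ennreal ((8 * pi) powr (real CARD('n) / 2)) * gauss_mass v \<tau>"
proof (cases "gauss_mass v \<tau> < \<infinity>")
  case True
  then show ?thesis by (simp add: caloric_moment_Parseval[OF assms])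
next
  case False
  then have "gauss_mass v \<tau> = top" by (simp add: less_top[symmetric])
  then show ?thesis by (simp add: ennreal_mult_top)
qed

lemma caloric_moment_sq_le:
  fixes v :: "(real ^ 'n::finite) \<times> real \<Rightarrow> complex"
  assumes \<tau>: "\<tau> > 0" and v: "v \<in> borel_measurable borel"
  shows "ennreal (\<tau> powr (2 * moment_order \<alpha>) * (norm (caloric_moment \<alpha> v \<tau>))\<^sup>2)
    \<le> ennreal ((8 * pi) powr (real CARD('n) / 2)) * gauss_mass v \<tau>"
proof -
  let ?h = "\<lambda>\<alpha>. ennreal (\<tau> powr (2 * moment_order \<alpha>) * (norm (caloric_moment \<alpha> v \<tau>))\<^sup>2)"
  have "?h \<alpha> = (\<integral>\<^sup>+\<beta>. ?h \<beta> * indicator {\<alpha>} \<beta> \<partial>count_space UNIV)"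
    by (subst nn_integral_count_space_indicator[symmetric]) (simp_all add: nn_integral_count_space_finite)
  also have "\<dots> \<le> (\<integral>\<^sup>+\<beta>. ?h \<beta> \<partial>count_space UNIV)" by (intro nn_integral_mono) (simp split: split_indicator)
  finally show ?thesis using caloric_moment_Bessel[OF assms] by (rule order_trans)
qed

text \<open>A single squared moment, weighted by 2 d, is at most the whole mass; the remaining
  exponent a - 2 d is non-positive, where flatness of the mass applies.\<close>

lemma flat_class_caloric_moment:
  fixes v :: "(real ^ 'n::finite) \<times> real \<Rightarrow> complex"
  assumes v: "v \<in> borel_measurable borel"
    and flat: "\<And>a. a \<le> 0 \<Longrightarrow> (\<integral>\<^sup>+t. ennreal (t powr a) * gauss_mass v t \<partial>half_line) < \<infinity>"
  shows "flat_class (moment_order \<alpha>) (caloric_moment \<alpha> v)"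
  unfolding flat_class_def
proof (intro conjI allI impI)
  show "caloric_moment \<alpha> v \<in> borel_measurable half_line"
    by (rule borel_measurable_half_line[OF caloric_moment_measurable[OF v]])
  fix a assume a: "a \<le> 2 * moment_order \<alpha>"
  let ?c = "ennreal ((8 * pi) powr (real CARD('n) / 2))"
  note [measurable] = borel_measurable_half_line[OF gauss_mass_measurable[OF v]]
  have "(\<integral>\<^sup>+t. ennreal (t powr a * (norm (caloric_moment \<alpha> v t))\<^sup>2) \<partial>half_line)
     \<le> (\<integral>\<^sup>+t. ?c * (ennreal (t powr (a - 2 * moment_order \<alpha>)) * gauss_mass v t) \<partial>half_line)"
  proof (rule nn_integral_mono)
    fix t assume "t \<in> space half_line"
    then have t: "t > 0" by simp
    have "ennreal (t powr a * (norm (caloric_moment \<alpha> v t))\<^sup>2) =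
        ennreal (t powr (a - 2 * moment_order \<alpha>)) * ennreal (t powr (2 * moment_order \<alpha>) * (norm (caloric_moment \<alpha> v t))\<^sup>2)"
      by (simp add: ennreal_mult[symmetric] mult.assoc[symmetric] powr_add[symmetric])
    also have "\<dots> \<le> ennreal (t powr (a - 2 * moment_order \<alpha>)) * (?c * gauss_mass v t)"
      by (intro mult_left_mono caloric_moment_sq_le[OF t v]) simp
    finally show "ennreal (t powr a * (norm (caloric_moment \<alpha> v t))\<^sup>2) \<le> ?c * (ennreal (t powr (a - 2 * moment_order \<alpha>)) * gauss_mass v t)"
      by (simp add: mult_ac)
  qed
  also have "\<dots> = ?c * (\<integral>\<^sup>+t. ennreal (t powr (a - 2 * moment_order \<alpha>)) * gauss_mass v t \<partial>half_line)"
    by (rule nn_integral_cmult) measurable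
  also have "\<dots> < \<infinity>" using flat[of "a - 2 * moment_order \<alpha>"] a by (simp add: ennreal_mult_less_top)
  finally show "(\<integral>\<^sup>+t. ennreal (t powr a * (norm (caloric_moment \<alpha> v t))\<^sup>2) \<partial>half_line) < \<infinity>" .
qed

text \<open>Below T the right-hand side carries the small factor L T^(2 s) and is absorbed; above T
  the weight is at most its value at T. Comparing weights at T / 2 and at T then leaves 2^-p times a
  constant, with p growing with j.\<close>

lemma vanishing_by_absorption:
  fixes W :: "real \<Rightarrow> ennreal"
  assumes W [measurable]: "W \<in> borel_measurable half_line" and s: "0 < s" "s < 1" and L: "0 \<le> L" and N: "1 / 2 \<le> N"
    and flat: "\<And>a. a \<le> 0 \<Longrightarrow> (\<integral>\<^sup>+t. ennreal (t powr a) * W t \<partial>half_line) < \<infinity>"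
    and est: "\<And>j :: nat. (\<integral>\<^sup>+t. ennreal (t powr (- 2 * (N + real j) - 1)) * W t \<partial>half_line)
      \<le> ennreal L * (\<integral>\<^sup>+t. ennreal (t powr (2 * s - 2 * (N + real j) - 1)) * W t \<partial>half_line)"
  obtains T where "T > 0" "AE t in half_line. t < T \<longrightarrow> W t = 0"
proof -
  note [measurable] = ident_measurable_half_line
  \<comment> \<open>Chosen so that L T^(2 s) = L / (2 (L + 1)) \<le> 1 / 2; the summand 1 covers L =
    0.\<close>
  define T where "T = (1 / (2 * (L + 1))) powr (1 / (2 * s))"
  have T: "T > 0" using L by (simp add: T_def)
  have TL: "T powr (2 * s) = 1 / (2 * (L + 1))" using s L by (simp add: T_def powr_powr)
  have LT: "L * T powr (2 * s) \<le> 1 / 2" unfolding TL using L by (simp add: field_simps)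
  obtain b where b: "b \<ge> 0" "(\<integral>\<^sup>+t. ennreal (t powr 0) * W t \<partial>half_line) = ennreal b"
    using flat[of 0] by (cases "\<integral>\<^sup>+t. ennreal (t powr 0) * W t \<partial>half_line") auto
  \<comment> \<open>The gap between T / 2 and T produces the geometric factor.\<close>
  define I where "I = (\<integral>\<^sup>+t. indicator {..<T / 2} t * W t \<partial>half_line)"
  have I_le: "I \<le> ennreal ((1 / 2) ^ j * b)" for j :: nat
  proof -
    define p where "p = 2 * (N + real j) + 1"
    have e: "- 2 * (N + real j) - 1 = - p" "2 * s - 2 * (N + real j) - 1 = 2 * s - p" by (simp_all add: p_def)
    have p: "p \<ge> 2" "p \<ge> real j" using N by (auto simp: p_def)
    \<comment> \<open>Flatness makes the left-hand side finite, without which half of it could not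
      be subtracted from both sides below.\<close>
    obtain a where a: "a \<ge> 0" "(\<integral>\<^sup>+t. ennreal (t powr (- p)) * W t \<partial>half_line) = ennreal a"
      using flat[of "- p"] p by (cases "\<integral>\<^sup>+t. ennreal (t powr (- p)) * W t \<partial>half_line") auto
    have "ennreal a \<le> ennreal L * (\<integral>\<^sup>+t. ennreal (t powr (2 * s - p)) * W t \<partial>half_line)"
      using est[of j] unfolding e a(2) .
    also have "(\<integral>\<^sup>+t. ennreal (t powr (2 * s - p)) * W t \<partial>half_line) \<le>
      (\<integral>\<^sup>+t. ennreal (T powr (2 * s)) * (ennreal (t powr (- p)) * W t) + ennreal (T powr (2 * s - p)) * (ennreal (t powr 0) * W t) \<partial>half_line)"
    proof (rule nn_integral_mono)
      fix t assume "t \<in> space half_line"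
      then have t: "t > 0" by simp
      have "t powr (2 * s - p) \<le> T powr (2 * s) * t powr (- p) + T powr (2 * s - p) * t powr 0"
      proof (cases "t < T")
        case True
        have "t powr (2 * s - p) = t powr (2 * s) * t powr (- p)" by (simp add: powr_add[symmetric])
        also have "\<dots> \<le> T powr (2 * s) * t powr (- p)" using True t s by (intro mult_right_mono powr_mono2) auto
        finally show ?thesis using t by (simp add: add_increasing2)
      next
        case False
        then have "t powr (2 * s - p) \<le> T powr (2 * s - p)" using T s p by (intro powr_mono2') auto
        then show ?thesis using t by (simp add: add_increasing)
      qed
      then have "ennreal (t powr (2 * s - p)) * W t \<le> ennreal (T powr (2 * s) * t powr (- p) + T powr (2 * s - p) * t powr 0) * W t"
        by (intro mult_right_mono ennreal_leI) auto
      then show "ennreal (t powr (2 * s - p)) * W t \<le> ennreal (T powr (2 * s)) * (ennreal (t powr (- p)) * W t) + ennreal (T powr (2 * s - p)) * (ennreal (t powr 0) * W t)"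
        by (simp add: ennreal_mult ennreal_plus distrib_right mult.assoc)
    qed
    also have "\<dots> = ennreal (T powr (2 * s)) * ennreal a + ennreal (T powr (2 * s - p)) * ennreal b"
      unfolding a(2)[symmetric] b(2)[symmetric] by (subst nn_integral_add) (simp_all add: nn_integral_cmult)
    finally have "ennreal a \<le> ennreal (L * (T powr (2 * s) * a + T powr (2 * s - p) * b))"
      using L a b by (simp add: ennreal_mult[symmetric] ennreal_plus[symmetric] mult_left_mono del: ennreal_plus)
    then have "a \<le> L * (T powr (2 * s) * a + T powr (2 * s - p) * b)"
      using L a b by (subst (asm) ennreal_le_iff) auto
    also have "\<dots> = (L * T powr (2 * s)) * (a + T powr (- p) * b)"
      by (simp add: powr_diff powr_minus_divide algebra_simps)
    also have "\<dots> \<le> 1 / 2 * (a + T powr (- p) * b)"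
      using LT a b by (intro mult_right_mono) auto
    finally have a_le: "a \<le> T powr (- p) * b" by simp
    have "I \<le> (\<integral>\<^sup>+t. ennreal ((T / 2) powr p) * (ennreal (t powr (- p)) * W t) \<partial>half_line)"
      unfolding I_def
    proof (rule nn_integral_mono)
      fix t assume "t \<in> space half_line"
      then have t: "t > 0" by simp
      have "1 \<le> (T / 2) powr p * t powr (- p)" if "t < T / 2"
      proof -
        have "1 = t powr p * t powr (- p)" using t by (simp add: powr_add[symmetric])
        also have "\<dots> \<le> (T / 2) powr p * t powr (- p)" using that t p by (intro mult_right_mono powr_mono2) auto
        finally show ?thesis .
      qed
      then have "indicator {..<T / 2} t \<le> ennreal ((T / 2) powr p * t powr (- p))"
        by (auto simp: indicator_def ennreal_1[symmetric] simp del: ennreal_1 intro: ennreal_leI)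
      then have "indicator {..<T / 2} t * W t \<le> ennreal ((T / 2) powr p * t powr (- p)) * W t" by (rule mult_right_mono) simp
      then show "indicator {..<T / 2} t * W t \<le> ennreal ((T / 2) powr p) * (ennreal (t powr (- p)) * W t)"
        by (simp add: ennreal_mult mult.assoc)
    qed
    also have "\<dots> = ennreal ((T / 2) powr p * a)"
      unfolding ennreal_mult[OF powr_ge_zero a(1)] a(2)[symmetric] by (rule nn_integral_cmult) measurable
    also have "\<dots> \<le> ennreal ((1 / 2) ^ j * b)"
    proof (rule ennreal_leI)
      have "(T / 2) powr p * a \<le> (T / 2) powr p * (T powr (- p) * b)" by (intro mult_left_mono a_le) simp
      also have "\<dots> = (1 / 2) powr p * b" using T by (simp add: powr_divide powr_minus_divide)
      also have "\<dots> \<le> (1 / 2) powr real j * b" using p b by (intro mult_right_mono powr_mono') auto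
      finally show "(T / 2) powr p * a \<le> (1 / 2) ^ j * b" by (simp add: powr_realpow)
    qed
    finally show ?thesis .
  qed
  have "(\<lambda>j. ennreal ((1 / 2) ^ j * b)) \<longlonglongrightarrow> ennreal (0 * b)"
    by (intro tendsto_ennrealI tendsto_mult_right LIMSEQ_realpow_zero) auto
  then have "I \<le> ennreal (0 * b)" by (rule LIMSEQ_le_const) (use I_le in auto)
  then have "(\<integral>\<^sup>+t. indicator {..<T / 2} t * W t \<partial>half_line) = 0" unfolding I_def by simp
  then have "AE t in half_line. indicator {..<T / 2} t * W t = 0"
    by (subst (asm) nn_integral_0_iff_AE) auto
  then have "AE t in half_line. t < T / 2 \<longrightarrow> W t = 0" by eventually_elim (auto simp: indicator_def)
  then show ?thesis using T by (intro that[of "T / 2"]) auto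
qed

section \<open>From parabolic vanishing to flatness of the Gaussian mass\<close>

lemma power_mult_exp_le:
  fixes z :: real
  assumes "z \<ge> 0"
  shows "(1 + z) ^ m * exp (- z / 4) \<le> 4 ^ m * fact m * exp (1 / 4)"
proof -
  have "((1 + z) / 4) ^ m /\<^sub>R fact m \<le> exp ((1 + z) / 4)"
    unfolding exp_def using assms summable_exp_generic[of "(1 + z) / 4"]
    by (intro sum_le_suminf[of _ "{m}", simplified]) auto
  then have "(1 + z) ^ m \<le> 4 ^ m * fact m * exp ((1 + z) / 4)"
    by (simp add: field_simps power_divide)
  then have "(1 + z) ^ m * exp (- z / 4) \<le> 4 ^ m * fact m * exp ((1 + z) / 4) * exp (- z / 4)"
    by (rule mult_right_mono) simp
  also have "\<dots> = 4 ^ m * fact m * exp (1 / 4)"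
    by (simp add: mult.assoc exp_add[symmetric] add_divide_distrib)
  finally show ?thesis .
qed

text \<open>The Gaussian trades a singularity at time 0, present for every y, for one at the
  space-time origin only, measured by the squared parabolic distance |y|^2 + \<theta>. With z =
  |y|^2 / \<theta> it is the bound on (1 + z)^m exp (- z / 4).\<close>

lemma parabolic_gauss_le:
  fixes y :: "'a::real_normed_vector"
  assumes \<theta>: "\<theta> > 0"
  shows "exp (- (norm y)\<^sup>2 / (4 * \<theta>)) / \<theta> ^ m \<le> 4 ^ m * fact m * exp (1 / 4) / ((norm y)\<^sup>2 + \<theta>) ^ m"
proof -
  define z where "z = (norm y)\<^sup>2 / \<theta>"
  have z: "z \<ge> 0" using \<theta> by (simp add: z_def)
  have S: "(norm y)\<^sup>2 + \<theta> = \<theta> * (1 + z)" using \<theta> by (simp add: z_def field_simps)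
  have E: "exp (- (norm y)\<^sup>2 / (4 * \<theta>)) = exp (- z / 4)" by (simp add: z_def)
  have "exp (- z / 4) \<le> 4 ^ m * fact m * exp (1 / 4) / (1 + z) ^ m"
    using power_mult_exp_le[OF z, of m] z by (subst pos_le_divide_eq) (auto simp: mult.commute)
  then have "exp (- z / 4) / \<theta> ^ m \<le> 4 ^ m * fact m * exp (1 / 4) / (1 + z) ^ m / \<theta> ^ m"
    using \<theta> by (intro divide_right_mono) auto
  then show ?thesis unfolding E S by (simp only: power_mult_distrib divide_divide_eq_left mult.commute)
qed

text \<open>Where the parabolic distance is at least b / 2 the weight is bounded and x^2 remains.
  Closer to the origin x is at most C r^m with r comparable to the distance, and r^(2 m) cancels the
  singular weight, leaving a constant on a bounded box.\<close>

lemma parabolic_weight_le: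
  fixes y :: "'a::real_normed_vector"
  assumes \<theta>: "\<theta> > 0" and b: "b > 0" and a: "- real m \<le> a" "a \<le> 0" and C: "C \<ge> 0" and x: "x \<ge> 0"
    and K: "K = 4 ^ m * fact m * exp (1 / 4)"
    and small: "\<And>r. r \<in> \<rat> \<Longrightarrow> 0 < r \<Longrightarrow> r < b \<Longrightarrow> norm y < r \<Longrightarrow> \<theta> < r\<^sup>2 \<Longrightarrow> x \<le> C * r ^ m"
  shows "\<theta> powr a * (x\<^sup>2 * exp (- (norm y)\<^sup>2 / (4 * \<theta>))) \<le>
    (K / (b / 2) ^ (2 * m) + 1) * x\<^sup>2 + K * (C\<^sup>2 * 4 ^ m) * indicator (cball 0 b \<times> {0..b\<^sup>2}) (y, \<theta>)"
proof -
  define S where "S = (norm y)\<^sup>2 + \<theta>"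
  have S: "S > 0" using \<theta> by (simp add: S_def add_nonneg_pos)
  have K0: "K > 0" by (simp add: K)
  let ?E = "exp (- (norm y)\<^sup>2 / (4 * \<theta>))"
  have E: "?E \<le> 1" using \<theta> by simp
  have "\<theta> powr a \<le> 1 / \<theta> ^ m + 1"
  proof (cases "\<theta> < 1")
    case True
    then have "\<theta> powr a \<le> \<theta> powr (- real m)" using \<theta> a by (intro powr_mono') auto
    also have "\<dots> = 1 / \<theta> ^ m" using \<theta> by (simp add: powr_minus_divide powr_realpow)
    finally show ?thesis by simp
  next
    case False
    then have "\<theta> powr a \<le> 1 powr a" using a by (intro powr_mono2') auto
    then show ?thesis using \<theta> by (simp add: add_increasing)
  qed
  then have "\<theta> powr a * (x\<^sup>2 * ?E) \<le> (1 / \<theta> ^ m + 1) * (x\<^sup>2 * ?E)" by (rule mult_right_mono) simp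
  also have "\<dots> = ?E / \<theta> ^ m * x\<^sup>2 + x\<^sup>2 * ?E" by (simp add: algebra_simps)
  also have "\<dots> \<le> K / S ^ m * x\<^sup>2 + x\<^sup>2 * 1"
    unfolding S_def K by (intro add_mono mult_right_mono mult_left_mono parabolic_gauss_le \<theta> E) auto
  also have "K / S ^ m * x\<^sup>2 \<le> K / (b / 2) ^ (2 * m) * x\<^sup>2 + K * (C\<^sup>2 * 4 ^ m) * indicator (cball 0 b \<times> {0..b\<^sup>2}) (y, \<theta>)"
  proof (cases "(b / 2)\<^sup>2 \<le> S")
    case True
    then have "K / S ^ m \<le> K / ((b / 2)\<^sup>2) ^ m" using K0 S b by (intro divide_left_mono power_mono mult_pos_pos zero_less_power) auto
    then have "K / S ^ m * x\<^sup>2 \<le> K / ((b / 2)\<^sup>2) ^ m * x\<^sup>2" by (rule mult_right_mono) simp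
    then show ?thesis using K0 by (simp add: power_mult add_increasing2)
  next
    case False
    have root: "sqrt S < b / 2" using False b by (intro real_less_lsqrt) auto
    have "sqrt S < 2 * sqrt S" using S by simp
    \<comment> \<open>Any radius between sqrt S and 2 sqrt S serves: the lower bound puts (y,
      \<theta>) into the cylinder, the upper one keeps r below b and costs the factor 4^m. A
      rational one is taken because smallness is available for rational radii only.\<close>
    then obtain r where r: "r \<in> \<rat>" "sqrt S < r" "r < 2 * sqrt S" using Rats_dense_in_real by blast
    have r0: "r > 0" using r(2) S by (meson less_trans real_sqrt_gt_zero)
    have rb: "r < b" using r(3) root by linarith
    have Sr: "S < r\<^sup>2" using r(2) r0 S by (metis real_sqrt_less_iff real_sqrt_abs abs_of_pos)
    have "(norm y)\<^sup>2 < r\<^sup>2" "\<theta> < r\<^sup>2" using Sr \<theta> zero_le_power2[of "norm y"] unfolding S_def by linarith+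
    then have y: "norm y < r" "\<theta> < r\<^sup>2" using r0 by (auto intro: power2_less_imp_less)
    have "x \<le> C * r ^ m" by (rule small[OF r(1) r0 rb y])
    then have "x\<^sup>2 \<le> (C * r ^ m)\<^sup>2" using x by (rule power_mono)
    also have "\<dots> = C\<^sup>2 * (r\<^sup>2) ^ m" by (simp add: power_mult_distrib power_mult[symmetric] mult.commute)
    also have "\<dots> \<le> C\<^sup>2 * ((2 * sqrt S)\<^sup>2) ^ m" using r r0 by (intro mult_left_mono power_mono) auto
    also have "(2 * sqrt S)\<^sup>2 = 4 * S" using S by (simp add: power_mult_distrib)
    finally have "x\<^sup>2 \<le> C\<^sup>2 * (4 * S) ^ m" .
    then have "K / S ^ m * x\<^sup>2 \<le> K / S ^ m * (C\<^sup>2 * (4 * S) ^ m)" using K0 S by (intro mult_left_mono) auto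
    also have "\<dots> = K * (C\<^sup>2 * 4 ^ m)" using S by (simp add: power_mult_distrib)
    finally have le: "K / S ^ m * x\<^sup>2 \<le> K * (C\<^sup>2 * 4 ^ m)" .
    have "\<theta> \<le> b\<^sup>2" using y(2) power_strict_mono[OF rb, of 2] r0 by simp
    then have "(y, \<theta>) \<in> cball 0 b \<times> {0..b\<^sup>2}" using y rb \<theta> by simp
    then show ?thesis using le K0 b by (simp add: add_increasing)
  qed
  finally show ?thesis by (simp add: algebra_simps)
qed

text \<open>Vanishing of some order m >= - a suffices for the weight t^a: pointwise, the weighted
  integrand is dominated by |v|^2 plus a multiple of the indicator of a compact box, both integrable
  on space-time.\<close>

lemma gauss_mass_flat:
  fixes v :: "(real ^ 'n::finite) \<times> real \<Rightarrow> complex"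
  assumes v: "square_integrable lborel v" and a: "a \<le> 0"
    and vanish: "\<And>N. N > 0 \<Longrightarrow> \<exists>C b. b > 0 \<and> (\<forall>r. 0 < r \<longrightarrow> r < b \<longrightarrow>
      (AE p in lborel. norm (fst p) < r \<longrightarrow> 0 \<le> snd p \<longrightarrow> snd p < r\<^sup>2 \<longrightarrow> norm (v p) \<le> C * r powr N))"
  shows "(\<integral>\<^sup>+t. ennreal (t powr a) * gauss_mass v t \<partial>half_line) < \<infinity>"
proof -
  have vm [measurable]: "v \<in> borel_measurable borel" using v by (simp add: square_integrable_def)
  define m where "m = nat \<lceil>- a\<rceil> + 1"
  have m: "- real m \<le> a" "real m > 0" unfolding m_def by linarith+
  obtain C b where b: "b > 0" and C: "\<And>r. 0 < r \<Longrightarrow> r < b \<Longrightarrow>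
      (AE p in lborel. norm (fst p) < r \<longrightarrow> 0 \<le> snd p \<longrightarrow> snd p < r\<^sup>2 \<longrightarrow> norm (v p) \<le> C * r powr real m)"
    using vanish[OF m(2)] by blast
  \<comment> \<open>The exceptional null set depends on the radius; restriction to rational radii
    leaves a countable union.\<close>
  have "AE p in lborel. \<forall>r\<in>\<rat> \<inter> {0<..<b}. norm (fst p) < r \<longrightarrow> 0 \<le> snd p \<longrightarrow> snd p < r\<^sup>2 \<longrightarrow> norm (v p) \<le> C * r powr real m"
    by (subst AE_ball_countable) (use C in \<open>auto intro: countable_Int1 countable_rat\<close>)
  then have AE1: "AE p in lborel. \<forall>r\<in>\<rat>. 0 < r \<longrightarrow> r < b \<longrightarrow> norm (fst p) < r \<longrightarrow> 0 \<le> snd p \<longrightarrow> snd p < r\<^sup>2 \<longrightarrow> norm (v p) \<le> \<bar>C\<bar> * r ^ m"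
  proof eventually_elim
    case (elim p)
    show ?case
    proof (intro ballI impI)
      fix r assume r: "r \<in> \<rat>" "0 < r" "r < b" "norm (fst p) < r" "0 \<le> snd p" "snd p < r\<^sup>2"
      then have "norm (v p) \<le> C * r ^ m" using elim by (simp add: powr_realpow)
      also have "\<dots> \<le> \<bar>C\<bar> * r ^ m" using r by (intro mult_right_mono) auto
      finally show "norm (v p) \<le> \<bar>C\<bar> * r ^ m" .
    qed
  qed
  define K where "K = 4 ^ m * fact m * exp (1 / 4 :: real)"
  define A where "A = K / (b / 2) ^ (2 * m) + 1"
  define B where "B = K * (\<bar>C\<bar>\<^sup>2 * 4 ^ m)"
  have A: "A \<ge> 0" and B: "B \<ge> 0" using b by (auto simp: A_def B_def K_def)
  define box where "box = cball (0 :: real ^ 'n) b \<times> {0..b\<^sup>2}"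
  have box: "compact box" unfolding box_def by (intro compact_Times) auto
  then have [measurable]: "box \<in> sets borel" by (simp add: compact_imp_closed)
  have bfin: "emeasure lborel box < \<infinity>" by (rule emeasure_bounded_finite[OF compact_imp_bounded[OF box]])
  define f where "f p = ennreal (snd p powr a * ((norm (v p))\<^sup>2 * exp (- (norm (fst p))\<^sup>2 / (4 * snd p)))) * indicator {0<..} (snd p)" for p
  have [measurable]: "(\<lambda>p. fst p) \<in> borel_measurable (borel :: ((real ^ 'n) \<times> real) measure)" "(\<lambda>p. snd p) \<in> borel_measurable (borel :: ((real ^ 'n) \<times> real) measure)"
    by (auto intro!: borel_measurable_continuous_onI continuous_intros)
  have [measurable]: "f \<in> borel_measurable borel" unfolding f_def by measurable
  note [measurable] = borel_measurable_section[OF vm]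
  have "(\<integral>\<^sup>+t. ennreal (t powr a) * gauss_mass v t \<partial>half_line) = (\<integral>\<^sup>+t. \<integral>\<^sup>+y. f (y, t) \<partial>lborel \<partial>lborel)"
    unfolding nn_integral_half_line
  proof (rule nn_integral_cong)
    fix t :: real
    have "(\<integral>\<^sup>+y. f (y, t) \<partial>lborel) = (\<integral>\<^sup>+y. (ennreal (t powr a) * indicator {0<..} t) * ennreal ((norm (v (y, t)))\<^sup>2 * exp (- (norm y)\<^sup>2 / (4 * t))) \<partial>lborel)"
      by (simp add: f_def ennreal_mult mult_ac)
    also have "\<dots> = (ennreal (t powr a) * indicator {0<..} t) * gauss_mass v t"
      unfolding gauss_mass_def by (rule nn_integral_cmult) measurable
    finally show "ennreal (t powr a) * gauss_mass v t * indicator {0<..} t = (\<integral>\<^sup>+y. f (y, t) \<partial>lborel)" by (simp add: mult_ac)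
  qed
  also have "\<dots> = (\<integral>\<^sup>+p. f p \<partial>lborel)" by (rule lborel_nn_integral_snd[symmetric]) measurable
  also have "\<dots> \<le> (\<integral>\<^sup>+p. ennreal A * ennreal ((norm (v p))\<^sup>2) + ennreal B * indicator box p \<partial>lborel)"
  proof (rule nn_integral_mono_AE)
    show "AE p in lborel. f p \<le> ennreal A * ennreal ((norm (v p))\<^sup>2) + ennreal B * indicator box p"
      using AE1
    proof eventually_elim
      case (elim p)
      show ?case
      proof (cases "snd p > 0")
        case True
        have "snd p powr a * ((norm (v p))\<^sup>2 * exp (- (norm (fst p))\<^sup>2 / (4 * snd p))) \<le> A * (norm (v p))\<^sup>2 + B * indicator box (fst p, snd p)"
          unfolding A_def B_def box_def using elim True
          by (intro parabolic_weight_le[OF True b m(1) a _ _ K_def]) auto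
        then have "f p \<le> ennreal (A * (norm (v p))\<^sup>2 + B * indicator box p)"
          using True by (simp add: f_def ennreal_leI)
        then show ?thesis using A B by (simp add: ennreal_mult ennreal_indicator)
      qed (simp add: f_def)
    qed
  qed
  also have "\<dots> = ennreal A * (\<integral>\<^sup>+p. ennreal ((norm (v p))\<^sup>2) \<partial>lborel) + ennreal B * emeasure lborel box"
    by (subst nn_integral_add) (simp_all add: nn_integral_cmult nn_integral_cmult_indicator)
  also have "\<dots> < \<infinity>"
    using v bfin by (simp add: square_integrable_iff_nn_integral ennreal_mult_less_top)
  finally show ?thesis .
qed

section \<open>Unique continuation\<close>

text \<open>Four times the difference is an odd integer, hence at least 1 in absolute value; a
  stands for |\<alpha>|.\<close>

lemma quarter_dist:
  fixes k j a :: nat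
  shows "1 / 4 \<le> \<bar>real k - (1 / 4 + real j - real a / 2)\<bar>"
proof -
  define i where "i = 4 * int k - 4 * int j + 2 * int a - 1"
  have "odd i" by (simp add: i_def)
  then have "i \<noteq> 0" by (metis even_zero)
  then have "1 \<le> \<bar>i\<bar>" by linarith
  then have "1 \<le> \<bar>real_of_int i\<bar>" by (metis of_int_1_le_iff of_int_abs)
  moreover have "real k - (1 / 4 + real j - real a / 2) = real_of_int i / 4" by (simp add: i_def field_simps)
  ultimately show ?thesis by (simp only: abs_divide)
qed

lemma flat_class_divide:
  assumes "flat_class d F"
  shows "flat_class d (\<lambda>t. F t / of_real c)"
proof -
  have [measurable]: "F \<in> borel_measurable half_line" using assms by (simp add: flat_class_def)
  note [measurable] = ident_measurable_half_line
  have "(\<integral>\<^sup>+t. ennreal (t powr a * (norm (F t / of_real c))\<^sup>2) \<partial>half_line) < \<infinity>" if "a \<le> 2 * d" for a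
  proof -
    have "(\<integral>\<^sup>+t. ennreal (t powr a * (norm (F t / of_real c))\<^sup>2) \<partial>half_line) =
      (\<integral>\<^sup>+t. ennreal (1 / c\<^sup>2) * ennreal (t powr a * (norm (F t))\<^sup>2) \<partial>half_line)"
      by (simp add: ennreal_mult[symmetric] norm_divide power_divide)
    also have "\<dots> = ennreal (1 / c\<^sup>2) * (\<integral>\<^sup>+t. ennreal (t powr a * (norm (F t))\<^sup>2) \<partial>half_line)"
      by (rule nn_integral_cmult) measurable
    finally show ?thesis using assms that by (simp add: flat_class_def ennreal_mult_less_top)
  qed
  then show ?thesis unfolding flat_class_def by simp
qed

lemma gauss_mass_mono:
  fixes u g :: "(real ^ 'n::finite) \<times> real \<Rightarrow> complex"
  assumes u: "u \<in> borel_measurable borel" and le: "\<And>p. norm (g p) \<le> K * norm (u p)"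
  shows "gauss_mass g t \<le> ennreal (K\<^sup>2) * gauss_mass u t"
proof -
  note [measurable] = borel_measurable_section[OF u]
  have "gauss_mass g t \<le> (\<integral>\<^sup>+y. ennreal (K\<^sup>2) * ennreal ((norm (u (y, t)))\<^sup>2 * exp (- (norm y)\<^sup>2 / (4 * t))) \<partial>lborel)"
    unfolding gauss_mass_def
  proof (rule nn_integral_mono)
    fix y :: "real ^ 'n"
    have "(norm (g (y, t)))\<^sup>2 \<le> (K * norm (u (y, t)))\<^sup>2" by (rule power_mono[OF le]) simp
    then have "(norm (g (y, t)))\<^sup>2 * exp (- (norm y)\<^sup>2 / (4 * t)) \<le> K\<^sup>2 * ((norm (u (y, t)))\<^sup>2 * exp (- (norm y)\<^sup>2 / (4 * t)))"
      by (simp add: power_mult_distrib mult.assoc[symmetric])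
    then show "ennreal ((norm (g (y, t)))\<^sup>2 * exp (- (norm y)\<^sup>2 / (4 * t))) \<le> ennreal (K\<^sup>2) * ennreal ((norm (u (y, t)))\<^sup>2 * exp (- (norm y)\<^sup>2 / (4 * t)))"
      by (simp add: ennreal_mult[symmetric] ennreal_leI)
  qed
  also have "\<dots> = ennreal (K\<^sup>2) * gauss_mass u t"
    unfolding gauss_mass_def by (rule nn_integral_cmult) measurable
  finally show ?thesis .
qed

lemma gauss_mass_eq_0:
  fixes u :: "(real ^ 'n::finite) \<times> real \<Rightarrow> complex"
  assumes u: "u \<in> borel_measurable borel" and zero: "AE t in half_line. gauss_mass u t = 0"
  shows "AE p in lborel. 0 < snd p \<longrightarrow> u p = 0"
proof -
  have [measurable]: "(\<lambda>p. fst p) \<in> borel_measurable (borel :: ((real ^ 'n) \<times> real) measure)" "(\<lambda>p. snd p) \<in> borel_measurable (borel :: ((real ^ 'n) \<times> real) measure)"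
    by (auto intro!: borel_measurable_continuous_onI continuous_intros)
  define f where "f p = ennreal ((norm (u p))\<^sup>2 * exp (- (norm (fst p))\<^sup>2 / (4 * snd p))) * indicator {0<..} (snd p)" for p
  note [measurable] = u
  have [measurable]: "f \<in> borel_measurable borel" unfolding f_def by measurable
  note [measurable] = borel_measurable_section[OF u]
  have "(\<integral>\<^sup>+p. f p \<partial>lborel) = (\<integral>\<^sup>+t. \<integral>\<^sup>+y. f (y, t) \<partial>lborel \<partial>lborel)"
    by (rule lborel_nn_integral_snd) measurable
  also have "\<dots> = (\<integral>\<^sup>+t. gauss_mass u t * indicator {0<..} t \<partial>lborel)"
    unfolding gauss_mass_def f_def by (intro nn_integral_cong) (simp add: nn_integral_multc)
  also have "\<dots> = (\<integral>\<^sup>+t. gauss_mass u t \<partial>half_line)" by (rule nn_integral_half_line[symmetric])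
  also have "\<dots> = (\<integral>\<^sup>+t. 0 \<partial>half_line)" by (rule nn_integral_cong_AE[OF zero])
  finally have "(\<integral>\<^sup>+p. f p \<partial>lborel) = 0" by simp
  then have "AE p in lborel. f p = 0" by (subst (asm) nn_integral_0_iff_AE) auto
  then show ?thesis by eventually_elim (auto simp: f_def)
qed

text \<open>Parseval turns the mass of u into moments, the Carleman inequality passes to the moments
  of g, and Bessel's inequality returns to the mass of g, which the pointwise bound compares with
  that of u. The constant depends neither on \<alpha> nor on j, so absorption applies.\<close>

lemma backward_unique_continuation:
  fixes u g :: "(real ^ 'n::finite) \<times> real \<Rightarrow> complex"
  assumes s: "0 < s" "s < 1"
    and u: "u \<in> borel_measurable borel" and g: "g \<in> borel_measurable borel"
    and le: "\<And>p. norm (g p) \<le> K * norm (u p)"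
    and flat: "\<And>a. a \<le> 0 \<Longrightarrow> (\<integral>\<^sup>+t. ennreal (t powr a) * gauss_mass u t \<partial>half_line) < \<infinity>"
    and weak: "\<And>\<alpha> p q. 0 < p \<Longrightarrow> p < q \<Longrightarrow> (LINT t|half_line. of_real (test_fun p q t) * caloric_moment \<alpha> u t) =
      (LINT \<tau>|half_line. of_real (frac_test s p q \<tau>) * (caloric_moment \<alpha> g \<tau> / of_real (Gamma s)))"
  shows "AE p in lborel. 0 < snd p \<longrightarrow> u p = 0"
proof -
  note [measurable] = ident_measurable_half_line
  define W where "W = gauss_mass u"
  define c where "c = (8 * pi) powr (real CARD('n) / 2)"
  define d where "d \<alpha> = moment_order \<alpha>" for \<alpha> :: "'n \<Rightarrow> nat"
  define F where "F \<alpha> = caloric_moment \<alpha> u" for \<alpha>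
  define G where "G \<alpha> \<tau> = caloric_moment \<alpha> g \<tau> / of_real (Gamma s)" for \<alpha> \<tau>
  have c: "c > 0" by (simp add: c_def)
  have \<Gamma>: "Gamma s > 0" by (rule Gamma_real_pos[OF s(1)])
  have Wm [measurable]: "W \<in> borel_measurable half_line"
    unfolding W_def by (rule borel_measurable_half_line[OF gauss_mass_measurable[OF u]])
  have gm [measurable]: "gauss_mass g \<in> borel_measurable half_line"
    by (rule borel_measurable_half_line[OF gauss_mass_measurable[OF g]])
  have Fm [measurable]: "F \<alpha> \<in> borel_measurable half_line" for \<alpha>
    unfolding F_def by (rule borel_measurable_half_line[OF caloric_moment_measurable[OF u]])
  have [measurable]: "caloric_moment \<alpha> g \<in> borel_measurable half_line" for \<alpha>
    by (rule borel_measurable_half_line[OF caloric_moment_measurable[OF g]])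
  then have Gm [measurable]: "G \<alpha> \<in> borel_measurable half_line" for \<alpha>
    unfolding G_def by measurable
  have mass: "gauss_mass g t \<le> ennreal (K\<^sup>2) * W t" for t unfolding W_def by (rule gauss_mass_mono[OF u le])
  have flat_g: "(\<integral>\<^sup>+t. ennreal (t powr a) * gauss_mass g t \<partial>half_line) < \<infinity>" if "a \<le> 0" for a
  proof -
    have "(\<integral>\<^sup>+t. ennreal (t powr a) * gauss_mass g t \<partial>half_line) \<le> (\<integral>\<^sup>+t. ennreal (K\<^sup>2) * (ennreal (t powr a) * W t) \<partial>half_line)"
      using mult_left_mono[OF mass] by (intro nn_integral_mono) (simp add: mult.left_commute)
    also have "\<dots> = ennreal (K\<^sup>2) * (\<integral>\<^sup>+t. ennreal (t powr a) * W t \<partial>half_line)" by (rule nn_integral_cmult) measurable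
    also have "\<dots> < \<infinity>" using flat[OF that] by (simp add: W_def ennreal_mult_less_top)
    finally show ?thesis .
  qed
  have pair: "frac_pair s (d \<alpha>) (F \<alpha>) (G \<alpha>)" for \<alpha>
  proof
    show "flat_class (d \<alpha>) (F \<alpha>)" unfolding d_def F_def by (rule flat_class_caloric_moment[OF u flat])
    show "flat_class (d \<alpha>) (G \<alpha>)" unfolding d_def G_def by (intro flat_class_divide flat_class_caloric_moment[OF g flat_g])
    show "1 / 4 \<le> d \<alpha>" unfolding d_def by (rule moment_order_ge)
    show "(LINT t|half_line. of_real (test_fun p q t) * F \<alpha> t) =
      (LINT \<tau>|half_line. of_real (LINT t|half_line. frac_kernel s 0 t \<tau> * test_fun p q t) * G \<alpha> \<tau>)" if "0 < p" "p < q" for p q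
      using weak[OF that] unfolding F_def G_def frac_test_def .
  qed (use s in auto)
  have "(\<integral>\<^sup>+t. ennreal (t powr 0) * W t \<partial>half_line) \<noteq> \<infinity>"
    using flat[of 0] by (simp add: W_def less_top[symmetric])
  then have "AE t in half_line. ennreal (t powr 0) * W t \<noteq> \<infinity>"
    by (rule nn_integral_PInf_AE[rotated]) measurable
  \<comment> \<open>Parseval's identity needs finite mass; the flatness integral with exponent 0
    provides it at almost every time.\<close>
  then have Wfin: "AE t in half_line. 0 < t \<and> W t < \<infinity>"
    using AE_space by eventually_elim (simp add: less_top[symmetric])
  have Parseval: "AE t in half_line. (\<integral>\<^sup>+\<alpha>. ennreal (t powr (2 * d \<alpha>) * (norm (F \<alpha> t))\<^sup>2) \<partial>count_space UNIV) = ennreal c * W t"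
    using Wfin unfolding F_def d_def W_def c_def by eventually_elim (rule caloric_moment_Parseval[OF _ u], auto)
  have Bessel: "(\<integral>\<^sup>+\<alpha>. ennreal (t powr (2 * d \<alpha>) * (norm (G \<alpha> t))\<^sup>2) \<partial>count_space UNIV) \<le> ennreal (c * (K / Gamma s)\<^sup>2) * W t" if t: "t > 0" for t
  proof -
    have "(\<integral>\<^sup>+\<alpha>. ennreal (t powr (2 * d \<alpha>) * (norm (G \<alpha> t))\<^sup>2) \<partial>count_space UNIV) =
      (\<integral>\<^sup>+\<alpha>. ennreal (1 / (Gamma s)\<^sup>2) * ennreal (t powr (2 * d \<alpha>) * (norm (caloric_moment \<alpha> g t))\<^sup>2) \<partial>count_space UNIV)"
      unfolding G_def by (simp add: ennreal_mult[symmetric] norm_divide power_divide)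
    also have "\<dots> \<le> ennreal (1 / (Gamma s)\<^sup>2) * (ennreal c * gauss_mass g t)"
      unfolding d_def c_def by (subst nn_integral_cmult) (auto intro!: mult_left_mono caloric_moment_Bessel t g)
    also have "\<dots> \<le> ennreal (1 / (Gamma s)\<^sup>2) * (ennreal c * (ennreal (K\<^sup>2) * W t))"
      by (intro mult_left_mono mass) auto
    also have "\<dots> = ennreal (c * (K / Gamma s)\<^sup>2) * W t"
    proof -
      have "c * (K / Gamma s)\<^sup>2 = 1 / (Gamma s)\<^sup>2 * (c * K\<^sup>2)" by (simp add: power_divide)
      moreover have "ennreal (1 / (Gamma s)\<^sup>2 * (c * K\<^sup>2)) = ennreal (1 / (Gamma s)\<^sup>2) * (ennreal c * ennreal (K\<^sup>2))"
        using c by (simp only: ennreal_mult less_imp_le zero_le_power2 zero_le_divide_1_iff mult_nonneg_nonneg)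
      ultimately show ?thesis by (simp add: mult.assoc)
    qed
    finally show ?thesis .
  qed
  have half: "0 < 1 / (4 :: real)" "1 / 4 \<le> 1 / (2 :: real)" by simp_all
  obtain C where C: "C \<ge> 0" "\<And>\<mu> m. \<mu> < real m \<Longrightarrow> m = 0 \<or> real m - 1 < \<mu> \<Longrightarrow> (\<And>k :: nat. 1 / 4 \<le> \<bar>real k - \<mu>\<bar>) \<Longrightarrow> kernel_norm s \<mu> \<le> ennreal C"
    using kernel_norm_bounded[OF s half] by blast
  have kernel: "kernel_norm s \<mu> \<le> ennreal C" if dist: "\<And>k :: nat. 1 / 4 \<le> \<bar>real k - \<mu>\<bar>" for \<mu>
  proof (cases "\<mu> < 0")
    case True
    then show ?thesis using dist by (intro C(2)[of \<mu> 0]) auto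
  next
    case False
    have "real (nat \<lfloor>\<mu>\<rfloor>) \<le> \<mu>" "\<mu> < real (nat \<lfloor>\<mu>\<rfloor>) + 1" using False by linarith+
    then obtain k :: nat where k: "real k \<le> \<mu>" "\<mu> < real k + 1" by blast
    moreover have "real k \<noteq> \<mu>" using dist[of k] by auto
    ultimately show ?thesis by (intro C(2)[of \<mu> "Suc k"] dist) auto
  qed
  \<comment> \<open>With this offset N + j - d_\<alpha> = 1/4 + j - |\<alpha>|/2 for every \<alpha>,
    at distance at least 1/4 from all integers: n / 4 cancels the dimension in the moment order, and
    1 / 4 avoids the half-integers.\<close>
  define N where "N = real CARD('n) / 4 + 1 / 4"
  have "1 \<le> real CARD('n)" by (simp add: Suc_leI)
  then have N: "1 / 2 \<le> N" unfolding N_def by linarith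
  define L where "L = C\<^sup>2 * (K / Gamma s)\<^sup>2"
  have est: "(\<integral>\<^sup>+t. ennreal (t powr (- 2 * (N + real j) - 1)) * W t \<partial>half_line)
      \<le> ennreal L * (\<integral>\<^sup>+t. ennreal (t powr (2 * s - 2 * (N + real j) - 1)) * W t \<partial>half_line)" for j :: nat
  proof -
    let ?N = "N + real j"
    have dist: "1 / 4 \<le> \<bar>real k - (?N - d \<alpha>)\<bar>" for k \<alpha>
    proof -
      have "?N - d \<alpha> = 1 / 4 + real j - real (sum \<alpha> UNIV) / 2" unfolding N_def d_def moment_order_def by linarith
      then show ?thesis using quarter_dist by metis
    qed
    have N': "1 / 2 \<le> ?N" using N by simp
    have "ennreal c * (\<integral>\<^sup>+t. ennreal (t powr (- 2 * ?N - 1)) * W t \<partial>half_line) =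
        (\<integral>\<^sup>+t. ennreal (t powr (- 2 * ?N - 1)) * (ennreal c * W t) \<partial>half_line)"
      by (subst nn_integral_cmult[symmetric]) (auto simp: mult_ac)
    \<comment> \<open>The weight t^(2 d_\<alpha>) of Parseval's identity shifts the exponent
      differently for each order, so the moment of order \<alpha> is estimated with its own \<mu> =
      N + j - d_\<alpha>.\<close>
    also have "\<dots> = (\<integral>\<^sup>+t. \<integral>\<^sup>+\<alpha>. ennreal (t powr (- 2 * (?N - d \<alpha>) - 1) * (norm (F \<alpha> t))\<^sup>2) \<partial>count_space UNIV \<partial>half_line)"
    proof (rule nn_integral_cong_AE)
      show "AE t in half_line. ennreal (t powr (- 2 * ?N - 1)) * (ennreal c * W t) =
          (\<integral>\<^sup>+\<alpha>. ennreal (t powr (- 2 * (?N - d \<alpha>) - 1) * (norm (F \<alpha> t))\<^sup>2) \<partial>count_space UNIV)"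
        using Parseval
      proof eventually_elim
        case (elim t)
        have "t powr (- 2 * (?N - d \<alpha>) - 1) = t powr (- 2 * ?N - 1) * t powr (2 * d \<alpha>)" for \<alpha>
          by (simp add: powr_add[symmetric] algebra_simps)
        then show ?case
          unfolding elim[symmetric] by (subst nn_integral_cmult[symmetric]) (simp_all add: ennreal_mult mult.assoc)
      qed
    qed
    also have "\<dots> = (\<integral>\<^sup>+\<alpha>. \<integral>\<^sup>+t. ennreal (t powr (- 2 * (?N - d \<alpha>) - 1) * (norm (F \<alpha> t))\<^sup>2) \<partial>half_line \<partial>count_space UNIV)"
      by (rule nn_integral_count_space_nn_integral) auto
    also have "\<dots> \<le> (\<integral>\<^sup>+\<alpha>. ennreal (C\<^sup>2) * (\<integral>\<^sup>+t. ennreal (t powr (2 * s - 2 * (?N - d \<alpha>) - 1) * (norm (G \<alpha> t))\<^sup>2) \<partial>half_line) \<partial>count_space UNIV)"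
    proof (rule nn_integral_mono)
      fix \<alpha> :: "'n \<Rightarrow> nat"
      have "(kernel_norm s (?N - d \<alpha>))\<^sup>2 \<le> (ennreal C)\<^sup>2" by (intro power_mono kernel dist) simp
      also have "\<dots> = ennreal (C\<^sup>2)" using C(1) by (rule ennreal_power)
      finally show "(\<integral>\<^sup>+t. ennreal (t powr (- 2 * (?N - d \<alpha>) - 1) * (norm (F \<alpha> t))\<^sup>2) \<partial>half_line)
         \<le> ennreal (C\<^sup>2) * (\<integral>\<^sup>+t. ennreal (t powr (2 * s - 2 * (?N - d \<alpha>) - 1) * (norm (G \<alpha> t))\<^sup>2) \<partial>half_line)"
        by (intro order_trans[OF frac_pair.Carleman[OF pair N' dist]] mult_right_mono) auto
    qed
    also have "\<dots> = ennreal (C\<^sup>2) * (\<integral>\<^sup>+\<alpha>. \<integral>\<^sup>+t. ennreal (t powr (2 * s - 2 * (?N - d \<alpha>) - 1) * (norm (G \<alpha> t))\<^sup>2) \<partial>half_line \<partial>count_space UNIV)"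
      by (rule nn_integral_cmult) simp
    also have "(\<integral>\<^sup>+\<alpha>. \<integral>\<^sup>+t. ennreal (t powr (2 * s - 2 * (?N - d \<alpha>) - 1) * (norm (G \<alpha> t))\<^sup>2) \<partial>half_line \<partial>count_space UNIV) =
        (\<integral>\<^sup>+t. \<integral>\<^sup>+\<alpha>. ennreal (t powr (2 * s - 2 * (?N - d \<alpha>) - 1) * (norm (G \<alpha> t))\<^sup>2) \<partial>count_space UNIV \<partial>half_line)"
      by (rule nn_integral_count_space_nn_integral[symmetric]) auto
    also have "\<dots> \<le> (\<integral>\<^sup>+t. ennreal (c * (K / Gamma s)\<^sup>2) * (ennreal (t powr (2 * s - 2 * ?N - 1)) * W t) \<partial>half_line)"
    proof (rule nn_integral_mono)
      fix t assume "t \<in> space half_line"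
      then have t: "t > 0" by simp
      have "t powr (2 * s - 2 * (?N - d \<alpha>) - 1) = t powr (2 * s - 2 * ?N - 1) * t powr (2 * d \<alpha>)" for \<alpha>
        by (simp add: powr_add[symmetric] algebra_simps)
      then have "(\<integral>\<^sup>+\<alpha>. ennreal (t powr (2 * s - 2 * (?N - d \<alpha>) - 1) * (norm (G \<alpha> t))\<^sup>2) \<partial>count_space UNIV) =
          ennreal (t powr (2 * s - 2 * ?N - 1)) * (\<integral>\<^sup>+\<alpha>. ennreal (t powr (2 * d \<alpha>) * (norm (G \<alpha> t))\<^sup>2) \<partial>count_space UNIV)"
        by (subst nn_integral_cmult[symmetric]) (simp_all add: ennreal_mult mult.assoc)
      also have "\<dots> \<le> ennreal (t powr (2 * s - 2 * ?N - 1)) * (ennreal (c * (K / Gamma s)\<^sup>2) * W t)"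
        by (intro mult_left_mono Bessel t) simp
      finally show "(\<integral>\<^sup>+\<alpha>. ennreal (t powr (2 * s - 2 * (?N - d \<alpha>) - 1) * (norm (G \<alpha> t))\<^sup>2) \<partial>count_space UNIV)
          \<le> ennreal (c * (K / Gamma s)\<^sup>2) * (ennreal (t powr (2 * s - 2 * ?N - 1)) * W t)" by (simp add: mult_ac)
    qed
    also have "\<dots> = ennreal (c * (K / Gamma s)\<^sup>2) * (\<integral>\<^sup>+t. ennreal (t powr (2 * s - 2 * ?N - 1)) * W t \<partial>half_line)"
      by (rule nn_integral_cmult) measurable
    finally have "ennreal c * (\<integral>\<^sup>+t. ennreal (t powr (- 2 * ?N - 1)) * W t \<partial>half_line) \<le>
        ennreal (C\<^sup>2) * (ennreal (c * (K / Gamma s)\<^sup>2) * (\<integral>\<^sup>+t. ennreal (t powr (2 * s - 2 * ?N - 1)) * W t \<partial>half_line))"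
      by (simp add: mult_left_mono)
    also have "\<dots> = ennreal c * (ennreal L * (\<integral>\<^sup>+t. ennreal (t powr (2 * s - 2 * ?N - 1)) * W t \<partial>half_line))"
      using c by (simp add: L_def ennreal_mult mult_ac)
    finally show ?thesis using c by (subst (asm) ennreal_mult_le_mult_iff) auto
  qed
  obtain T where T: "T > 0" "AE t in half_line. t < T \<longrightarrow> W t = 0"
  proof (rule vanishing_by_absorption[OF Wm s _ N _ est])
    show "0 \<le> L" by (simp add: L_def)
    show "(\<integral>\<^sup>+t. ennreal (t powr a) * W t \<partial>half_line) < \<infinity>" if "a \<le> 0" for a using flat[OF that] by (simp add: W_def)
  qed
  have F0: "AE t in half_line. F \<alpha> t = 0" for \<alpha>
  proof (rule frac_pair.unique_continuation(2)[OF pair T(1)])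
    show "AE t in half_line. t < T \<longrightarrow> G \<alpha> t = 0"
      using T(2) AE_space
    proof eventually_elim
      case (elim t)
      show ?case
      proof
        assume "t < T"
        then have "gauss_mass g t = 0" using elim mass[of t] by simp
        then show "G \<alpha> t = 0" using caloric_moment_sq_le[of t g \<alpha>] g elim(2) by (simp add: G_def)
      qed
    qed
  qed
  then have "AE t in half_line. \<forall>\<alpha>. F \<alpha> t = 0" by (simp add: AE_all_countable)
  then have "AE t in half_line. W t = 0" using Parseval
  proof eventually_elim
    case (elim t)
    then show ?case using c by simp
  qed
  then show ?thesis unfolding W_def by (rule gauss_mass_eq_0[OF u])
qed

section \<open>Reading off the hypotheses\<close>

lemma Dx_zero: "Dx (\<lambda>_. 0) f = f"
proof -
  have "\<forall>i. count_list (SOME is :: 'a list. \<forall>i. count_list is i = 0) i = 0" by (rule someI_ex) (auto intro: exI[of _ "[]"])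
  \<comment> \<open>The empty list is the only one in which every index occurs zero times, so the
    choice of an order of differentiation has a single outcome here.\<close>
  then have "(SOME is :: 'a list. \<forall>i. count_list is i = 0) = []" by (metis count_list_0_iff list.set_intros(1) neq_Nil_conv)
  then show ?thesis by (simp add: Dx_def)
qed

lemma C_norm_bound:
  fixes V :: "(real ^ 'n::finite) \<times> real \<Rightarrow> real"
  assumes "C_norm k V \<le> ennreal K" and "0 \<le> K"
  shows "\<bar>V p\<bar> \<le> K"
proof -
  let ?A = "{(\<alpha> :: 'n \<Rightarrow> nat, j). sum \<alpha> UNIV + j \<le> k}"
  let ?f = "\<lambda>(\<alpha> :: 'n \<Rightarrow> nat, j). SUP p. ennreal \<bar>Dx \<alpha> ((Dt ^^ j) V) p\<bar>"
  have "ennreal \<bar>V p\<bar> \<le> (SUP p. ennreal \<bar>V p\<bar>)" by (rule SUP_upper) simp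
  also have "\<dots> = ?f ((\<lambda>_. 0), 0)" by (simp add: Dx_zero)
  also have "\<dots> \<le> (\<Sum>i\<in>?A. ?f i)" by (rule member_le_sum) (simp_all add: finite_multi_indices)
  also have "\<dots> \<le> ennreal K" using assms(1) unfolding C_norm_def .
  finally show ?thesis using assms(2) by simp
qed

lemma C_class_continuous: "C_class k V \<Longrightarrow> continuous_on UNIV V"
  by (cases k) auto

lemma vanishes_backwardD:
  fixes u :: "(real ^ 'n::finite) \<times> real \<Rightarrow> complex"
  assumes "vanishes_backward u x\<^sub>0 t\<^sub>0" and "N > 0"
  obtains C b where "b > 0" "\<And>r. 0 < r \<Longrightarrow> r < b \<Longrightarrow> AE p in lborel. p \<in> Q r x\<^sub>0 t\<^sub>0 \<longrightarrow> norm (u p) \<le> C * r powr N"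
proof -
  obtain C where "\<forall>\<^sub>F r in at_right 0. Linf_norm_on (Q r x\<^sub>0 t\<^sub>0) u \<le> ennreal (C * r powr N)"
    using assms unfolding vanishes_backward_def by blast
  then obtain b where b: "b > 0" "\<And>r. 0 < r \<Longrightarrow> r < b \<Longrightarrow> Linf_norm_on (Q r x\<^sub>0 t\<^sub>0) u \<le> ennreal (C * r powr N)"
    unfolding eventually_at_right_field by blast
  \<comment> \<open>The constant C may be negative, where \<open>ennreal\<close> truncates to 0; its
    absolute value gives a bound valid for real numbers.\<close>
  have "AE p in lborel. p \<in> Q r x\<^sub>0 t\<^sub>0 \<longrightarrow> norm (u p) \<le> \<bar>C\<bar> * r powr N" if r: "0 < r" "r < b" for r
  proof -
    have "Q r x\<^sub>0 t\<^sub>0 \<in> sets (borel \<Otimes>\<^sub>M borel)" unfolding Q_def by (intro pair_measureI) auto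
    then have Qb: "Q r x\<^sub>0 t\<^sub>0 \<inter> space lebesgue \<in> sets lebesgue" unfolding borel_prod by simp
    have "AE p in lebesgue_on (Q r x\<^sub>0 t\<^sub>0). ennreal (norm (u p)) \<le> Linf_norm_on (Q r x\<^sub>0 t\<^sub>0) u"
      unfolding Linf_norm_on_def by (rule esssup_AE)
    then have "AE p in lborel. p \<in> Q r x\<^sub>0 t\<^sub>0 \<longrightarrow> ennreal (norm (u p)) \<le> Linf_norm_on (Q r x\<^sub>0 t\<^sub>0) u"
      unfolding AE_restrict_space_iff[OF Qb] AE_lebesgue_iff .
    then show ?thesis
    proof eventually_elim
      case (elim p)
      show ?case
      proof
        assume "p \<in> Q r x\<^sub>0 t\<^sub>0"
        then have "ennreal (norm (u p)) \<le> ennreal (C * r powr N)" using elim b(2)[OF r] by (blast intro: order_trans)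
        also have "\<dots> \<le> ennreal (\<bar>C\<bar> * r powr N)" by (intro ennreal_leI mult_right_mono) auto
        finally show "norm (u p) \<le> \<bar>C\<bar> * r powr N" by (subst (asm) ennreal_le_iff) auto
      qed
    qed
  qed
  with b(1) show ?thesis by (rule that)
qed

lemma AE_snd_neq: "AE p in lborel. snd (p :: 'a::euclidean_space \<times> real) \<noteq> c"
proof -
  have [measurable]: "(\<lambda>p. snd p) \<in> borel_measurable (borel :: ('a \<times> real) measure)"
    by (auto intro!: borel_measurable_continuous_onI continuous_intros)
  have "AE p in (lborel \<Otimes>\<^sub>M lborel). snd (p :: 'a \<times> real) \<noteq> c"
  proof (rule lborel_pair.AE_pair_measure)
    show "AE x in lborel. AE y in lborel. snd (x :: 'a, y :: real) \<noteq> c"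
      using AE_lborel_singleton[of c] by simp
  qed measurable
  then show ?thesis unfolding lborel_prod .
qed

text \<open>Before time c the points where v is nonzero form an open null set, hence none exist; the
  final time c itself is reached by continuity.\<close>

lemma continuous_AE_zero:
  fixes v :: "'a::euclidean_space \<times> real \<Rightarrow> 'b::real_normed_vector"
  assumes v: "continuous_on UNIV v" and zero: "AE p in lborel. snd p \<le> c \<longrightarrow> v p = 0" and t: "t \<le> c"
  shows "v (x, t) = 0"
proof -
  define U where "U = v -` (- {0}) \<inter> snd -` {..<c}"
  have "open U" unfolding U_def
    by (intro open_Int open_vimage continuous_on_snd continuous_on_id v) auto
  have "AE p in lebesgue. p \<notin> U" using zero unfolding AE_lebesgue_iff by eventually_elim (auto simp: U_def)
  then have "U \<in> null_sets lebesgue" using \<open>open U\<close> by (subst AE_iff_null_sets) auto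
  then have "negligible U" by (simp add: negligible_iff_null_sets)
  then have "U = {}" using open_not_negligible[OF \<open>open U\<close>] by blast
  then have strict: "v (x, t) = 0" if "t < c" for t using that by (auto simp: U_def)
  have "(\<lambda>n. (x, t - 1 / real (Suc n))) \<longlonglongrightarrow> (x, t - 0)"
    by (intro tendsto_intros LIMSEQ_inverse_real_of_nat[unfolded inverse_eq_divide])
  then have "(\<lambda>n. v (x, t - 1 / real (Suc n))) \<longlonglongrightarrow> v (x, t - 0)"
    using v by (intro isCont_tendsto_compose[of _ v]) (auto simp: continuous_on_eq_continuous_at)
  moreover have "v (x, t - 1 / real (Suc n)) = 0" for n
  proof (rule strict)
    have "1 / real (Suc n) > 0" by simp
    then show "t - 1 / real (Suc n) < c" using t by linarith
  qed
  ultimately show ?thesis by (simp add: LIMSEQ_const_iff)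
qed

text \<open>As an element of L^2, u is given up to a null set. Its vanishing up to t_0 is therefore
  stated almost everywhere and, for a continuous representative, at every point, including the null
  slice t = t_0.\<close>

theorem theorem1p2:
  fixes s K t\<^sub>0 :: real
    and V :: "(real ^ 'n::finite) \<times> real \<Rightarrow> real"
    and u :: "(real ^ 'n) \<times> real \<Rightarrow> complex"
    and x\<^sub>0 :: "real ^ 'n"
  assumes "0 < s" and "s < 1" and "0 < K"
    and "1 / 2 \<le> s \<Longrightarrow> C_class 1 V \<and> C_norm 1 V \<le> ennreal K"
    and "s < 1 / 2 \<Longrightarrow> C_class 2 V \<and> C_norm 2 V \<le> ennreal K \<and>
           Linf_norm_on UNIV (\<lambda>(x, t). grad_x V (x, t) \<bullet> x) \<le> ennreal K"
    and "u \<in> Dom_H s"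
    and "AE p in lebesgue. H s u p = of_real (V p) * u p"
    and "vanishes_backward u x\<^sub>0 t\<^sub>0"
  shows "(AE (x, t) in lebesgue. t \<le> t\<^sub>0 \<longrightarrow> u (x, t) = 0) \<and>
    (\<forall>v. continuous_on UNIV v \<and> (AE p in lebesgue. v p = u p) \<longrightarrow>
       (\<forall>t\<le>t\<^sub>0. \<forall>x. v (x, t) = 0))"
proof -
  have s: "0 < s" "s < 1" by fact+
  obtain k where k: "C_class k V" "C_norm k V \<le> ennreal K" using assms(4,5) by (meson not_le)
  have V: "\<bar>V p\<bar> \<le> K" for p using C_norm_bound[OF k(2)] assms(3) by simp
  have Vm [measurable]: "V \<in> borel_measurable borel" by (rule borel_measurable_continuous_onI[OF C_class_continuous[OF k(1)]])
  have "u \<in> L2" using assms(6) by (simp add: Dom_H_def)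
  then obtain u' where u': "square_integrable lborel u'" "AE p in lborel. u p = u' p"
    by (rule L2_borel_representative)
  have u'm [measurable]: "u' \<in> borel_measurable borel" using u'(1) by (simp add: square_integrable_def)
  \<comment> \<open>Multiplying the Borel representative of u by V yields a representative of the
    right-hand side for which |w'| \<le> K |u'| holds at every point.\<close>
  define w' where "w' p = of_real (V p) * u' p" for p
  have w'm [measurable]: "w' \<in> borel_measurable borel" unfolding w'_def by measurable
  have w'_le: "norm (w' p) \<le> K * norm (u' p)" for p
    unfolding w'_def norm_mult norm_of_real by (rule mult_right_mono[OF V]) simp
  have "integrable lborel (\<lambda>p. (norm (w' p))\<^sup>2)"
  proof (rule Bochner_Integration.integrable_bound[OF integrable_mult_right[OF square_integrableD(2)[OF u'(1)], of "K\<^sup>2"]])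
    have "(norm (w' p))\<^sup>2 \<le> K\<^sup>2 * (norm (u' p))\<^sup>2" for p
      unfolding power_mult_distrib[symmetric] by (rule power_mono[OF w'_le]) simp
    then show "AE p in lborel. norm ((norm (w' p))\<^sup>2) \<le> norm (K\<^sup>2 * (norm (u' p))\<^sup>2)" by simp
  qed simp
  then have w': "square_integrable lborel w'" using w'm by (simp add: square_integrable_def)
  have w'_eq: "AE p in lborel. of_real (V p) * u p = w' p" using u'(2) by eventually_elim (simp add: w'_def)
  let ?u = "\<lambda>p. u' (reflect_at x\<^sub>0 t\<^sub>0 p)" and ?g = "\<lambda>p. w' (reflect_at x\<^sub>0 t\<^sub>0 p)"
  have "AE p in lborel. 0 < snd p \<longrightarrow> ?u p = 0"
  proof (rule backward_unique_continuation[OF s])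
    show "?u \<in> borel_measurable borel" "?g \<in> borel_measurable borel" by measurable
    show "norm (?g p) \<le> K * norm (?u p)" for p by (rule w'_le)
    show "(LINT t|half_line. of_real (test_fun p q t) * caloric_moment \<alpha> ?u t) =
      (LINT \<tau>|half_line. of_real (frac_test s p q \<tau>) * (caloric_moment \<alpha> ?g \<tau> / of_real (Gamma s)))" if "0 < p" "p < q" for \<alpha> p q
      by (rule caloric_moment_weak[OF s assms(6,7) u' w' w'_eq that])
    fix a :: real assume a: "a \<le> 0"
    show "(\<integral>\<^sup>+t. ennreal (t powr a) * gauss_mass ?u t \<partial>half_line) < \<infinity>"
    proof (rule gauss_mass_flat[OF square_integrable_reflect_at[OF u'(1)] a])
      fix N :: real assume "N > 0"
      then obtain C b where b: "b > 0" "\<And>r. 0 < r \<Longrightarrow> r < b \<Longrightarrow> AE p in lborel. p \<in> Q r x\<^sub>0 t\<^sub>0 \<longrightarrow> norm (u p) \<le> C * r powr N"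
        using vanishes_backwardD[OF assms(8)] by blast
      have "AE p in lborel. norm (fst p) < r \<longrightarrow> 0 \<le> snd p \<longrightarrow> snd p < r\<^sup>2 \<longrightarrow> norm (?u p) \<le> C * r powr N" if "0 < r" "r < b" for r
      proof -
        have "AE p in lborel. p \<in> Q r x\<^sub>0 t\<^sub>0 \<longrightarrow> norm (u' p) \<le> C * r powr N"
          using b(2)[OF that] u'(2) by eventually_elim simp
        from AE_reflect_at[OF this] show ?thesis
          by eventually_elim (auto simp: Q_def reflect_at_def dist_norm)
      qed
      with b(1) show "\<exists>C b. b > 0 \<and> (\<forall>r. 0 < r \<longrightarrow> r < b \<longrightarrow>
        (AE p in lborel. norm (fst p) < r \<longrightarrow> 0 \<le> snd p \<longrightarrow> snd p < r\<^sup>2 \<longrightarrow> norm (?u p) \<le> C * r powr N))" by blast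
    qed
  qed
  then have "AE p in lborel. snd (reflect_at x\<^sub>0 t\<^sub>0 p) < t\<^sub>0 \<longrightarrow> ?u p = 0"
    by eventually_elim (simp add: reflect_at_def)
  then have "AE p in lborel. snd p < t\<^sub>0 \<longrightarrow> u' p = 0" by (rule AE_unreflect_at)
  \<comment> \<open>Positive reversed time corresponds to t < t_0 only; the slice t = t_0 is added
    as a null set.\<close>
  then have zero: "AE p in lborel. snd p \<le> t\<^sub>0 \<longrightarrow> u p = 0"
    using u'(2) AE_snd_neq[of t\<^sub>0] by eventually_elim auto
  show ?thesis
  proof (intro conjI allI impI)
    show "AE (x, t) in lebesgue. t \<le> t\<^sub>0 \<longrightarrow> u (x, t) = 0"
      using zero unfolding AE_lebesgue_iff by eventually_elim auto
    fix v t x assume v: "continuous_on UNIV v \<and> (AE p in lebesgue. v p = u p)" and t: "t \<le> t\<^sub>0"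
    have "AE p in lborel. v p = u p" using v unfolding AE_lebesgue_iff by blast
    then have "AE p in lborel. snd p \<le> t\<^sub>0 \<longrightarrow> v p = 0" using zero by eventually_elim simp
    then show "v (x, t) = 0" using v t by (intro continuous_AE_zero[of v t\<^sub>0]) auto
  qed
qed

end
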